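(* For any square group $A$ the functor $A\,\underline{\circledcirc}\,-:\mathsf{SG}\to\mathsf{SG}$ preserves filtered colimits, reflexive coequalizers and finite products. It is right exact and balanced, that is, for any short exact sequence of square groups $$0\to B_1\xrightarrow{\mu}B\xrightarrow{\sigma}B_2\to0$$ the induced sequence $$A\underline{\circledcirc}B_1\to A\underline{\circledcirc}B\to A\underline{\circledcirc}B_2\to0$$ is exact, and the first arrow $A\underline{\circledcirc}\mu$ is a monomorphism provided $A$ is a projective object in the category $\mathsf{SG}$.
   Context: Groups are written additively. A map $f:G\to A$ from a group to an abelian group is quadratic if its cross-effect $(x|y)_f:=f(x+y)-f(x)-f(y)$ is linear in $x$ and in $y$. A square group $M=(M_e\xrightarrow{H}M_{ee}\xrightarrow{P}M_e)$ consists of a group $M_e$, an abelian group $M_{ee}$, a homomorphism $P$ and a quadratic map $H$ such that for all $x,y\in M_e$, $a,b\in M_{ee}$: $(Pa|y)_H=0=(x|Pb)_H$, $P(x|y)_H=-x-y+x+y$, $PHP(a)=2P(a)$. Morphisms are pairs of homomorphisms $(f_e,f_{ee})$ commuting with $H$ and $P$; the category is $\mathsf{SG}$. In a square group $\mathrm{Im}(P)$ is central and contains all commutators, so $\mathrm{Coker}(P)$ is an abelian group; $\bar x$ is the class of $x\in M_e$. The cross-effect induces a homomorphism $(-|-)_H:\mathrm{Coker}(P)\otimes\mathrm{Coker}(P)\to M_{ee}$; there is a homomorphism $\Delta:\mathrm{Coker}(P)\to M_{ee}$, $\Delta(\bar x)=HPH(x)+H(x+x)-4H(x)$ (also written $\Delta(x)$);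 and $T:=HP-\mathrm{Id}:M_{ee}\to M_{ee}$ is a homomorphism with $T^2=\mathrm{Id}$. Tensor product: $(M\underline{\circledcirc}N)_{ee}=M_{ee}\otimes N_{ee}$, and $(M\underline{\circledcirc}N)_e$ is the group with generators $x\underline{\circledcirc}y$ ($x\in M_e,y\in N_e$) and $a\bar\otimes b$ ($a\in M_{ee},b\in N_{ee}$) and relations: (1) $a\bar\otimes b$ is bilinear and central; (2) $x\underline{\circledcirc}(y_1+y_2)=x\underline{\circledcirc}y_1+x\underline{\circledcirc}y_2$; (3) $(x_1+x_2)\underline{\circledcirc}y=x_1\underline{\circledcirc}y+x_2\underline{\circledcirc}y+(x_2|x_1)_H\bar\otimes H(y)$; (4) $x\underline{\circledcirc}P(b)=(x|x)_H\bar\otimes b$; (5) $P(a)\underline{\circledcirc}y=a\bar\otimes\Delta(y)$; (6) $T(a)\bar\otimes T(b)=-a\bar\otimes b$. The homomorphism $P$ is $P(a\otimes b)=a\bar\otimes b$, so that $\mathrm{Coker}(P^{M\underline{\circledcirc}N})=\mathrm{Coker}(P^M)\otimes\mathrm{Coker}(P^N)$, and $H$ is the unique quadratic map with cross-effect induced by $(\bar x\otimes\bar y)\otimes(\bar x'\otimes\bar y')\mapsto(x|x')_H\otimes(y|y')_H$ and with $H(x\underline{\circledcirc}y)=(x|x)_H\otimes H(y)+H(x)\otimes\Delta(y)$, $H(a\bar\otimes b)=a\otimes b-T(a)\otimes T(b)$. This is a square group, functorial in $M$ and $N$. A sequence of square groups is exact if it is exact on both the $e$-level and the $ee$-level. An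 epimorphism of square groups means a morphism surjective on both levels; a square group is projective if it has the lifting property with respect to epimorphisms. A functor $R:\mathsf{SG}\to\mathsf{SG}$ preserves reflexive coequalizers if for any simplicial object $B_*$ in $\mathsf{SG}$ the canonical morphism $\pi_0(R(B_* ))\to R(\pi_0(B_* ))$ is an isomorphism, where $\pi_0(B_* )$ is the coequalizer of $d_0,d_1:B_1\to B_0$ (computed on each level). *)

theory Defs
  imports "HOL-Algebra.Coset" "HOL-Algebra.Product_Groups" "HOL-Algebra.Free_Abelian_Groups"
begin

text \<open>
  All groups are HOL-Algebra groups, hence written multiplicatively: a sum of the additive notation
  customary for square groups is \<open>\<otimes>\<close> here, zero is \<open>\<one>\<close>, and \<open>-x\<close> is \<open>inv x\<close>.
\<close>

section \<open>Square groups\<close>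

definition cross_effect ::
  "'a monoid \<Rightarrow> 'b monoid \<Rightarrow> ('a \<Rightarrow> 'b) \<Rightarrow> 'a \<Rightarrow> 'a \<Rightarrow> 'b" where
  "cross_effect G A f x y = f (x \<otimes>\<^bsub>G\<^esub> y) \<otimes>\<^bsub>A\<^esub> inv\<^bsub>A\<^esub> (f x) \<otimes>\<^bsub>A\<^esub> inv\<^bsub>A\<^esub> (f y)"

definition quadratic_map :: "'a monoid \<Rightarrow> 'b monoid \<Rightarrow> ('a \<Rightarrow> 'b) \<Rightarrow> bool" where
  "quadratic_map G A f \<longleftrightarrow>
     f \<in> carrier G \<rightarrow> carrier A \<and>
     (\<forall>x\<in>carrier G. cross_effect G A f x \<in> hom G A) \<and>
     (\<forall>y\<in>carrier G. (\<lambda>x. cross_effect G A f x y) \<in> hom G A)"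

record ('a, 'b) square =
  SGe :: "'a monoid"
  SGee :: "'b monoid"
  SGH :: "'a \<Rightarrow> 'b"
  SGP :: "'b \<Rightarrow> 'a"

abbreviation sg_cross :: "('a, 'b) square \<Rightarrow> 'a \<Rightarrow> 'a \<Rightarrow> 'b" where
  "sg_cross M \<equiv> cross_effect (SGe M) (SGee M) (SGH M)"

locale square_group =
  fixes M :: "('a, 'b) square"
  assumes group_e: "group (SGe M)"
    and comm_group_ee: "comm_group (SGee M)"
    and P_hom: "SGP M \<in> hom (SGee M) (SGe M)"
    and H_quadratic: "quadratic_map (SGe M) (SGee M) (SGH M)"
    and cross_P_left: "\<lbrakk>a \<in> carrier (SGee M); y \<in> carrier (SGe M)\<rbrakk>
          \<Longrightarrow> sg_cross M (SGP M a) y = \<one>\<^bsub>SGee M\<^esub>"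
    and cross_P_right: "\<lbrakk>x \<in> carrier (SGe M); b \<in> carrier (SGee M)\<rbrakk>
          \<Longrightarrow> sg_cross M x (SGP M b) = \<one>\<^bsub>SGee M\<^esub>"
    and P_cross: "\<lbrakk>x \<in> carrier (SGe M); y \<in> carrier (SGe M)\<rbrakk>
          \<Longrightarrow> SGP M (sg_cross M x y) =
              inv\<^bsub>SGe M\<^esub> x \<otimes>\<^bsub>SGe M\<^esub> inv\<^bsub>SGe M\<^esub> y \<otimes>\<^bsub>SGe M\<^esub> x \<otimes>\<^bsub>SGe M\<^esub> y"
    and PHP: "a \<in> carrier (SGee M)
          \<Longrightarrow> SGP M (SGH M (SGP M a)) = SGP M a \<otimes>\<^bsub>SGe M\<^esub> SGP M a"

definition sg_Delta :: "('a, 'b) square \<Rightarrow> 'a \<Rightarrow> 'b" where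
  "sg_Delta M x =
     SGH M (SGP M (SGH M x)) \<otimes>\<^bsub>SGee M\<^esub> SGH M (x \<otimes>\<^bsub>SGe M\<^esub> x)
       \<otimes>\<^bsub>SGee M\<^esub> inv\<^bsub>SGee M\<^esub> (SGH M x [^]\<^bsub>SGee M\<^esub> (4::nat))"

definition sg_T :: "('a, 'b) square \<Rightarrow> 'b \<Rightarrow> 'b" where
  "sg_T M a = SGH M (SGP M a) \<otimes>\<^bsub>SGee M\<^esub> inv\<^bsub>SGee M\<^esub> a"

text \<open>Morphisms are pairs of functions \<open>(f\<^sub>e, f\<^sub>e\<^sub>e)\<close>; only their values on the carriers are meaningful,
  so equality of morphisms is \<open>sg_eq\<close>.\<close>

type_synonym ('a, 'b, 'c, 'd) sg_map = "('a \<Rightarrow> 'c) \<times> ('b \<Rightarrow> 'd)"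

definition sg_hom :: "('a, 'b) square \<Rightarrow> ('c, 'd) square \<Rightarrow> ('a, 'b, 'c, 'd) sg_map set" where
  "sg_hom M N = {f. fst f \<in> hom (SGe M) (SGe N) \<and> snd f \<in> hom (SGee M) (SGee N) \<and>
     (\<forall>x\<in>carrier (SGe M). snd f (SGH M x) = SGH N (fst f x)) \<and>
     (\<forall>a\<in>carrier (SGee M). fst f (SGP M a) = SGP N (snd f a))}"

definition sg_eq ::
  "('a, 'b) square \<Rightarrow> ('a, 'b, 'c, 'd) sg_map \<Rightarrow> ('a, 'b, 'c, 'd) sg_map \<Rightarrow> bool" where
  "sg_eq M f g \<longleftrightarrow> (\<forall>x\<in>carrier (SGe M). fst f x = fst g x) \<and>
                  (\<forall>a\<in>carrier (SGee M). snd f a = snd g a)"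

definition sg_id :: "('a, 'b, 'a, 'b) sg_map" where
  "sg_id = (id, id)"

definition sg_comp ::
  "('c, 'd, 'x, 'y) sg_map \<Rightarrow> ('a, 'b, 'c, 'd) sg_map \<Rightarrow> ('a, 'b, 'x, 'y) sg_map" where
  "sg_comp g f = (fst g \<circ> fst f, snd g \<circ> snd f)"

definition sg_mon :: "('a, 'b) square \<Rightarrow> ('c, 'd) square \<Rightarrow> ('a, 'b, 'c, 'd) sg_map set" where
  "sg_mon M N = {f \<in> sg_hom M N. inj_on (fst f) (carrier (SGe M)) \<and> inj_on (snd f) (carrier (SGee M))}"

definition sg_epi :: "('a, 'b) square \<Rightarrow> ('c, 'd) square \<Rightarrow> ('a, 'b, 'c, 'd) sg_map set" where
  "sg_epi M N = {f \<in> sg_hom M N. fst f ` carrier (SGe M) = carrier (SGe N) \<and>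
                                 snd f ` carrier (SGee M) = carrier (SGee N)}"

definition sg_iso :: "('a, 'b) square \<Rightarrow> ('c, 'd) square \<Rightarrow> ('a, 'b, 'c, 'd) sg_map set" where
  "sg_iso M N = sg_mon M N \<inter> sg_epi M N"

definition sg_exact_at ::
  "('a, 'b) square \<Rightarrow> ('c, 'd) square \<Rightarrow> ('x, 'y) square \<Rightarrow>
   ('a, 'b, 'c, 'd) sg_map \<Rightarrow> ('c, 'd, 'x, 'y) sg_map \<Rightarrow> bool" where
  "sg_exact_at L M N f g \<longleftrightarrow> f \<in> sg_hom L M \<and> g \<in> sg_hom M N \<and>
     fst f ` carrier (SGe L) = kernel (SGe M) (SGe N) (fst g) \<and>
     snd f ` carrier (SGee L) = kernel (SGee M) (SGee N) (snd g)"

definition sg_short_exact ::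
  "('a, 'b) square \<Rightarrow> ('c, 'd) square \<Rightarrow> ('x, 'y) square \<Rightarrow>
   ('a, 'b, 'c, 'd) sg_map \<Rightarrow> ('c, 'd, 'x, 'y) sg_map \<Rightarrow> bool" where
  "sg_short_exact L M N f g \<longleftrightarrow>
     square_group L \<and> square_group M \<and> square_group N \<and>
     f \<in> sg_mon L M \<and> sg_exact_at L M N f g \<and> g \<in> sg_epi M N"

text \<open>Projectivity quantifies over all square groups, which is not possible inside one formula;
  the carriers of the test objects range over the subsets of the two types given as arguments.
  For \<open>A :: ('a, 'b) square\<close> the types \<open>('a + 'b) list set\<close> lose nothing: they contain copies of \<open>A\<close>
  and of the free square group on the elements of \<open>A\<close>, whose carriers have cardinality at most
  that of \<open>('a + 'b) list\<close>; lifting against the epimorphism between these two makes \<open>A\<close> a retract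
  of a free object.\<close>

definition sg_projective :: "'u itself \<Rightarrow> 'v itself \<Rightarrow> ('a, 'b) square \<Rightarrow> bool" where
  "sg_projective _ _ A \<longleftrightarrow> square_group A \<and>
     (\<forall>(X :: ('u, 'v) square) (Y :: ('u, 'v) square) p f.
        square_group X \<and> square_group Y \<and> p \<in> sg_epi X Y \<and> f \<in> sg_hom A Y
        \<longrightarrow> (\<exists>g\<in>sg_hom A X. sg_eq A (sg_comp p g) f))"


section \<open>Groups given by generators and relations\<close>

text \<open>A letter \<open>(True, x)\<close> stands for the generator \<open>x\<close>, and \<open>(False, x)\<close> for its inverse.\<close>

type_synonym 'g word = "(bool \<times> 'g) list"

inductive presentation_eq :: "'g set \<Rightarrow> ('g word \<times> 'g word) set \<Rightarrow> 'g word \<Rightarrow> 'g word \<Rightarrow> bool"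
  for S R where
  refl: "set u \<subseteq> UNIV \<times> S \<Longrightarrow> presentation_eq S R u u"
| sym: "presentation_eq S R u v \<Longrightarrow> presentation_eq S R v u"
| trans: "\<lbrakk>presentation_eq S R u v; presentation_eq S R v w\<rbrakk> \<Longrightarrow> presentation_eq S R u w"
| append: "\<lbrakk>presentation_eq S R u u'; presentation_eq S R v v'\<rbrakk>
    \<Longrightarrow> presentation_eq S R (u @ v) (u' @ v')"
| cancel: "x \<in> S \<Longrightarrow> presentation_eq S R [(b, x), (\<not> b, x)] []"
| relation: "(u, v) \<in> R \<Longrightarrow> presentation_eq S R u v"

definition presentation_class :: "'g set \<Rightarrow> ('g word \<times> 'g word) set \<Rightarrow> 'g word \<Rightarrow> 'g word set" where
  "presentation_class S R u = {v. presentation_eq S R u v}"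

definition presented_group :: "'g set \<Rightarrow> ('g word \<times> 'g word) set \<Rightarrow> 'g word set monoid" where
  "presented_group S R =
     \<lparr>carrier = presentation_class S R ` {u. set u \<subseteq> UNIV \<times> S},
      monoid.mult = (\<lambda>X Y. \<Union>u\<in>X. \<Union>v\<in>Y. presentation_class S R (u @ v)),
      one = presentation_class S R []\<rparr>"


section \<open>Tensor product of abelian groups\<close>

definition ab_tensor_rels :: "'a monoid \<Rightarrow> 'b monoid \<Rightarrow> ('a \<times> 'b \<Rightarrow>\<^sub>0 int) set" where
  "ab_tensor_rels A B =
     {frag_of (x \<otimes>\<^bsub>A\<^esub> x', y) - frag_of (x, y) - frag_of (x', y) | x x' y.
        x \<in> carrier A \<and> x' \<in> carrier A \<and> y \<in> carrier B} \<union>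
     {frag_of (x, y \<otimes>\<^bsub>B\<^esub> y') - frag_of (x, y) - frag_of (x, y') | x y y'.
        x \<in> carrier A \<and> y \<in> carrier B \<and> y' \<in> carrier B}"

definition ab_tensor_kernel :: "'a monoid \<Rightarrow> 'b monoid \<Rightarrow> ('a \<times> 'b \<Rightarrow>\<^sub>0 int) set" where
  "ab_tensor_kernel A B =
     generate (free_Abelian_group (carrier A \<times> carrier B)) (ab_tensor_rels A B)"

definition ab_tensor :: "'a monoid \<Rightarrow> 'b monoid \<Rightarrow> ('a \<times> 'b \<Rightarrow>\<^sub>0 int) set monoid" where
  "ab_tensor A B = free_Abelian_group (carrier A \<times> carrier B) Mod ab_tensor_kernel A B"

definition ab_pure :: "'a monoid \<Rightarrow> 'b monoid \<Rightarrow> 'a \<Rightarrow> 'b \<Rightarrow> ('a \<times> 'b \<Rightarrow>\<^sub>0 int) set" where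
  "ab_pure A B x y =
     ab_tensor_kernel A B #>\<^bsub>free_Abelian_group (carrier A \<times> carrier B)\<^esub> frag_of (x, y)"


section \<open>Tensor product of square groups\<close>

datatype ('a, 'b, 'c, 'd) tensor_gen = Circ 'a 'c | Bar 'b 'd

definition tensor_gens ::
  "('a, 'b) square \<Rightarrow> ('c, 'd) square \<Rightarrow> ('a, 'b, 'c, 'd) tensor_gen set" where
  "tensor_gens M N = {Circ x y | x y. x \<in> carrier (SGe M) \<and> y \<in> carrier (SGe N)} \<union>
                     {Bar a b | a b. a \<in> carrier (SGee M) \<and> b \<in> carrier (SGee N)}"

inductive_set tensor_rels ::
  "('a, 'b) square \<Rightarrow> ('c, 'd) square \<Rightarrow>
   (('a, 'b, 'c, 'd) tensor_gen word \<times> ('a, 'b, 'c, 'd) tensor_gen word) set"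
  for M :: "('a, 'b) square" and N :: "('c, 'd) square" where
  bar_add_left: "\<lbrakk>a \<in> carrier (SGee M); a' \<in> carrier (SGee M); b \<in> carrier (SGee N)\<rbrakk> \<Longrightarrow>
    ([(True, Bar (a \<otimes>\<^bsub>SGee M\<^esub> a') b)], [(True, Bar a b), (True, Bar a' b)]) \<in> tensor_rels M N"
| bar_add_right: "\<lbrakk>a \<in> carrier (SGee M); b \<in> carrier (SGee N); b' \<in> carrier (SGee N)\<rbrakk> \<Longrightarrow>
    ([(True, Bar a (b \<otimes>\<^bsub>SGee N\<^esub> b'))], [(True, Bar a b), (True, Bar a b')]) \<in> tensor_rels M N"
| bar_central: "\<lbrakk>a \<in> carrier (SGee M); b \<in> carrier (SGee N); g \<in> tensor_gens M N\<rbrakk> \<Longrightarrow>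
    ([(True, Bar a b), (True, g)], [(True, g), (True, Bar a b)]) \<in> tensor_rels M N"
| circ_add_right: "\<lbrakk>x \<in> carrier (SGe M); y \<in> carrier (SGe N); y' \<in> carrier (SGe N)\<rbrakk> \<Longrightarrow>
    ([(True, Circ x (y \<otimes>\<^bsub>SGe N\<^esub> y'))], [(True, Circ x y), (True, Circ x y')]) \<in> tensor_rels M N"
| circ_add_left: "\<lbrakk>x \<in> carrier (SGe M); x' \<in> carrier (SGe M); y \<in> carrier (SGe N)\<rbrakk> \<Longrightarrow>
    ([(True, Circ (x \<otimes>\<^bsub>SGe M\<^esub> x') y)],
     [(True, Circ x y), (True, Circ x' y), (True, Bar (sg_cross M x' x) (SGH N y))]) \<in> tensor_rels M N"
| circ_P_right: "\<lbrakk>x \<in> carrier (SGe M); b \<in> carrier (SGee N)\<rbrakk> \<Longrightarrow>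
    ([(True, Circ x (SGP N b))], [(True, Bar (sg_cross M x x) b)]) \<in> tensor_rels M N"
| circ_P_left: "\<lbrakk>a \<in> carrier (SGee M); y \<in> carrier (SGe N)\<rbrakk> \<Longrightarrow>
    ([(True, Circ (SGP M a) y)], [(True, Bar a (sg_Delta N y))]) \<in> tensor_rels M N"
| bar_T: "\<lbrakk>a \<in> carrier (SGee M); b \<in> carrier (SGee N)\<rbrakk> \<Longrightarrow>
    ([(True, Bar (sg_T M a) (sg_T N b))], [(False, Bar a b)]) \<in> tensor_rels M N"

type_synonym ('a, 'b, 'c, 'd) tensor_e = "('a, 'b, 'c, 'd) tensor_gen word set"
type_synonym ('b, 'd) tensor_ee = "('b \<times> 'd \<Rightarrow>\<^sub>0 int) set"

definition tensor_e ::
  "('a, 'b) square \<Rightarrow> ('c, 'd) square \<Rightarrow> ('a, 'b, 'c, 'd) tensor_e monoid" where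
  "tensor_e M N = presented_group (tensor_gens M N) (tensor_rels M N)"

definition tensor_ee :: "('a, 'b) square \<Rightarrow> ('c, 'd) square \<Rightarrow> ('b, 'd) tensor_ee monoid" where
  "tensor_ee M N = ab_tensor (SGee M) (SGee N)"

definition circ ::
  "('a, 'b) square \<Rightarrow> ('c, 'd) square \<Rightarrow> 'a \<Rightarrow> 'c \<Rightarrow> ('a, 'b, 'c, 'd) tensor_e" where
  "circ M N x y = presentation_class (tensor_gens M N) (tensor_rels M N) [(True, Circ x y)]"

definition bar ::
  "('a, 'b) square \<Rightarrow> ('c, 'd) square \<Rightarrow> 'b \<Rightarrow> 'd \<Rightarrow> ('a, 'b, 'c, 'd) tensor_e" where
  "bar M N a b = presentation_class (tensor_gens M N) (tensor_rels M N) [(True, Bar a b)]"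

abbreviation pure ::
  "('a, 'b) square \<Rightarrow> ('c, 'd) square \<Rightarrow> 'b \<Rightarrow> 'd \<Rightarrow> ('b, 'd) tensor_ee" where
  "pure M N \<equiv> ab_pure (SGee M) (SGee N)"

definition tensor_P ::
  "('a, 'b) square \<Rightarrow> ('c, 'd) square \<Rightarrow> ('b, 'd) tensor_ee \<Rightarrow> ('a, 'b, 'c, 'd) tensor_e" where
  "tensor_P M N = (THE p. p \<in> extensional (carrier (tensor_ee M N)) \<and>
     p \<in> hom (tensor_ee M N) (tensor_e M N) \<and>
     (\<forall>a\<in>carrier (SGee M). \<forall>b\<in>carrier (SGee N). p (pure M N a b) = bar M N a b))"

text \<open>The second to fourth conditions say that the cross-effect is induced by the stated map on
  \<open>Coker P \<otimes> Coker P\<close>: in \<open>Coker P\<close> of the tensor product, \<open>bar a b\<close> is trivial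
  and \<open>circ x y\<close> is the class of \<open>x\<close> tensor the class of \<open>y\<close>.\<close>

definition tensor_H ::
  "('a, 'b) square \<Rightarrow> ('c, 'd) square \<Rightarrow> ('a, 'b, 'c, 'd) tensor_e \<Rightarrow> ('b, 'd) tensor_ee" where
  "tensor_H M N = (THE h. h \<in> extensional (carrier (tensor_e M N)) \<and>
     quadratic_map (tensor_e M N) (tensor_ee M N) h \<and>
     (\<forall>x\<in>carrier (SGe M). \<forall>y\<in>carrier (SGe N). \<forall>x'\<in>carrier (SGe M). \<forall>y'\<in>carrier (SGe N).
        cross_effect (tensor_e M N) (tensor_ee M N) h (circ M N x y) (circ M N x' y')
          = pure M N (sg_cross M x x') (sg_cross N y y')) \<and>
     (\<forall>a\<in>carrier (SGee M). \<forall>b\<in>carrier (SGee N). \<forall>z\<in>carrier (tensor_e M N).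
        cross_effect (tensor_e M N) (tensor_ee M N) h (bar M N a b) z = \<one>\<^bsub>tensor_ee M N\<^esub> \<and>
        cross_effect (tensor_e M N) (tensor_ee M N) h z (bar M N a b) = \<one>\<^bsub>tensor_ee M N\<^esub>) \<and>
     (\<forall>x\<in>carrier (SGe M). \<forall>y\<in>carrier (SGe N).
        h (circ M N x y) = pure M N (sg_cross M x x) (SGH N y)
          \<otimes>\<^bsub>tensor_ee M N\<^esub> pure M N (SGH M x) (sg_Delta N y)) \<and>
     (\<forall>a\<in>carrier (SGee M). \<forall>b\<in>carrier (SGee N).
        h (bar M N a b) = pure M N a b
          \<otimes>\<^bsub>tensor_ee M N\<^esub> inv\<^bsub>tensor_ee M N\<^esub> (pure M N (sg_T M a) (sg_T N b))))"

definition sg_tensor ::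
  "('a, 'b) square \<Rightarrow> ('c, 'd) square \<Rightarrow> (('a, 'b, 'c, 'd) tensor_e, ('b, 'd) tensor_ee) square" where
  "sg_tensor M N = \<lparr>SGe = tensor_e M N, SGee = tensor_ee M N,
                    SGH = tensor_H M N, SGP = tensor_P M N\<rparr>"

text \<open>The action of the functor \<open>sg_tensor A -\<close> on a morphism \<open>f\<close> from \<open>N\<close> to \<open>N'\<close>.\<close>

definition sg_tensor_map ::
  "('a, 'b) square \<Rightarrow> ('c, 'd) square \<Rightarrow> ('x, 'y) square \<Rightarrow> ('c, 'd, 'x, 'y) sg_map \<Rightarrow>
   (('a, 'b, 'c, 'd) tensor_e, ('b, 'd) tensor_ee, ('a, 'b, 'x, 'y) tensor_e, ('b, 'y) tensor_ee) sg_map"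
  where
  "sg_tensor_map A N N' f =
     (THE h. h \<in> extensional (carrier (tensor_e A N)) \<and>
        h \<in> hom (tensor_e A N) (tensor_e A N') \<and>
        (\<forall>x\<in>carrier (SGe A). \<forall>y\<in>carrier (SGe N). h (circ A N x y) = circ A N' x (fst f y)) \<and>
        (\<forall>a\<in>carrier (SGee A). \<forall>b\<in>carrier (SGee N). h (bar A N a b) = bar A N' a (snd f b)),
      THE h. h \<in> extensional (carrier (tensor_ee A N)) \<and>
        h \<in> hom (tensor_ee A N) (tensor_ee A N') \<and>
        (\<forall>a\<in>carrier (SGee A). \<forall>b\<in>carrier (SGee N). h (pure A N a b) = pure A N' a (snd f b)))"


section \<open>Products\<close>

definition sg_product :: "'i set \<Rightarrow> ('i \<Rightarrow> ('a, 'b) square) \<Rightarrow> ('i \<Rightarrow> 'a, 'i \<Rightarrow> 'b) square" where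
  "sg_product I D =
     \<lparr>SGe = product_group I (\<lambda>i. SGe (D i)), SGee = product_group I (\<lambda>i. SGee (D i)),
      SGH = (\<lambda>x. \<lambda>i\<in>I. SGH (D i) (x i)), SGP = (\<lambda>a. \<lambda>i\<in>I. SGP (D i) (a i))\<rparr>"

definition sg_proj :: "'i \<Rightarrow> ('i \<Rightarrow> 'a, 'i \<Rightarrow> 'b, 'a, 'b) sg_map" where
  "sg_proj i = (\<lambda>x. x i, \<lambda>a. a i)"

definition sg_pair ::
  "'i set \<Rightarrow> ('i \<Rightarrow> ('a, 'b, 'c, 'd) sg_map) \<Rightarrow> ('a, 'b, 'i \<Rightarrow> 'c, 'i \<Rightarrow> 'd) sg_map" where
  "sg_pair I f = (\<lambda>x. \<lambda>i\<in>I. fst (f i) x, \<lambda>a. \<lambda>i\<in>I. snd (f i) a)"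


section \<open>Simplicial objects\<close>

text \<open>\<open>d n i\<close> is the face map from \<open>B (n + 1)\<close> to \<open>B n\<close>, and \<open>s n i\<close> the degeneracy from \<open>B n\<close> to
  \<open>B (n + 1)\<close>.\<close>

definition sg_simplicial ::
  "(nat \<Rightarrow> ('a, 'b) square) \<Rightarrow> (nat \<Rightarrow> nat \<Rightarrow> ('a, 'b, 'a, 'b) sg_map) \<Rightarrow>
   (nat \<Rightarrow> nat \<Rightarrow> ('a, 'b, 'a, 'b) sg_map) \<Rightarrow> bool" where
  "sg_simplicial B d s \<longleftrightarrow>
     (\<forall>n. square_group (B n)) \<and>
     (\<forall>n. \<forall>i\<le>Suc n. d n i \<in> sg_hom (B (Suc n)) (B n)) \<and>
     (\<forall>n. \<forall>i\<le>n. s n i \<in> sg_hom (B n) (B (Suc n))) \<and>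
     (\<forall>n. \<forall>j\<le>n + 2. \<forall>i<j.
        sg_eq (B (n + 2)) (sg_comp (d n i) (d (n + 1) j)) (sg_comp (d n (j - 1)) (d (n + 1) i))) \<and>
     (\<forall>n. \<forall>j\<le>n. \<forall>i\<le>j.
        sg_eq (B n) (sg_comp (s (n + 1) i) (s n j)) (sg_comp (s (n + 1) (j + 1)) (s n i))) \<and>
     (\<forall>n. \<forall>j\<le>n. sg_eq (B n) (sg_comp (d n j) (s n j)) sg_id \<and>
                  sg_eq (B n) (sg_comp (d n (j + 1)) (s n j)) sg_id) \<and>
     (\<forall>n. \<forall>j\<le>n + 1. \<forall>i<j.
        sg_eq (B (n + 1)) (sg_comp (d (n + 1) i) (s (n + 1) j)) (sg_comp (s n (j - 1)) (d n i))) \<and>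
     (\<forall>n. \<forall>i\<le>n + 2. \<forall>j. j + 1 < i \<longrightarrow>
        sg_eq (B (n + 1)) (sg_comp (d (n + 1) i) (s (n + 1) j)) (sg_comp (s n j) (d n (i - 1))))"

definition normal_closure :: "'a monoid \<Rightarrow> 'a set \<Rightarrow> 'a set" where
  "normal_closure G S = \<Inter> {N. N \<lhd> G \<and> S \<subseteq> N}"

definition coeq_kernel :: "'a monoid \<Rightarrow> 'b monoid \<Rightarrow> ('a \<Rightarrow> 'b) \<Rightarrow> ('a \<Rightarrow> 'b) \<Rightarrow> 'b set" where
  "coeq_kernel G' G f g = normal_closure G ((\<lambda>x. f x \<otimes>\<^bsub>G\<^esub> inv\<^bsub>G\<^esub> (g x)) ` carrier G')"

definition coeq_kernel_e ::
  "(nat \<Rightarrow> ('a, 'b) square) \<Rightarrow> (nat \<Rightarrow> nat \<Rightarrow> ('a, 'b, 'a, 'b) sg_map) \<Rightarrow> 'a set" where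
  "coeq_kernel_e B d = coeq_kernel (SGe (B 1)) (SGe (B 0)) (fst (d 0 0)) (fst (d 0 1))"

definition coeq_kernel_ee ::
  "(nat \<Rightarrow> ('a, 'b) square) \<Rightarrow> (nat \<Rightarrow> nat \<Rightarrow> ('a, 'b, 'a, 'b) sg_map) \<Rightarrow> 'b set" where
  "coeq_kernel_ee B d = coeq_kernel (SGee (B 1)) (SGee (B 0)) (snd (d 0 0)) (snd (d 0 1))"

text \<open>On each level \<open>\<pi>\<^sub>0\<close> is the coequalizer of groups; \<open>H\<close> and \<open>P\<close> of a coset are the
  cosets of the values on its elements.\<close>

definition sg_pi0 ::
  "(nat \<Rightarrow> ('a, 'b) square) \<Rightarrow> (nat \<Rightarrow> nat \<Rightarrow> ('a, 'b, 'a, 'b) sg_map) \<Rightarrow> ('a set, 'b set) square" where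
  "sg_pi0 B d =
     \<lparr>SGe = SGe (B 0) Mod coeq_kernel_e B d,
      SGee = SGee (B 0) Mod coeq_kernel_ee B d,
      SGH = (\<lambda>X. the_elem ((\<lambda>x. coeq_kernel_ee B d #>\<^bsub>SGee (B 0)\<^esub> SGH (B 0) x) ` X)),
      SGP = (\<lambda>X. the_elem ((\<lambda>a. coeq_kernel_e B d #>\<^bsub>SGe (B 0)\<^esub> SGP (B 0) a) ` X))\<rparr>"

definition sg_pi0_proj ::
  "(nat \<Rightarrow> ('a, 'b) square) \<Rightarrow> (nat \<Rightarrow> nat \<Rightarrow> ('a, 'b, 'a, 'b) sg_map) \<Rightarrow>
   ('a, 'b, 'a set, 'b set) sg_map" where
  "sg_pi0_proj B d = (\<lambda>x. coeq_kernel_e B d #>\<^bsub>SGe (B 0)\<^esub> x, \<lambda>a. coeq_kernel_ee B d #>\<^bsub>SGee (B 0)\<^esub> a)"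


section \<open>Filtered colimits\<close>

record ('i, 'm) small_cat =
  Obj :: "'i set"
  Arr :: "'m set"
  Dom :: "'m \<Rightarrow> 'i"
  Cod :: "'m \<Rightarrow> 'i"
  Ide :: "'i \<Rightarrow> 'm"
  Cmp :: "'m \<Rightarrow> 'm \<Rightarrow> 'm"

definition small_category :: "('i, 'm) small_cat \<Rightarrow> bool" where
  "small_category J \<longleftrightarrow>
     (\<forall>m\<in>Arr J. Dom J m \<in> Obj J \<and> Cod J m \<in> Obj J) \<and>
     (\<forall>i\<in>Obj J. Ide J i \<in> Arr J \<and> Dom J (Ide J i) = i \<and> Cod J (Ide J i) = i) \<and>
     (\<forall>g\<in>Arr J. \<forall>f\<in>Arr J. Dom J g = Cod J f \<longrightarrow>
        Cmp J g f \<in> Arr J \<and> Dom J (Cmp J g f) = Dom J f \<and> Cod J (Cmp J g f) = Cod J g) \<and>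
     (\<forall>f\<in>Arr J. Cmp J f (Ide J (Dom J f)) = f \<and> Cmp J (Ide J (Cod J f)) f = f) \<and>
     (\<forall>h\<in>Arr J. \<forall>g\<in>Arr J. \<forall>f\<in>Arr J. Dom J h = Cod J g \<longrightarrow> Dom J g = Cod J f \<longrightarrow>
        Cmp J h (Cmp J g f) = Cmp J (Cmp J h g) f)"

definition filtered_category :: "('i, 'm) small_cat \<Rightarrow> bool" where
  "filtered_category J \<longleftrightarrow> small_category J \<and> Obj J \<noteq> {} \<and>
     (\<forall>i\<in>Obj J. \<forall>j\<in>Obj J. \<exists>f\<in>Arr J. \<exists>g\<in>Arr J. Dom J f = i \<and> Dom J g = j \<and> Cod J f = Cod J g) \<and>
     (\<forall>f\<in>Arr J. \<forall>g\<in>Arr J. Dom J f = Dom J g \<longrightarrow> Cod J f = Cod J g \<longrightarrow>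
        (\<exists>h\<in>Arr J. Dom J h = Cod J f \<and> Cmp J h f = Cmp J h g))"

definition sg_diagram ::
  "('i, 'm) small_cat \<Rightarrow> ('i \<Rightarrow> ('a, 'b) square) \<Rightarrow> ('m \<Rightarrow> ('a, 'b, 'a, 'b) sg_map) \<Rightarrow> bool" where
  "sg_diagram J D F \<longleftrightarrow>
     (\<forall>i\<in>Obj J. square_group (D i)) \<and>
     (\<forall>m\<in>Arr J. F m \<in> sg_hom (D (Dom J m)) (D (Cod J m))) \<and>
     (\<forall>i\<in>Obj J. sg_eq (D i) (F (Ide J i)) sg_id) \<and>
     (\<forall>g\<in>Arr J. \<forall>f\<in>Arr J. Dom J g = Cod J f \<longrightarrow>
        sg_eq (D (Dom J f)) (F (Cmp J g f)) (sg_comp (F g) (F f)))"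

definition sg_cocone ::
  "('i, 'm) small_cat \<Rightarrow> ('i \<Rightarrow> ('a, 'b) square) \<Rightarrow> ('m \<Rightarrow> ('a, 'b, 'a, 'b) sg_map) \<Rightarrow>
   ('c, 'd) square \<Rightarrow> ('i \<Rightarrow> ('a, 'b, 'c, 'd) sg_map) \<Rightarrow> bool" where
  "sg_cocone J D F C \<iota> \<longleftrightarrow> square_group C \<and>
     (\<forall>i\<in>Obj J. \<iota> i \<in> sg_hom (D i) C) \<and>
     (\<forall>m\<in>Arr J. sg_eq (D (Dom J m)) (sg_comp (\<iota> (Cod J m)) (F m)) (\<iota> (Dom J m)))"

text \<open>As for projectivity, the universal property is tested on the square groups with carriers
  in the two types given as arguments. For a filtered diagram of \<open>('a, 'b) square\<close>s indexed by \<open>'i\<close>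
  and a cocone \<open>C :: ('c, 'd) square\<close>, it suffices to test on \<open>'c, 'd\<close> and on
  \<open>('i \<times> 'a) set, ('i \<times> 'b) set\<close>: the latter carry the usual construction of the colimit by classes
  of pairs of an index and an element, and both together make \<open>C\<close> isomorphic to it.\<close>

definition sg_colimit ::
  "'u itself \<Rightarrow> 'v itself \<Rightarrow> ('i, 'm) small_cat \<Rightarrow> ('i \<Rightarrow> ('a, 'b) square) \<Rightarrow>
   ('m \<Rightarrow> ('a, 'b, 'a, 'b) sg_map) \<Rightarrow> ('c, 'd) square \<Rightarrow> ('i \<Rightarrow> ('a, 'b, 'c, 'd) sg_map) \<Rightarrow> bool" where
  "sg_colimit _ _ J D F C \<iota> \<longleftrightarrow> sg_cocone J D F C \<iota> \<and>
     (\<forall>(X :: ('u, 'v) square) \<tau>. sg_cocone J D F X \<tau> \<longrightarrow>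
        (\<exists>\<phi>\<in>sg_hom C X. (\<forall>i\<in>Obj J. sg_eq (D i) (sg_comp \<phi> (\<iota> i)) (\<tau> i)) \<and>
           (\<forall>\<psi>\<in>sg_hom C X. (\<forall>i\<in>Obj J. sg_eq (D i) (sg_comp \<psi> (\<iota> i)) (\<tau> i)) \<longrightarrow> sg_eq C \<psi> \<phi>)))"

end

theory Submission
  imports Defs "HOL-Algebra.Ring"
begin

text \<open>
  Homomorphisms out of \<open>sg_tensor A B\<close> are given by their values on generators, and quadratic maps
  are homomorphisms into a central extension. Right exactness holds because the subgroup generated by the
  \<open>circ x k\<close> and \<open>bar a k\<close> with \<open>k\<close> in the kernel of \<open>\<sigma>\<close> is normal and the universal property of
  \<open>sg_tensor A B\<^sub>2\<close> inverts the map from the quotient. For reflexive pairs, the kernel of the coequalizer is the image under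
  one face map of the kernel of the other, so right exactness applies. Filtered colimits
  are handled by choosing representatives of finitely many elements, and finite products by splitting the identity into the
  idempotents of the factors.

  For the last claim, every square group \<open>A\<close> is the quotient of a free square group \<open>X\<close>, realised by
  generators inside \<open>A\<close> times a group of integer vectors. The coordinates of these
  vectors induce homomorphisms from \<open>sg_tensor X B\<close> to the two levels of \<open>B\<close> that are natural in \<open>B\<close>
  and detect elements, so \<open>sg_tensor X\<close> preserves monomorphisms. A projective \<open>A\<close> is a retract of \<open>X\<close>.
\<close>

section \<open>Groups\<close>

text \<open>Two features shape the proof. First, \<open>circ\<close> is additive only in its second
  variable and \<open>tensor_e\<close> is not abelian, so \<open>H\<close> cannot be obtained by
  extending values additively. Commutators stay under control: expanding \<open>circ\<close> of two
  sums in both orders shows that the commutator of two generators is a central bar. Hence normality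
  of a subgroup can be tested on cross-effects, and homomorphisms may be added as soon as their
  images have trivial mutual cross-effect. Second, for the monomorphism claim, the relation
  \<open>bar_T\<close> makes bars over a free square group dependent: \<open>T\<close> permutes the
  basis of the \<open>ee\<close>-level up to sign, so basis elements are identified in pairs and
  only one of each pair may be kept. The self-cross-effects (s|s) have to be left out as well, since
  their bars are values of \<open>circ\<close> at s and elements P b, and so are seen by the
  coordinates that read off \<open>circ\<close>. On what remains, \<open>H\<close> after
  \<open>P\<close> is injective, which reduces the \<open>e\<close>-level to the
  \<open>ee\<close>-level. Coordinate vectors may have infinite support, which is why the copies
  used in the lifting argument are built from sets of lists.\<close>

lemma (in group) inv_cancel_left:
  assumes "x \<in> carrier G" "y \<in> carrier G"
  shows "x \<otimes> (inv x \<otimes> y) = y" "inv x \<otimes> (x \<otimes> y) = y"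
  using assms by (simp_all flip: m_assoc)

text \<open>Rewriting rules for words in an abelian group; most identities between values of
  \<open>H\<close>, \<open>T\<close> and cross-effects below are settled by them.\<close>

lemmas (in comm_group) [algebra comm_group "m_inv G" "one G" "monoid.mult G"] =
  m_assoc m_comm m_lcomm inv_mult inv_inv r_inv l_inv l_one r_one inv_cancel_left
  m_closed inv_closed one_closed inv_one

lemma (in comm_group) conj_cancel:
  "x \<in> carrier G \<Longrightarrow> y \<in> carrier G \<Longrightarrow> inv x \<otimes> y \<otimes> x \<otimes> inv y = \<one>"
  by algebra

lemma hom_inv:
  assumes "h \<in> hom G K" "group G" "group K" "x \<in> carrier G"
  shows "h (inv\<^bsub>G\<^esub> x) = inv\<^bsub>K\<^esub> (h x)"
  using assms by (simp add: group_hom.hom_inv group_hom.intro group_hom_axioms.intro)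

lemma hom_eq_on_generate:
  assumes "group G" "group K" "f \<in> hom G K" "g \<in> hom G K" "S \<subseteq> carrier G"
    and "\<And>s. s \<in> S \<Longrightarrow> f s = g s" and "x \<in> generate G S"
  shows "f x = g x"
  using assms(7)
proof (induction rule: generate.induct)
  case one
  then show ?case using assms hom_one by metis
next
  case (inv h)
  then show ?case using assms hom_inv[of f G K h] hom_inv[of g G K h] by auto
next
  case (eng h1 h2)
  then show ?case
    using group.generate_in_carrier[OF assms(1,5)] assms(3,4) by (simp add: hom_mult)
qed (use assms in auto)

lemma subgroup_generate_incl:
  assumes "group G" "subgroup K G" "S \<subseteq> K" "x \<in> generate G S"
  shows "x \<in> K"
  using group.generate_subgroup_incl[OF assms(1,3,2)] assms(4) by blast

lemma generate_hom_mem: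
  assumes "group G" "group K" "f \<in> hom G K" "S \<subseteq> carrier G" "subgroup N K"
    and "\<And>s. s \<in> S \<Longrightarrow> f s \<in> N" and "x \<in> generate G S"
  shows "f x \<in> N"
  using assms(7)
proof (induction rule: generate.induct)
  case one
  then show ?case using assms hom_one subgroup.one_closed by metis
next
  case (inv h)
  then show ?case using assms hom_inv[of f G K h] subgroup.m_inv_closed[of N K] by auto
next
  case (eng h1 h2)
  then show ?case
    using group.generate_in_carrier[OF assms(1,4)] assms(3,5) subgroup.m_closed[of N K] by (simp add: hom_mult)
qed (use assms in auto)

lemma Mod_coset_eq_iff:
  assumes "N \<lhd> G" "x \<in> carrier G" "y \<in> carrier G"
  shows "N #>\<^bsub>G\<^esub> x = N #>\<^bsub>G\<^esub> y \<longleftrightarrow> x \<otimes>\<^bsub>G\<^esub> inv\<^bsub>G\<^esub> y \<in> N"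
proof -
  interpret normal N G by fact
  show ?thesis
    using assms(2,3) rcos_module repr_independence repr_independenceD rcos_self
    by (metis rcos_module_imp is_subgroup subgroup_axioms is_group)
qed

lemma Mod_coset_one_iff:
  assumes "N \<lhd> G" "x \<in> carrier G"
  shows "N #>\<^bsub>G\<^esub> x = N \<longleftrightarrow> x \<in> N"
proof -
  interpret normal N G by fact
  show ?thesis using assms(2) coset_join1 coset_join2 is_subgroup subset by (metis)
qed

section \<open>Biadditive and quadratic maps\<close>

text \<open>The two sources may be non-commutative, so that cross-effects on the
  \<open>e\<close>-level are covered as well as tensors.\<close>

definition biadditive :: "'a monoid \<Rightarrow> 'b monoid \<Rightarrow> 'c monoid \<Rightarrow> ('a \<Rightarrow> 'b \<Rightarrow> 'c) \<Rightarrow> bool" where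
  "biadditive G K A c \<longleftrightarrow> (\<forall>x\<in>carrier G. c x \<in> hom K A) \<and> (\<forall>y\<in>carrier K. (\<lambda>x. c x y) \<in> hom G A)"

lemma biadditiveI:
  assumes "\<And>x y. x \<in> carrier G \<Longrightarrow> y \<in> carrier K \<Longrightarrow> c x y \<in> carrier A"
    and "\<And>x x' y. x \<in> carrier G \<Longrightarrow> x' \<in> carrier G \<Longrightarrow> y \<in> carrier K \<Longrightarrow> c (x \<otimes>\<^bsub>G\<^esub> x') y = c x y \<otimes>\<^bsub>A\<^esub> c x' y"
    and "\<And>x y y'. x \<in> carrier G \<Longrightarrow> y \<in> carrier K \<Longrightarrow> y' \<in> carrier K \<Longrightarrow> c x (y \<otimes>\<^bsub>K\<^esub> y') = c x y \<otimes>\<^bsub>A\<^esub> c x y'"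
  shows "biadditive G K A c"
  using assms by (auto simp: biadditive_def hom_def)

locale biadditive_map = G: group G + K: group K + A: comm_group A
  for G :: "'a monoid" and K :: "'b monoid" and A :: "'c monoid" +
  fixes c
  assumes biadditive: "biadditive G K A c"
begin

lemma closed [simp, intro]: "x \<in> carrier G \<Longrightarrow> y \<in> carrier K \<Longrightarrow> c x y \<in> carrier A"
  using biadditive by (auto simp: biadditive_def hom_def)

lemma mult_left [simp]:
  "x \<in> carrier G \<Longrightarrow> x' \<in> carrier G \<Longrightarrow> y \<in> carrier K \<Longrightarrow> c (x \<otimes>\<^bsub>G\<^esub> x') y = c x y \<otimes>\<^bsub>A\<^esub> c x' y"
  using biadditive by (auto simp: biadditive_def hom_def)

lemma mult_right [simp]:
  "x \<in> carrier G \<Longrightarrow> y \<in> carrier K \<Longrightarrow> y' \<in> carrier K \<Longrightarrow> c x (y \<otimes>\<^bsub>K\<^esub> y') = c x y \<otimes>\<^bsub>A\<^esub> c x y'"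
  using biadditive by (auto simp: biadditive_def hom_def)

lemma hom_left: "y \<in> carrier K \<Longrightarrow> (\<lambda>x. c x y) \<in> hom G A"
  and hom_right: "x \<in> carrier G \<Longrightarrow> c x \<in> hom K A"
  using biadditive by (auto simp: biadditive_def)

lemma one_left [simp]: "y \<in> carrier K \<Longrightarrow> c \<one>\<^bsub>G\<^esub> y = \<one>\<^bsub>A\<^esub>"
  using hom_one[OF hom_left] G.is_group A.is_group by auto

lemma one_right [simp]: "x \<in> carrier G \<Longrightarrow> c x \<one>\<^bsub>K\<^esub> = \<one>\<^bsub>A\<^esub>"
  using hom_one[OF hom_right] K.is_group A.is_group by auto

lemma inv_left [simp]: "x \<in> carrier G \<Longrightarrow> y \<in> carrier K \<Longrightarrow> c (inv\<^bsub>G\<^esub> x) y = inv\<^bsub>A\<^esub> c x y"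
  using hom_inv[OF hom_left] G.is_group A.is_group by auto

lemma inv_right [simp]: "x \<in> carrier G \<Longrightarrow> y \<in> carrier K \<Longrightarrow> c x (inv\<^bsub>K\<^esub> y) = inv\<^bsub>A\<^esub> c x y"
  using hom_inv[OF hom_right] K.is_group A.is_group by auto

end

lemma biadditive_mapI:
  "group G \<Longrightarrow> group K \<Longrightarrow> comm_group A \<Longrightarrow> biadditive G K A c \<Longrightarrow> biadditive_map G K A c"
  by (simp add: biadditive_map_def biadditive_map_axioms_def)

lemma biadditive_eq_on_generate:
  assumes "biadditive_map G K A c" "biadditive_map G K A d"
    and S: "S \<subseteq> carrier G" "U \<subseteq> carrier K" and "\<And>s u. s \<in> S \<Longrightarrow> u \<in> U \<Longrightarrow> c s u = d s u"
    and "x \<in> generate G S" "y \<in> generate K U"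
  shows "c x y = d x y"
proof -
  interpret c: biadditive_map G K A c by fact
  interpret d: biadditive_map G K A d by fact
  have x: "x \<in> carrier G" and y: "y \<in> carrier K"
    using assms c.G.generate_in_carrier c.K.generate_in_carrier by auto
  have "c s y = d s y" if "s \<in> S" for s
    by (rule hom_eq_on_generate[OF c.K.is_group c.A.is_group _ _ S(2) _ assms(7)])
      (use that S assms(5) c.hom_right d.hom_right in auto)
  then show ?thesis
    using hom_eq_on_generate[OF c.G.is_group c.A.is_group c.hom_left[OF y] d.hom_left[OF y] S(1) _ assms(6)]
    by auto
qed

locale quadratic = G: group G + A: comm_group A
  for G :: "'a monoid" and A :: "'b monoid" +
  fixes f
  assumes quadratic: "quadratic_map G A f"
begin

lemma f_closed [simp, intro]: "x \<in> carrier G \<Longrightarrow> f x \<in> carrier A"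
  using quadratic by (auto simp: quadratic_map_def)

sublocale cr: biadditive_map G G A "cross_effect G A f"
  by unfold_locales (use quadratic in \<open>auto simp: quadratic_map_def biadditive_def\<close>)

lemma f_mult:
  "x \<in> carrier G \<Longrightarrow> y \<in> carrier G \<Longrightarrow> f (x \<otimes>\<^bsub>G\<^esub> y) = f x \<otimes>\<^bsub>A\<^esub> f y \<otimes>\<^bsub>A\<^esub> cross_effect G A f x y"
  using f_closed[of x] f_closed[of y] f_closed[of "x \<otimes>\<^bsub>G\<^esub> y"] G.m_closed[of x y]
  unfolding cross_effect_def by algebra

lemma f_one [simp]: "f \<one>\<^bsub>G\<^esub> = \<one>\<^bsub>A\<^esub>"
  using f_mult[of "\<one>\<^bsub>G\<^esub>" "\<one>\<^bsub>G\<^esub>"] by simp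

lemma f_inv: "x \<in> carrier G \<Longrightarrow> f (inv\<^bsub>G\<^esub> x) = inv\<^bsub>A\<^esub> (f x) \<otimes>\<^bsub>A\<^esub> cross_effect G A f x x"
proof -
  assume x: "x \<in> carrier G"
  have e: "f x \<otimes>\<^bsub>A\<^esub> f (inv\<^bsub>G\<^esub> x) \<otimes>\<^bsub>A\<^esub> inv\<^bsub>A\<^esub> cross_effect G A f x x = \<one>\<^bsub>A\<^esub>"
    using f_mult[of x "inv\<^bsub>G\<^esub> x"] x by simp
  \<comment> \<open>The parenthesised last factor is trivial by \<open>e\<close>. Inserting it turns
    the claim into an identity of words in an abelian group; removing it again gives the
    result.\<close>
  have "f (inv\<^bsub>G\<^esub> x) = inv\<^bsub>A\<^esub> (f x) \<otimes>\<^bsub>A\<^esub> cross_effect G A f x x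
      \<otimes>\<^bsub>A\<^esub> (f x \<otimes>\<^bsub>A\<^esub> f (inv\<^bsub>G\<^esub> x) \<otimes>\<^bsub>A\<^esub> inv\<^bsub>A\<^esub> cross_effect G A f x x)"
    using f_closed[of x] f_closed[of "inv\<^bsub>G\<^esub> x"] x cr.closed[of x x] G.inv_closed[of x] by algebra
  from this[unfolded e] show ?thesis using x by simp
qed

end

lemma quadraticI:
  assumes "group G" "comm_group A" "quadratic_map G A f"
  shows "quadratic G A f"
  using assms by (simp add: quadratic_def quadratic_axioms_def)

lemma cross_effect_eqI:
  assumes "comm_group A" "q \<in> carrier G \<rightarrow> carrier A" "x \<in> carrier G" "y \<in> carrier G" "d \<in> carrier A"
    and "q (x \<otimes>\<^bsub>G\<^esub> y) = q x \<otimes>\<^bsub>A\<^esub> q y \<otimes>\<^bsub>A\<^esub> d"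
  shows "cross_effect G A q x y = d"
proof -
  interpret comm_group A by fact
  have "q x \<in> carrier A" "q y \<in> carrier A" using assms by auto
  then show ?thesis using assms(5) unfolding cross_effect_def assms(6) by algebra
qed

text \<open>A deviation from additivity that is known to be biadditive must be the cross-effect, so
  a single formula yields both the quadratic property and the cross-effect.\<close>

lemma quadratic_mapI:
  assumes "group G" "comm_group A" "q \<in> carrier G \<rightarrow> carrier A" "biadditive G G A c"
    and "\<And>x y. x \<in> carrier G \<Longrightarrow> y \<in> carrier G \<Longrightarrow> q (x \<otimes>\<^bsub>G\<^esub> y) = q x \<otimes>\<^bsub>A\<^esub> q y \<otimes>\<^bsub>A\<^esub> c x y"
  shows "quadratic_map G A q"
    and "x \<in> carrier G \<Longrightarrow> y \<in> carrier G \<Longrightarrow> cross_effect G A q x y = c x y"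
proof -
  interpret biadditive_map G G A c using assms by (simp add: biadditive_mapI)
  show cr: "cross_effect G A q x y = c x y" if "x \<in> carrier G" "y \<in> carrier G" for x y
    by (rule cross_effect_eqI) (use assms that in auto)
  have "biadditive G G A (cross_effect G A q)"
    by (rule biadditiveI) (simp_all add: cr)
  then show "quadratic_map G A q"
    using assms(3) by (auto simp: quadratic_map_def biadditive_def)
qed

text \<open>Biadditivity propagates agreement of the cross-effects from pairs of generators to all
  pairs. The values then follow by induction, where inverses bring in the cross-effect of an element
  with itself.\<close>

lemma quadratic_eq_on_generate:
  assumes "quadratic G A f" "quadratic G A g" and S: "S \<subseteq> carrier G"
    and "\<And>s. s \<in> S \<Longrightarrow> f s = g s"
    and "\<And>s t. s \<in> S \<Longrightarrow> t \<in> S \<Longrightarrow> cross_effect G A f s t = cross_effect G A g s t"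
    and "x \<in> generate G S"
  shows "f x = g x"
proof -
  interpret f: quadratic G A f by fact
  interpret g: quadratic G A g by fact
  have cr: "cross_effect G A f u v = cross_effect G A g u v"
    if "u \<in> generate G S" "v \<in> generate G S" for u v
    by (rule biadditive_eq_on_generate[OF f.cr.biadditive_map_axioms g.cr.biadditive_map_axioms S S])
      (use assms that in auto)
  show ?thesis using assms(6)
  proof (induction rule: generate.induct)
    case (inv h)
    then show ?case using assms S cr[of h h] by (auto simp: f.f_inv g.f_inv generate.incl subset_iff)
  next
    case (eng h1 h2)
    then have "h1 \<in> carrier G" "h2 \<in> carrier G" using f.G.generate_in_carrier[OF S] by auto
    then show ?case using eng cr by (simp add: f.f_mult g.f_mult)
  qed (use assms in auto)
qed

lemma quadratic_hom_comp:
  assumes "quadratic G A f" "comm_group B" "h \<in> hom A B"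
  shows "quadratic G B (h \<circ> f)"
    and "x \<in> carrier G \<Longrightarrow> y \<in> carrier G \<Longrightarrow>
      cross_effect G B (h \<circ> f) x y = h (cross_effect G A f x y)"
proof -
  interpret quadratic G A f by fact
  interpret B: comm_group B by fact
  interpret h: group_hom A B h by unfold_locales fact
  have b: "biadditive G G B (\<lambda>x y. h (cross_effect G A f x y))"
    by (rule biadditiveI) auto
  have m: "(h \<circ> f) (x \<otimes>\<^bsub>G\<^esub> y) = (h \<circ> f) x \<otimes>\<^bsub>B\<^esub> (h \<circ> f) y \<otimes>\<^bsub>B\<^esub> h (cross_effect G A f x y)"
    if "x \<in> carrier G" "y \<in> carrier G" for x y
    using that by (simp add: f_mult)
  show "quadratic G B (h \<circ> f)"
    by (intro quadraticI G.is_group assms(2) quadratic_mapI(1)[OF _ _ _ b m]) auto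
  show "cross_effect G B (h \<circ> f) x y = h (cross_effect G A f x y)" if "x \<in> carrier G" "y \<in> carrier G"
    by (rule quadratic_mapI(2)[OF _ _ _ b m]) (use that assms G.is_group in auto)
qed

lemma quadratic_comp_hom:
  assumes "quadratic G A f" "group K" "h \<in> hom K G"
  shows "quadratic K A (f \<circ> h)"
    and "x \<in> carrier K \<Longrightarrow> y \<in> carrier K \<Longrightarrow>
      cross_effect K A (f \<circ> h) x y = cross_effect G A f (h x) (h y)"
proof -
  interpret quadratic G A f by fact
  interpret K: group K by fact
  interpret h: group_hom K G h by unfold_locales fact
  have b: "biadditive K K A (\<lambda>x y. cross_effect G A f (h x) (h y))"
    by (rule biadditiveI) auto
  have m: "(f \<circ> h) (x \<otimes>\<^bsub>K\<^esub> y) = (f \<circ> h) x \<otimes>\<^bsub>A\<^esub> (f \<circ> h) y \<otimes>\<^bsub>A\<^esub> cross_effect G A f (h x) (h y)"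
    if "x \<in> carrier K" "y \<in> carrier K" for x y
    using that by (simp add: f_mult)
  show "quadratic K A (f \<circ> h)"
    by (intro quadraticI K.is_group A.comm_group_axioms quadratic_mapI(1)[OF _ _ _ b m]) auto
  show "cross_effect K A (f \<circ> h) x y = cross_effect G A f (h x) (h y)" if "x \<in> carrier K" "y \<in> carrier K"
    by (rule quadratic_mapI(2)[OF _ _ _ b m]) (use that A.comm_group_axioms in auto)
qed

text \<open>The central extension of \<^term>\<open>G\<close> by \<^term>\<open>A\<close> with cocycle \<^term>\<open>c\<close>: its homomorphic
  sections are the maps from \<^term>\<open>G\<close> to \<^term>\<open>A\<close> with cross-effect \<^term>\<open>c\<close>.\<close>

definition twisted_prod :: "'a monoid \<Rightarrow> 'b monoid \<Rightarrow> ('a \<Rightarrow> 'a \<Rightarrow> 'b) \<Rightarrow> ('b \<times> 'a) monoid" where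
  "twisted_prod G A c = \<lparr>carrier = carrier A \<times> carrier G,
     monoid.mult = (\<lambda>u v. (fst u \<otimes>\<^bsub>A\<^esub> fst v \<otimes>\<^bsub>A\<^esub> c (snd u) (snd v), snd u \<otimes>\<^bsub>G\<^esub> snd v)),
     one = (\<one>\<^bsub>A\<^esub>, \<one>\<^bsub>G\<^esub>)\<rparr>"

text \<open>A biadditive map satisfies the cocycle identity: both ways of bracketing (a,g), (b,h),
  (d,k) produce the correction c(g,h) + c(g,k) + c(h,k).\<close>

lemma twisted_prod_group:
  assumes "biadditive_map G G A c"
  shows "group (twisted_prod G A c)"
proof -
  interpret biadditive_map G G A c by fact
  show ?thesis
  proof (rule groupI)
  show "u \<otimes>\<^bsub>twisted_prod G A c\<^esub> v \<otimes>\<^bsub>twisted_prod G A c\<^esub> w =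
    u \<otimes>\<^bsub>twisted_prod G A c\<^esub> (v \<otimes>\<^bsub>twisted_prod G A c\<^esub> w)"
    if "u \<in> carrier (twisted_prod G A c)" "v \<in> carrier (twisted_prod G A c)"
      "w \<in> carrier (twisted_prod G A c)" for u v w
    using that by (auto simp: twisted_prod_def G.m_assoc A.m_ac)
  show "\<exists>v\<in>carrier (twisted_prod G A c). v \<otimes>\<^bsub>twisted_prod G A c\<^esub> u = \<one>\<^bsub>twisted_prod G A c\<^esub>"
    if "u \<in> carrier (twisted_prod G A c)" for u
  proof
    \<comment> \<open>The summand c(g,g) compensates for c(-g,g) = -c(g,g) in the product with
      (a,g).\<close>
    let ?v = "(inv\<^bsub>A\<^esub> (fst u) \<otimes>\<^bsub>A\<^esub> c (snd u) (snd u), inv\<^bsub>G\<^esub> (snd u))"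
    have u: "fst u \<in> carrier A" "c (snd u) (snd u) \<in> carrier A" "snd u \<in> carrier G"
      using that by (auto simp: twisted_prod_def)
    show "?v \<in> carrier (twisted_prod G A c)" using u by (simp add: twisted_prod_def)
    show "?v \<otimes>\<^bsub>twisted_prod G A c\<^esub> u = \<one>\<^bsub>twisted_prod G A c\<^esub>"
      using u by (simp add: twisted_prod_def A.conj_cancel)
  qed
qed (auto simp: twisted_prod_def)
qed

lemma twisted_prod_simps:
  "carrier (twisted_prod G A c) = carrier A \<times> carrier G"
  "(a, g) \<otimes>\<^bsub>twisted_prod G A c\<^esub> (b, h) = (a \<otimes>\<^bsub>A\<^esub> b \<otimes>\<^bsub>A\<^esub> c g h, g \<otimes>\<^bsub>G\<^esub> h)"
  "\<one>\<^bsub>twisted_prod G A c\<^esub> = (\<one>\<^bsub>A\<^esub>, \<one>\<^bsub>G\<^esub>)"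
  by (simp_all add: twisted_prod_def)

lemma twisted_prod_inv:
  assumes "biadditive_map G G A c" "a \<in> carrier A" "g \<in> carrier G"
  shows "inv\<^bsub>twisted_prod G A c\<^esub> (a, g) = (inv\<^bsub>A\<^esub> a \<otimes>\<^bsub>A\<^esub> c g g, inv\<^bsub>G\<^esub> g)"
proof -
  interpret biadditive_map G G A c by fact
  have "c g g \<in> carrier A" using assms by simp
  with assms show ?thesis
    by (intro group.inv_equality[OF twisted_prod_group[OF assms(1)]])
      (auto simp: twisted_prod_simps A.conj_cancel)
qed

section \<open>Presented groups\<close>

primrec word_eval :: "('b, 'z) monoid_scheme \<Rightarrow> ('g \<Rightarrow> 'b) \<Rightarrow> 'g word \<Rightarrow> 'b" where
  "word_eval K f [] = \<one>\<^bsub>K\<^esub>"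
| "word_eval K f (l # w) = (if fst l then f (snd l) else inv\<^bsub>K\<^esub> (f (snd l))) \<otimes>\<^bsub>K\<^esub> word_eval K f w"

lemma (in group) word_eval_closed:
  "set w \<subseteq> UNIV \<times> S \<Longrightarrow> f \<in> S \<rightarrow> carrier G \<Longrightarrow> word_eval G f w \<in> carrier G"
  by (induction w) (auto simp: Pi_iff)

lemma (in group) word_eval_append:
  "set u \<subseteq> UNIV \<times> S \<Longrightarrow> set v \<subseteq> UNIV \<times> S \<Longrightarrow> f \<in> S \<rightarrow> carrier G \<Longrightarrow>
    word_eval G f (u @ v) = word_eval G f u \<otimes> word_eval G f v"
  by (induction u) (auto simp: Pi_iff m_assoc word_eval_closed)

locale presentation =
  fixes S :: "'g set" and R :: "('g word \<times> 'g word) set"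
  assumes rels_wf: "(u, v) \<in> R \<Longrightarrow> set u \<subseteq> UNIV \<times> S \<and> set v \<subseteq> UNIV \<times> S"
begin

abbreviation "E \<equiv> presentation_eq S R"
abbreviation "cls \<equiv> presentation_class S R"
abbreviation "G \<equiv> presented_group S R"

lemma eq_wf: "E u v \<Longrightarrow> set u \<subseteq> UNIV \<times> S \<and> set v \<subseteq> UNIV \<times> S"
  by (induction rule: presentation_eq.induct) (use rels_wf in auto)

lemma cls_eqI: "E u v \<Longrightarrow> cls u = cls v"
  unfolding presentation_class_def by (blast intro: presentation_eq.sym presentation_eq.trans)

lemma self_in_cls: "set u \<subseteq> UNIV \<times> S \<Longrightarrow> u \<in> cls u"
  by (simp add: presentation_class_def presentation_eq.refl)

lemma carrier_iff: "X \<in> carrier G \<longleftrightarrow> (\<exists>u. set u \<subseteq> UNIV \<times> S \<and> X = cls u)"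
  by (auto simp: presented_group_def)

lemma cls_carrier: "set u \<subseteq> UNIV \<times> S \<Longrightarrow> cls u \<in> carrier G"
  by (auto simp: carrier_iff)

lemma one_eq: "\<one>\<^bsub>G\<^esub> = cls []"
  by (simp add: presented_group_def)

lemma mult_eq:
  assumes "set u \<subseteq> UNIV \<times> S" "set v \<subseteq> UNIV \<times> S"
  shows "cls u \<otimes>\<^bsub>G\<^esub> cls v = cls (u @ v)"
proof -
  have "cls (u' @ v') = cls (u @ v)" if "u' \<in> cls u" "v' \<in> cls v" for u' v'
    using that by (intro cls_eqI) (auto simp: presentation_class_def intro: presentation_eq.intros)
  then have "(\<Union>u'\<in>cls u. \<Union>v'\<in>cls v. cls (u' @ v')) = cls (u @ v)"
    using self_in_cls assms by blast
  then show ?thesis by (simp add: presented_group_def)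
qed

lemma inverse_word:
  "set u \<subseteq> UNIV \<times> S \<Longrightarrow> E (map (\<lambda>l. (\<not> fst l, snd l)) (rev u) @ u) []"
proof (induction u)
  case (Cons l u)
  obtain b x where l: "l = (b, x)" by fastforce
  let ?r = "map (\<lambda>l. (\<not> fst l, snd l)) (rev u)"
  have "set ?r \<subseteq> UNIV \<times> S" using Cons(2) by auto
  moreover have "E ([(\<not> b, x), (b, x)] @ u) ([] @ u)"
    using Cons(2) l presentation_eq.cancel[of x S R "\<not> b"]
    by (intro presentation_eq.append) (auto intro: presentation_eq.refl)
  ultimately have "E (?r @ [(\<not> b, x), (b, x)] @ u) (?r @ u)"
    by (intro presentation_eq.append presentation_eq.refl) auto
  then show ?case using Cons l by (auto intro: presentation_eq.trans)
qed (simp add: presentation_eq.refl)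

lemma group_presented: "group G"
proof (rule groupI)
  show "\<one>\<^bsub>G\<^esub> \<in> carrier G" by (simp add: one_eq cls_carrier)
  fix X assume "X \<in> carrier G"
  then obtain u where u: "set u \<subseteq> UNIV \<times> S" "X = cls u" by (auto simp: carrier_iff)
  show "\<one>\<^bsub>G\<^esub> \<otimes>\<^bsub>G\<^esub> X = X" using u by (simp add: one_eq mult_eq)
  have "set (map (\<lambda>l. (\<not> fst l, snd l)) (rev u)) \<subseteq> UNIV \<times> S" using u by auto
  then show "\<exists>Y\<in>carrier G. Y \<otimes>\<^bsub>G\<^esub> X = \<one>\<^bsub>G\<^esub>"
    using u inverse_word[OF u(1)]
    by (intro bexI[of _ "cls (map (\<lambda>l. (\<not> fst l, snd l)) (rev u))"])
      (auto simp: mult_eq one_eq cls_carrier cls_eqI)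
next
  fix X Y Z assume "X \<in> carrier G" "Y \<in> carrier G" "Z \<in> carrier G"
  then obtain u v w where "set u \<subseteq> UNIV \<times> S" "set v \<subseteq> UNIV \<times> S" "set w \<subseteq> UNIV \<times> S"
    "X = cls u" "Y = cls v" "Z = cls w" by (auto simp: carrier_iff)
  then show "X \<otimes>\<^bsub>G\<^esub> Y \<otimes>\<^bsub>G\<^esub> Z = X \<otimes>\<^bsub>G\<^esub> (Y \<otimes>\<^bsub>G\<^esub> Z)" by (simp add: mult_eq)
next
  fix X Y assume "X \<in> carrier G" "Y \<in> carrier G"
  then obtain u v where "set u \<subseteq> UNIV \<times> S" "set v \<subseteq> UNIV \<times> S" "X = cls u" "Y = cls v"
    by (auto simp: carrier_iff)
  then show "X \<otimes>\<^bsub>G\<^esub> Y \<in> carrier G" by (simp add: mult_eq cls_carrier)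
qed

abbreviation "gen x \<equiv> cls [(True, x)]"

lemma gen_closed: "x \<in> S \<Longrightarrow> gen x \<in> carrier G"
  by (simp add: cls_carrier)

lemma inv_gen:
  assumes "x \<in> S"
  shows "inv\<^bsub>G\<^esub> (gen x) = cls [(False, x)]"
proof (rule group.inv_equality[OF group_presented])
  show "cls [(False, x)] \<otimes>\<^bsub>G\<^esub> gen x = \<one>\<^bsub>G\<^esub>"
    using assms cls_eqI[OF presentation_eq.cancel[of x S R False]] by (simp add: mult_eq one_eq)
qed (use assms in \<open>auto simp: cls_carrier\<close>)

lemma word_eval_gen: "set u \<subseteq> UNIV \<times> S \<Longrightarrow> word_eval G gen u = cls u"
proof (induction u)
  case (Cons l u)
  then have l: "snd l \<in> S" by auto
  have "cls [l] \<otimes>\<^bsub>G\<^esub> cls u = cls (l # u)" using mult_eq[of "[l]" u] Cons by auto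
  then show ?case using Cons l inv_gen by (cases l) auto
qed (simp add: one_eq)

lemma carrier_generate: "carrier G = generate G (gen ` S)"
proof
  interpret group G by (rule group_presented)
  show "generate G (gen ` S) \<subseteq> carrier G" using gen_closed by (intro generate_incl) auto
  have "word_eval G gen u \<in> generate G (gen ` S)" if "set u \<subseteq> UNIV \<times> S" for u
    using that
  proof (induction u)
    case (Cons l u)
    then have "snd l \<in> S" by auto
    then show ?case
      using Cons by (auto intro!: generate.eng intro: generate.incl generate.inv)
  qed (simp add: generate.one)
  then show "carrier G \<subseteq> generate G (gen ` S)" by (auto simp: carrier_iff word_eval_gen)
qed

lemma relation_holds: "(u, v) \<in> R \<Longrightarrow> word_eval G gen u = word_eval G gen v"
  using rels_wf[of u v] by (simp add: word_eval_gen cls_eqI presentation_eq.relation)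

lemma lift:
  assumes K: "group K" and f: "f \<in> S \<rightarrow> carrier K"
    and rel: "\<And>u v. (u, v) \<in> R \<Longrightarrow> word_eval K f u = word_eval K f v"
  shows "\<exists>h\<in>hom G K. \<forall>x\<in>S. h (gen x) = f x"
proof -
  interpret K: group K by fact
  have ev: "word_eval K f u = word_eval K f v" if "E u v" for u v
    using that
  proof (induction rule: presentation_eq.induct)
    case (append u u' v v')
    then show ?case
      using eq_wf[of u u'] eq_wf[of v v'] K.word_eval_append[of u S v f] K.word_eval_append[of u' S v' f] f
      by simp
  next
    case (cancel x b)
    then show ?case using f by (auto simp: Pi_iff)
  qed (use rel in auto)
  \<comment> \<open>Any representative will do: by \<open>ev\<close>, evaluation is constant on the
    classes of words.\<close>
  define h where "h X = word_eval K f (SOME u. u \<in> X)" for X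
  have h: "h (cls u) = word_eval K f u" if "set u \<subseteq> UNIV \<times> S" for u
  proof -
    have "(SOME v. v \<in> cls u) \<in> cls u" by (rule someI) (rule self_in_cls[OF that])
    then show ?thesis unfolding h_def using ev by (simp add: presentation_class_def)
  qed
  have "h \<in> hom G K"
    by (rule homI) (auto simp: carrier_iff h mult_eq K.word_eval_closed[OF _ f] K.word_eval_append[OF _ _ f])
  moreover have "h (gen x) = f x" if "x \<in> S" for x
    using that f by (auto simp: h Pi_iff)
  ultimately show ?thesis by blast
qed

text \<open>Each generator is sent to the pair of its prescribed value and its own class. Relations
  are then checked in the twisted product, whose multiplication adds the cross-effects of the
  factors automatically.\<close>

lemma quadratic_lift:
  assumes A: "comm_group A" and c: "biadditive G G A c" and q: "q \<in> S \<rightarrow> carrier A"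
    and rel: "\<And>u v. (u, v) \<in> R \<Longrightarrow> word_eval (twisted_prod G A c) (\<lambda>x. (q x, gen x)) u
      = word_eval (twisted_prod G A c) (\<lambda>x. (q x, gen x)) v"
  shows "\<exists>f. f \<in> carrier G \<rightarrow> carrier A \<and> (\<forall>x\<in>S. f (gen x) = q x) \<and>
    (\<forall>x\<in>carrier G. \<forall>y\<in>carrier G. f (x \<otimes>\<^bsub>G\<^esub> y) = f x \<otimes>\<^bsub>A\<^esub> f y \<otimes>\<^bsub>A\<^esub> c x y)"
proof -
  let ?E = "twisted_prod G A c"
  have bm: "biadditive_map G G A c" using A c group_presented by (simp add: biadditive_mapI)
  interpret biadditive_map G G A c by fact
  have E: "group ?E" by (rule twisted_prod_group[OF bm])
  obtain h where h: "h \<in> hom G ?E" "\<And>x. x \<in> S \<Longrightarrow> h (gen x) = (q x, gen x)"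
  proof -
    have "(\<lambda>x. (q x, gen x)) \<in> S \<rightarrow> carrier ?E"
      using q gen_closed by (auto simp: twisted_prod_simps)
    then show thesis using lift[OF E _ rel] that by blast
  qed
  \<comment> \<open>An endomorphism that fixes all generators is the identity, so \<open>h\<close>
    is a section of the second projection and its first component has deviation
    \<open>c\<close>.\<close>
  have "snd \<circ> h \<in> hom G G"
    by (rule hom_compose[OF h(1)]) (auto simp: hom_def twisted_prod_def)
  then have snd: "snd (h x) = x" if "x \<in> carrier G" for x
  proof -
    have "(snd \<circ> h) x = (\<lambda>x. x) x"
    proof (rule hom_eq_on_generate[OF group_presented group_presented \<open>snd \<circ> h \<in> hom G G\<close>])
      show "(\<lambda>x. x) \<in> hom G G" by (simp add: hom_def)
      show "gen ` S \<subseteq> carrier G" using gen_closed by blast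
      show "x \<in> generate G (gen ` S)" using that by (simp only: carrier_generate)
      show "(snd \<circ> h) s = s" if "s \<in> gen ` S" for s using that h(2) by auto
    qed
    then show ?thesis by simp
  qed
  have "fst (h (x \<otimes>\<^bsub>G\<^esub> y)) = fst (h x) \<otimes>\<^bsub>A\<^esub> fst (h y) \<otimes>\<^bsub>A\<^esub> c x y" if "x \<in> carrier G" "y \<in> carrier G" for x y
    using hom_mult[OF h(1) that] snd that by (simp add: twisted_prod_def)
  moreover have "fst \<circ> h \<in> carrier G \<rightarrow> carrier A"
    using hom_in_carrier[OF h(1)] by (auto simp: twisted_prod_simps mem_Times_iff)
  ultimately show ?thesis using h(2) by (intro exI[of _ "fst \<circ> h"]) auto
qed

end

section \<open>Tensor products of abelian groups\<close>

locale ab_tensor_of = A: comm_group A + B: comm_group B for A :: "'a monoid" and B :: "'b monoid"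
begin

abbreviation "F \<equiv> free_Abelian_group (carrier A \<times> carrier B)"
abbreviation "Q \<equiv> ab_tensor_kernel A B"
abbreviation "AB \<equiv> ab_tensor A B"

sublocale F: comm_group F by (rule abelian_free_Abelian_group)

lemma frag_diff_carrier:
  assumes "p \<in> carrier A \<times> carrier B" "q \<in> carrier A \<times> carrier B" "r \<in> carrier A \<times> carrier B"
  shows "frag_of p - frag_of q - frag_of r \<in> carrier F"
proof -
  have "frag_of p \<otimes>\<^bsub>F\<^esub> inv\<^bsub>F\<^esub> frag_of q \<otimes>\<^bsub>F\<^esub> inv\<^bsub>F\<^esub> frag_of r \<in> carrier F"
    using assms by (intro F.m_closed F.inv_closed) auto
  then show ?thesis using assms by simp
qed

lemma rels_carrier: "ab_tensor_rels A B \<subseteq> carrier F"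
proof
  fix z assume "z \<in> ab_tensor_rels A B"
  then obtain p q r where "z = frag_of p - frag_of q - frag_of r" "p \<in> carrier A \<times> carrier B"
    "q \<in> carrier A \<times> carrier B" "r \<in> carrier A \<times> carrier B"
    unfolding ab_tensor_rels_def by blast
  then show "z \<in> carrier F" using frag_diff_carrier by blast
qed

lemma Q_subgroup: "subgroup Q F"
  unfolding ab_tensor_kernel_def by (rule F.generate_is_subgroup[OF rels_carrier])

lemma Q_normal: "Q \<lhd> F"
  by (rule F.subgroup_imp_normal[OF Q_subgroup])

sublocale AB: comm_group AB
  unfolding ab_tensor_def by (rule F.abelian_FactGroup[OF Q_subgroup])

lemma proj_hom: "(\<lambda>z. Q #>\<^bsub>F\<^esub> z) \<in> hom F AB"
  unfolding ab_tensor_def by (rule normal.r_coset_hom_Mod[OF Q_normal])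

lemma pure_closed [simp, intro]: "a \<in> carrier A \<Longrightarrow> b \<in> carrier B \<Longrightarrow> ab_pure A B a b \<in> carrier AB"
  unfolding ab_pure_def using hom_in_carrier[OF proj_hom] by simp

text \<open>Both families of tensor relations have the shape p - q - r, so one argument serves for
  additivity in either variable.\<close>

lemma proj_rel:
  assumes "frag_of p - frag_of q - frag_of r \<in> ab_tensor_rels A B"
    and "p \<in> carrier A \<times> carrier B" "q \<in> carrier A \<times> carrier B" "r \<in> carrier A \<times> carrier B"
  shows "Q #>\<^bsub>F\<^esub> frag_of p = (Q #>\<^bsub>F\<^esub> frag_of q) \<otimes>\<^bsub>AB\<^esub> (Q #>\<^bsub>F\<^esub> frag_of r)"
proof -
  have "frag_of p - frag_of q - frag_of r \<in> Q"
    unfolding ab_tensor_kernel_def using assms(1) by (rule generate.incl)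
  moreover have "frag_of q + frag_of r \<in> carrier F" "frag_of p \<in> carrier F"
    using assms F.m_closed[of "frag_of q" "frag_of r"] by auto
  ultimately have "Q #>\<^bsub>F\<^esub> frag_of p = Q #>\<^bsub>F\<^esub> (frag_of q + frag_of r)"
    by (subst Mod_coset_eq_iff[OF Q_normal]) (auto simp: algebra_simps)
  also have "\<dots> = (Q #>\<^bsub>F\<^esub> frag_of q) \<otimes>\<^bsub>AB\<^esub> (Q #>\<^bsub>F\<^esub> frag_of r)"
    using hom_mult[OF proj_hom, of "frag_of q" "frag_of r"] assms by simp
  finally show ?thesis .
qed

lemma pure_biadditive: "biadditive A B AB (ab_pure A B)"
proof (rule biadditiveI)
  show "ab_pure A B (x \<otimes>\<^bsub>A\<^esub> x') y = ab_pure A B x y \<otimes>\<^bsub>AB\<^esub> ab_pure A B x' y"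
    if "x \<in> carrier A" "x' \<in> carrier A" "y \<in> carrier B" for x x' y
    unfolding ab_pure_def by (rule proj_rel) (use that in \<open>auto simp: ab_tensor_rels_def\<close>)
  show "ab_pure A B x (y \<otimes>\<^bsub>B\<^esub> y') = ab_pure A B x y \<otimes>\<^bsub>AB\<^esub> ab_pure A B x y'"
    if "x \<in> carrier A" "y \<in> carrier B" "y' \<in> carrier B" for x y y'
    unfolding ab_pure_def by (rule proj_rel) (use that in \<open>auto simp: ab_tensor_rels_def\<close>)
qed auto

sublocale pure: biadditive_map A B AB "ab_pure A B"
  by unfold_locales (rule pure_biadditive)

lemma carrier_generate:
  "carrier AB = generate AB {ab_pure A B a b | a b. a \<in> carrier A \<and> b \<in> carrier B}" (is "_ = ?g")
proof
  have sub: "{ab_pure A B a b | a b. a \<in> carrier A \<and> b \<in> carrier B} \<subseteq> carrier AB" by auto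
  then show "?g \<subseteq> carrier AB" by (rule AB.generate_incl)
  have "Q #>\<^bsub>F\<^esub> z \<in> ?g" if "Poly_Mapping.keys z \<subseteq> carrier A \<times> carrier B" for z
    using that
  proof (rule free_Abelian_group_induct)
    show "Q #>\<^bsub>F\<^esub> 0 \<in> ?g"
      using hom_one[OF proj_hom F.is_group AB.is_group] generate.one[of AB] by simp
  next
    fix x y :: "('a \<times> 'b) \<Rightarrow>\<^sub>0 int"
    assume xy: "Poly_Mapping.keys x \<subseteq> carrier A \<times> carrier B"
      "Poly_Mapping.keys y \<subseteq> carrier A \<times> carrier B" "Q #>\<^bsub>F\<^esub> x \<in> ?g" "Q #>\<^bsub>F\<^esub> y \<in> ?g"
    then have cl: "x \<in> carrier F" "y \<in> carrier F" by auto
    have "x - y = x \<otimes>\<^bsub>F\<^esub> inv\<^bsub>F\<^esub> y" using xy by simp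
    then have "Q #>\<^bsub>F\<^esub> (x - y) = (Q #>\<^bsub>F\<^esub> x) \<otimes>\<^bsub>AB\<^esub> inv\<^bsub>AB\<^esub> (Q #>\<^bsub>F\<^esub> y)"
      using hom_mult[OF proj_hom cl(1) F.inv_closed[OF cl(2)]] hom_inv[OF proj_hom F.is_group AB.is_group cl(2)]
      by metis
    then show "Q #>\<^bsub>F\<^esub> (x - y) \<in> ?g"
      using xy AB.generate_m_inv_closed[OF sub] by (simp add: generate.eng)
  next
    fix p assume "p \<in> carrier A \<times> carrier B"
    then show "Q #>\<^bsub>F\<^esub> frag_of p \<in> ?g" by (intro generate.incl) (auto simp: ab_pure_def)
  qed
  then show "carrier AB \<subseteq> ?g"
    unfolding ab_tensor_def carrier_FactGroup by auto
qed

lemma lift: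
  assumes "comm_group C" "biadditive A B C f"
  shows "\<exists>h\<in>hom AB C. \<forall>a\<in>carrier A. \<forall>b\<in>carrier B. h (ab_pure A B a b) = f a b"
proof -
  interpret C: comm_group C by fact
  interpret f: biadditive_map A B C f by unfold_locales fact
  obtain h where h: "h \<in> hom F C" "\<And>p. p \<in> carrier A \<times> carrier B \<Longrightarrow> h (frag_of p) = case_prod f p"
  proof (rule C.free_Abelian_group_universal[of "case_prod f" "carrier A \<times> carrier B"])
    show "case_prod f ` (carrier A \<times> carrier B) \<subseteq> carrier C" by auto
  qed (rule that)
  have "h z = \<one>\<^bsub>C\<^esub>" if "z \<in> Q" for z
  proof -
    have tr: "(\<lambda>_. \<one>\<^bsub>C\<^esub>) \<in> hom F C" by (simp add: hom_def)
    have hd: "h (x - y) = h x \<otimes>\<^bsub>C\<^esub> inv\<^bsub>C\<^esub> h y" if "x \<in> carrier F" "y \<in> carrier F" for x y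
    proof -
      have "x - y = x \<otimes>\<^bsub>F\<^esub> inv\<^bsub>F\<^esub> y" using that by simp
      then show ?thesis
        using hom_mult[OF h(1) that(1) F.inv_closed[OF that(2)]] hom_inv[OF h(1) F.is_group C.is_group that(2)]
        by metis
    qed
    have "h s = \<one>\<^bsub>C\<^esub>" if s: "s \<in> ab_tensor_rels A B" for s
    proof -
      obtain p q r where s: "s = frag_of p - frag_of q - frag_of r"
        and pqr: "p \<in> carrier A \<times> carrier B" "q \<in> carrier A \<times> carrier B" "r \<in> carrier A \<times> carrier B"
        and eq: "case_prod f p = case_prod f q \<otimes>\<^bsub>C\<^esub> case_prod f r"
        using s unfolding ab_tensor_rels_def by auto
      have cl: "frag_of p - frag_of q \<in> carrier F" "case_prod f q \<in> carrier C" "case_prod f r \<in> carrier C"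
        using pqr by (auto intro!: order.trans[OF keys_diff])
      have "h s = case_prod f p \<otimes>\<^bsub>C\<^esub> inv\<^bsub>C\<^esub> case_prod f q \<otimes>\<^bsub>C\<^esub> inv\<^bsub>C\<^esub> case_prod f r"
        unfolding s using hd cl(1) pqr h(2) by simp
      also have "\<dots> = \<one>\<^bsub>C\<^esub>" unfolding eq using cl(2,3) by algebra
      finally show ?thesis .
    qed
    then show ?thesis
      using hom_eq_on_generate[OF F.is_group C.is_group h(1) tr rels_carrier] that
      unfolding ab_tensor_kernel_def by auto
  qed
  then have "h x = h y" if "x \<in> carrier F" "y \<in> carrier F" "Q #>\<^bsub>F\<^esub> x = Q #>\<^bsub>F\<^esub> y" for x y
  proof -
    have "h (x \<otimes>\<^bsub>F\<^esub> inv\<^bsub>F\<^esub> y) = \<one>\<^bsub>C\<^esub>"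
      using Mod_coset_eq_iff[OF Q_normal that(1,2)] that(3) \<open>\<And>z. z \<in> Q \<Longrightarrow> h z = \<one>\<^bsub>C\<^esub>\<close> by blast
    then have "h x \<otimes>\<^bsub>C\<^esub> inv\<^bsub>C\<^esub> h y = \<one>\<^bsub>C\<^esub>"
      using hom_mult[OF h(1) that(1) F.inv_closed[OF that(2)]] hom_inv[OF h(1) F.is_group C.is_group that(2)]
      by metis
    then show ?thesis
      using hom_in_carrier[OF h(1)] that by (metis C.inv_closed C.inv_equality C.inv_inv)
  qed
  from FactGroup_universal[OF h(1) Q_normal this]
  obtain g where "g \<in> hom (F Mod Q) C" "\<And>x. x \<in> carrier F \<Longrightarrow> g (Q #>\<^bsub>F\<^esub> x) = h x" by blast
  then show ?thesis
    using h(2) by (intro bexI[of _ g]) (auto simp: ab_tensor_def ab_pure_def)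
qed

lemma hom_eqI:
  assumes "group K" "f \<in> hom AB K" "g \<in> hom AB K" "t \<in> carrier AB"
    and "\<And>a b. a \<in> carrier A \<Longrightarrow> b \<in> carrier B \<Longrightarrow> f (ab_pure A B a b) = g (ab_pure A B a b)"
  shows "f t = g t"
  by (rule hom_eq_on_generate[OF AB.is_group assms(1-3)]) (use assms carrier_generate in auto)

end

section \<open>Square groups\<close>

lemma (in group) inv_inv_mult_self: "x \<in> carrier G \<Longrightarrow> inv x \<otimes> inv x \<otimes> x \<otimes> x = \<one>"
  by (simp add: m_assoc)

lemma (in group) mult_commutator:
  "x \<in> carrier G \<Longrightarrow> y \<in> carrier G \<Longrightarrow> y \<otimes> x \<otimes> (inv x \<otimes> inv y \<otimes> x \<otimes> y) = x \<otimes> y"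
  by (simp add: m_assoc inv_cancel_left)

context square_group
begin

sublocale e: group "SGe M" by (rule group_e)
sublocale ee: comm_group "SGee M" by (rule comm_group_ee)
sublocale P: group_hom "SGee M" "SGe M" "SGP M"
  by unfold_locales (rule P_hom)
sublocale H: quadratic "SGe M" "SGee M" "SGH M"
  by unfold_locales (rule H_quadratic)

lemma cross_P [simp]:
  "a \<in> carrier (SGee M) \<Longrightarrow> y \<in> carrier (SGe M) \<Longrightarrow> sg_cross M (SGP M a) y = \<one>\<^bsub>SGee M\<^esub>"
  "a \<in> carrier (SGee M) \<Longrightarrow> y \<in> carrier (SGe M) \<Longrightarrow> sg_cross M y (SGP M a) = \<one>\<^bsub>SGee M\<^esub>"
  using cross_P_left cross_P_right by auto

lemma commutator:
  assumes "x \<in> carrier (SGe M)" "y \<in> carrier (SGe M)"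
  shows "x \<otimes>\<^bsub>SGe M\<^esub> y = y \<otimes>\<^bsub>SGe M\<^esub> x \<otimes>\<^bsub>SGe M\<^esub> SGP M (sg_cross M x y)"
  using e.mult_commutator[OF assms] assms by (simp add: P_cross)

text \<open>A commutator is \<open>P\<close> of a cross-effect, and cross-effects with elements of
  the image of \<open>P\<close> vanish.\<close>

lemma P_central:
  assumes "a \<in> carrier (SGee M)" "y \<in> carrier (SGe M)"
  shows "SGP M a \<otimes>\<^bsub>SGe M\<^esub> y = y \<otimes>\<^bsub>SGe M\<^esub> SGP M a"
proof -
  have "SGP M a \<otimes>\<^bsub>SGe M\<^esub> y = y \<otimes>\<^bsub>SGe M\<^esub> SGP M a \<otimes>\<^bsub>SGe M\<^esub> SGP M (sg_cross M (SGP M a) y)"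
    by (rule commutator) (use assms in auto)
  also have "\<dots> = y \<otimes>\<^bsub>SGe M\<^esub> SGP M a" using assms by simp
  finally show ?thesis .
qed

lemma H_mult_P [simp]:
  "x \<in> carrier (SGe M) \<Longrightarrow> a \<in> carrier (SGee M) \<Longrightarrow>
    SGH M (x \<otimes>\<^bsub>SGe M\<^esub> SGP M a) = SGH M x \<otimes>\<^bsub>SGee M\<^esub> SGH M (SGP M a)"
  by (simp add: H.f_mult)

lemma HP_hom: "(\<lambda>a. SGH M (SGP M a)) \<in> hom (SGee M) (SGee M)"
  by (rule homI) (simp_all add: H.f_mult)

lemma T_closed [simp, intro]: "a \<in> carrier (SGee M) \<Longrightarrow> sg_T M a \<in> carrier (SGee M)"
  by (simp add: sg_T_def)

lemma T_hom: "sg_T M \<in> hom (SGee M) (SGee M)"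
proof (rule homI)
  fix a b assume ab: "a \<in> carrier (SGee M)" "b \<in> carrier (SGee M)"
  have "SGH M (SGP M a) \<in> carrier (SGee M)" "SGH M (SGP M b) \<in> carrier (SGee M)" using ab by auto
  moreover have "SGH M (SGP M (a \<otimes>\<^bsub>SGee M\<^esub> b)) = SGH M (SGP M a) \<otimes>\<^bsub>SGee M\<^esub> SGH M (SGP M b)"
    using ab by (simp add: H.f_mult)
  ultimately show "sg_T M (a \<otimes>\<^bsub>SGee M\<^esub> b) = sg_T M a \<otimes>\<^bsub>SGee M\<^esub> sg_T M b"
    unfolding sg_T_def using ab by algebra
qed simp

sublocale T: group_hom "SGee M" "SGee M" "sg_T M"
  by unfold_locales (rule T_hom)

lemma HP_eq: "a \<in> carrier (SGee M) \<Longrightarrow> SGH M (SGP M a) = a \<otimes>\<^bsub>SGee M\<^esub> sg_T M a"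
  using H.f_closed[OF P.hom_closed[of a]] unfolding sg_T_def by algebra

lemma P_T [simp]: "a \<in> carrier (SGee M) \<Longrightarrow> SGP M (sg_T M a) = SGP M a"
  by (simp add: sg_T_def PHP e.inv_solve_right')

text \<open>As \<open>P\<close> absorbs \<open>T\<close>, the element T(T a) is HP(a) - T a, and
  HP(a) = a + T a.\<close>

lemma T_T [simp]: "a \<in> carrier (SGee M) \<Longrightarrow> sg_T M (sg_T M a) = a"
proof -
  assume a: "a \<in> carrier (SGee M)"
  have "sg_T M (sg_T M a) = SGH M (SGP M a) \<otimes>\<^bsub>SGee M\<^esub> inv\<^bsub>SGee M\<^esub> sg_T M a"
    using a by (subst sg_T_def) simp
  also have "\<dots> = a" using a unfolding HP_eq[OF a] by (simp add: ee.m_assoc)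
  finally show ?thesis .
qed

text \<open>Apply \<open>H\<close> to x + y = y + x + P(x|y). The last summand contributes HP(x|y) =
  (x|y) + T(x|y), and comparing both sides leaves T(x|y) = -(y|x).\<close>

lemma T_cross [simp]:
  assumes "x \<in> carrier (SGe M)" "y \<in> carrier (SGe M)"
  shows "sg_T M (sg_cross M x y) = inv\<^bsub>SGee M\<^esub> sg_cross M y x"
proof -
  note [simp] = assms
  have "SGH M (x \<otimes>\<^bsub>SGe M\<^esub> y) = SGH M (y \<otimes>\<^bsub>SGe M\<^esub> x) \<otimes>\<^bsub>SGee M\<^esub> SGH M (SGP M (sg_cross M x y))"
    by (subst commutator[OF assms]) simp
  then have eq: "SGH M x \<otimes>\<^bsub>SGee M\<^esub> SGH M y \<otimes>\<^bsub>SGee M\<^esub> sg_cross M x y =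
    SGH M y \<otimes>\<^bsub>SGee M\<^esub> SGH M x \<otimes>\<^bsub>SGee M\<^esub> sg_cross M y x \<otimes>\<^bsub>SGee M\<^esub> (sg_cross M x y \<otimes>\<^bsub>SGee M\<^esub> sg_T M (sg_cross M x y))"
    by (simp add: H.f_mult HP_eq)
  have cl: "SGH M x \<in> carrier (SGee M)" "SGH M y \<in> carrier (SGee M)" "sg_cross M x y \<in> carrier (SGee M)"
    "sg_cross M y x \<in> carrier (SGee M)" "sg_T M (sg_cross M x y) \<in> carrier (SGee M)" by auto
  \<comment> \<open>Both sides of \<open>eq\<close> are inserted, one of them inverted. This is an
    identity in every abelian group, and rewriting with \<open>eq\<close> makes the two
    cancel.\<close>
  have "sg_T M (sg_cross M x y) = inv\<^bsub>SGee M\<^esub> sg_cross M y x \<otimes>\<^bsub>SGee M\<^esub>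
      inv\<^bsub>SGee M\<^esub> (SGH M x \<otimes>\<^bsub>SGee M\<^esub> SGH M y \<otimes>\<^bsub>SGee M\<^esub> sg_cross M x y) \<otimes>\<^bsub>SGee M\<^esub>
    (SGH M y \<otimes>\<^bsub>SGee M\<^esub> SGH M x \<otimes>\<^bsub>SGee M\<^esub> sg_cross M y x \<otimes>\<^bsub>SGee M\<^esub> (sg_cross M x y \<otimes>\<^bsub>SGee M\<^esub> sg_T M (sg_cross M x y)))"
    using cl by algebra
  also have "\<dots> = inv\<^bsub>SGee M\<^esub> sg_cross M y x"
    unfolding eq[symmetric] using cl by (simp add: ee.m_assoc)
  finally show ?thesis .
qed

text \<open>Substituting HPH(x) = H(x) + TH(x) and H(x + x) = 2H(x) + (x|x) consumes the multiple
  4H(x) up to one copy. All later properties of \<open>Delta\<close> are read off this form.\<close>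

lemma Delta_eq:
  assumes "x \<in> carrier (SGe M)"
  shows "sg_Delta M x = sg_T M (SGH M x) \<otimes>\<^bsub>SGee M\<^esub> inv\<^bsub>SGee M\<^esub> SGH M x \<otimes>\<^bsub>SGee M\<^esub> sg_cross M x x"
proof -
  have cl: "SGH M x \<in> carrier (SGee M)" "sg_cross M x x \<in> carrier (SGee M)" "sg_T M (SGH M x) \<in> carrier (SGee M)"
    using assms by auto
  have p: "SGH M x [^]\<^bsub>SGee M\<^esub> (4::nat) =
    SGH M x \<otimes>\<^bsub>SGee M\<^esub> SGH M x \<otimes>\<^bsub>SGee M\<^esub> SGH M x \<otimes>\<^bsub>SGee M\<^esub> SGH M x"
    using cl by (simp add: eval_nat_numeral)
  show ?thesis
    unfolding sg_Delta_def HP_eq[OF cl(1)] H.f_mult[OF assms assms] p using cl by algebra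
qed

lemma Delta_closed [simp, intro]: "x \<in> carrier (SGe M) \<Longrightarrow> sg_Delta M x \<in> carrier (SGee M)"
  by (simp add: Delta_eq)

text \<open>This is the form in which \<open>Delta\<close> enters the check that \<open>H\<close>
  respects the expansion of \<open>circ\<close> in its first variable.\<close>

lemma H_Delta:
  assumes "x \<in> carrier (SGe M)"
  shows "SGH M x \<otimes>\<^bsub>SGee M\<^esub> sg_Delta M x = sg_T M (SGH M x) \<otimes>\<^bsub>SGee M\<^esub> sg_cross M x x"
proof -
  have "SGH M x \<in> carrier (SGee M)" "sg_cross M x x \<in> carrier (SGee M)" "sg_T M (SGH M x) \<in> carrier (SGee M)"
    using assms by auto
  then show ?thesis unfolding Delta_eq[OF assms] by algebra
qed

text \<open>The mixed terms of (x + y|x + y) are (x|y) and (y|x). The first cancels against the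
  deviation of -H, the second against that of TH, because T(x|y) = -(y|x).\<close>

lemma Delta_hom: "sg_Delta M \<in> hom (SGe M) (SGee M)"
proof (rule homI)
  fix x y assume xy: "x \<in> carrier (SGe M)" "y \<in> carrier (SGe M)"
  then have cl: "SGH M x \<in> carrier (SGee M)" "SGH M y \<in> carrier (SGee M)"
     "sg_T M (SGH M x) \<in> carrier (SGee M)" "sg_T M (SGH M y) \<in> carrier (SGee M)"
     "sg_cross M x y \<in> carrier (SGee M)" "sg_cross M y x \<in> carrier (SGee M)"
     "sg_cross M x x \<in> carrier (SGee M)" "sg_cross M y y \<in> carrier (SGee M)" by auto
  have "sg_Delta M (x \<otimes>\<^bsub>SGe M\<^esub> y) =
     (sg_T M (SGH M x) \<otimes>\<^bsub>SGee M\<^esub> sg_T M (SGH M y) \<otimes>\<^bsub>SGee M\<^esub> inv\<^bsub>SGee M\<^esub> sg_cross M y x) \<otimes>\<^bsub>SGee M\<^esub>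
     inv\<^bsub>SGee M\<^esub> (SGH M x \<otimes>\<^bsub>SGee M\<^esub> SGH M y \<otimes>\<^bsub>SGee M\<^esub> sg_cross M x y) \<otimes>\<^bsub>SGee M\<^esub>
     ((sg_cross M x x \<otimes>\<^bsub>SGee M\<^esub> sg_cross M x y) \<otimes>\<^bsub>SGee M\<^esub> (sg_cross M y x \<otimes>\<^bsub>SGee M\<^esub> sg_cross M y y))"
    using xy by (subst Delta_eq) (simp_all add: H.f_mult ee.m_ac)
  also have "\<dots> = sg_Delta M x \<otimes>\<^bsub>SGee M\<^esub> sg_Delta M y"
    unfolding Delta_eq[OF xy(1)] Delta_eq[OF xy(2)] using cl by algebra
  finally show "sg_Delta M (x \<otimes>\<^bsub>SGe M\<^esub> y) = sg_Delta M x \<otimes>\<^bsub>SGee M\<^esub> sg_Delta M y" .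
qed simp

sublocale Delta: group_hom "SGe M" "SGee M" "sg_Delta M"
  by unfold_locales (rule Delta_hom)

lemma Delta_P [simp]: "a \<in> carrier (SGee M) \<Longrightarrow> sg_Delta M (SGP M a) = \<one>\<^bsub>SGee M\<^esub>"
proof -
  assume a: "a \<in> carrier (SGee M)"
  then have "sg_T M (a \<otimes>\<^bsub>SGee M\<^esub> sg_T M a) \<otimes>\<^bsub>SGee M\<^esub> inv\<^bsub>SGee M\<^esub> (a \<otimes>\<^bsub>SGee M\<^esub> sg_T M a) = \<one>\<^bsub>SGee M\<^esub>"
    by (simp add: ee.m_comm)
  then show ?thesis using a by (simp add: Delta_eq HP_eq)
qed

text \<open>\<open>T\<close> exchanges TH(x) and H(x) and negates (x|x), hence reverses every term
  of \<open>Delta_eq\<close>. The relation \<open>circ_P_left\<close> is compatible with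
  \<open>H\<close> for this reason.\<close>

lemma T_Delta [simp]: "x \<in> carrier (SGe M) \<Longrightarrow> sg_T M (sg_Delta M x) = inv\<^bsub>SGee M\<^esub> sg_Delta M x"
proof -
  assume x: "x \<in> carrier (SGe M)"
  have "SGH M x \<in> carrier (SGee M)" "sg_cross M x x \<in> carrier (SGee M)" "sg_T M (SGH M x) \<in> carrier (SGee M)"
    using x by auto
  moreover have "sg_T M (sg_Delta M x) =
     SGH M x \<otimes>\<^bsub>SGee M\<^esub> inv\<^bsub>SGee M\<^esub> sg_T M (SGH M x) \<otimes>\<^bsub>SGee M\<^esub> inv\<^bsub>SGee M\<^esub> sg_cross M x x"
    using x by (subst Delta_eq) simp_all
  ultimately show ?thesis unfolding Delta_eq[OF x] by algebra
qed

lemma P_cross_self: "x \<in> carrier (SGe M) \<Longrightarrow> SGP M (sg_cross M x x) = \<one>\<^bsub>SGe M\<^esub>"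
  using e.inv_inv_mult_self[of x] by (simp only: P_cross)

lemma P_Delta [simp]: "x \<in> carrier (SGe M) \<Longrightarrow> SGP M (sg_Delta M x) = \<one>\<^bsub>SGe M\<^esub>"
proof -
  assume x: "x \<in> carrier (SGe M)"
  have "SGP M (sg_T M (SGH M x) \<otimes>\<^bsub>SGee M\<^esub> inv\<^bsub>SGee M\<^esub> SGH M x) = \<one>\<^bsub>SGe M\<^esub>"
    using x by simp
  moreover have "SGP M (sg_T M (SGH M x) \<otimes>\<^bsub>SGee M\<^esub> inv\<^bsub>SGee M\<^esub> SGH M x \<otimes>\<^bsub>SGee M\<^esub> sg_cross M x x) =
    SGP M (sg_T M (SGH M x) \<otimes>\<^bsub>SGee M\<^esub> inv\<^bsub>SGee M\<^esub> SGH M x) \<otimes>\<^bsub>SGe M\<^esub> SGP M (sg_cross M x x)"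
    by (rule P.hom_mult) (use x in auto)
  ultimately show ?thesis unfolding Delta_eq[OF x] P_cross_self[OF x] by simp
qed

end

section \<open>Morphisms, recognition and substructures of square groups\<close>

lemma sg_homD:
  assumes "f \<in> sg_hom M N"
  shows "fst f \<in> hom (SGe M) (SGe N)" "snd f \<in> hom (SGee M) (SGee N)"
    "x \<in> carrier (SGe M) \<Longrightarrow> snd f (SGH M x) = SGH N (fst f x)"
    "a \<in> carrier (SGee M) \<Longrightarrow> fst f (SGP M a) = SGP N (snd f a)"
    "x \<in> carrier (SGe M) \<Longrightarrow> fst f x \<in> carrier (SGe N)"
    "a \<in> carrier (SGee M) \<Longrightarrow> snd f a \<in> carrier (SGee N)"
  using assms by (auto simp: sg_hom_def hom_def)

lemma sg_hom_id: "sg_id \<in> sg_hom M M"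
  by (auto simp: sg_hom_def sg_id_def hom_def)

lemma sg_hom_comp: "f \<in> sg_hom L M \<Longrightarrow> g \<in> sg_hom M N \<Longrightarrow> sg_comp g f \<in> sg_hom L N"
  by (auto simp: sg_hom_def sg_comp_def hom_def Pi_iff)

locale square_group_hom = M: square_group M + N: square_group N
  for M :: "('a, 'b) square" and N :: "('c, 'd) square" +
  fixes f
  assumes hom: "f \<in> sg_hom M N"
begin

lemma H [simp]: "x \<in> carrier (SGe M) \<Longrightarrow> snd f (SGH M x) = SGH N (fst f x)"
  and P [simp]: "a \<in> carrier (SGee M) \<Longrightarrow> fst f (SGP M a) = SGP N (snd f a)"
  using sg_homD[OF hom] by auto

sublocale e: group_hom "SGe M" "SGe N" "fst f"
  by unfold_locales (rule sg_homD[OF hom])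
sublocale ee: group_hom "SGee M" "SGee N" "snd f"
  by unfold_locales (rule sg_homD[OF hom])

lemma cross [simp]:
  assumes "x \<in> carrier (SGe M)" "y \<in> carrier (SGe M)"
  shows "snd f (sg_cross M x y) = sg_cross N (fst f x) (fst f y)"
  using assms by (simp add: cross_effect_def)

lemma T [simp]: "a \<in> carrier (SGee M) \<Longrightarrow> snd f (sg_T M a) = sg_T N (snd f a)"
  by (simp add: sg_T_def)

lemma Delta [simp]: "x \<in> carrier (SGe M) \<Longrightarrow> snd f (sg_Delta M x) = sg_Delta N (fst f x)"
  by (simp add: M.Delta_eq N.Delta_eq)

lemma kernel_e_normal: "kernel (SGe M) (SGe N) (fst f) \<lhd> SGe M"
  by (rule e.normal_kernel)

lemma kernel_ee_normal: "kernel (SGee M) (SGee N) (snd f) \<lhd> SGee M"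
  by (rule ee.normal_kernel)

end

lemma square_group_homI:
  "square_group M \<Longrightarrow> square_group N \<Longrightarrow> f \<in> sg_hom M N \<Longrightarrow> square_group_hom M N f"
  by (simp add: square_group_hom_def square_group_hom_axioms_def)

text \<open>The axioms of a square group mention at most three elements of each level, so they can be
  checked on square groups that map to the given structure and jointly cover it.\<close>

lemma square_groupI_cover:
  fixes C :: "('c, 'd) square"
  assumes ne: "carrier (SGe C) \<noteq> {}" "carrier (SGee C) \<noteq> {}"
    and cover: "\<And>x y z a b c. {x, y, z} \<subseteq> carrier (SGe C) \<Longrightarrow> {a, b, c} \<subseteq> carrier (SGee C) \<Longrightarrow>
      \<exists>(D :: ('a, 'b) square) f. square_group D \<and> f \<in> sg_hom D C \<and>
        fst f \<one>\<^bsub>SGe D\<^esub> = \<one>\<^bsub>SGe C\<^esub> \<and> snd f \<one>\<^bsub>SGee D\<^esub> = \<one>\<^bsub>SGee C\<^esub> \<and>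
        {x, y, z} \<subseteq> fst f ` carrier (SGe D) \<and> {a, b, c} \<subseteq> snd f ` carrier (SGee D)"
  shows "square_group C"
proof -
  \<comment> \<open>These two elements fill the slots of \<open>cov\<close> that an axiom on fewer
    than three elements of a level leaves free.\<close>
  obtain x0 a0 where x0: "x0 \<in> carrier (SGe C)" and a0: "a0 \<in> carrier (SGee C)" using ne by blast
  have cov: "\<exists>(D :: ('a, 'b) square) f x' y' z' a' b' c'. square_group D \<and> f \<in> sg_hom D C \<and>
        fst f \<one>\<^bsub>SGe D\<^esub> = \<one>\<^bsub>SGe C\<^esub> \<and> snd f \<one>\<^bsub>SGee D\<^esub> = \<one>\<^bsub>SGee C\<^esub> \<and>
        x' \<in> carrier (SGe D) \<and> x = fst f x' \<and> y' \<in> carrier (SGe D) \<and> y = fst f y' \<and>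
        z' \<in> carrier (SGe D) \<and> z = fst f z' \<and> a' \<in> carrier (SGee D) \<and> a = snd f a' \<and>
        b' \<in> carrier (SGee D) \<and> b = snd f b' \<and> c' \<in> carrier (SGee D) \<and> c = snd f c'"
    if "x \<in> carrier (SGe C)" "y \<in> carrier (SGe C)" "z \<in> carrier (SGe C)"
      "a \<in> carrier (SGee C)" "b \<in> carrier (SGee C)" "c \<in> carrier (SGee C)" for x y z a b c
  proof -
    have "{x, y, z} \<subseteq> carrier (SGe C)" "{a, b, c} \<subseteq> carrier (SGee C)" using that by auto
    from cover[OF this] obtain D :: "('a, 'b) square" and f where
      D: "square_group D" "f \<in> sg_hom D C" "fst f \<one>\<^bsub>SGe D\<^esub> = \<one>\<^bsub>SGe C\<^esub>"
        "snd f \<one>\<^bsub>SGee D\<^esub> = \<one>\<^bsub>SGee C\<^esub>"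
      and im: "{x, y, z} \<subseteq> fst f ` carrier (SGe D)" "{a, b, c} \<subseteq> snd f ` carrier (SGee D)"
      by (elim exE conjE) (rule that; assumption)
    obtain x' where "x' \<in> carrier (SGe D)" "x = fst f x'" using im(1) by auto
    moreover obtain y' where "y' \<in> carrier (SGe D)" "y = fst f y'" using im(1) by auto
    moreover obtain z' where "z' \<in> carrier (SGe D)" "z = fst f z'" using im(1) by auto
    moreover obtain a' where "a' \<in> carrier (SGee D)" "a = snd f a'" using im(2) by auto
    moreover obtain b' where "b' \<in> carrier (SGee D)" "b = snd f b'" using im(2) by auto
    moreover obtain c' where "c' \<in> carrier (SGee D)" "c = snd f c'" using im(2) by auto
    ultimately show ?thesis using D by (intro exI conjI)
  qed
  have me: "fst f u \<otimes>\<^bsub>SGe C\<^esub> fst f v = fst f (u \<otimes>\<^bsub>SGe D\<^esub> v)"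
    if "f \<in> sg_hom D C" "u \<in> carrier (SGe D)" "v \<in> carrier (SGe D)" for D :: "('a, 'b) square" and f u v
    using hom_mult[OF sg_homD(1)[OF that(1)] that(2,3)] by simp
  have mee: "snd f u \<otimes>\<^bsub>SGee C\<^esub> snd f v = snd f (u \<otimes>\<^bsub>SGee D\<^esub> v)"
    if "f \<in> sg_hom D C" "u \<in> carrier (SGee D)" "v \<in> carrier (SGee D)" for D :: "('a, 'b) square" and f u v
    using hom_mult[OF sg_homD(2)[OF that(1)] that(2,3)] by simp
  note cl = sg_homD(5,6)
  have P: "SGP C (snd f u) = fst f (SGP D u)" if "f \<in> sg_hom D C" "u \<in> carrier (SGee D)"
    for D :: "('a, 'b) square" and f u
    using sg_homD(4)[OF that] by simp
  have H: "SGH C (fst f u) = snd f (SGH D u)" if "f \<in> sg_hom D C" "u \<in> carrier (SGe D)"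
    for D :: "('a, 'b) square" and f u
    using sg_homD(3)[OF that] by simp
  have ge: "group (SGe C)"
  proof (rule groupI)
    fix x y assume "x \<in> carrier (SGe C)" "y \<in> carrier (SGe C)"
    from cov[OF this x0 a0 a0 a0] obtain D :: "('a, 'b) square" and f x' y' where
      D: "square_group D" "f \<in> sg_hom D C" "x' \<in> carrier (SGe D)" "x = fst f x'"
        "y' \<in> carrier (SGe D)" "y = fst f y'"
      by (elim exE conjE) (rule that; assumption)
    interpret D: group "SGe D" using D(1) by (rule square_group.group_e)
    show "x \<otimes>\<^bsub>SGe C\<^esub> y \<in> carrier (SGe C)"
      using D(3-) by (simp add: me[OF D(2)] cl[OF D(2)])
  next
    from cov[OF x0 x0 x0 a0 a0 a0] obtain D :: "('a, 'b) square" and f where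
      D: "square_group D" "f \<in> sg_hom D C" "fst f \<one>\<^bsub>SGe D\<^esub> = \<one>\<^bsub>SGe C\<^esub>"
      by (elim exE conjE) (rule that; assumption)
    interpret D: group "SGe D" using D(1) by (rule square_group.group_e)
    show "\<one>\<^bsub>SGe C\<^esub> \<in> carrier (SGe C)" unfolding D(3)[symmetric] by (simp add: cl[OF D(2)])
  next
    fix x y z assume "x \<in> carrier (SGe C)" "y \<in> carrier (SGe C)" "z \<in> carrier (SGe C)"
    from cov[OF this a0 a0 a0] obtain D :: "('a, 'b) square" and f x' y' z' where
      D: "square_group D" "f \<in> sg_hom D C" "x' \<in> carrier (SGe D)" "x = fst f x'"
        "y' \<in> carrier (SGe D)" "y = fst f y'" "z' \<in> carrier (SGe D)" "z = fst f z'"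
      by (elim exE conjE) (rule that; assumption)
    interpret D: group "SGe D" using D(1) by (rule square_group.group_e)
    show "x \<otimes>\<^bsub>SGe C\<^esub> y \<otimes>\<^bsub>SGe C\<^esub> z = x \<otimes>\<^bsub>SGe C\<^esub> (y \<otimes>\<^bsub>SGe C\<^esub> z)"
      using D(3-) by (simp add: me[OF D(2)] D.m_assoc)
  next
    fix x assume "x \<in> carrier (SGe C)"
    from cov[OF this x0 x0 a0 a0 a0] obtain D :: "('a, 'b) square" and f x' where
      D: "square_group D" "f \<in> sg_hom D C" "fst f \<one>\<^bsub>SGe D\<^esub> = \<one>\<^bsub>SGe C\<^esub>"
        "x' \<in> carrier (SGe D)" "x = fst f x'"
      by (elim exE conjE) (rule that; assumption)
    interpret D: group "SGe D" using D(1) by (rule square_group.group_e)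
    show "\<one>\<^bsub>SGe C\<^esub> \<otimes>\<^bsub>SGe C\<^esub> x = x"
      using D(4-) unfolding D(3)[symmetric] by (simp add: me[OF D(2)])
    have "fst f (inv\<^bsub>SGe D\<^esub> x') \<otimes>\<^bsub>SGe C\<^esub> x = \<one>\<^bsub>SGe C\<^esub>"
      using D(4-) unfolding D(3)[symmetric] by (simp add: me[OF D(2)])
    then show "\<exists>y\<in>carrier (SGe C). y \<otimes>\<^bsub>SGe C\<^esub> x = \<one>\<^bsub>SGe C\<^esub>"
      using cl(1)[OF D(2)] D(4) by (intro bexI[of _ "fst f (inv\<^bsub>SGe D\<^esub> x')"]) auto
  qed
  have gee: "comm_group (SGee C)"
  proof (rule comm_groupI)
    fix x y assume "x \<in> carrier (SGee C)" "y \<in> carrier (SGee C)"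
    from cov[OF x0 x0 x0 this a0] obtain D :: "('a, 'b) square" and f x' y' where
      D: "square_group D" "f \<in> sg_hom D C" "x' \<in> carrier (SGee D)" "x = snd f x'"
        "y' \<in> carrier (SGee D)" "y = snd f y'"
      by (elim exE conjE) (rule that; assumption)
    interpret D: comm_group "SGee D" using D(1) by (rule square_group.comm_group_ee)
    show "x \<otimes>\<^bsub>SGee C\<^esub> y \<in> carrier (SGee C)"
      using D(3-) by (simp add: mee[OF D(2)] cl[OF D(2)])
    show "x \<otimes>\<^bsub>SGee C\<^esub> y = y \<otimes>\<^bsub>SGee C\<^esub> x"
      using D(3-) by (simp add: mee[OF D(2)] D.m_comm)
  next
    from cov[OF x0 x0 x0 a0 a0 a0] obtain D :: "('a, 'b) square" and f where
      D: "square_group D" "f \<in> sg_hom D C" "snd f \<one>\<^bsub>SGee D\<^esub> = \<one>\<^bsub>SGee C\<^esub>"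
      by (elim exE conjE) (rule that; assumption)
    interpret D: comm_group "SGee D" using D(1) by (rule square_group.comm_group_ee)
    show "\<one>\<^bsub>SGee C\<^esub> \<in> carrier (SGee C)" unfolding D(3)[symmetric] by (simp add: cl[OF D(2)])
  next
    fix x y z assume "x \<in> carrier (SGee C)" "y \<in> carrier (SGee C)" "z \<in> carrier (SGee C)"
    from cov[OF x0 x0 x0 this] obtain D :: "('a, 'b) square" and f x' y' z' where
      D: "square_group D" "f \<in> sg_hom D C" "x' \<in> carrier (SGee D)" "x = snd f x'"
        "y' \<in> carrier (SGee D)" "y = snd f y'" "z' \<in> carrier (SGee D)" "z = snd f z'"
      by (elim exE conjE) (rule that; assumption)
    interpret D: comm_group "SGee D" using D(1) by (rule square_group.comm_group_ee)
    show "x \<otimes>\<^bsub>SGee C\<^esub> y \<otimes>\<^bsub>SGee C\<^esub> z = x \<otimes>\<^bsub>SGee C\<^esub> (y \<otimes>\<^bsub>SGee C\<^esub> z)"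
      using D(3-) by (simp add: mee[OF D(2)] D.m_assoc)
  next
    fix x assume "x \<in> carrier (SGee C)"
    from cov[OF x0 x0 x0 this a0 a0] obtain D :: "('a, 'b) square" and f x' where
      D: "square_group D" "f \<in> sg_hom D C" "snd f \<one>\<^bsub>SGee D\<^esub> = \<one>\<^bsub>SGee C\<^esub>"
        "x' \<in> carrier (SGee D)" "x = snd f x'"
      by (elim exE conjE) (rule that; assumption)
    interpret D: comm_group "SGee D" using D(1) by (rule square_group.comm_group_ee)
    show "\<one>\<^bsub>SGee C\<^esub> \<otimes>\<^bsub>SGee C\<^esub> x = x"
      using D(4-) unfolding D(3)[symmetric] by (simp add: mee[OF D(2)])
    have "snd f (inv\<^bsub>SGee D\<^esub> x') \<otimes>\<^bsub>SGee C\<^esub> x = \<one>\<^bsub>SGee C\<^esub>"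
      using D(4-) unfolding D(3)[symmetric] by (simp add: mee[OF D(2)])
    then show "\<exists>y\<in>carrier (SGee C). y \<otimes>\<^bsub>SGee C\<^esub> x = \<one>\<^bsub>SGee C\<^esub>"
      using cl(2)[OF D(2)] D(4) by (intro bexI[of _ "snd f (inv\<^bsub>SGee D\<^esub> x')"]) auto
  qed
  interpret e: group "SGe C" by fact
  interpret ee: comm_group "SGee C" by fact
  have ie: "inv\<^bsub>SGe C\<^esub> fst f u = fst f (inv\<^bsub>SGe D\<^esub> u)"
    if "square_group D" "f \<in> sg_hom D C" "u \<in> carrier (SGe D)" for D :: "('a, 'b) square" and f u
    using hom_inv[OF sg_homD(1)[OF that(2)] square_group.group_e[OF that(1)] ge that(3)] by simp
  have iee: "inv\<^bsub>SGee C\<^esub> snd f u = snd f (inv\<^bsub>SGee D\<^esub> u)"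
    if "square_group D" "f \<in> sg_hom D C" "u \<in> carrier (SGee D)" for D :: "('a, 'b) square" and f u
    using hom_inv[OF sg_homD(2)[OF that(2)] _ ee.is_group that(3)]
      square_group.comm_group_ee[OF that(1)] by (simp add: comm_group_def)
  have cross: "sg_cross C (fst f x) (fst f y) = snd f (sg_cross D x y)"
    if "square_group D" "f \<in> sg_hom D C" "x \<in> carrier (SGe D)" "y \<in> carrier (SGe D)"
    for D :: "('a, 'b) square" and f x y
  proof -
    interpret D: square_group D by fact
    show ?thesis
      using that(3,4) by (simp add: cross_effect_def me[OF that(2)] mee[OF that(2)] iee[OF that(1,2)] H[OF that(2)])
  qed
  have Hc: "SGH C x \<in> carrier (SGee C)" if "x \<in> carrier (SGe C)" for x
  proof -
    from cov[OF that x0 x0 a0 a0 a0] obtain D :: "('a, 'b) square" and f x' where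
      D: "square_group D" "f \<in> sg_hom D C" "x' \<in> carrier (SGe D)" "x = fst f x'"
      by (elim exE conjE) (rule that; assumption)
    interpret D: square_group D by fact
    show ?thesis using D(3-) by (simp add: H[OF D(2)] cl[OF D(2)])
  qed
  have bi: "biadditive (SGe C) (SGe C) (SGee C) (sg_cross C)"
  proof (rule biadditiveI)
    show "sg_cross C x y \<in> carrier (SGee C)" if "x \<in> carrier (SGe C)" "y \<in> carrier (SGe C)" for x y
      using that Hc by (simp add: cross_effect_def)
    fix x y z assume "x \<in> carrier (SGe C)" "y \<in> carrier (SGe C)" "z \<in> carrier (SGe C)"
    from cov[OF this a0 a0 a0] obtain D :: "('a, 'b) square" and f x' y' z' where
      D: "square_group D" "f \<in> sg_hom D C" "x' \<in> carrier (SGe D)" "x = fst f x'"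
        "y' \<in> carrier (SGe D)" "y = fst f y'" "z' \<in> carrier (SGe D)" "z = fst f z'"
      by (elim exE conjE) (rule that; assumption)
    interpret D: square_group D by fact
    show "sg_cross C (x \<otimes>\<^bsub>SGe C\<^esub> y) z = sg_cross C x z \<otimes>\<^bsub>SGee C\<^esub> sg_cross C y z"
      and "sg_cross C x (y \<otimes>\<^bsub>SGe C\<^esub> z) = sg_cross C x y \<otimes>\<^bsub>SGee C\<^esub> sg_cross C x z"
      using D(3-) by (simp_all add: me[OF D(2)] mee[OF D(2)] cross[OF D(1,2)])
  qed
  show ?thesis
  proof (rule square_group.intro)
    show "SGP C \<in> hom (SGee C) (SGe C)"
    proof (rule homI)
      fix x y assume "x \<in> carrier (SGee C)" "y \<in> carrier (SGee C)"
      from cov[OF x0 x0 x0 this a0] obtain D :: "('a, 'b) square" and f x' y' where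
        D: "square_group D" "f \<in> sg_hom D C" "x' \<in> carrier (SGee D)" "x = snd f x'"
          "y' \<in> carrier (SGee D)" "y = snd f y'"
        by (elim exE conjE) (rule that; assumption)
      interpret D: square_group D by fact
      show "SGP C x \<in> carrier (SGe C)" using D(3-) by (simp add: P[OF D(2)] cl[OF D(2)])
      show "SGP C (x \<otimes>\<^bsub>SGee C\<^esub> y) = SGP C x \<otimes>\<^bsub>SGe C\<^esub> SGP C y"
        using D(3-) by (simp add: P[OF D(2)] me[OF D(2)] mee[OF D(2)])
    qed
    show "quadratic_map (SGe C) (SGee C) (SGH C)"
      using bi Hc by (auto simp: quadratic_map_def biadditive_def)
    have *: "sg_cross C (SGP C a) y = \<one>\<^bsub>SGee C\<^esub> \<and> sg_cross C y (SGP C a) = \<one>\<^bsub>SGee C\<^esub> \<and>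
      SGP C (SGH C (SGP C a)) = SGP C a \<otimes>\<^bsub>SGe C\<^esub> SGP C a \<and>
      SGP C (sg_cross C x y) = inv\<^bsub>SGe C\<^esub> x \<otimes>\<^bsub>SGe C\<^esub> inv\<^bsub>SGe C\<^esub> y \<otimes>\<^bsub>SGe C\<^esub> x \<otimes>\<^bsub>SGe C\<^esub> y"
      if "x \<in> carrier (SGe C)" "y \<in> carrier (SGe C)" "a \<in> carrier (SGee C)" for x y a
    proof -
      from cov[OF that(1,2) x0 that(3) a0 a0] obtain D :: "('a, 'b) square" and f x' y' a' where
        D: "square_group D" "f \<in> sg_hom D C" "snd f \<one>\<^bsub>SGee D\<^esub> = \<one>\<^bsub>SGee C\<^esub>" "x' \<in> carrier (SGe D)" "x = fst f x'"
          "y' \<in> carrier (SGe D)" "y = fst f y'" "a' \<in> carrier (SGee D)" "a = snd f a'"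
        by (elim exE conjE) (rule that; assumption)
      interpret D: square_group D by fact
      show ?thesis
        using D(3-) by (simp add: P[OF D(2)] H[OF D(2)] me[OF D(2)] mee[OF D(2)] ie[OF D(1,2)]
          cross[OF D(1,2)] D.P_cross D.PHP)
    qed
    show "sg_cross C (SGP C a) y = \<one>\<^bsub>SGee C\<^esub>" if "a \<in> carrier (SGee C)" "y \<in> carrier (SGe C)" for a y
      using *[OF x0 that(2,1)] by simp
    show "sg_cross C x (SGP C b) = \<one>\<^bsub>SGee C\<^esub>" if "x \<in> carrier (SGe C)" "b \<in> carrier (SGee C)" for x b
      using *[OF x0 that] by simp
    show "SGP C (sg_cross C x y) = inv\<^bsub>SGe C\<^esub> x \<otimes>\<^bsub>SGe C\<^esub> inv\<^bsub>SGe C\<^esub> y \<otimes>\<^bsub>SGe C\<^esub> x \<otimes>\<^bsub>SGe C\<^esub> y"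
      if "x \<in> carrier (SGe C)" "y \<in> carrier (SGe C)" for x y
      using *[OF that a0] by simp
    show "SGP C (SGH C (SGP C a)) = SGP C a \<otimes>\<^bsub>SGe C\<^esub> SGP C a" if "a \<in> carrier (SGee C)" for a
      using *[OF x0 x0 that] by simp
  qed (fact ge gee)+
qed

definition sg_restrict :: "('a, 'b) square \<Rightarrow> 'a set \<Rightarrow> 'b set \<Rightarrow> ('a, 'b) square" where
  "sg_restrict M U V = \<lparr>SGe = (SGe M)\<lparr>carrier := U\<rparr>, SGee = (SGee M)\<lparr>carrier := V\<rparr>,
     SGH = SGH M, SGP = SGP M\<rparr>"

lemma sg_restrict_simps [simp]:
  "carrier (SGe (sg_restrict M U V)) = U" "carrier (SGee (sg_restrict M U V)) = V"
  "monoid.mult (SGe (sg_restrict M U V)) = monoid.mult (SGe M)"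
  "monoid.mult (SGee (sg_restrict M U V)) = monoid.mult (SGee M)"
  "one (SGe (sg_restrict M U V)) = one (SGe M)" "one (SGee (sg_restrict M U V)) = one (SGee M)"
  "SGH (sg_restrict M U V) = SGH M" "SGP (sg_restrict M U V) = SGP M"
  by (simp_all add: sg_restrict_def)

lemma (in square_group) square_group_restrict:
  assumes U: "subgroup U (SGe M)" and V: "subgroup V (SGee M)"
    and H: "\<And>x. x \<in> U \<Longrightarrow> SGH M x \<in> V" and P: "\<And>a. a \<in> V \<Longrightarrow> SGP M a \<in> U"
  shows "square_group (sg_restrict M U V)"
proof -
  interpret U: subgroup U "SGe M" by fact
  interpret V: subgroup V "SGee M" by fact
  have inv_e: "inv\<^bsub>SGe (sg_restrict M U V)\<^esub> x = inv\<^bsub>SGe M\<^esub> x" if "x \<in> U" for x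
    using e.m_inv_consistent[OF U that] by (simp add: sg_restrict_def)
  have inv_ee: "inv\<^bsub>SGee (sg_restrict M U V)\<^esub> x = inv\<^bsub>SGee M\<^esub> x" if "x \<in> V" for x
    using ee.m_inv_consistent[OF V that] by (simp add: sg_restrict_def)
  have cr: "sg_cross (sg_restrict M U V) x y = sg_cross M x y" if "x \<in> U" "y \<in> U" for x y
    using that H by (simp add: cross_effect_def inv_ee)
  \<comment> \<open>Cross-effects are built from values of \<open>H\<close>, so closure under
    \<open>H\<close> already keeps them inside \<open>V\<close>.\<close>
  have crV: "sg_cross M x y \<in> V" if "x \<in> U" "y \<in> U" for x y
    using that H by (simp add: cross_effect_def)
  have bi: "biadditive (SGe (sg_restrict M U V)) (SGe (sg_restrict M U V)) (SGee (sg_restrict M U V))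
     (sg_cross (sg_restrict M U V))"
    by (rule biadditiveI) (simp_all add: cr crV flip: sg_restrict_simps(7))
  show ?thesis
  proof (rule square_group.intro)
    show "group (SGe (sg_restrict M U V))" by (simp add: sg_restrict_def U.subgroup_is_group)
    show "comm_group (SGee (sg_restrict M U V))"
      using group.group_comm_groupI[OF V.subgroup_is_group[OF ee.is_group]] by (simp add: sg_restrict_def ee.m_comm)
    show "SGP (sg_restrict M U V) \<in> hom (SGee (sg_restrict M U V)) (SGe (sg_restrict M U V))"
      by (rule homI) (simp_all add: P)
    show "quadratic_map (SGe (sg_restrict M U V)) (SGee (sg_restrict M U V)) (SGH (sg_restrict M U V))"
      using bi H by (auto simp: quadratic_map_def biadditive_def)
  qed (simp_all add: cr[unfolded sg_restrict_simps(7)] P inv_e P_cross PHP)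
qed

lemma sg_restrict_incl:
  assumes "U \<subseteq> carrier (SGe M)" "V \<subseteq> carrier (SGee M)"
  shows "sg_id \<in> sg_hom (sg_restrict M U V) M"
  using assms by (auto simp: sg_hom_def sg_id_def hom_def)

section \<open>The tensor product of square groups\<close>

lemma (in group) center_subgroup: "subgroup {z \<in> carrier G. \<forall>w\<in>carrier G. z \<otimes> w = w \<otimes> z} G"
proof (rule subgroupI)
  show "inv a \<in> {z \<in> carrier G. \<forall>w\<in>carrier G. z \<otimes> w = w \<otimes> z}"
    if "a \<in> {z \<in> carrier G. \<forall>w\<in>carrier G. z \<otimes> w = w \<otimes> z}" for a
  proof -
    have a: "a \<in> carrier G" "\<And>w. w \<in> carrier G \<Longrightarrow> a \<otimes> w = w \<otimes> a" using that by auto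
    have "inv a \<otimes> w = w \<otimes> inv a" if w: "w \<in> carrier G" for w
    proof -
      have "inv a \<otimes> w = inv a \<otimes> (w \<otimes> a) \<otimes> inv a" using a(1) w by (simp add: m_assoc)
      also have "\<dots> = inv a \<otimes> (a \<otimes> w) \<otimes> inv a" by (simp only: a(2)[OF w])
      also have "\<dots> = w \<otimes> inv a" using a(1) w by (simp add: inv_cancel_left)
      finally show ?thesis .
    qed
    with a(1) show ?thesis by blast
  qed
  show "a \<otimes> b \<in> {z \<in> carrier G. \<forall>w\<in>carrier G. z \<otimes> w = w \<otimes> z}"
    if "a \<in> {z \<in> carrier G. \<forall>w\<in>carrier G. z \<otimes> w = w \<otimes> z}" "b \<in> {z \<in> carrier G. \<forall>w\<in>carrier G. z \<otimes> w = w \<otimes> z}" for a b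
  proof -
    have a: "a \<in> carrier G" "\<And>w. w \<in> carrier G \<Longrightarrow> a \<otimes> w = w \<otimes> a"
      and b: "b \<in> carrier G" "\<And>w. w \<in> carrier G \<Longrightarrow> b \<otimes> w = w \<otimes> b" using that by auto
    have "a \<otimes> b \<otimes> w = w \<otimes> (a \<otimes> b)" if w: "w \<in> carrier G" for w
    proof -
      have "a \<otimes> b \<otimes> w = a \<otimes> (b \<otimes> w)" using a(1) b(1) w by (simp add: m_assoc)
      also have "\<dots> = (a \<otimes> w) \<otimes> b" unfolding b(2)[OF w] using a(1) b(1) w by (simp add: m_assoc)
      also have "\<dots> = w \<otimes> (a \<otimes> b)" unfolding a(2)[OF w] using a(1) b(1) w by (simp add: m_assoc)
      finally show ?thesis .
    qed
    with a(1) b(1) show ?thesis by blast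
  qed
qed auto

lemma (in group) subgroup_comm_group:
  assumes "subgroup K G" "\<And>x y. x \<in> K \<Longrightarrow> y \<in> K \<Longrightarrow> x \<otimes> y = y \<otimes> x"
  shows "comm_group (G\<lparr>carrier := K\<rparr>)"
  by (rule group.group_comm_groupI[OF subgroup_imp_group[OF assms(1)]]) (simp add: assms(2))

text \<open>For fixed y the claim says that conjugation of x by y agrees with x + p(x,y). Both are
  homomorphisms in x because \<open>p\<close> is central and additive, so agreement on
  \<open>S\<close> extends. The same argument in y, with x fixed, finishes the proof.\<close>

lemma (in group) commutator_on_generate:
  assumes S: "S \<subseteq> carrier G"
    and cl: "\<And>x y. x \<in> carrier G \<Longrightarrow> y \<in> carrier G \<Longrightarrow> p x y \<in> carrier G"
    and central: "\<And>x y w. x \<in> carrier G \<Longrightarrow> y \<in> carrier G \<Longrightarrow> w \<in> carrier G \<Longrightarrow> p x y \<otimes> w = w \<otimes> p x y"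
    and left: "\<And>x x' y. x \<in> carrier G \<Longrightarrow> x' \<in> carrier G \<Longrightarrow> y \<in> carrier G \<Longrightarrow> p (x \<otimes> x') y = p x y \<otimes> p x' y"
    and right: "\<And>x y y'. x \<in> carrier G \<Longrightarrow> y \<in> carrier G \<Longrightarrow> y' \<in> carrier G \<Longrightarrow> p x (y \<otimes> y') = p x y \<otimes> p x y'"
    and gen: "\<And>s t. s \<in> S \<Longrightarrow> t \<in> S \<Longrightarrow> s \<otimes> t = t \<otimes> s \<otimes> p s t"
    and "x \<in> generate G S" "y \<in> generate G S"
  shows "x \<otimes> y = y \<otimes> x \<otimes> p x y"
proof -
  have conj_hom: "(\<lambda>z. inv w \<otimes> z \<otimes> w) \<in> hom G G" if "w \<in> carrier G" for w
    using that by (intro homI) (auto simp: m_assoc inv_cancel_left)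
  have conj_hom': "(\<lambda>z. w \<otimes> z \<otimes> inv w) \<in> hom G G" if "w \<in> carrier G" for w
    using conj_hom[of "inv w"] that by simp
  have eq1: "x \<otimes> y = y \<otimes> x \<otimes> p x y \<longleftrightarrow> inv y \<otimes> x \<otimes> y = x \<otimes> p x y" if "x \<in> carrier G" "y \<in> carrier G" for x y
    using that cl[OF that] by (simp add: inv_solve_left' m_assoc)
  have eq2: "x \<otimes> y = y \<otimes> x \<otimes> p x y \<longleftrightarrow> x \<otimes> y \<otimes> inv x = y \<otimes> p x y" if "x \<in> carrier G" "y \<in> carrier G" for x y
  proof -
    have "y \<otimes> p x y \<otimes> x = y \<otimes> (p x y \<otimes> x)" using that cl[OF that] by (simp add: m_assoc)
    also have "\<dots> = y \<otimes> x \<otimes> p x y"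
      unfolding central[OF that that(1)] using that cl[OF that] by (simp add: m_assoc)
    finally have "y \<otimes> x \<otimes> p x y = y \<otimes> p x y \<otimes> x" ..
    then show ?thesis using that cl[OF that] by (simp add: inv_solve_right')
  qed
  have l: "(\<lambda>z. z \<otimes> p z w) \<in> hom G G" if "w \<in> carrier G" for w
  proof (rule homI)
    fix a b assume ab: "a \<in> carrier G" "b \<in> carrier G"
    have "a \<otimes> b \<otimes> p (a \<otimes> b) w = a \<otimes> (b \<otimes> p a w) \<otimes> p b w"
      using ab that cl by (simp add: left m_assoc)
    also have "\<dots> = a \<otimes> p a w \<otimes> (b \<otimes> p b w)"
      unfolding central[OF ab(1) that ab(2), symmetric] using ab that cl by (simp add: m_assoc)
    finally show "a \<otimes> b \<otimes> p (a \<otimes> b) w = a \<otimes> p a w \<otimes> (b \<otimes> p b w)" .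
  qed (use that cl in auto)
  have r: "(\<lambda>z. z \<otimes> p w z) \<in> hom G G" if "w \<in> carrier G" for w
  proof (rule homI)
    fix a b assume ab: "a \<in> carrier G" "b \<in> carrier G"
    have "a \<otimes> b \<otimes> p w (a \<otimes> b) = a \<otimes> (b \<otimes> p w a) \<otimes> p w b"
      using ab that cl by (simp add: right m_assoc)
    also have "\<dots> = a \<otimes> p w a \<otimes> (b \<otimes> p w b)"
      unfolding central[OF that ab, symmetric] using ab that cl by (simp add: m_assoc)
    finally show "a \<otimes> b \<otimes> p w (a \<otimes> b) = a \<otimes> p w a \<otimes> (b \<otimes> p w b)" .
  qed (use that cl in auto)
  have x: "x \<in> carrier G" and y: "y \<in> carrier G"
    by (rule generate_in_carrier[OF S assms(7)], rule generate_in_carrier[OF S assms(8)])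
  have t: "x \<otimes> t = t \<otimes> x \<otimes> p x t" if "t \<in> S" for t
  proof -
    have t: "t \<in> carrier G" using that S by blast
    have "inv t \<otimes> s \<otimes> t = s \<otimes> p s t" if "s \<in> S" for s
      using eq1[of s t] gen[OF that \<open>t \<in> S\<close>] S that t by blast
    then have "inv t \<otimes> x \<otimes> t = x \<otimes> p x t"
      by (rule hom_eq_on_generate[OF is_group is_group conj_hom[OF t] l[OF t] S _ assms(7)])
    then show ?thesis using eq1[OF x t] by blast
  qed
  have "x \<otimes> s \<otimes> inv x = s \<otimes> p x s" if "s \<in> S" for s
    using eq2[of x s] t[OF that] S that x by blast
  then have "x \<otimes> y \<otimes> inv x = y \<otimes> p x y"
    by (rule hom_eq_on_generate[OF is_group is_group conj_hom'[OF x] r[OF x] S _ assms(8)])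
  then show ?thesis using eq2[OF x y] by blast
qed

section \<open>The presentation of the tensor product and its universal properties\<close>

locale square_tensor = M: square_group M + N: square_group N
  for M :: "('a, 'b) square" and N :: "('c, 'd) square"
begin

abbreviation "TE \<equiv> tensor_e M N"
abbreviation "TEE \<equiv> tensor_ee M N"

lemma gens_mem: "Circ x y \<in> tensor_gens M N \<longleftrightarrow> x \<in> carrier (SGe M) \<and> y \<in> carrier (SGe N)"
  "Bar a b \<in> tensor_gens M N \<longleftrightarrow> a \<in> carrier (SGee M) \<and> b \<in> carrier (SGee N)"
  by (auto simp: tensor_gens_def)

sublocale pres: presentation "tensor_gens M N" "tensor_rels M N"
proof
  fix u v assume "(u, v) \<in> tensor_rels M N"
  then show "set u \<subseteq> UNIV \<times> tensor_gens M N \<and> set v \<subseteq> UNIV \<times> tensor_gens M N"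
    by (cases rule: tensor_rels.cases) (simp_all add: gens_mem)
qed

lemma TE_eq: "TE = presented_group (tensor_gens M N) (tensor_rels M N)"
  by (rule tensor_e_def)

lemma gen_Circ: "pres.gen (Circ x y) = circ M N x y" and gen_Bar: "pres.gen (Bar a b) = bar M N a b"
  by (simp_all add: circ_def bar_def)

sublocale E: group TE
  unfolding TE_eq by (rule pres.group_presented)

lemma tensor_of: "ab_tensor_of (SGee M) (SGee N)"
  by (intro ab_tensor_of.intro M.comm_group_ee N.comm_group_ee)

sublocale EE: comm_group TEE
proof -
  interpret tp: ab_tensor_of "SGee M" "SGee N" by (rule tensor_of)
  show "comm_group TEE" unfolding tensor_ee_def by (rule tp.AB.comm_group_axioms)
qed

sublocale pure: biadditive_map "SGee M" "SGee N" TEE "pure M N"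
  by unfold_locales (rule ab_tensor_of.pure_biadditive[OF tensor_of, folded tensor_ee_def])

lemma circ_closed [simp, intro]:
  "x \<in> carrier (SGe M) \<Longrightarrow> y \<in> carrier (SGe N) \<Longrightarrow> circ M N x y \<in> carrier TE"
  unfolding TE_eq gen_Circ[symmetric] by (rule pres.gen_closed) (simp add: gens_mem)

lemma bar_closed [simp, intro]:
  "a \<in> carrier (SGee M) \<Longrightarrow> b \<in> carrier (SGee N) \<Longrightarrow> bar M N a b \<in> carrier TE"
  unfolding TE_eq gen_Bar[symmetric] by (rule pres.gen_closed) (simp add: gens_mem)

definition gen_set where
  "gen_set = {circ M N x y | x y. x \<in> carrier (SGe M) \<and> y \<in> carrier (SGe N)} \<union>
    {bar M N a b | a b. a \<in> carrier (SGee M) \<and> b \<in> carrier (SGee N)}"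

lemma gen_set_sub: "gen_set \<subseteq> carrier TE"
  by (auto simp: gen_set_def)

lemma carrier_generate: "carrier TE = generate TE gen_set"
proof -
  have "pres.gen ` tensor_gens M N = gen_set"
    unfolding gen_set_def tensor_gens_def gen_Circ[symmetric] gen_Bar[symmetric] by blast
  then show ?thesis using pres.carrier_generate TE_eq by metis
qed

lemmas rel = pres.relation_holds[folded TE_eq]

lemma circ_mult_right [simp]:
  assumes "x \<in> carrier (SGe M)" "y \<in> carrier (SGe N)" "y' \<in> carrier (SGe N)"
  shows "circ M N x (y \<otimes>\<^bsub>SGe N\<^esub> y') = circ M N x y \<otimes>\<^bsub>TE\<^esub> circ M N x y'"
  using rel[OF tensor_rels.circ_add_right[OF assms]] assms by (simp add: gen_Circ)

lemma bar_biadditive: "biadditive (SGee M) (SGee N) TE (bar M N)"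
proof (rule biadditiveI)
  show "bar M N (a \<otimes>\<^bsub>SGee M\<^esub> a') b = bar M N a b \<otimes>\<^bsub>TE\<^esub> bar M N a' b"
    if "a \<in> carrier (SGee M)" "a' \<in> carrier (SGee M)" "b \<in> carrier (SGee N)" for a a' b
    using rel[OF tensor_rels.bar_add_left[OF that]] that by (simp add: gen_Bar)
  show "bar M N a (b \<otimes>\<^bsub>SGee N\<^esub> b') = bar M N a b \<otimes>\<^bsub>TE\<^esub> bar M N a b'"
    if "a \<in> carrier (SGee M)" "b \<in> carrier (SGee N)" "b' \<in> carrier (SGee N)" for a b b'
    using rel[OF tensor_rels.bar_add_right[OF that]] that by (simp add: gen_Bar)
qed auto

text \<open>The presentation makes a bar commute with single generators. Conjugation by the bar is
  thus an endomorphism that fixes all generators, hence the identity.\<close>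

lemma bar_central:
  assumes "a \<in> carrier (SGee M)" "b \<in> carrier (SGee N)" "z \<in> carrier TE"
  shows "bar M N a b \<otimes>\<^bsub>TE\<^esub> z = z \<otimes>\<^bsub>TE\<^esub> bar M N a b"
proof -
  let ?b = "bar M N a b"
  have g: "?b \<otimes>\<^bsub>TE\<^esub> s = s \<otimes>\<^bsub>TE\<^esub> ?b" if "s \<in> gen_set" for s
  proof -
    from that obtain g where g: "g \<in> tensor_gens M N" "s = pres.gen g"
      unfolding gen_set_def tensor_gens_def gen_Circ[symmetric] gen_Bar[symmetric] by blast
    then show ?thesis
      using rel[OF tensor_rels.bar_central[OF assms(1,2) g(1)]] assms(1,2) that gen_set_sub
      by (auto simp: gen_Bar)
  qed
  have "inv\<^bsub>TE\<^esub> ?b \<otimes>\<^bsub>TE\<^esub> z \<otimes>\<^bsub>TE\<^esub> ?b = z"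
  proof (rule hom_eq_on_generate[OF E.is_group E.is_group _ _ gen_set_sub])
    show "(\<lambda>z. inv\<^bsub>TE\<^esub> ?b \<otimes>\<^bsub>TE\<^esub> z \<otimes>\<^bsub>TE\<^esub> ?b) \<in> hom TE TE"
      using assms by (intro homI) (auto simp: E.m_assoc E.inv_cancel_left)
    show "(\<lambda>z. z) \<in> hom TE TE" by (simp add: hom_def)
    show "inv\<^bsub>TE\<^esub> ?b \<otimes>\<^bsub>TE\<^esub> s \<otimes>\<^bsub>TE\<^esub> ?b = s" if "s \<in> gen_set" for s
      using g[OF that] that gen_set_sub assms by (auto simp: E.m_assoc E.inv_cancel_left simp flip: g)
    show "z \<in> generate TE gen_set" using assms by (simp only: carrier_generate)
  qed
  then have "?b \<otimes>\<^bsub>TE\<^esub> (inv\<^bsub>TE\<^esub> ?b \<otimes>\<^bsub>TE\<^esub> z \<otimes>\<^bsub>TE\<^esub> ?b) = ?b \<otimes>\<^bsub>TE\<^esub> z" by simp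
  then show ?thesis using assms by (simp add: E.m_assoc E.inv_cancel_left)
qed

lemma circ_mult_left:
  assumes "x \<in> carrier (SGe M)" "x' \<in> carrier (SGe M)" "y \<in> carrier (SGe N)"
  shows "circ M N (x \<otimes>\<^bsub>SGe M\<^esub> x') y =
    circ M N x y \<otimes>\<^bsub>TE\<^esub> circ M N x' y \<otimes>\<^bsub>TE\<^esub> bar M N (sg_cross M x' x) (SGH N y)"
  using rel[OF tensor_rels.circ_add_left[OF assms]] assms by (simp add: gen_Circ gen_Bar E.m_assoc)

lemma circ_P_right [simp]:
  assumes "x \<in> carrier (SGe M)" "b \<in> carrier (SGee N)"
  shows "circ M N x (SGP N b) = bar M N (sg_cross M x x) b"
  using rel[OF tensor_rels.circ_P_right[OF assms]] assms by (simp add: gen_Circ gen_Bar)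

lemma circ_P_left [simp]:
  assumes "a \<in> carrier (SGee M)" "y \<in> carrier (SGe N)"
  shows "circ M N (SGP M a) y = bar M N a (sg_Delta N y)"
  using rel[OF tensor_rels.circ_P_left[OF assms]] assms by (simp add: gen_Circ gen_Bar)

lemma bar_T:
  assumes "a \<in> carrier (SGee M)" "b \<in> carrier (SGee N)"
  shows "bar M N (sg_T M a) (sg_T N b) = inv\<^bsub>TE\<^esub> bar M N a b"
  using rel[OF tensor_rels.bar_T[OF assms]] assms by (simp add: gen_Bar)

lemma circ_hom_right: "x \<in> carrier (SGe M) \<Longrightarrow> circ M N x \<in> hom (SGe N) TE"
  by (rule homI) auto

lemma circ_one_right [simp]: "x \<in> carrier (SGe M) \<Longrightarrow> circ M N x \<one>\<^bsub>SGe N\<^esub> = \<one>\<^bsub>TE\<^esub>"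
  using hom_one[OF circ_hom_right] by auto

lemma circ_inv_right: "x \<in> carrier (SGe M) \<Longrightarrow> y \<in> carrier (SGe N) \<Longrightarrow> circ M N x (inv\<^bsub>SGe N\<^esub> y) = inv\<^bsub>TE\<^esub> circ M N x y"
  using hom_inv[OF circ_hom_right] by auto

lemma bar_hom_left: "b \<in> carrier (SGee N) \<Longrightarrow> (\<lambda>a. bar M N a b) \<in> hom (SGee M) TE"
  and bar_hom_right: "a \<in> carrier (SGee M) \<Longrightarrow> bar M N a \<in> hom (SGee N) TE"
  using bar_biadditive by (auto simp: biadditive_def)

lemma bar_one [simp]:
  "b \<in> carrier (SGee N) \<Longrightarrow> bar M N \<one>\<^bsub>SGee M\<^esub> b = \<one>\<^bsub>TE\<^esub>"
  "a \<in> carrier (SGee M) \<Longrightarrow> bar M N a \<one>\<^bsub>SGee N\<^esub> = \<one>\<^bsub>TE\<^esub>"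
  using hom_one[OF bar_hom_left] hom_one[OF bar_hom_right] by auto

lemma bar_inv:
  "a \<in> carrier (SGee M) \<Longrightarrow> b \<in> carrier (SGee N) \<Longrightarrow> bar M N (inv\<^bsub>SGee M\<^esub> a) b = inv\<^bsub>TE\<^esub> bar M N a b"
  "a \<in> carrier (SGee M) \<Longrightarrow> b \<in> carrier (SGee N) \<Longrightarrow> bar M N a (inv\<^bsub>SGee N\<^esub> b) = inv\<^bsub>TE\<^esub> bar M N a b"
  using hom_inv[OF bar_hom_left] hom_inv[OF bar_hom_right] by auto

lemma bar_mult:
  "a \<in> carrier (SGee M) \<Longrightarrow> a' \<in> carrier (SGee M) \<Longrightarrow> b \<in> carrier (SGee N) \<Longrightarrow>
    bar M N (a \<otimes>\<^bsub>SGee M\<^esub> a') b = bar M N a b \<otimes>\<^bsub>TE\<^esub> bar M N a' b"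
  "a \<in> carrier (SGee M) \<Longrightarrow> b \<in> carrier (SGee N) \<Longrightarrow> b' \<in> carrier (SGee N) \<Longrightarrow>
    bar M N a (b \<otimes>\<^bsub>SGee N\<^esub> b') = bar M N a b \<otimes>\<^bsub>TE\<^esub> bar M N a b'"
  using hom_mult[OF bar_hom_left] hom_mult[OF bar_hom_right] by auto

lemma circ_one_left [simp]: "y \<in> carrier (SGe N) \<Longrightarrow> circ M N \<one>\<^bsub>SGe M\<^esub> y = \<one>\<^bsub>TE\<^esub>"
  using circ_P_left[of "\<one>\<^bsub>SGee M\<^esub>" y] by simp

lemma e_hom_eqI:
  assumes "group K" "f \<in> hom TE K" "g \<in> hom TE K" "z \<in> carrier TE"
    and "\<And>x y. x \<in> carrier (SGe M) \<Longrightarrow> y \<in> carrier (SGe N) \<Longrightarrow> f (circ M N x y) = g (circ M N x y)"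
    and "\<And>a b. a \<in> carrier (SGee M) \<Longrightarrow> b \<in> carrier (SGee N) \<Longrightarrow> f (bar M N a b) = g (bar M N a b)"
  shows "f z = g z"
  by (rule hom_eq_on_generate[OF E.is_group assms(1-3) gen_set_sub])
    (use assms carrier_generate in \<open>auto simp: gen_set_def\<close>)

lemma ee_hom_eqI:
  assumes "group K" "f \<in> hom TEE K" "g \<in> hom TEE K" "t \<in> carrier TEE"
    and "\<And>a b. a \<in> carrier (SGee M) \<Longrightarrow> b \<in> carrier (SGee N) \<Longrightarrow> f (pure M N a b) = g (pure M N a b)"
  shows "f t = g t"
  using ab_tensor_of.hom_eqI[OF tensor_of assms(1), of f g t] assms by (simp add: tensor_ee_def)

lemmas ee_lift = ab_tensor_of.lift[OF tensor_of, folded tensor_ee_def]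

lemma ee_carrier_generate:
  "carrier TEE = generate TEE {pure M N a b | a b. a \<in> carrier (SGee M) \<and> b \<in> carrier (SGee N)}"
  unfolding tensor_ee_def by (rule ab_tensor_of.carrier_generate[OF tensor_of])

text \<open>The presentation spelled out for homomorphisms: centrality of the bars becomes two
  conditions, one against each kind of generator.\<close>

lemma e_lift:
  assumes K: "group K"
    and fc [simp]: "\<And>x y. x \<in> carrier (SGe M) \<Longrightarrow> y \<in> carrier (SGe N) \<Longrightarrow> fc x y \<in> carrier K"
    and fb [simp]: "\<And>a b. a \<in> carrier (SGee M) \<Longrightarrow> b \<in> carrier (SGee N) \<Longrightarrow> fb a b \<in> carrier K"
    and "\<And>a a' b. a \<in> carrier (SGee M) \<Longrightarrow> a' \<in> carrier (SGee M) \<Longrightarrow> b \<in> carrier (SGee N) \<Longrightarrow>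
      fb (a \<otimes>\<^bsub>SGee M\<^esub> a') b = fb a b \<otimes>\<^bsub>K\<^esub> fb a' b"
    and "\<And>a b b'. a \<in> carrier (SGee M) \<Longrightarrow> b \<in> carrier (SGee N) \<Longrightarrow> b' \<in> carrier (SGee N) \<Longrightarrow>
      fb a (b \<otimes>\<^bsub>SGee N\<^esub> b') = fb a b \<otimes>\<^bsub>K\<^esub> fb a b'"
    and "\<And>a b x y. a \<in> carrier (SGee M) \<Longrightarrow> b \<in> carrier (SGee N) \<Longrightarrow> x \<in> carrier (SGe M) \<Longrightarrow> y \<in> carrier (SGe N) \<Longrightarrow>
      fb a b \<otimes>\<^bsub>K\<^esub> fc x y = fc x y \<otimes>\<^bsub>K\<^esub> fb a b"
    and "\<And>a b a' b'. a \<in> carrier (SGee M) \<Longrightarrow> b \<in> carrier (SGee N) \<Longrightarrow> a' \<in> carrier (SGee M) \<Longrightarrow> b' \<in> carrier (SGee N) \<Longrightarrow>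
      fb a b \<otimes>\<^bsub>K\<^esub> fb a' b' = fb a' b' \<otimes>\<^bsub>K\<^esub> fb a b"
    and "\<And>x y y'. x \<in> carrier (SGe M) \<Longrightarrow> y \<in> carrier (SGe N) \<Longrightarrow> y' \<in> carrier (SGe N) \<Longrightarrow>
      fc x (y \<otimes>\<^bsub>SGe N\<^esub> y') = fc x y \<otimes>\<^bsub>K\<^esub> fc x y'"
    and "\<And>x x' y. x \<in> carrier (SGe M) \<Longrightarrow> x' \<in> carrier (SGe M) \<Longrightarrow> y \<in> carrier (SGe N) \<Longrightarrow>
      fc (x \<otimes>\<^bsub>SGe M\<^esub> x') y = fc x y \<otimes>\<^bsub>K\<^esub> fc x' y \<otimes>\<^bsub>K\<^esub> fb (sg_cross M x' x) (SGH N y)"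
    and "\<And>x b. x \<in> carrier (SGe M) \<Longrightarrow> b \<in> carrier (SGee N) \<Longrightarrow> fc x (SGP N b) = fb (sg_cross M x x) b"
    and "\<And>a y. a \<in> carrier (SGee M) \<Longrightarrow> y \<in> carrier (SGe N) \<Longrightarrow> fc (SGP M a) y = fb a (sg_Delta N y)"
    and "\<And>a b. a \<in> carrier (SGee M) \<Longrightarrow> b \<in> carrier (SGee N) \<Longrightarrow> fb (sg_T M a) (sg_T N b) = inv\<^bsub>K\<^esub> fb a b"
  shows "\<exists>h\<in>hom TE K. (\<forall>x\<in>carrier (SGe M). \<forall>y\<in>carrier (SGe N). h (circ M N x y) = fc x y) \<and>
    (\<forall>a\<in>carrier (SGee M). \<forall>b\<in>carrier (SGee N). h (bar M N a b) = fb a b)"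
proof -
  interpret K: group K by fact
  let ?f = "case_tensor_gen fc fb"
  have "\<exists>h\<in>hom (presented_group (tensor_gens M N) (tensor_rels M N)) K. \<forall>x\<in>tensor_gens M N. h (pres.gen x) = ?f x"
  proof (rule pres.lift[OF K])
    show "?f \<in> tensor_gens M N \<rightarrow> carrier K" by (auto simp: tensor_gens_def)
    fix u v assume "(u, v) \<in> tensor_rels M N"
    then show "word_eval K ?f u = word_eval K ?f v"
    proof (cases rule: tensor_rels.cases)
      case (bar_central a b g)
      then show ?thesis using assms by (cases g) (simp_all add: gens_mem)
    qed (use assms in \<open>simp_all add: K.m_assoc\<close>)
  qed
  then obtain h where h: "h \<in> hom TE K" "\<And>x. x \<in> tensor_gens M N \<Longrightarrow> h (pres.gen x) = ?f x"
    unfolding TE_eq by blast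
  show ?thesis
    using h(2)[of "Circ _ _"] h(2)[of "Bar _ _"] by (intro bexI[OF _ h(1)]) (auto simp: gens_mem gen_Circ gen_Bar)
qed

text \<open>With all bars sent to zero only biadditivity and vanishing on the images of
  \<open>P\<close> survive of the relations. These are the homomorphisms that factor through
  \<open>Coker P\<close>, the tensor product of the two cokernels.\<close>

lemma e_lift_biadditive:
  assumes A: "comm_group A" and f: "biadditive (SGe M) (SGe N) A f"
    and "\<And>x b. x \<in> carrier (SGe M) \<Longrightarrow> b \<in> carrier (SGee N) \<Longrightarrow> f x (SGP N b) = \<one>\<^bsub>A\<^esub>"
    and "\<And>a y. a \<in> carrier (SGee M) \<Longrightarrow> y \<in> carrier (SGe N) \<Longrightarrow> f (SGP M a) y = \<one>\<^bsub>A\<^esub>"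
  shows "\<exists>h\<in>hom TE A. (\<forall>x\<in>carrier (SGe M). \<forall>y\<in>carrier (SGe N). h (circ M N x y) = f x y) \<and>
    (\<forall>a\<in>carrier (SGee M). \<forall>b\<in>carrier (SGee N). h (bar M N a b) = \<one>\<^bsub>A\<^esub>)"
proof -
  interpret A: comm_group A by fact
  interpret f: biadditive_map "SGe M" "SGe N" A f by unfold_locales fact
  show ?thesis
    by (rule e_lift[where fc = f and fb = "\<lambda>_ _. \<one>\<^bsub>A\<^esub>"]) (simp_all add: A.is_group assms(3,4))
qed

subsection \<open>The homomorphism P\<close>

lemma P_exists: "\<exists>p\<in>hom TEE TE. \<forall>a\<in>carrier (SGee M). \<forall>b\<in>carrier (SGee N). p (pure M N a b) = bar M N a b"
proof -
  \<comment> \<open>The universal property of the tensor product of abelian groups needs an abelian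
    target, and \<open>tensor_e\<close> is not abelian; its centre is, and it contains the
    bars.\<close>
  define Z where "Z = {z \<in> carrier TE. \<forall>w\<in>carrier TE. z \<otimes>\<^bsub>TE\<^esub> w = w \<otimes>\<^bsub>TE\<^esub> z}"
  have Z: "subgroup Z TE" unfolding Z_def by (rule E.center_subgroup)
  have cg: "comm_group (TE\<lparr>carrier := Z\<rparr>)"
    by (rule E.subgroup_comm_group[OF Z]) (unfold Z_def, blast)
  have ba: "biadditive (SGee M) (SGee N) (TE\<lparr>carrier := Z\<rparr>) (bar M N)"
  proof (rule biadditiveI)
    have "bar M N a b \<in> Z" if "a \<in> carrier (SGee M)" "b \<in> carrier (SGee N)" for a b
      unfolding Z_def using bar_central[OF that] bar_closed[OF that] by blast
    then show "bar M N a b \<in> carrier (TE\<lparr>carrier := Z\<rparr>)"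
      if "a \<in> carrier (SGee M)" "b \<in> carrier (SGee N)" for a b
      using that by simp
  qed (simp_all add: bar_mult)
  from ee_lift[OF cg ba] obtain p where p: "p \<in> hom TEE (TE\<lparr>carrier := Z\<rparr>)"
    "\<forall>a\<in>carrier (SGee M). \<forall>b\<in>carrier (SGee N). p (pure M N a b) = bar M N a b"
    by blast
  moreover have "p \<in> hom TEE TE"
    using p(1) subgroup.subset[OF Z] by (auto simp: hom_def)
  ultimately show ?thesis by blast
qed

text \<open>Existence is \<open>P_exists\<close>. Uniqueness holds because the pure tensors generate
  and \<open>extensional\<close> fixes the values off the carrier, so the definite description is
  meaningful.\<close>

lemma
  shows tensor_P_hom: "tensor_P M N \<in> hom TEE TE"
    and tensor_P_pure [simp]: "\<And>a b. a \<in> carrier (SGee M) \<Longrightarrow> b \<in> carrier (SGee N) \<Longrightarrow>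
      tensor_P M N (pure M N a b) = bar M N a b"
proof -
  let ?Q = "\<lambda>p. p \<in> extensional (carrier TEE) \<and> p \<in> hom TEE TE \<and>
     (\<forall>a\<in>carrier (SGee M). \<forall>b\<in>carrier (SGee N). p (pure M N a b) = bar M N a b)"
  obtain p where p: "p \<in> hom TEE TE" "\<forall>a\<in>carrier (SGee M). \<forall>b\<in>carrier (SGee N). p (pure M N a b) = bar M N a b"
    using P_exists by blast
  have "\<exists>!p. ?Q p"
  proof (rule ex1I)
    show "?Q (restrict p (carrier TEE))"
      using p by (auto simp: hom_def)
    fix q assume q: "?Q q"
    show "q = restrict p (carrier TEE)"
    proof (rule extensionalityI[of _ "carrier TEE"])
      show "q t = restrict p (carrier TEE) t" if "t \<in> carrier TEE" for t
        using ee_hom_eqI[OF E.is_group _ p(1) that, of q] q p(2) that by simp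
    qed (use q in auto)
  qed
  from theI'[OF this, folded tensor_P_def]
  show "tensor_P M N \<in> hom TEE TE" "\<And>a b. a \<in> carrier (SGee M) \<Longrightarrow> b \<in> carrier (SGee N) \<Longrightarrow>
      tensor_P M N (pure M N a b) = bar M N a b" by auto
qed

end

subsection \<open>The quadratic map H\<close>

context square_tensor
begin

text \<open>The pairing is extended from generators one variable at a time: \<open>r x y\<close> is
  the homomorphism that pairs \<open>circ x y\<close> with its argument, and for a fixed argument z
  the values \<open>r x y z\<close> are extended in x and y to \<open>l z\<close>.\<close>

lemma cross_exists:
  obtains c where "biadditive TE TE TEE c"
    and "\<And>x y x' y'. x \<in> carrier (SGe M) \<Longrightarrow> y \<in> carrier (SGe N) \<Longrightarrow> x' \<in> carrier (SGe M) \<Longrightarrow>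
      y' \<in> carrier (SGe N) \<Longrightarrow> c (circ M N x y) (circ M N x' y') = pure M N (sg_cross M x x') (sg_cross N y y')"
    and "\<And>a b z. a \<in> carrier (SGee M) \<Longrightarrow> b \<in> carrier (SGee N) \<Longrightarrow> z \<in> carrier TE \<Longrightarrow> c (bar M N a b) z = \<one>\<^bsub>TEE\<^esub>"
    and "\<And>a b z. a \<in> carrier (SGee M) \<Longrightarrow> b \<in> carrier (SGee N) \<Longrightarrow> z \<in> carrier TE \<Longrightarrow> c z (bar M N a b) = \<one>\<^bsub>TEE\<^esub>"
proof -
  let ?g = "\<lambda>x y x' y'. pure M N (sg_cross M x x') (sg_cross N y y')"
  let ?Q = "\<lambda>x y r. r \<in> hom TE TEE \<and> (\<forall>x'\<in>carrier (SGe M). \<forall>y'\<in>carrier (SGe N). r (circ M N x' y') = ?g x y x' y')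
      \<and> (\<forall>a\<in>carrier (SGee M). \<forall>b\<in>carrier (SGee N). r (bar M N a b) = \<one>\<^bsub>TEE\<^esub>)"
  have "\<exists>r. ?Q x y r" if "x \<in> carrier (SGe M)" "y \<in> carrier (SGe N)" for x y
  proof -
    have "biadditive (SGe M) (SGe N) TEE (?g x y)"
      by (rule biadditiveI) (use that in simp_all)
    from e_lift_biadditive[OF EE.comm_group_axioms this] that show ?thesis by auto
  qed
  then have "\<exists>r. \<forall>x\<in>carrier (SGe M). \<forall>y\<in>carrier (SGe N). ?Q x y (r x y)"
    by metis
  then obtain r where r: "\<And>x y. x \<in> carrier (SGe M) \<Longrightarrow> y \<in> carrier (SGe N) \<Longrightarrow> ?Q x y (r x y)"
    by blast
  have r_hom: "r x y \<in> hom TE TEE" if "x \<in> carrier (SGe M)" "y \<in> carrier (SGe N)" for x y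
    using r[OF that] by blast
  have r_cl [simp]: "r x y z \<in> carrier TEE" if "x \<in> carrier (SGe M)" "y \<in> carrier (SGe N)" "z \<in> carrier TE" for x y z
    using hom_in_carrier[OF r_hom[OF that(1,2)] that(3)] .
  have r_circ [simp]: "r x y (circ M N x' y') = ?g x y x' y'"
    if "x \<in> carrier (SGe M)" "y \<in> carrier (SGe N)" "x' \<in> carrier (SGe M)" "y' \<in> carrier (SGe N)" for x y x' y'
    using r[OF that(1,2)] that(3,4) by blast
  have r_bar [simp]: "r x y (bar M N a b) = \<one>\<^bsub>TEE\<^esub>"
    if "x \<in> carrier (SGe M)" "y \<in> carrier (SGe N)" "a \<in> carrier (SGee M)" "b \<in> carrier (SGee N)" for x y a b
    using r[OF that(1,2)] that(3,4) by blast
  have r_mult: "r x y (z \<otimes>\<^bsub>TE\<^esub> z') = r x y z \<otimes>\<^bsub>TEE\<^esub> r x y z'"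
    if "x \<in> carrier (SGe M)" "y \<in> carrier (SGe N)" "z \<in> carrier TE" "z' \<in> carrier TE" for x y z z'
    using hom_mult[OF r_hom[OF that(1,2)] that(3,4)] .
  have const: "(\<lambda>_. \<one>\<^bsub>TEE\<^esub>) \<in> hom TE TEE" by (simp add: hom_def)
  let ?Q' = "\<lambda>z l. l \<in> hom TE TEE \<and> (\<forall>x\<in>carrier (SGe M). \<forall>y\<in>carrier (SGe N). l (circ M N x y) = r x y z)
      \<and> (\<forall>a\<in>carrier (SGee M). \<forall>b\<in>carrier (SGee N). l (bar M N a b) = \<one>\<^bsub>TEE\<^esub>)"
  have "\<exists>l. ?Q' z l" if z: "z \<in> carrier TE" for z
  proof -
    \<comment> \<open>Additivity in x and in y is an equation between homomorphisms of z, hence it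
      suffices to see it for generators z, where it is additivity of the cross-effects.\<close>
    have "biadditive (SGe M) (SGe N) TEE (\<lambda>x y. r x y z)"
    proof (rule biadditiveI)
      show "r (x \<otimes>\<^bsub>SGe M\<^esub> x') y z = r x y z \<otimes>\<^bsub>TEE\<^esub> r x' y z"
        if "x \<in> carrier (SGe M)" "x' \<in> carrier (SGe M)" "y \<in> carrier (SGe N)" for x x' y
        by (rule e_hom_eqI[OF EE.is_group r_hom EE.hom_group_mult[OF r_hom r_hom] z]) (use that in simp_all)
      show "r x (y \<otimes>\<^bsub>SGe N\<^esub> y') z = r x y z \<otimes>\<^bsub>TEE\<^esub> r x y' z"
        if "x \<in> carrier (SGe M)" "y \<in> carrier (SGe N)" "y' \<in> carrier (SGe N)" for x y y'
        by (rule e_hom_eqI[OF EE.is_group r_hom EE.hom_group_mult[OF r_hom r_hom] z]) (use that in simp_all)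
    qed (use z in simp)
    moreover have "r x (SGP N b) z = \<one>\<^bsub>TEE\<^esub>" if "x \<in> carrier (SGe M)" "b \<in> carrier (SGee N)" for x b
      by (rule e_hom_eqI[OF EE.is_group r_hom const z]) (use that in simp_all)
    moreover have "r (SGP M a) y z = \<one>\<^bsub>TEE\<^esub>" if "a \<in> carrier (SGee M)" "y \<in> carrier (SGe N)" for a y
      by (rule e_hom_eqI[OF EE.is_group r_hom const z]) (use that in simp_all)
    ultimately show ?thesis using e_lift_biadditive[OF EE.comm_group_axioms, of "\<lambda>x y. r x y z"] by blast
  qed
  then have "\<exists>l. \<forall>z\<in>carrier TE. ?Q' z (l z)" by metis
  then obtain l where l: "\<And>z. z \<in> carrier TE \<Longrightarrow> ?Q' z (l z)" by blast
  have l_hom: "l z \<in> hom TE TEE" if "z \<in> carrier TE" for z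
    using l[OF that] by blast
  have l_circ [simp]: "l z (circ M N x y) = r x y z"
    if "z \<in> carrier TE" "x \<in> carrier (SGe M)" "y \<in> carrier (SGe N)" for x y z
    using l[OF that(1)] that(2,3) by blast
  have l_bar [simp]: "l z (bar M N a b) = \<one>\<^bsub>TEE\<^esub>"
    if "z \<in> carrier TE" "a \<in> carrier (SGee M)" "b \<in> carrier (SGee N)" for a b z
    using l[OF that(1)] that(2,3) by blast
  show thesis
  \<comment> \<open>The arguments are exchanged: the first variable of the pairing is the argument
    of \<open>l z\<close>, the second is z.\<close>
  proof (rule that[of "\<lambda>w z. l z w"])
    show "biadditive TE TE TEE (\<lambda>w z. l z w)"
    proof (rule biadditiveI)
      show "l z w \<in> carrier TEE" if "w \<in> carrier TE" "z \<in> carrier TE" for w z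
        using hom_in_carrier[OF l_hom[OF that(2)] that(1)] .
      show "l z (w \<otimes>\<^bsub>TE\<^esub> w') = l z w \<otimes>\<^bsub>TEE\<^esub> l z w'" if "w \<in> carrier TE" "w' \<in> carrier TE" "z \<in> carrier TE" for w w' z
        using hom_mult[OF l_hom[OF that(3)] that(1,2)] .
      show "l (z \<otimes>\<^bsub>TE\<^esub> z') w = l z w \<otimes>\<^bsub>TEE\<^esub> l z' w" if "w \<in> carrier TE" "z \<in> carrier TE" "z' \<in> carrier TE" for w z z'
        by (rule e_hom_eqI[OF EE.is_group l_hom EE.hom_group_mult[OF l_hom l_hom] that(1)])
          (use that in \<open>simp_all add: r_mult\<close>)
    qed
    show "l z (bar M N a b) = \<one>\<^bsub>TEE\<^esub>" if "a \<in> carrier (SGee M)" "b \<in> carrier (SGee N)" "z \<in> carrier TE" for a b z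
      using that by simp
    show "l (bar M N a b) z = \<one>\<^bsub>TEE\<^esub>" if "a \<in> carrier (SGee M)" "b \<in> carrier (SGee N)" "z \<in> carrier TE" for a b z
      by (rule e_hom_eqI[OF EE.is_group l_hom const that(3)]) (use that in simp_all)
    show "l (circ M N x' y') (circ M N x y) = ?g x y x' y'"
      if "x \<in> carrier (SGe M)" "y \<in> carrier (SGe N)" "x' \<in> carrier (SGe M)" "y' \<in> carrier (SGe N)" for x y x' y'
      using that by simp
  qed
qed

abbreviation "hc x y \<equiv> pure M N (sg_cross M x x) (SGH N y) \<otimes>\<^bsub>TEE\<^esub> pure M N (SGH M x) (sg_Delta N y)"
abbreviation "hb a b \<equiv> pure M N a b \<otimes>\<^bsub>TEE\<^esub> inv\<^bsub>TEE\<^esub> pure M N (sg_T M a) (sg_T N b)"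

text \<open>Only \<open>H\<close> deviates from additivity in y; its deviation (x|x) tensor (y|y')
  is the cross-effect prescribed for \<open>circ x y\<close> and \<open>circ x y'\<close>.\<close>

lemma hc_mult_right:
  assumes "x \<in> carrier (SGe M)" "y \<in> carrier (SGe N)" "y' \<in> carrier (SGe N)"
  shows "hc x (y \<otimes>\<^bsub>SGe N\<^esub> y') = hc x y \<otimes>\<^bsub>TEE\<^esub> hc x y' \<otimes>\<^bsub>TEE\<^esub> pure M N (sg_cross M x x) (sg_cross N y y')"
proof -
  let ?p = "pure M N (sg_cross M x x)" and ?q = "pure M N (SGH M x)"
  have eq: "?p (SGH N (y \<otimes>\<^bsub>SGe N\<^esub> y')) = ?p (SGH N y) \<otimes>\<^bsub>TEE\<^esub> ?p (SGH N y') \<otimes>\<^bsub>TEE\<^esub> ?p (sg_cross N y y')"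
    "?q (sg_Delta N (y \<otimes>\<^bsub>SGe N\<^esub> y')) = ?q (sg_Delta N y) \<otimes>\<^bsub>TEE\<^esub> ?q (sg_Delta N y')"
    using assms by (simp_all add: N.H.f_mult)
  have "?p (SGH N y) \<in> carrier TEE" "?p (SGH N y') \<in> carrier TEE" "?p (sg_cross N y y') \<in> carrier TEE"
    "?q (sg_Delta N y) \<in> carrier TEE" "?q (sg_Delta N y') \<in> carrier TEE"
    using assms by simp_all
  then show ?thesis unfolding eq by algebra
qed

text \<open>Expanding leaves (x'|x) tensor H(y) and (x|x') tensor (H(y) + Delta(y)). By
  \<open>H_Delta\<close> the latter is (x|x') tensor (TH(y) + (y|y)). Since (x|x') = -T(x'|x), its
  first part completes \<open>hb (x'|x) (H y)\<close>, and the second part is the prescribed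
  cross-effect.\<close>

lemma hc_mult_left:
  assumes "x \<in> carrier (SGe M)" "x' \<in> carrier (SGe M)" "y \<in> carrier (SGe N)"
  shows "hc (x \<otimes>\<^bsub>SGe M\<^esub> x') y = hc x y \<otimes>\<^bsub>TEE\<^esub> hc x' y \<otimes>\<^bsub>TEE\<^esub> pure M N (sg_cross M x x') (sg_cross N y y)
    \<otimes>\<^bsub>TEE\<^esub> hb (sg_cross M x' x) (SGH N y)"
proof -
  let ?p = "\<lambda>s t. pure M N s t" and ?h = "SGH N y" and ?c = "sg_cross M"
  have "?p (?c x x') (?h \<otimes>\<^bsub>SGee N\<^esub> sg_Delta N y) = ?p (?c x x') (sg_T N ?h \<otimes>\<^bsub>SGee N\<^esub> sg_cross N y y)"
    by (simp only: N.H_Delta[OF assms(3)])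
  then have eq: "?p (?c x x') ?h \<otimes>\<^bsub>TEE\<^esub> ?p (?c x x') (sg_Delta N y) =
      ?p (?c x x') (sg_T N ?h) \<otimes>\<^bsub>TEE\<^esub> ?p (?c x x') (sg_cross N y y)"
    using assms by simp
  have cl: "?p (?c x x') ?h \<in> carrier TEE" "?p (?c x x) ?h \<in> carrier TEE" "?p (?c x' x') ?h \<in> carrier TEE"
    "?p (?c x' x) ?h \<in> carrier TEE" "?p (?c x x') (sg_Delta N y) \<in> carrier TEE"
    "?p (SGH M x) (sg_Delta N y) \<in> carrier TEE" "?p (SGH M x') (sg_Delta N y) \<in> carrier TEE"
    "?p (?c x x') (sg_T N ?h) \<in> carrier TEE" "?p (?c x x') (sg_cross N y y) \<in> carrier TEE"
    using assms by simp_all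
  have l: "?p (?c (x \<otimes>\<^bsub>SGe M\<^esub> x') (x \<otimes>\<^bsub>SGe M\<^esub> x')) ?h =
    ?p (?c x x) ?h \<otimes>\<^bsub>TEE\<^esub> ?p (?c x' x) ?h \<otimes>\<^bsub>TEE\<^esub> (?p (?c x x') ?h \<otimes>\<^bsub>TEE\<^esub> ?p (?c x' x') ?h)"
    "?p (SGH M (x \<otimes>\<^bsub>SGe M\<^esub> x')) (sg_Delta N y) =
    ?p (SGH M x) (sg_Delta N y) \<otimes>\<^bsub>TEE\<^esub> ?p (SGH M x') (sg_Delta N y) \<otimes>\<^bsub>TEE\<^esub> ?p (?c x x') (sg_Delta N y)"
    using assms by (simp_all add: M.H.f_mult EE.m_ac)
  have r: "inv\<^bsub>TEE\<^esub> ?p (sg_T M (?c x' x)) (sg_T N ?h) = ?p (?c x x') (sg_T N ?h)"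
    using assms by simp
  have "hc (x \<otimes>\<^bsub>SGe M\<^esub> x') y = (?p (?c x x') ?h \<otimes>\<^bsub>TEE\<^esub> ?p (?c x x') (sg_Delta N y)) \<otimes>\<^bsub>TEE\<^esub>
    (hc x y \<otimes>\<^bsub>TEE\<^esub> hc x' y \<otimes>\<^bsub>TEE\<^esub> ?p (?c x' x) ?h)"
    unfolding l using cl by algebra
  also have "\<dots> = hc x y \<otimes>\<^bsub>TEE\<^esub> hc x' y \<otimes>\<^bsub>TEE\<^esub> ?p (?c x x') (sg_cross N y y)
    \<otimes>\<^bsub>TEE\<^esub> hb (?c x' x) ?h"
    unfolding eq r using cl by algebra
  finally show ?thesis .
qed

text \<open>The term with \<open>Delta\<close> vanishes on P b, and HP(b) = b + T b supplies both
  terms of \<open>hb\<close>, as T(x|x) = -(x|x).\<close>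

lemma hc_P_right:
  assumes "x \<in> carrier (SGe M)" "b \<in> carrier (SGee N)"
  shows "hc x (SGP N b) = hb (sg_cross M x x) b"
  using assms by (simp add: N.HP_eq)

text \<open>Here the cross-effect of P a with itself vanishes, and the sign in the second term of
  \<open>hb\<close> is absorbed by \<open>T_Delta\<close>.\<close>

lemma hc_P_left:
  assumes "a \<in> carrier (SGee M)" "y \<in> carrier (SGe N)"
  shows "hc (SGP M a) y = hb a (sg_Delta N y)"
  using assms by (simp add: M.HP_eq)

lemma hb_mult:
  assumes "a \<in> carrier (SGee M)" "b \<in> carrier (SGee N)"
  shows "a' \<in> carrier (SGee M) \<Longrightarrow> hb (a \<otimes>\<^bsub>SGee M\<^esub> a') b = hb a b \<otimes>\<^bsub>TEE\<^esub> hb a' b"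
    and "b' \<in> carrier (SGee N) \<Longrightarrow> hb a (b \<otimes>\<^bsub>SGee N\<^esub> b') = hb a b \<otimes>\<^bsub>TEE\<^esub> hb a b'"
  using assms by (simp_all add: EE.inv_mult EE.m_ac)

lemma hb_T:
  assumes "a \<in> carrier (SGee M)" "b \<in> carrier (SGee N)"
  shows "hb (sg_T M a) (sg_T N b) = inv\<^bsub>TEE\<^esub> hb a b"
  using assms by (simp add: EE.inv_mult EE.m_comm)

lemmas bar_commutes = bar_central and bar_T_T = bar_T

text \<open>Every relation of the presentation, read in the twisted product, becomes one of the
  identities for \<open>hc\<close> and \<open>hb\<close>; the cross-effect terms that
  \<open>hc_mult_right\<close> and \<open>hc_mult_left\<close> leave over are what the twisted
  multiplication adds.\<close>

lemma H_exists:
  obtains h where "quadratic TE TEE h"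
    and "\<And>x y x' y'. x \<in> carrier (SGe M) \<Longrightarrow> y \<in> carrier (SGe N) \<Longrightarrow> x' \<in> carrier (SGe M) \<Longrightarrow>
      y' \<in> carrier (SGe N) \<Longrightarrow>
      cross_effect TE TEE h (circ M N x y) (circ M N x' y') = pure M N (sg_cross M x x') (sg_cross N y y')"
    and "\<And>a b z. a \<in> carrier (SGee M) \<Longrightarrow> b \<in> carrier (SGee N) \<Longrightarrow> z \<in> carrier TE \<Longrightarrow>
      cross_effect TE TEE h (bar M N a b) z = \<one>\<^bsub>TEE\<^esub> \<and> cross_effect TE TEE h z (bar M N a b) = \<one>\<^bsub>TEE\<^esub>"
    and "\<And>x y. x \<in> carrier (SGe M) \<Longrightarrow> y \<in> carrier (SGe N) \<Longrightarrow> h (circ M N x y) = hc x y"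
    and "\<And>a b. a \<in> carrier (SGee M) \<Longrightarrow> b \<in> carrier (SGee N) \<Longrightarrow> h (bar M N a b) = hb a b"
proof -
  obtain c where c: "biadditive TE TE TEE c"
    and c_circ: "\<And>x y x' y'. x \<in> carrier (SGe M) \<Longrightarrow> y \<in> carrier (SGe N) \<Longrightarrow> x' \<in> carrier (SGe M) \<Longrightarrow>
      y' \<in> carrier (SGe N) \<Longrightarrow> c (circ M N x y) (circ M N x' y') = pure M N (sg_cross M x x') (sg_cross N y y')"
    and c_bar: "\<And>a b z. a \<in> carrier (SGee M) \<Longrightarrow> b \<in> carrier (SGee N) \<Longrightarrow> z \<in> carrier TE \<Longrightarrow> c (bar M N a b) z = \<one>\<^bsub>TEE\<^esub>"
      "\<And>a b z. a \<in> carrier (SGee M) \<Longrightarrow> b \<in> carrier (SGee N) \<Longrightarrow> z \<in> carrier TE \<Longrightarrow> c z (bar M N a b) = \<one>\<^bsub>TEE\<^esub>"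
    by (rule cross_exists) blast
  have bm: "biadditive_map TE TE TEE c"
    by (intro biadditive_mapI c E.is_group EE.comm_group_axioms)
  interpret c: biadditive_map TE TE TEE c by fact
  let ?q = "case_tensor_gen hc hb"
  let ?E = "twisted_prod TE TEE c"
  have "\<exists>f. f \<in> carrier TE \<rightarrow> carrier TEE \<and> (\<forall>g\<in>tensor_gens M N. f (pres.gen g) = ?q g) \<and>
    (\<forall>x\<in>carrier TE. \<forall>y\<in>carrier TE. f (x \<otimes>\<^bsub>TE\<^esub> y) = f x \<otimes>\<^bsub>TEE\<^esub> f y \<otimes>\<^bsub>TEE\<^esub> c x y)"
  proof (rule pres.quadratic_lift[folded TE_eq, OF EE.comm_group_axioms c])
    show "?q \<in> tensor_gens M N \<rightarrow> carrier TEE" by (auto simp: tensor_gens_def)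
    fix u v assume "(u, v) \<in> tensor_rels M N"
    then show "word_eval ?E (\<lambda>x. (?q x, pres.gen x)) u = word_eval ?E (\<lambda>x. (?q x, pres.gen x)) v"
    proof (cases rule: tensor_rels.cases)
      case (bar_add_left a a' b)
      then show ?thesis using hb_mult(1)[of a b a']
        by (simp add: twisted_prod_simps gen_Circ gen_Bar c_bar bar_mult)
    next
      case (bar_add_right a b b')
      then show ?thesis using hb_mult(2)[of a b b']
        by (simp add: twisted_prod_simps gen_Circ gen_Bar c_bar bar_mult)
    next
      case (bar_central a b g)
      have "?q g \<in> carrier TEE" "pres.gen g \<in> carrier TE" "hb a b \<in> carrier TEE"
        using bar_central by (cases g; simp add: gens_mem gen_Circ gen_Bar)+
      then show ?thesis using bar_central bar_commutes[of a b "pres.gen g"]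
        by (simp add: twisted_prod_simps gen_Bar c_bar EE.m_comm)
    next
      case (circ_add_right x y y')
      then show ?thesis using hc_mult_right[of x y y']
        by (simp add: twisted_prod_simps gen_Circ gen_Bar c_circ)
    next
      \<comment> \<open>The only nonzero twist on the right-hand side is that between
        \<open>circ x y\<close> and \<open>circ x' y\<close>, because bars pair trivially.
        \<open>hc_mult_left\<close> is reordered to match.\<close>
      case (circ_add_left x x' y)
      have "hc x y \<in> carrier TEE" "hc x' y \<in> carrier TEE" "hb (sg_cross M x' x) (SGH N y) \<in> carrier TEE"
        "pure M N (sg_cross M x x') (sg_cross N y y) \<in> carrier TEE" using circ_add_left by auto
      then have "hc (x \<otimes>\<^bsub>SGe M\<^esub> x') y = hc x y \<otimes>\<^bsub>TEE\<^esub> (hc x' y \<otimes>\<^bsub>TEE\<^esub> hb (sg_cross M x' x) (SGH N y))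
        \<otimes>\<^bsub>TEE\<^esub> pure M N (sg_cross M x x') (sg_cross N y y)"
        unfolding hc_mult_left[OF circ_add_left(3-5)] by algebra
      then show ?thesis using circ_add_left
        by (simp add: twisted_prod_simps gen_Circ gen_Bar c_circ c_bar circ_mult_left E.m_assoc del: M.T_cross)
    next
      case (circ_P_right x b)
      then show ?thesis using hc_P_right[of x b]
        by (simp add: twisted_prod_simps gen_Circ gen_Bar)
    next
      case (circ_P_left a y)
      then show ?thesis using hc_P_left[of a y]
        by (simp add: twisted_prod_simps gen_Circ gen_Bar)
    next
      \<comment> \<open>An inverse in the twisted product carries the pairing of the element with
        itself, which is zero for a bar.\<close>
      case (bar_T a b)
      have "hb a b \<in> carrier TEE" "bar M N a b \<in> carrier TE" using bar_T by auto
      then show ?thesis using bar_T hb_T[of a b] bar_T_T[of a b] twisted_prod_inv[OF bm, of "hb a b" "bar M N a b"]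
        by (simp add: twisted_prod_simps gen_Bar c_bar)
    qed
  qed
  then obtain h where h: "h \<in> carrier TE \<rightarrow> carrier TEE" "\<And>g. g \<in> tensor_gens M N \<Longrightarrow> h (pres.gen g) = ?q g"
    "\<And>x y. x \<in> carrier TE \<Longrightarrow> y \<in> carrier TE \<Longrightarrow> h (x \<otimes>\<^bsub>TE\<^esub> y) = h x \<otimes>\<^bsub>TEE\<^esub> h y \<otimes>\<^bsub>TEE\<^esub> c x y"
    by blast
  note qm = quadratic_mapI[OF E.is_group EE.comm_group_axioms h(1) c h(3)]
  show thesis
  proof (rule that)
    show "quadratic TE TEE h"
      by (intro quadraticI E.is_group EE.comm_group_axioms qm(1))
    show "h (circ M N x y) = hc x y" if "x \<in> carrier (SGe M)" "y \<in> carrier (SGe N)" for x y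
      using h(2)[of "Circ x y"] that by (simp add: gens_mem gen_Circ)
    show "h (bar M N a b) = hb a b" if "a \<in> carrier (SGee M)" "b \<in> carrier (SGee N)" for a b
      using h(2)[of "Bar a b"] that by (simp add: gens_mem gen_Bar)
  qed (simp_all add: qm(2) c_circ c_bar)
qed

text \<open>The defining conditions prescribe values and mutual cross-effects on
  \<open>gen_set\<close>. These determine a quadratic map, so there is only one candidate once it is
  made extensional.\<close>

lemma
  shows tensor_H_quadratic: "quadratic_map TE TEE (tensor_H M N)"
    and tensor_H_cross_circ: "\<And>x y x' y'. x \<in> carrier (SGe M) \<Longrightarrow> y \<in> carrier (SGe N) \<Longrightarrow> x' \<in> carrier (SGe M) \<Longrightarrow>
      y' \<in> carrier (SGe N) \<Longrightarrow> cross_effect TE TEE (tensor_H M N) (circ M N x y) (circ M N x' y')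
        = pure M N (sg_cross M x x') (sg_cross N y y')"
    and tensor_H_cross_bar: "\<And>a b z. a \<in> carrier (SGee M) \<Longrightarrow> b \<in> carrier (SGee N) \<Longrightarrow> z \<in> carrier TE \<Longrightarrow>
      cross_effect TE TEE (tensor_H M N) (bar M N a b) z = \<one>\<^bsub>TEE\<^esub>"
      "\<And>a b z. a \<in> carrier (SGee M) \<Longrightarrow> b \<in> carrier (SGee N) \<Longrightarrow> z \<in> carrier TE \<Longrightarrow>
      cross_effect TE TEE (tensor_H M N) z (bar M N a b) = \<one>\<^bsub>TEE\<^esub>"
    and tensor_H_circ: "\<And>x y. x \<in> carrier (SGe M) \<Longrightarrow> y \<in> carrier (SGe N) \<Longrightarrow> tensor_H M N (circ M N x y) = hc x y"
    and tensor_H_bar: "\<And>a b. a \<in> carrier (SGee M) \<Longrightarrow> b \<in> carrier (SGee N) \<Longrightarrow> tensor_H M N (bar M N a b) = hb a b"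
proof -
  let ?Q = "\<lambda>h. h \<in> extensional (carrier TE) \<and> quadratic_map TE TEE h \<and>
     (\<forall>x\<in>carrier (SGe M). \<forall>y\<in>carrier (SGe N). \<forall>x'\<in>carrier (SGe M). \<forall>y'\<in>carrier (SGe N).
        cross_effect TE TEE h (circ M N x y) (circ M N x' y') = pure M N (sg_cross M x x') (sg_cross N y y')) \<and>
     (\<forall>a\<in>carrier (SGee M). \<forall>b\<in>carrier (SGee N). \<forall>z\<in>carrier TE.
        cross_effect TE TEE h (bar M N a b) z = \<one>\<^bsub>TEE\<^esub> \<and> cross_effect TE TEE h z (bar M N a b) = \<one>\<^bsub>TEE\<^esub>) \<and>
     (\<forall>x\<in>carrier (SGe M). \<forall>y\<in>carrier (SGe N). h (circ M N x y) = hc x y) \<and>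
     (\<forall>a\<in>carrier (SGee M). \<forall>b\<in>carrier (SGee N). h (bar M N a b) = hb a b)"
  obtain h where h: "quadratic TE TEE h"
    and h_cr: "\<And>x y x' y'. x \<in> carrier (SGe M) \<Longrightarrow> y \<in> carrier (SGe N) \<Longrightarrow> x' \<in> carrier (SGe M) \<Longrightarrow>
      y' \<in> carrier (SGe N) \<Longrightarrow>
      cross_effect TE TEE h (circ M N x y) (circ M N x' y') = pure M N (sg_cross M x x') (sg_cross N y y')"
    and h_cr': "\<And>a b z. a \<in> carrier (SGee M) \<Longrightarrow> b \<in> carrier (SGee N) \<Longrightarrow> z \<in> carrier TE \<Longrightarrow>
      cross_effect TE TEE h (bar M N a b) z = \<one>\<^bsub>TEE\<^esub> \<and> cross_effect TE TEE h z (bar M N a b) = \<one>\<^bsub>TEE\<^esub>"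
    and h_c: "\<And>x y. x \<in> carrier (SGe M) \<Longrightarrow> y \<in> carrier (SGe N) \<Longrightarrow> h (circ M N x y) = hc x y"
    and h_b: "\<And>a b. a \<in> carrier (SGee M) \<Longrightarrow> b \<in> carrier (SGee N) \<Longrightarrow> h (bar M N a b) = hb a b"
    by (rule H_exists) blast
  interpret h: quadratic TE TEE h by fact
  let ?h = "restrict h (carrier TE)"
  have cr_eq: "cross_effect TE TEE ?h z w = cross_effect TE TEE h z w" if "z \<in> carrier TE" "w \<in> carrier TE" for z w
    using that by (simp add: cross_effect_def)
  have "\<exists>!h. ?Q h"
  proof (rule ex1I)
    have "quadratic_map TE TEE ?h"
      by (rule quadratic_mapI(1)[OF E.is_group EE.comm_group_axioms _ h.cr.biadditive]) (auto simp: h.f_mult)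
    then show "?Q ?h"
      by (simp add: cr_eq h_cr h_cr' h_c h_b del: M.T_cross)
    fix k assume k: "?Q k"
    then have qk: "quadratic TE TEE k" by (intro quadraticI E.is_group EE.comm_group_axioms) auto
    have eq: "k z = h z" if "z \<in> carrier TE" for z
    proof (rule quadratic_eq_on_generate[OF qk h gen_set_sub])
      show "k s = h s" if "s \<in> gen_set" for s
        using that k h_c h_b by (auto simp: gen_set_def)
      show "cross_effect TE TEE k s t = cross_effect TE TEE h s t" if "s \<in> gen_set" "t \<in> gen_set" for s t
      proof -
        have "s \<in> carrier TE" "t \<in> carrier TE" using that gen_set_sub by auto
        with that k h_cr h_cr' show ?thesis by (auto simp: gen_set_def)
      qed
      show "z \<in> generate TE gen_set" using that by (simp only: carrier_generate)
    qed
    show "k = ?h"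
      by (rule extensionalityI[of _ "carrier TE"]) (use k eq in auto)
  qed
  from theI'[OF this, folded tensor_H_def]
  show "quadratic_map TE TEE (tensor_H M N)"
    "\<And>x y x' y'. x \<in> carrier (SGe M) \<Longrightarrow> y \<in> carrier (SGe N) \<Longrightarrow> x' \<in> carrier (SGe M) \<Longrightarrow>
      y' \<in> carrier (SGe N) \<Longrightarrow> cross_effect TE TEE (tensor_H M N) (circ M N x y) (circ M N x' y')
        = pure M N (sg_cross M x x') (sg_cross N y y')"
    "\<And>a b z. a \<in> carrier (SGee M) \<Longrightarrow> b \<in> carrier (SGee N) \<Longrightarrow> z \<in> carrier TE \<Longrightarrow>
      cross_effect TE TEE (tensor_H M N) (bar M N a b) z = \<one>\<^bsub>TEE\<^esub>"
    "\<And>a b z. a \<in> carrier (SGee M) \<Longrightarrow> b \<in> carrier (SGee N) \<Longrightarrow> z \<in> carrier TE \<Longrightarrow>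
      cross_effect TE TEE (tensor_H M N) z (bar M N a b) = \<one>\<^bsub>TEE\<^esub>"
    "\<And>x y. x \<in> carrier (SGe M) \<Longrightarrow> y \<in> carrier (SGe N) \<Longrightarrow> tensor_H M N (circ M N x y) = hc x y"
    "\<And>a b. a \<in> carrier (SGee M) \<Longrightarrow> b \<in> carrier (SGee N) \<Longrightarrow> tensor_H M N (bar M N a b) = hb a b"
    by blast+
qed

end

subsection \<open>The square group structure and functoriality\<close>

lemma sg_tensor_simps [simp]:
  "SGe (sg_tensor M N) = tensor_e M N" "SGee (sg_tensor M N) = tensor_ee M N"
  "SGH (sg_tensor M N) = tensor_H M N" "SGP (sg_tensor M N) = tensor_P M N"
  by (simp_all add: sg_tensor_def)

text \<open>The word problem behind \<open>circ_commutator\<close>: once the bars are moved to the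
  right, both sides share the left factor \<open>a\<close> and the right factor
  \<open>d \<otimes> (b1 \<otimes> b2)\<close>, which cancel.\<close>

lemma (in group) swap_from_expansions:
  assumes cl [simp]: "a \<in> carrier G" "u \<in> carrier G" "v \<in> carrier G" "d \<in> carrier G"
    "b1 \<in> carrier G" "b2 \<in> carrier G" "b3 \<in> carrier G"
    and c1: "b1 \<otimes> (v \<otimes> d) = (v \<otimes> d) \<otimes> b1" and c2: "b3 \<otimes> (b1 \<otimes> b2) = (b1 \<otimes> b2) \<otimes> b3" and c3: "b3 \<otimes> d = d \<otimes> b3"
    and eq: "a \<otimes> u \<otimes> b1 \<otimes> (v \<otimes> d \<otimes> b2) = a \<otimes> v \<otimes> (u \<otimes> d) \<otimes> (b1 \<otimes> b2 \<otimes> b3)"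
  shows "u \<otimes> v = v \<otimes> u \<otimes> b3"
proof -
  have "a \<otimes> u \<otimes> b1 \<otimes> (v \<otimes> d \<otimes> b2) = a \<otimes> u \<otimes> (b1 \<otimes> (v \<otimes> d)) \<otimes> b2" by (simp add: m_assoc)
  also have "\<dots> = a \<otimes> (u \<otimes> v) \<otimes> (d \<otimes> (b1 \<otimes> b2))" unfolding c1 by (simp add: m_assoc)
  finally have l: "a \<otimes> u \<otimes> b1 \<otimes> (v \<otimes> d \<otimes> b2) = a \<otimes> (u \<otimes> v) \<otimes> (d \<otimes> (b1 \<otimes> b2))" .
  have "a \<otimes> v \<otimes> (u \<otimes> d) \<otimes> (b1 \<otimes> b2 \<otimes> b3) = a \<otimes> v \<otimes> u \<otimes> (d \<otimes> b3) \<otimes> (b1 \<otimes> b2)"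
    unfolding c2[symmetric] by (simp add: m_assoc)
  also have "\<dots> = a \<otimes> (v \<otimes> u \<otimes> b3) \<otimes> (d \<otimes> (b1 \<otimes> b2))" unfolding c3[symmetric] by (simp add: m_assoc)
  finally have "a \<otimes> (u \<otimes> v) \<otimes> (d \<otimes> (b1 \<otimes> b2)) = a \<otimes> (v \<otimes> u \<otimes> b3) \<otimes> (d \<otimes> (b1 \<otimes> b2))"
    unfolding eq[unfolded l] .
  then show ?thesis by (simp del: m_assoc)
qed

context square_tensor
begin

lemma gen_set_cases:
  assumes "s \<in> gen_set"
  obtains (circ) x y where "x \<in> carrier (SGe M)" "y \<in> carrier (SGe N)" "s = circ M N x y"
  | (bar) a b where "a \<in> carrier (SGee M)" "b \<in> carrier (SGee N)" "s = bar M N a b"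
  using assms unfolding gen_set_def by blast

lemma gen_set_pair_cases:
  assumes "s \<in> gen_set" "t \<in> gen_set"
  obtains (bar1) a b where "a \<in> carrier (SGee M)" "b \<in> carrier (SGee N)" "s = bar M N a b"
  | (bar2) a b where "a \<in> carrier (SGee M)" "b \<in> carrier (SGee N)" "t = bar M N a b"
  | (circ) x y x' y' where "x \<in> carrier (SGe M)" "y \<in> carrier (SGe N)" "s = circ M N x y"
    "x' \<in> carrier (SGe M)" "y' \<in> carrier (SGe N)" "t = circ M N x' y'"
  by (rule gen_set_cases[OF assms(1)]; rule gen_set_cases[OF assms(2)]) (rule that; assumption)+

text \<open>Expand \<open>circ\<close> at x' + x and y + y' in two ways, splitting first y + y' or
  first x' + x. The results contain the two middle terms \<open>circ x y\<close> and
  \<open>circ x' y'\<close> in opposite orders and differ by the bar of (x|x') and the cross-effect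
  (y|y') of \<open>H\<close>.\<close>

lemma circ_commutator:
  assumes "x \<in> carrier (SGe M)" "y \<in> carrier (SGe N)" "x' \<in> carrier (SGe M)" "y' \<in> carrier (SGe N)"
  shows "circ M N x y \<otimes>\<^bsub>TE\<^esub> circ M N x' y' =
    circ M N x' y' \<otimes>\<^bsub>TE\<^esub> circ M N x y \<otimes>\<^bsub>TE\<^esub> bar M N (sg_cross M x x') (sg_cross N y y')"
proof (rule E.swap_from_expansions)
  let ?b = "bar M N (sg_cross M x x')"
  have "circ M N x' y \<otimes>\<^bsub>TE\<^esub> circ M N x y \<otimes>\<^bsub>TE\<^esub> ?b (SGH N y) \<otimes>\<^bsub>TE\<^esub>
      (circ M N x' y' \<otimes>\<^bsub>TE\<^esub> circ M N x y' \<otimes>\<^bsub>TE\<^esub> ?b (SGH N y')) =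
    circ M N (x' \<otimes>\<^bsub>SGe M\<^esub> x) (y \<otimes>\<^bsub>SGe N\<^esub> y')"
    using assms by (simp add: circ_mult_left del: M.T_cross)
  also have "\<dots> = circ M N x' (y \<otimes>\<^bsub>SGe N\<^esub> y') \<otimes>\<^bsub>TE\<^esub> circ M N x (y \<otimes>\<^bsub>SGe N\<^esub> y') \<otimes>\<^bsub>TE\<^esub> ?b (SGH N (y \<otimes>\<^bsub>SGe N\<^esub> y'))"
    using assms by (intro circ_mult_left) auto
  also have "\<dots> = circ M N x' y \<otimes>\<^bsub>TE\<^esub> circ M N x' y' \<otimes>\<^bsub>TE\<^esub> (circ M N x y \<otimes>\<^bsub>TE\<^esub> circ M N x y') \<otimes>\<^bsub>TE\<^esub>
     (?b (SGH N y) \<otimes>\<^bsub>TE\<^esub> ?b (SGH N y') \<otimes>\<^bsub>TE\<^esub> ?b (sg_cross N y y'))"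
    using assms by (simp add: N.H.f_mult bar_mult)
  finally show "circ M N x' y \<otimes>\<^bsub>TE\<^esub> circ M N x y \<otimes>\<^bsub>TE\<^esub> ?b (SGH N y) \<otimes>\<^bsub>TE\<^esub>
      (circ M N x' y' \<otimes>\<^bsub>TE\<^esub> circ M N x y' \<otimes>\<^bsub>TE\<^esub> ?b (SGH N y')) =
     circ M N x' y \<otimes>\<^bsub>TE\<^esub> circ M N x' y' \<otimes>\<^bsub>TE\<^esub> (circ M N x y \<otimes>\<^bsub>TE\<^esub> circ M N x y') \<otimes>\<^bsub>TE\<^esub>
     (?b (SGH N y) \<otimes>\<^bsub>TE\<^esub> ?b (SGH N y') \<otimes>\<^bsub>TE\<^esub> ?b (sg_cross N y y'))" .
qed (simp_all add: assms, (rule bar_central; simp add: assms)+)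

sublocale P: group_hom TEE TE "tensor_P M N"
  by unfold_locales (rule tensor_P_hom)

sublocale H: quadratic TE TEE "tensor_H M N"
  by unfold_locales (rule tensor_H_quadratic)

lemma tensor_P_central:
  assumes "t \<in> carrier TEE" "z \<in> carrier TE"
  shows "tensor_P M N t \<otimes>\<^bsub>TE\<^esub> z = z \<otimes>\<^bsub>TE\<^esub> tensor_P M N t"
proof -
  have "inv\<^bsub>TE\<^esub> z \<otimes>\<^bsub>TE\<^esub> tensor_P M N t \<otimes>\<^bsub>TE\<^esub> z = tensor_P M N t"
  proof (rule ee_hom_eqI[OF E.is_group _ tensor_P_hom assms(1)])
    show "(\<lambda>t. inv\<^bsub>TE\<^esub> z \<otimes>\<^bsub>TE\<^esub> tensor_P M N t \<otimes>\<^bsub>TE\<^esub> z) \<in> hom TEE TE"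
      using assms by (intro homI) (auto simp: E.m_assoc E.inv_cancel_left)
    show "inv\<^bsub>TE\<^esub> z \<otimes>\<^bsub>TE\<^esub> tensor_P M N (pure M N a b) \<otimes>\<^bsub>TE\<^esub> z = tensor_P M N (pure M N a b)"
      if "a \<in> carrier (SGee M)" "b \<in> carrier (SGee N)" for a b
    proof -
      have "inv\<^bsub>TE\<^esub> z \<otimes>\<^bsub>TE\<^esub> bar M N a b \<otimes>\<^bsub>TE\<^esub> z = inv\<^bsub>TE\<^esub> z \<otimes>\<^bsub>TE\<^esub> (bar M N a b \<otimes>\<^bsub>TE\<^esub> z)"
        using that assms by (simp add: E.m_assoc)
      also have "\<dots> = bar M N a b"
        unfolding bar_central[OF that assms(2)] using that assms by (simp add: E.inv_cancel_left)
      finally show ?thesis using that by simp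
    qed
  qed
  then have "z \<otimes>\<^bsub>TE\<^esub> (inv\<^bsub>TE\<^esub> z \<otimes>\<^bsub>TE\<^esub> tensor_P M N t \<otimes>\<^bsub>TE\<^esub> z) = z \<otimes>\<^bsub>TE\<^esub> tensor_P M N t" by simp
  then show ?thesis using assms by (simp add: E.m_assoc E.inv_cancel_left)
qed

lemma cross_tensor_P:
  assumes "t \<in> carrier TEE" "z \<in> carrier TE"
  shows "cross_effect TE TEE (tensor_H M N) (tensor_P M N t) z = \<one>\<^bsub>TEE\<^esub>"
    and "cross_effect TE TEE (tensor_H M N) z (tensor_P M N t) = \<one>\<^bsub>TEE\<^esub>"
proof -
  have const: "(\<lambda>_. \<one>\<^bsub>TEE\<^esub>) \<in> hom TEE TEE" by (simp add: hom_def)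
  show "cross_effect TE TEE (tensor_H M N) (tensor_P M N t) z = \<one>\<^bsub>TEE\<^esub>"
    by (rule ee_hom_eqI[OF EE.is_group _ const assms(1)])
      (use assms in \<open>auto intro!: homI simp: tensor_H_cross_bar\<close>)
  show "cross_effect TE TEE (tensor_H M N) z (tensor_P M N t) = \<one>\<^bsub>TEE\<^esub>"
    by (rule ee_hom_eqI[OF EE.is_group _ const assms(1)])
      (use assms in \<open>auto intro!: homI simp: tensor_H_cross_bar\<close>)
qed

text \<open>\<open>P\<close> of the cross-effect is central and biadditive, so
  \<open>commutator_on_generate\<close> leaves the generators: bars commute with everything, and
  pairs of \<open>circ\<close> are \<open>circ_commutator\<close>.\<close>

lemma tensor_commutator:
  assumes "z \<in> carrier TE" "w \<in> carrier TE"
  shows "z \<otimes>\<^bsub>TE\<^esub> w = w \<otimes>\<^bsub>TE\<^esub> z \<otimes>\<^bsub>TE\<^esub> tensor_P M N (cross_effect TE TEE (tensor_H M N) z w)"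
proof (rule E.commutator_on_generate[OF gen_set_sub])
  let ?p = "\<lambda>z w. tensor_P M N (cross_effect TE TEE (tensor_H M N) z w)"
  show "?p z w \<otimes>\<^bsub>TE\<^esub> v = v \<otimes>\<^bsub>TE\<^esub> ?p z w" if "z \<in> carrier TE" "w \<in> carrier TE" "v \<in> carrier TE" for z w v
    using that by (intro tensor_P_central) auto
  show "s \<otimes>\<^bsub>TE\<^esub> t = t \<otimes>\<^bsub>TE\<^esub> s \<otimes>\<^bsub>TE\<^esub> ?p s t" if "s \<in> gen_set" "t \<in> gen_set" for s t
  proof -
    have cl: "s \<in> carrier TE" "t \<in> carrier TE" using that gen_set_sub by auto
    show ?thesis
      using that
    proof (cases rule: gen_set_pair_cases)
      case bar1
      then show ?thesis using bar_central[OF bar1(1,2) cl(2)] cl by (simp add: tensor_H_cross_bar)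
    next
      case bar2
      then show ?thesis using bar_central[OF bar2(1,2) cl(1)] cl by (simp add: tensor_H_cross_bar)
    next
      case circ
      show ?thesis
        using circ_commutator[OF circ(1,2,4,5)] circ(1,2,4,5) unfolding circ(3,6)
        by (simp only: tensor_H_cross_circ tensor_P_pure M.H.cr.closed N.H.cr.closed)
    qed
  qed
qed (simp_all flip: carrier_generate add: assms)

lemma tensor_square_group: "square_group (sg_tensor M N)"
proof (rule square_group.intro; unfold sg_tensor_simps)
  show "group TE" "comm_group TEE" by unfold_locales
  show "tensor_P M N \<in> hom TEE TE" by (rule tensor_P_hom)
  show "quadratic_map TE TEE (tensor_H M N)" by (rule tensor_H_quadratic)
  show "tensor_P M N (cross_effect TE TEE (tensor_H M N) z w) = inv\<^bsub>TE\<^esub> z \<otimes>\<^bsub>TE\<^esub> inv\<^bsub>TE\<^esub> w \<otimes>\<^bsub>TE\<^esub> z \<otimes>\<^bsub>TE\<^esub> w"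
    if "z \<in> carrier TE" "w \<in> carrier TE" for z w
  proof -
    let ?c = "tensor_P M N (cross_effect TE TEE (tensor_H M N) z w)"
    have "inv\<^bsub>TE\<^esub> z \<otimes>\<^bsub>TE\<^esub> inv\<^bsub>TE\<^esub> w \<otimes>\<^bsub>TE\<^esub> z \<otimes>\<^bsub>TE\<^esub> w = inv\<^bsub>TE\<^esub> z \<otimes>\<^bsub>TE\<^esub> inv\<^bsub>TE\<^esub> w \<otimes>\<^bsub>TE\<^esub> (z \<otimes>\<^bsub>TE\<^esub> w)"
      using that by (simp add: E.m_assoc)
    also have "\<dots> = inv\<^bsub>TE\<^esub> z \<otimes>\<^bsub>TE\<^esub> inv\<^bsub>TE\<^esub> w \<otimes>\<^bsub>TE\<^esub> (w \<otimes>\<^bsub>TE\<^esub> z \<otimes>\<^bsub>TE\<^esub> ?c)"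
      by (simp only: tensor_commutator[OF that])
    also have "\<dots> = ?c" using that by (simp add: E.m_assoc E.inv_cancel_left)
    finally show ?thesis ..
  qed
  show "tensor_P M N (tensor_H M N (tensor_P M N t)) = tensor_P M N t \<otimes>\<^bsub>TE\<^esub> tensor_P M N t"
    if t: "t \<in> carrier TEE" for t
  proof -
    \<comment> \<open>Both sides are homomorphisms in t, so pure tensors suffice. There
      \<open>H\<close> yields a difference whose second bar is, by \<open>bar_T\<close>, the first
      one with the opposite sign.\<close>
    have "tensor_P M N (tensor_H M N (tensor_P M N t)) = tensor_P M N (t \<otimes>\<^bsub>TEE\<^esub> t)"
    proof (rule ee_hom_eqI[OF E.is_group _ _ t])
      show "(\<lambda>t. tensor_P M N (tensor_H M N (tensor_P M N t))) \<in> hom TEE TE"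
        by (rule homI) (simp_all add: H.f_mult cross_tensor_P)
      show "(\<lambda>t. tensor_P M N (t \<otimes>\<^bsub>TEE\<^esub> t)) \<in> hom TEE TE"
      proof (rule homI)
        fix s t assume st: "s \<in> carrier TEE" "t \<in> carrier TEE"
        have "s \<otimes>\<^bsub>TEE\<^esub> t \<otimes>\<^bsub>TEE\<^esub> (s \<otimes>\<^bsub>TEE\<^esub> t) = (s \<otimes>\<^bsub>TEE\<^esub> s) \<otimes>\<^bsub>TEE\<^esub> (t \<otimes>\<^bsub>TEE\<^esub> t)" using st by algebra
        then show "tensor_P M N (s \<otimes>\<^bsub>TEE\<^esub> t \<otimes>\<^bsub>TEE\<^esub> (s \<otimes>\<^bsub>TEE\<^esub> t)) =
            tensor_P M N (s \<otimes>\<^bsub>TEE\<^esub> s) \<otimes>\<^bsub>TE\<^esub> tensor_P M N (t \<otimes>\<^bsub>TEE\<^esub> t)"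
          using st by (simp only: P.hom_mult EE.m_closed)
      qed simp
      show "tensor_P M N (tensor_H M N (tensor_P M N (pure M N a b))) =
          tensor_P M N (pure M N a b \<otimes>\<^bsub>TEE\<^esub> pure M N a b)"
        if "a \<in> carrier (SGee M)" "b \<in> carrier (SGee N)" for a b
        using that by (simp add: tensor_H_bar bar_T)
    qed
    then show ?thesis using t by simp
  qed
qed (simp_all add: cross_tensor_P)

text \<open>Compatibility with \<open>P\<close> equates two homomorphisms, compatibility with
  \<open>H\<close> two quadratic maps. Hence generators suffice for the former, while the latter
  also requires the cross-effects of pairs of \<open>circ\<close>.\<close>

lemma tensor_sg_homI:
  assumes K: "square_group K" and he: "he \<in> hom TE (SGe K)" and hee: "hee \<in> hom TEE (SGee K)"
    and P: "\<And>a b. a \<in> carrier (SGee M) \<Longrightarrow> b \<in> carrier (SGee N) \<Longrightarrow> he (bar M N a b) = SGP K (hee (pure M N a b))"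
    and Hc: "\<And>x y. x \<in> carrier (SGe M) \<Longrightarrow> y \<in> carrier (SGe N) \<Longrightarrow>
      hee (tensor_H M N (circ M N x y)) = SGH K (he (circ M N x y))"
    and Hb: "\<And>a b. a \<in> carrier (SGee M) \<Longrightarrow> b \<in> carrier (SGee N) \<Longrightarrow>
      hee (tensor_H M N (bar M N a b)) = SGH K (he (bar M N a b))"
    and cr: "\<And>x y x' y'. x \<in> carrier (SGe M) \<Longrightarrow> y \<in> carrier (SGe N) \<Longrightarrow> x' \<in> carrier (SGe M) \<Longrightarrow> y' \<in> carrier (SGe N) \<Longrightarrow>
      hee (pure M N (sg_cross M x x') (sg_cross N y y')) = sg_cross K (he (circ M N x y)) (he (circ M N x' y'))"
  shows "(he, hee) \<in> sg_hom (sg_tensor M N) K"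
proof -
  interpret K: square_group K by fact
  have P_eq: "he (tensor_P M N t) = SGP K (hee t)" if "t \<in> carrier TEE" for t
  proof -
    have "(he \<circ> tensor_P M N) t = (SGP K \<circ> hee) t"
      by (rule ee_hom_eqI[OF K.group_e hom_compose[OF tensor_P_hom he] hom_compose[OF hee K.P_hom] that])
        (simp add: P)
    then show ?thesis by simp
  qed
  note q1 = quadratic_hom_comp[OF H.quadratic_axioms K.comm_group_ee hee]
  note q2 = quadratic_comp_hom[OF K.H.quadratic_axioms E.is_group he]
  have he_cl: "he z \<in> carrier (SGe K)" if "z \<in> carrier TE" for z
    using hom_in_carrier[OF he that] .
  have hee_cl: "hee z \<in> carrier (SGee K)" if "z \<in> carrier TEE" for z
    using hom_in_carrier[OF hee that] .
  have hee1: "hee \<one>\<^bsub>TEE\<^esub> = \<one>\<^bsub>SGee K\<^esub>" using hom_one[OF hee] by simp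
  have "(hee \<circ> tensor_H M N) z = (SGH K \<circ> he) z" if "z \<in> carrier TE" for z
  proof (rule quadratic_eq_on_generate[OF q1(1) q2(1) gen_set_sub])
    show "z \<in> generate TE gen_set" using that by (simp only: carrier_generate)
    show "(hee \<circ> tensor_H M N) s = (SGH K \<circ> he) s" if "s \<in> gen_set" for s
      using that Hc Hb by (auto simp: gen_set_def)
    show "cross_effect TE (SGee K) (hee \<circ> tensor_H M N) s t = cross_effect TE (SGee K) (SGH K \<circ> he) s t"
      if "s \<in> gen_set" "t \<in> gen_set" for s t
    proof -
      have cl: "s \<in> carrier TE" "t \<in> carrier TE" using that gen_set_sub by auto
      show ?thesis
      using that
      proof (cases rule: gen_set_pair_cases)
        case bar1
        then show ?thesis
          unfolding q1(2)[OF cl] q2(2)[OF cl]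
          using cl by (simp add: tensor_H_cross_bar P hee1 he_cl hee_cl)
      next
        case bar2
        then show ?thesis
          unfolding q1(2)[OF cl] q2(2)[OF cl]
          using cl by (simp add: tensor_H_cross_bar P hee1 he_cl hee_cl)
      next
        case circ
        then show ?thesis
          using cr[OF circ(1,2,4,5)] circ(1,2,4,5) unfolding q1(2)[OF cl] q2(2)[OF cl] unfolding circ(3,6)
          by (simp only: tensor_H_cross_circ)
      qed
    qed
  qed
  then show ?thesis using he hee P_eq by (simp add: sg_hom_def)
qed

end

section \<open>Functoriality of the tensor product in both variables\<close>

lemma square_tensorI: "square_group M \<Longrightarrow> square_group N \<Longrightarrow> square_tensor M N"
  by (simp add: square_tensor_def)

text \<open>\<open>sg_tensor_map\<close> moves the second variable only; the coordinates on a free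
  square group and the retraction argument for projective ones need maps in the first.\<close>

lemma tensor_map_exists:
  assumes sq: "square_group M" "square_group N" "square_group M'" "square_group N'"
    and f: "f \<in> sg_hom M M'" and g: "g \<in> sg_hom N N'"
  obtains h where "h \<in> sg_hom (sg_tensor M N) (sg_tensor M' N')"
    and "\<And>x y. x \<in> carrier (SGe M) \<Longrightarrow> y \<in> carrier (SGe N) \<Longrightarrow>
      fst h (circ M N x y) = circ M' N' (fst f x) (fst g y)"
    and "\<And>a b. a \<in> carrier (SGee M) \<Longrightarrow> b \<in> carrier (SGee N) \<Longrightarrow>
      fst h (bar M N a b) = bar M' N' (snd f a) (snd g b)"
    and "\<And>a b. a \<in> carrier (SGee M) \<Longrightarrow> b \<in> carrier (SGee N) \<Longrightarrow>
      snd h (pure M N a b) = pure M' N' (snd f a) (snd g b)"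
proof -
  interpret S: square_tensor M N using sq by (simp add: square_tensorI)
  interpret S': square_tensor M' N' using sq by (simp add: square_tensorI)
  interpret f: square_group_hom M M' f using sq f by (simp add: square_group_homI)
  interpret g: square_group_hom N N' g using sq g by (simp add: square_group_homI)
  have "\<exists>h\<in>hom (tensor_e M N) (tensor_e M' N').
    (\<forall>x\<in>carrier (SGe M). \<forall>y\<in>carrier (SGe N). h (circ M N x y) = circ M' N' (fst f x) (fst g y)) \<and>
    (\<forall>a\<in>carrier (SGee M). \<forall>b\<in>carrier (SGee N). h (bar M N a b) = bar M' N' (snd f a) (snd g b))"
    by (rule S.e_lift[OF S'.E.is_group])
      (simp_all add: S'.bar_mult S'.circ_mult_left S'.bar_T del: S'.M.T_cross, (rule S'.bar_central; simp)+)
  then obtain he where he: "he \<in> hom (tensor_e M N) (tensor_e M' N')"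
    "\<And>x y. x \<in> carrier (SGe M) \<Longrightarrow> y \<in> carrier (SGe N) \<Longrightarrow> he (circ M N x y) = circ M' N' (fst f x) (fst g y)"
    "\<And>a b. a \<in> carrier (SGee M) \<Longrightarrow> b \<in> carrier (SGee N) \<Longrightarrow> he (bar M N a b) = bar M' N' (snd f a) (snd g b)"
    by blast
  have "biadditive (SGee M) (SGee N) (tensor_ee M' N') (\<lambda>a b. pure M' N' (snd f a) (snd g b))"
    by (rule biadditiveI) simp_all
  from S.ee_lift[OF S'.EE.comm_group_axioms this]
  obtain hee where hee: "hee \<in> hom (tensor_ee M N) (tensor_ee M' N')"
    "\<And>a b. a \<in> carrier (SGee M) \<Longrightarrow> b \<in> carrier (SGee N) \<Longrightarrow> hee (pure M N a b) = pure M' N' (snd f a) (snd g b)"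
    by blast
  interpret hee: group_hom "tensor_ee M N" "tensor_ee M' N'" hee by unfold_locales (rule hee(1))
  have "(he, hee) \<in> sg_hom (sg_tensor M N) (sg_tensor M' N')"
    by (rule S.tensor_sg_homI[OF S'.tensor_square_group])
      (simp_all add: he hee S.tensor_H_circ S'.tensor_H_circ S.tensor_H_bar S'.tensor_H_bar
        S'.tensor_H_cross_circ del: S.M.T_cross S'.M.T_cross S.N.T_cross S'.N.T_cross)
  then show thesis using that[of "(he, hee)"] he hee by simp
qed

lemma
  assumes sq: "square_group A" "square_group N" "square_group N'" and f: "f \<in> sg_hom N N'"
  shows sg_tensor_map_hom: "sg_tensor_map A N N' f \<in> sg_hom (sg_tensor A N) (sg_tensor A N')"
    and sg_tensor_map_circ: "x \<in> carrier (SGe A) \<Longrightarrow> y \<in> carrier (SGe N) \<Longrightarrow>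
      fst (sg_tensor_map A N N' f) (circ A N x y) = circ A N' x (fst f y)"
    and sg_tensor_map_bar: "a \<in> carrier (SGee A) \<Longrightarrow> b \<in> carrier (SGee N) \<Longrightarrow>
      fst (sg_tensor_map A N N' f) (bar A N a b) = bar A N' a (snd f b)"
    and sg_tensor_map_pure: "a \<in> carrier (SGee A) \<Longrightarrow> b \<in> carrier (SGee N) \<Longrightarrow>
      snd (sg_tensor_map A N N' f) (pure A N a b) = pure A N' a (snd f b)"
proof -
  interpret S: square_tensor A N using sq by (simp add: square_tensorI)
  interpret S': square_tensor A N' using sq by (simp add: square_tensorI)
  obtain h where h: "h \<in> sg_hom (sg_tensor A N) (sg_tensor A N')"
    and hc: "\<And>x y. x \<in> carrier (SGe A) \<Longrightarrow> y \<in> carrier (SGe N) \<Longrightarrow> fst h (circ A N x y) = circ A N' x (fst f y)"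
    and hb: "\<And>a b. a \<in> carrier (SGee A) \<Longrightarrow> b \<in> carrier (SGee N) \<Longrightarrow> fst h (bar A N a b) = bar A N' a (snd f b)"
    and hp: "\<And>a b. a \<in> carrier (SGee A) \<Longrightarrow> b \<in> carrier (SGee N) \<Longrightarrow> snd h (pure A N a b) = pure A N' a (snd f b)"
    using tensor_map_exists[OF sq(1,2,1,3) sg_hom_id f] unfolding sg_id_def fst_conv snd_conv id_apply by blast
  note hh = sg_homD[OF h, unfolded sg_tensor_simps]
  let ?Q = "\<lambda>h. h \<in> extensional (carrier (tensor_e A N)) \<and> h \<in> hom (tensor_e A N) (tensor_e A N') \<and>
        (\<forall>x\<in>carrier (SGe A). \<forall>y\<in>carrier (SGe N). h (circ A N x y) = circ A N' x (fst f y)) \<and>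
        (\<forall>a\<in>carrier (SGee A). \<forall>b\<in>carrier (SGee N). h (bar A N a b) = bar A N' a (snd f b))"
  let ?Q' = "\<lambda>h. h \<in> extensional (carrier (tensor_ee A N)) \<and> h \<in> hom (tensor_ee A N) (tensor_ee A N') \<and>
        (\<forall>a\<in>carrier (SGee A). \<forall>b\<in>carrier (SGee N). h (pure A N a b) = pure A N' a (snd f b))"
  have "(THE h. ?Q h) = restrict (fst h) (carrier (tensor_e A N))"
  proof (rule the_equality)
    show "?Q (restrict (fst h) (carrier (tensor_e A N)))"
      using hh(1) by (auto simp: hom_def hc hb)
    fix k assume k: "?Q k"
    show "k = restrict (fst h) (carrier (tensor_e A N))"
    proof (rule extensionalityI[of _ "carrier (tensor_e A N)"])
      show "k z = restrict (fst h) (carrier (tensor_e A N)) z" if "z \<in> carrier (tensor_e A N)" for z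
        using S.e_hom_eqI[OF S'.E.is_group _ hh(1) that, of k] k that by (simp add: hc hb)
    qed (use k in auto)
  qed
  moreover have "(THE h. ?Q' h) = restrict (snd h) (carrier (tensor_ee A N))"
  proof (rule the_equality)
    show "?Q' (restrict (snd h) (carrier (tensor_ee A N)))"
      using hh(2) by (auto simp: hom_def hp)
    fix k assume k: "?Q' k"
    show "k = restrict (snd h) (carrier (tensor_ee A N))"
    proof (rule extensionalityI[of _ "carrier (tensor_ee A N)"])
      show "k z = restrict (snd h) (carrier (tensor_ee A N)) z" if "z \<in> carrier (tensor_ee A N)" for z
        using S.ee_hom_eqI[OF S'.EE.is_group _ hh(2) that, of k] k that by (simp add: hp)
    qed (use k in auto)
  qed
  ultimately have eq: "sg_tensor_map A N N' f =
      (restrict (fst h) (carrier (tensor_e A N)), restrict (snd h) (carrier (tensor_ee A N)))"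
    unfolding sg_tensor_map_def by (rule arg_cong2[where f = Pair])
  show "sg_tensor_map A N N' f \<in> sg_hom (sg_tensor A N) (sg_tensor A N')"
    using h unfolding eq by (auto simp: sg_hom_def hom_def Pi_iff)
  show "fst (sg_tensor_map A N N' f) (circ A N x y) = circ A N' x (fst f y)"
    if "x \<in> carrier (SGe A)" "y \<in> carrier (SGe N)"
    using that by (simp add: eq hc)
  show "fst (sg_tensor_map A N N' f) (bar A N a b) = bar A N' a (snd f b)"
    if "a \<in> carrier (SGee A)" "b \<in> carrier (SGee N)"
    using that by (simp add: eq hb)
  show "snd (sg_tensor_map A N N' f) (pure A N a b) = pure A N' a (snd f b)"
    if "a \<in> carrier (SGee A)" "b \<in> carrier (SGee N)"
    using that by (simp add: eq hp)
qed

section \<open>Right exactness\<close>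

lemma kernel_iff: "x \<in> kernel G K h \<longleftrightarrow> x \<in> carrier G \<and> h x = \<one>\<^bsub>K\<^esub>"
  by (simp add: kernel_def)

lemma sg_epiD:
  assumes "\<sigma> \<in> sg_epi B C"
  shows "\<sigma> \<in> sg_hom B C" "fst \<sigma> ` carrier (SGe B) = carrier (SGe C)" "snd \<sigma> ` carrier (SGee B) = carrier (SGee C)"
  using assms by (auto simp: sg_epi_def)

lemma hom_image_generate:
  assumes "group G" "group K" "h \<in> hom G K" "carrier K = generate K S" "S \<subseteq> h ` carrier G"
  shows "h ` carrier G = carrier K"
proof
  interpret group_hom G K h using assms by (simp add: group_hom_def group_hom_axioms_def)
  show "h ` carrier G \<subseteq> carrier K" by auto
  show "carrier K \<subseteq> h ` carrier G"
    unfolding assms(4) using subgroup_generate_incl[OF assms(2) img_is_subgroup assms(5)] by blast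
qed

locale tensor_epi = A: square_group A + B: square_group B + C: square_group C
  for A :: "('a, 'b) square" and B :: "('c, 'd) square" and C :: "('x, 'y) square" +
  fixes \<sigma>
  assumes epi: "\<sigma> \<in> sg_epi B C"
begin

sublocale sigma: square_group_hom B C \<sigma>
  by unfold_locales (rule sg_epiD[OF epi])

lemma tensor_AB: "square_tensor A B" and tensor_AC: "square_tensor A C"
  by (intro square_tensor.intro A.square_group_axioms B.square_group_axioms C.square_group_axioms)+

sublocale AB: square_tensor A B by (rule tensor_AB)
sublocale AC: square_tensor A C by (rule tensor_AC)

abbreviation "A\<sigma> \<equiv> sg_tensor_map A B C \<sigma>"

lemmas map_simps = sg_tensor_map_circ[OF A.square_group_axioms B.square_group_axioms C.square_group_axioms sigma.hom]
  sg_tensor_map_bar[OF A.square_group_axioms B.square_group_axioms C.square_group_axioms sigma.hom]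
  sg_tensor_map_pure[OF A.square_group_axioms B.square_group_axioms C.square_group_axioms sigma.hom]

lemma map_hom: "A\<sigma> \<in> sg_hom (sg_tensor A B) (sg_tensor A C)"
  by (rule sg_tensor_map_hom[OF A.square_group_axioms B.square_group_axioms C.square_group_axioms sigma.hom])

lemmas map_homs = sg_homD(1,2)[OF map_hom, unfolded sg_tensor_simps]

lemma lift_e: "y \<in> carrier (SGe C) \<Longrightarrow> \<exists>y'\<in>carrier (SGe B). y = fst \<sigma> y'"
  and lift_ee: "b \<in> carrier (SGee C) \<Longrightarrow> \<exists>b'\<in>carrier (SGee B). b = snd \<sigma> b'"
  using sg_epiD[OF epi] by blast+

lemma map_epi: "A\<sigma> \<in> sg_epi (sg_tensor A B) (sg_tensor A C)"
proof -
  have "fst A\<sigma> ` carrier (tensor_e A B) = carrier (tensor_e A C)"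
  proof (rule hom_image_generate[OF AB.E.is_group AC.E.is_group map_homs(1) AC.carrier_generate])
    show "AC.gen_set \<subseteq> fst A\<sigma> ` carrier (tensor_e A B)"
    proof
      fix s assume "s \<in> AC.gen_set"
      then show "s \<in> fst A\<sigma> ` carrier (tensor_e A B)"
      proof (cases rule: AC.gen_set_cases)
        case (circ x y)
        then obtain y' where "y' \<in> carrier (SGe B)" "y = fst \<sigma> y'" using lift_e by blast
        then show ?thesis using circ by (intro image_eqI[of _ _ "circ A B x y'"]) (simp_all add: map_simps)
      next
        case (bar a b)
        then obtain b' where "b' \<in> carrier (SGee B)" "b = snd \<sigma> b'" using lift_ee by blast
        then show ?thesis using bar by (intro image_eqI[of _ _ "bar A B a b'"]) (simp_all add: map_simps)
      qed
    qed
  qed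
  moreover have "snd A\<sigma> ` carrier (tensor_ee A B) = carrier (tensor_ee A C)"
  proof (rule hom_image_generate[OF AB.EE.is_group AC.EE.is_group map_homs(2) AC.ee_carrier_generate], safe)
    fix a b assume "a \<in> carrier (SGee A)" "b \<in> carrier (SGee C)"
    moreover from this obtain b' where "b' \<in> carrier (SGee B)" "b = snd \<sigma> b'" using lift_ee by blast
    ultimately show "pure A C a b \<in> snd A\<sigma> ` carrier (tensor_ee A B)"
      by (intro image_eqI[of _ _ "pure A B a b'"]) (simp_all add: map_simps)
  qed
  ultimately show ?thesis using map_hom by (simp add: sg_epi_def)
qed

text \<open>Modulo \<open>N\<close> the elements \<open>circ x y\<close> and \<open>bar a b\<close>
  depend only on the images of y and b in \<open>C\<close>. The universal property of
  \<open>sg_tensor A C\<close> therefore gives a map back to the quotient, and its composite with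
  \<open>A\<sigma>\<close> is the projection. What \<open>A\<sigma>\<close> kills thus lies in
  \<open>N\<close>.\<close>

lemma kernel_e:
  assumes N: "N \<lhd> tensor_e A B"
    and Nc: "\<And>x k. x \<in> carrier (SGe A) \<Longrightarrow> k \<in> kernel (SGe B) (SGe C) (fst \<sigma>) \<Longrightarrow> circ A B x k \<in> N"
    and Nb: "\<And>a k. a \<in> carrier (SGee A) \<Longrightarrow> k \<in> kernel (SGee B) (SGee C) (snd \<sigma>) \<Longrightarrow> bar A B a k \<in> N"
    and w: "w \<in> kernel (tensor_e A B) (tensor_e A C) (fst A\<sigma>)"
  shows "w \<in> N"
proof -
  interpret N: normal N "tensor_e A B" by (rule N)
  let ?K = "tensor_e A B Mod N"
  define \<pi> where "\<pi> z = N #>\<^bsub>tensor_e A B\<^esub> z" for z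
  have K: "group ?K" by (rule N.factorgroup_is_group)
  interpret K: group ?K by (rule K)
  have \<pi>_hom: "\<pi> \<in> hom (tensor_e A B) ?K" unfolding \<pi>_def by (rule N.r_coset_hom_Mod)
  interpret \<pi>: group_hom "tensor_e A B" ?K \<pi> by unfold_locales (rule \<pi>_hom)
  \<comment> \<open>An arbitrary preimage under \<open>\<sigma>\<close> is taken; the facts
    \<open>fc\<close> and \<open>fb\<close> below show that the choice is invisible modulo
    \<open>N\<close>.\<close>
  define fc where "fc x y = \<pi> (circ A B x (inv_into (carrier (SGe B)) (fst \<sigma>) y))" for x y
  define fb where "fb a b = \<pi> (bar A B a (inv_into (carrier (SGee B)) (snd \<sigma>) b))" for a b
  have fc: "fc x (fst \<sigma> y) = \<pi> (circ A B x y)" if "x \<in> carrier (SGe A)" "y \<in> carrier (SGe B)" for x y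
  proof -
    let ?y = "inv_into (carrier (SGe B)) (fst \<sigma>) (fst \<sigma> y)"
    have y: "?y \<in> carrier (SGe B)" "fst \<sigma> ?y = fst \<sigma> y"
      using that by (auto intro: inv_into_into f_inv_into_f)
    have "?y \<otimes>\<^bsub>SGe B\<^esub> inv\<^bsub>SGe B\<^esub> y \<in> kernel (SGe B) (SGe C) (fst \<sigma>)"
      using y that by (simp add: kernel_iff)
    from Nc[OF that(1) this] have "circ A B x ?y \<otimes>\<^bsub>tensor_e A B\<^esub> inv\<^bsub>tensor_e A B\<^esub> circ A B x y \<in> N"
      using y that by (simp add: AB.circ_inv_right)
    then show ?thesis unfolding fc_def \<pi>_def
      by (subst Mod_coset_eq_iff[OF N]) (use y that in simp_all)
  qed
  have fb: "fb a (snd \<sigma> b) = \<pi> (bar A B a b)" if "a \<in> carrier (SGee A)" "b \<in> carrier (SGee B)" for a b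
  proof -
    let ?b = "inv_into (carrier (SGee B)) (snd \<sigma>) (snd \<sigma> b)"
    have b: "?b \<in> carrier (SGee B)" "snd \<sigma> ?b = snd \<sigma> b"
      using that by (auto intro: inv_into_into f_inv_into_f)
    have "?b \<otimes>\<^bsub>SGee B\<^esub> inv\<^bsub>SGee B\<^esub> b \<in> kernel (SGee B) (SGee C) (snd \<sigma>)"
      using b that by (simp add: kernel_iff)
    from Nb[OF that(1) this] have "bar A B a ?b \<otimes>\<^bsub>tensor_e A B\<^esub> inv\<^bsub>tensor_e A B\<^esub> bar A B a b \<in> N"
      using b that by (simp add: AB.bar_inv AB.bar_mult)
    then show ?thesis unfolding fb_def \<pi>_def
      by (subst Mod_coset_eq_iff[OF N]) (use b that in simp_all)
  qed
  have com: "\<pi> (bar A B a b) \<otimes>\<^bsub>?K\<^esub> \<pi> z = \<pi> z \<otimes>\<^bsub>?K\<^esub> \<pi> (bar A B a b)"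
    if "a \<in> carrier (SGee A)" "b \<in> carrier (SGee B)" "z \<in> carrier (tensor_e A B)" for a b z
    using that AB.bar_central[OF that] by (simp del: mult_FactGroup flip: \<pi>.hom_mult)
  have sg: "fst \<sigma> y \<otimes>\<^bsub>SGe C\<^esub> fst \<sigma> y' = fst \<sigma> (y \<otimes>\<^bsub>SGe B\<^esub> y')"
    if "y \<in> carrier (SGe B)" "y' \<in> carrier (SGe B)" for y y' using that by simp
  have sgg: "snd \<sigma> y \<otimes>\<^bsub>SGee C\<^esub> snd \<sigma> y' = snd \<sigma> (y \<otimes>\<^bsub>SGee B\<^esub> y')"
    if "y \<in> carrier (SGee B)" "y' \<in> carrier (SGee B)" for y y' using that by simp
  have "\<exists>h\<in>hom (tensor_e A C) ?K. (\<forall>x\<in>carrier (SGe A). \<forall>y\<in>carrier (SGe C). h (circ A C x y) = fc x y) \<and>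
    (\<forall>a\<in>carrier (SGee A). \<forall>b\<in>carrier (SGee C). h (bar A C a b) = fb a b)"
  proof (rule AC.e_lift[OF K])
    show "fc x y \<in> carrier ?K" if "x \<in> carrier (SGe A)" "y \<in> carrier (SGe C)" for x y
      using lift_e[OF that(2)] that(1) by (elim bexE) (simp add: fc)
    show "fb a b \<in> carrier ?K" if "a \<in> carrier (SGee A)" "b \<in> carrier (SGee C)" for a b
      using lift_ee[OF that(2)] that(1) by (elim bexE) (simp add: fb)
    show "fb (a \<otimes>\<^bsub>SGee A\<^esub> a') b = fb a b \<otimes>\<^bsub>?K\<^esub> fb a' b"
      if "a \<in> carrier (SGee A)" "a' \<in> carrier (SGee A)" "b \<in> carrier (SGee C)" for a a' b
      using lift_ee[OF that(3)] that(1,2) by (elim bexE) (simp add: fb AB.bar_mult)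
    show "fb a (b \<otimes>\<^bsub>SGee C\<^esub> b') = fb a b \<otimes>\<^bsub>?K\<^esub> fb a b'"
      if "a \<in> carrier (SGee A)" "b \<in> carrier (SGee C)" "b' \<in> carrier (SGee C)" for a b b'
      using lift_ee[OF that(2)] lift_ee[OF that(3)] that(1)
      by (elim bexE) (simp add: fb sgg AB.bar_mult del: sigma.ee.hom_mult)
    show "fb a b \<otimes>\<^bsub>?K\<^esub> fc x y = fc x y \<otimes>\<^bsub>?K\<^esub> fb a b"
      if "a \<in> carrier (SGee A)" "b \<in> carrier (SGee C)" "x \<in> carrier (SGe A)" "y \<in> carrier (SGe C)" for a b x y
    proof -
      from lift_ee[OF that(2)] lift_e[OF that(4)] obtain b' y' where l: "b' \<in> carrier (SGee B)" "b = snd \<sigma> b'" "y' \<in> carrier (SGe B)" "y = fst \<sigma> y'" by blast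
      show ?thesis unfolding l(2,4) fb[OF that(1) l(1)] fc[OF that(3) l(3)]
        by (rule com) (use that l in simp_all)
    qed
    show "fb a b \<otimes>\<^bsub>?K\<^esub> fb a' b' = fb a' b' \<otimes>\<^bsub>?K\<^esub> fb a b"
      if "a \<in> carrier (SGee A)" "b \<in> carrier (SGee C)" "a' \<in> carrier (SGee A)" "b' \<in> carrier (SGee C)" for a b a' b'
    proof -
      from lift_ee[OF that(2)] lift_ee[OF that(4)] obtain c c' where l: "c \<in> carrier (SGee B)" "b = snd \<sigma> c" "c' \<in> carrier (SGee B)" "b' = snd \<sigma> c'" by blast
      show ?thesis unfolding l(2,4) fb[OF that(1) l(1)] fb[OF that(3) l(3)]
        by (rule com) (use that l in simp_all)
    qed
    show "fc x (y \<otimes>\<^bsub>SGe C\<^esub> y') = fc x y \<otimes>\<^bsub>?K\<^esub> fc x y'"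
      if "x \<in> carrier (SGe A)" "y \<in> carrier (SGe C)" "y' \<in> carrier (SGe C)" for x y y'
      using lift_e[OF that(2)] lift_e[OF that(3)] that(1)
      by (elim bexE) (simp add: fc sg del: sigma.e.hom_mult)
    show "fc (x \<otimes>\<^bsub>SGe A\<^esub> x') y = fc x y \<otimes>\<^bsub>?K\<^esub> fc x' y \<otimes>\<^bsub>?K\<^esub> fb (sg_cross A x' x) (SGH C y)"
      if "x \<in> carrier (SGe A)" "x' \<in> carrier (SGe A)" "y \<in> carrier (SGe C)" for x x' y
      using lift_e[OF that(3)] that(1,2)
      by (elim bexE) (simp add: fc AB.circ_mult_left fb flip: sigma.H del: A.T_cross)
    show "fc x (SGP C b) = fb (sg_cross A x x) b" if "x \<in> carrier (SGe A)" "b \<in> carrier (SGee C)" for x b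
      using lift_ee[OF that(2)] that(1) by (elim bexE) (simp add: fc fb flip: sigma.P)
    show "fc (SGP A a) y = fb a (sg_Delta C y)" if "a \<in> carrier (SGee A)" "y \<in> carrier (SGe C)" for a y
      using lift_e[OF that(2)] that(1) by (elim bexE) (simp add: fc fb flip: sigma.Delta)
    show "fb (sg_T A a) (sg_T C b) = inv\<^bsub>?K\<^esub> fb a b" if "a \<in> carrier (SGee A)" "b \<in> carrier (SGee C)" for a b
      using lift_ee[OF that(2)] that(1) by (elim bexE) (simp add: fb AB.bar_T flip: sigma.T)
  qed
  then obtain h where h: "h \<in> hom (tensor_e A C) ?K"
    "\<And>x y. x \<in> carrier (SGe A) \<Longrightarrow> y \<in> carrier (SGe C) \<Longrightarrow> h (circ A C x y) = fc x y"
    "\<And>a b. a \<in> carrier (SGee A) \<Longrightarrow> b \<in> carrier (SGee C) \<Longrightarrow> h (bar A C a b) = fb a b"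
    by blast
  have wc: "w \<in> carrier (tensor_e A B)" "fst A\<sigma> w = \<one>\<^bsub>tensor_e A C\<^esub>"
    using w by (simp_all add: kernel_iff)
  have "(h \<circ> fst A\<sigma>) w = \<pi> w"
    by (rule AB.e_hom_eqI[OF K hom_compose[OF map_homs(1) h(1)] \<pi>_hom wc(1)])
      (simp_all add: map_simps h fc fb)
  then have "\<pi> w = \<one>\<^bsub>?K\<^esub>" using wc(2) hom_one[OF h(1) AC.E.is_group K] by simp
  then show ?thesis using wc(1) by (simp add: \<pi>_def Mod_coset_one_iff[OF N])
qed

lemma kernel_ee:
  assumes N: "subgroup N (tensor_ee A B)"
    and Np: "\<And>a k. a \<in> carrier (SGee A) \<Longrightarrow> k \<in> kernel (SGee B) (SGee C) (snd \<sigma>) \<Longrightarrow> pure A B a k \<in> N"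
    and w: "w \<in> kernel (tensor_ee A B) (tensor_ee A C) (snd A\<sigma>)"
  shows "w \<in> N"
proof -
  have Nn: "N \<lhd> tensor_ee A B" by (rule AB.EE.subgroup_imp_normal[OF N])
  interpret N: normal N "tensor_ee A B" by (rule Nn)
  let ?K = "tensor_ee A B Mod N"
  define \<pi> where "\<pi> z = N #>\<^bsub>tensor_ee A B\<^esub> z" for z
  have K: "comm_group ?K" by (rule AB.EE.abelian_FactGroup[OF N])
  interpret K: comm_group ?K by (rule K)
  have \<pi>_hom: "\<pi> \<in> hom (tensor_ee A B) ?K" unfolding \<pi>_def by (rule N.r_coset_hom_Mod)
  interpret \<pi>: group_hom "tensor_ee A B" ?K \<pi> by unfold_locales (rule \<pi>_hom)
  define fb where "fb a b = \<pi> (pure A B a (inv_into (carrier (SGee B)) (snd \<sigma>) b))" for a b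
  have fb: "fb a (snd \<sigma> b) = \<pi> (pure A B a b)" if "a \<in> carrier (SGee A)" "b \<in> carrier (SGee B)" for a b
  proof -
    let ?b = "inv_into (carrier (SGee B)) (snd \<sigma>) (snd \<sigma> b)"
    have b: "?b \<in> carrier (SGee B)" "snd \<sigma> ?b = snd \<sigma> b"
      using that by (auto intro: inv_into_into f_inv_into_f)
    have "?b \<otimes>\<^bsub>SGee B\<^esub> inv\<^bsub>SGee B\<^esub> b \<in> kernel (SGee B) (SGee C) (snd \<sigma>)"
      using b that by (simp add: kernel_iff)
    from Np[OF that(1) this] have "pure A B a ?b \<otimes>\<^bsub>tensor_ee A B\<^esub> inv\<^bsub>tensor_ee A B\<^esub> pure A B a b \<in> N"
      using b that by simp
    then show ?thesis unfolding fb_def \<pi>_def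
      by (subst Mod_coset_eq_iff[OF Nn]) (use b that in simp_all)
  qed
  have sgg: "snd \<sigma> y \<otimes>\<^bsub>SGee C\<^esub> snd \<sigma> y' = snd \<sigma> (y \<otimes>\<^bsub>SGee B\<^esub> y')"
    if "y \<in> carrier (SGee B)" "y' \<in> carrier (SGee B)" for y y' using that by simp
  have "biadditive (SGee A) (SGee C) ?K fb"
  proof (rule biadditiveI)
    show "fb a b \<in> carrier ?K" if "a \<in> carrier (SGee A)" "b \<in> carrier (SGee C)" for a b
      using lift_ee[OF that(2)] that(1) by (elim bexE) (simp add: fb)
    show "fb (a \<otimes>\<^bsub>SGee A\<^esub> a') b = fb a b \<otimes>\<^bsub>?K\<^esub> fb a' b"
      if "a \<in> carrier (SGee A)" "a' \<in> carrier (SGee A)" "b \<in> carrier (SGee C)" for a a' b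
      using lift_ee[OF that(3)] that(1,2) by (elim bexE) (simp add: fb)
    show "fb a (b \<otimes>\<^bsub>SGee C\<^esub> b') = fb a b \<otimes>\<^bsub>?K\<^esub> fb a b'"
      if "a \<in> carrier (SGee A)" "b \<in> carrier (SGee C)" "b' \<in> carrier (SGee C)" for a b b'
      using lift_ee[OF that(2)] lift_ee[OF that(3)] that(1)
      by (elim bexE) (simp add: fb sgg del: sigma.ee.hom_mult)
  qed
  from AC.ee_lift[OF K this] obtain h where h: "h \<in> hom (tensor_ee A C) ?K"
    "\<And>a b. a \<in> carrier (SGee A) \<Longrightarrow> b \<in> carrier (SGee C) \<Longrightarrow> h (pure A C a b) = fb a b"
    by blast
  have wc: "w \<in> carrier (tensor_ee A B)" "snd A\<sigma> w = \<one>\<^bsub>tensor_ee A C\<^esub>"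
    using w by (simp_all add: kernel_iff)
  have "(h \<circ> snd A\<sigma>) w = \<pi> w"
    by (rule AB.ee_hom_eqI[OF K.is_group hom_compose[OF map_homs(2) h(1)] \<pi>_hom wc(1)])
      (simp_all add: map_simps h fb)
  then have "\<pi> w = \<one>\<^bsub>?K\<^esub>" using wc(2) hom_one[OF h(1) AC.EE.is_group K.is_group] by simp
  then show ?thesis using wc(1) by (simp add: \<pi>_def Mod_coset_one_iff[OF Nn])
qed

end

lemma tensor_epiI:
  "square_group A \<Longrightarrow> square_group B \<Longrightarrow> square_group C \<Longrightarrow> \<sigma> \<in> sg_epi B C \<Longrightarrow> tensor_epi A B C \<sigma>"
  by (simp add: tensor_epi_def tensor_epi_axioms_def)

text \<open>The image of \<open>sg_tensor A L\<close> contains the elements required by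
  \<open>kernel_e\<close> and \<open>kernel_ee\<close>. What has to be proved is that it is normal
  on the \<open>e\<close>-level, although its generators are not central.\<close>

theorem tensor_right_exact:
  assumes A: "square_group A" and ex: "sg_short_exact L M N f g"
  shows "sg_exact_at (sg_tensor A L) (sg_tensor A M) (sg_tensor A N) (sg_tensor_map A L M f) (sg_tensor_map A M N g)"
    and "sg_tensor_map A M N g \<in> sg_epi (sg_tensor A M) (sg_tensor A N)"
proof -
  have sq: "square_group L" "square_group M" "square_group N" and f: "f \<in> sg_hom L M" and g: "g \<in> sg_epi M N"
    and ke: "kernel (SGe M) (SGe N) (fst g) = fst f ` carrier (SGe L)"
    and kee: "kernel (SGee M) (SGee N) (snd g) = snd f ` carrier (SGee L)"
    using ex by (auto simp: sg_short_exact_def sg_exact_at_def)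
  interpret te: tensor_epi A M N g by (rule tensor_epiI[OF A sq(2,3) g])
  interpret AL: square_tensor A L by (rule square_tensorI[OF A sq(1)])
  interpret f: square_group_hom L M f by (rule square_group_homI[OF sq(1,2) f])
  let ?F = "sg_tensor_map A L M f"
  note F = sg_tensor_map_hom[OF A sq(1,2) f]
  note F_simps = sg_tensor_map_circ[OF A sq(1,2) f] sg_tensor_map_bar[OF A sq(1,2) f] sg_tensor_map_pure[OF A sq(1,2) f]
  note Fh = sg_homD(1,2)[OF F, unfolded sg_tensor_simps]
  interpret F: square_group_hom "sg_tensor A L" "sg_tensor A M" ?F
    by (rule square_group_homI[OF AL.tensor_square_group te.AB.tensor_square_group F])
  show "sg_tensor_map A M N g \<in> sg_epi (sg_tensor A M) (sg_tensor A N)" by (rule te.map_epi)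
  have gf: "fst g (fst f x) = \<one>\<^bsub>SGe N\<^esub>" if "x \<in> carrier (SGe L)" for x
    using ke that by (auto simp: kernel_def)
  have gf': "snd g (snd f x) = \<one>\<^bsub>SGee N\<^esub>" if "x \<in> carrier (SGee L)" for x
    using kee that by (auto simp: kernel_def)
  define Ne where "Ne = fst ?F ` carrier (tensor_e A L)"
  define Nee where "Nee = snd ?F ` carrier (tensor_ee A L)"
  have Ne: "subgroup Ne (tensor_e A M)" using F.e.img_is_subgroup by (simp add: Ne_def)
  have Nee: "subgroup Nee (tensor_ee A M)" using F.ee.img_is_subgroup by (simp add: Nee_def)
  interpret Ne: subgroup Ne "tensor_e A M" by (rule Ne)
  interpret Nee: subgroup Nee "tensor_ee A M" by (rule Nee)
  let ?c = "cross_effect (tensor_e A M) (tensor_ee A M) (tensor_H A M)"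
  \<comment> \<open>The relevant pair is \<open>circ x y\<close> with the image of
    \<open>circ x' y'\<close>. The cross-effect of y and \<open>f y'\<close> goes to the
    cross-effect of \<open>g y\<close> with zero, so it is in the kernel of \<open>g\<close> and
    comes from \<open>L\<close>.\<close>
  have c1: "?c z (fst ?F s) \<in> Nee" if z: "z \<in> te.AB.gen_set" and s: "s \<in> AL.gen_set" for z s
    using z
  proof (cases rule: te.AB.gen_set_cases)
    case (bar a b)
    have "fst ?F s \<in> carrier (tensor_e A M)" using s AL.gen_set_sub hom_in_carrier[OF Fh(1)] by blast
    then show ?thesis using bar by (simp add: te.AB.tensor_H_cross_bar)
  next
    case c: (circ x y)
    show ?thesis using s
    proof (cases rule: AL.gen_set_cases)
      case (bar a b)
      then show ?thesis using c by (simp add: F_simps te.AB.tensor_H_cross_bar)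
    next
      case (circ x' y')
      have "sg_cross M y (fst f y') \<in> kernel (SGee M) (SGee N) (snd g)"
        using c circ by (simp add: kernel_iff gf)
      then obtain b where b: "b \<in> carrier (SGee L)" "sg_cross M y (fst f y') = snd f b"
        using kee by auto
      have "?c z (fst ?F s) = snd ?F (pure A L (sg_cross A x x') b)"
        using c circ b by (simp add: F_simps te.AB.tensor_H_cross_circ)
      then show ?thesis using c circ b unfolding Nee_def by (intro image_eqI) auto
    qed
  qed
  have c2: "?c z (fst ?F w) \<in> Nee" if z: "z \<in> te.AB.gen_set" and w: "w \<in> carrier (tensor_e A L)" for z w
  proof -
    have z': "z \<in> carrier (tensor_e A M)" using z te.AB.gen_set_sub by blast
    have "(?c z \<circ> fst ?F) w \<in> Nee"
      by (rule generate_hom_mem[OF AL.E.is_group te.AB.EE.is_group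
            hom_compose[OF Fh(1) te.AB.H.cr.hom_right[OF z']] AL.gen_set_sub Nee])
        (use c1[OF z] w in \<open>simp_all flip: AL.carrier_generate\<close>)
    then show ?thesis by simp
  qed
  have c3: "?c z n \<in> Nee" if z: "z \<in> carrier (tensor_e A M)" and n: "n \<in> Ne" for z n
  proof -
    obtain w where w: "w \<in> carrier (tensor_e A L)" "n = fst ?F w" using n by (auto simp: Ne_def)
    have "n \<in> carrier (tensor_e A M)" using n by simp
    from generate_hom_mem[OF te.AB.E.is_group te.AB.EE.is_group te.AB.H.cr.hom_left[OF this] te.AB.gen_set_sub Nee]
    show ?thesis using c2 w z by (simp flip: te.AB.carrier_generate)
  qed
  have PN: "tensor_P A M t \<in> Ne" if t: "t \<in> Nee" for t
  proof -
    obtain w where w: "w \<in> carrier (tensor_ee A L)" "t = snd ?F w" using t by (auto simp: Nee_def)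
    then have "tensor_P A M t = fst ?F (tensor_P A L w)" using F.P[of w] by simp
    then show ?thesis unfolding Ne_def using w(1) by (intro image_eqI) auto
  qed
  \<comment> \<open>Conjugating n by z multiplies n by \<open>P\<close> of their cross-effect, which
    lies in the image by \<open>c3\<close> and \<open>PN\<close>.\<close>
  have Nn: "Ne \<lhd> tensor_e A M"
  proof (rule te.AB.E.normal_invI[OF Ne])
    fix z n assume z: "z \<in> carrier (tensor_e A M)" and n: "n \<in> Ne"
    have nc: "n \<in> carrier (tensor_e A M)" using n by simp
    have cl: "?c z n \<in> carrier (tensor_ee A M)" "tensor_P A M (?c z n) \<in> carrier (tensor_e A M)" using z nc by auto
    have "z \<otimes>\<^bsub>tensor_e A M\<^esub> n \<otimes>\<^bsub>tensor_e A M\<^esub> inv\<^bsub>tensor_e A M\<^esub> z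
      = n \<otimes>\<^bsub>tensor_e A M\<^esub> (z \<otimes>\<^bsub>tensor_e A M\<^esub> tensor_P A M (?c z n)) \<otimes>\<^bsub>tensor_e A M\<^esub> inv\<^bsub>tensor_e A M\<^esub> z"
      unfolding te.AB.tensor_commutator[OF z nc] using z nc cl by (simp add: te.AB.E.m_assoc)
    also have "\<dots> = n \<otimes>\<^bsub>tensor_e A M\<^esub> tensor_P A M (?c z n)"
      unfolding te.AB.tensor_P_central[OF cl(1) z, symmetric] using z nc cl by (simp add: te.AB.E.m_assoc)
    finally show "z \<otimes>\<^bsub>tensor_e A M\<^esub> n \<otimes>\<^bsub>tensor_e A M\<^esub> inv\<^bsub>tensor_e A M\<^esub> z \<in> Ne"
      using Ne.m_closed[OF n PN[OF c3[OF z n]]] by simp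
  qed
  have e: "kernel (tensor_e A M) (tensor_e A N) (fst te.A\<sigma>) = Ne"
  proof (intro equalityI subsetI)
    show "w \<in> Ne" if "w \<in> kernel (tensor_e A M) (tensor_e A N) (fst te.A\<sigma>)" for w
    proof (rule te.kernel_e[OF Nn _ _ that])
      show "circ A M x k \<in> Ne" if x: "x \<in> carrier (SGe A)" and k: "k \<in> kernel (SGe M) (SGe N) (fst g)" for x k
      proof -
        obtain k' where k': "k' \<in> carrier (SGe L)" "k = fst f k'" using k unfolding ke by blast
        show ?thesis unfolding Ne_def
          by (rule image_eqI[of _ _ "circ A L x k'"]) (use x k' in \<open>simp_all add: F_simps\<close>)
      qed
      show "bar A M a k \<in> Ne" if x: "a \<in> carrier (SGee A)" and k: "k \<in> kernel (SGee M) (SGee N) (snd g)" for a k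
      proof -
        obtain k' where k': "k' \<in> carrier (SGee L)" "k = snd f k'" using k unfolding kee by blast
        show ?thesis unfolding Ne_def
          by (rule image_eqI[of _ _ "bar A L a k'"]) (use x k' in \<open>simp_all add: F_simps\<close>)
      qed
    qed
    show "n \<in> kernel (tensor_e A M) (tensor_e A N) (fst te.A\<sigma>)" if n: "n \<in> Ne" for n
    proof -
      obtain w where w: "w \<in> carrier (tensor_e A L)" "n = fst ?F w" using n by (auto simp: Ne_def)
      have tr: "(\<lambda>_. \<one>\<^bsub>tensor_e A N\<^esub>) \<in> hom (tensor_e A L) (tensor_e A N)" by (simp add: hom_def)
      have "(fst te.A\<sigma> \<circ> fst ?F) w = \<one>\<^bsub>tensor_e A N\<^esub>"
        by (rule AL.e_hom_eqI[OF te.AC.E.is_group hom_compose[OF Fh(1) te.map_homs(1)] tr w(1)])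
          (simp_all add: F_simps te.map_simps gf gf')
      then show ?thesis using n w(2) by (simp add: kernel_iff)
    qed
  qed
  have ee: "kernel (tensor_ee A M) (tensor_ee A N) (snd te.A\<sigma>) = Nee"
  proof (intro equalityI subsetI)
    show "w \<in> Nee" if "w \<in> kernel (tensor_ee A M) (tensor_ee A N) (snd te.A\<sigma>)" for w
    proof (rule te.kernel_ee[OF Nee _ that])
      show "pure A M a k \<in> Nee" if x: "a \<in> carrier (SGee A)" and k: "k \<in> kernel (SGee M) (SGee N) (snd g)" for a k
      proof -
        obtain k' where k': "k' \<in> carrier (SGee L)" "k = snd f k'" using k unfolding kee by blast
        show ?thesis unfolding Nee_def
          by (rule image_eqI[of _ _ "pure A L a k'"]) (use x k' in \<open>simp_all add: F_simps\<close>)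
      qed
    qed
    show "n \<in> kernel (tensor_ee A M) (tensor_ee A N) (snd te.A\<sigma>)" if n: "n \<in> Nee" for n
    proof -
      obtain w where w: "w \<in> carrier (tensor_ee A L)" "n = snd ?F w" using n by (auto simp: Nee_def)
      have tr: "(\<lambda>_. \<one>\<^bsub>tensor_ee A N\<^esub>) \<in> hom (tensor_ee A L) (tensor_ee A N)" by (simp add: hom_def)
      have "(snd te.A\<sigma> \<circ> snd ?F) w = \<one>\<^bsub>tensor_ee A N\<^esub>"
        by (rule AL.ee_hom_eqI[OF te.AC.EE.is_group hom_compose[OF Fh(2) te.map_homs(2)] tr w(1)])
          (simp_all add: F_simps te.map_simps gf')
      then show ?thesis using n w(2) by (simp add: kernel_iff)
    qed
  qed
  show "sg_exact_at (sg_tensor A L) (sg_tensor A M) (sg_tensor A N) ?F te.A\<sigma>"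
    unfolding sg_exact_at_def sg_tensor_simps e ee Ne_def Nee_def using F te.map_hom by simp
qed

section \<open>Reflexive coequalizers\<close>

locale sg_ideal = square_group M for M :: "('a, 'b) square" +
  fixes U V
  assumes U: "U \<lhd> SGe M" and V: "V \<lhd> SGee M"
    and H_coset: "\<And>x x'. x \<in> carrier (SGe M) \<Longrightarrow> x' \<in> carrier (SGe M) \<Longrightarrow> U #>\<^bsub>SGe M\<^esub> x = U #>\<^bsub>SGe M\<^esub> x' \<Longrightarrow>
      V #>\<^bsub>SGee M\<^esub> SGH M x = V #>\<^bsub>SGee M\<^esub> SGH M x'"
    and P_coset: "\<And>a a'. a \<in> carrier (SGee M) \<Longrightarrow> a' \<in> carrier (SGee M) \<Longrightarrow> V #>\<^bsub>SGee M\<^esub> a = V #>\<^bsub>SGee M\<^esub> a' \<Longrightarrow>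
      U #>\<^bsub>SGe M\<^esub> SGP M a = U #>\<^bsub>SGe M\<^esub> SGP M a'"

text \<open>This is \<open>sg_pi0\<close> with arbitrary subgroups in place of the two coequalizer
  kernels.\<close>

definition sg_quot :: "('a, 'b) square \<Rightarrow> 'a set \<Rightarrow> 'b set \<Rightarrow> ('a set, 'b set) square" where
  "sg_quot M U V =
     \<lparr>SGe = SGe M Mod U, SGee = SGee M Mod V,
      SGH = (\<lambda>X. the_elem ((\<lambda>x. V #>\<^bsub>SGee M\<^esub> SGH M x) ` X)),
      SGP = (\<lambda>X. the_elem ((\<lambda>a. U #>\<^bsub>SGe M\<^esub> SGP M a) ` X))\<rparr>"

definition sg_quot_proj :: "('a, 'b) square \<Rightarrow> 'a set \<Rightarrow> 'b set \<Rightarrow> ('a, 'b, 'a set, 'b set) sg_map" where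
  "sg_quot_proj M U V = (\<lambda>x. U #>\<^bsub>SGe M\<^esub> x, \<lambda>a. V #>\<^bsub>SGee M\<^esub> a)"

lemma coset_the_elem:
  assumes "N \<lhd> G" "x \<in> carrier G"
    and "\<And>y. y \<in> carrier G \<Longrightarrow> N #>\<^bsub>G\<^esub> y = N #>\<^bsub>G\<^esub> x \<Longrightarrow> f y = f x"
  shows "the_elem (f ` (N #>\<^bsub>G\<^esub> x)) = f x"
proof -
  interpret normal N G by fact
  have x: "x \<in> N #>\<^bsub>G\<^esub> x" by (rule rcos_self[OF assms(2) subgroup_axioms])
  have "f y = f x" if y: "y \<in> N #>\<^bsub>G\<^esub> x" for y
  proof (rule assms(3))
    show "y \<in> carrier G" using y r_coset_subset_G[OF subset assms(2)] by blast
    show "N #>\<^bsub>G\<^esub> y = N #>\<^bsub>G\<^esub> x" using repr_independence[OF y assms(2) subgroup_axioms] by simp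
  qed
  then have "f ` (N #>\<^bsub>G\<^esub> x) = {f x}" using x by blast
  then show ?thesis by simp
qed

context sg_ideal
begin

lemma proj_epi: "sg_quot_proj M U V \<in> sg_epi M (sg_quot M U V)"
proof -
  have "SGH (sg_quot M U V) (U #>\<^bsub>SGe M\<^esub> x) = V #>\<^bsub>SGee M\<^esub> SGH M x" if "x \<in> carrier (SGe M)" for x
  proof -
    have "the_elem ((\<lambda>x. V #>\<^bsub>SGee M\<^esub> SGH M x) ` (U #>\<^bsub>SGe M\<^esub> x)) = V #>\<^bsub>SGee M\<^esub> SGH M x"
      by (rule coset_the_elem[OF U that]) (use H_coset[OF _ that] in blast)
    then show ?thesis by (simp add: sg_quot_def)
  qed
  moreover have "SGP (sg_quot M U V) (V #>\<^bsub>SGee M\<^esub> a) = U #>\<^bsub>SGe M\<^esub> SGP M a" if "a \<in> carrier (SGee M)" for a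
  proof -
    have "the_elem ((\<lambda>a. U #>\<^bsub>SGe M\<^esub> SGP M a) ` (V #>\<^bsub>SGee M\<^esub> a)) = U #>\<^bsub>SGe M\<^esub> SGP M a"
      by (rule coset_the_elem[OF V that]) (use P_coset[OF _ that] in blast)
    then show ?thesis by (simp add: sg_quot_def)
  qed
  ultimately show ?thesis
    using normal.r_coset_hom_Mod[OF U] normal.r_coset_hom_Mod[OF V]
    by (simp add: sg_epi_def sg_hom_def sg_quot_proj_def) (simp add: sg_quot_def carrier_FactGroup)
qed

text \<open>The projection from \<open>M\<close> is surjective on both levels, so \<open>M\<close>
  by itself covers the quotient and all axioms descend.\<close>

lemma square_group_quot: "square_group (sg_quot M U V)"
proof (rule square_groupI_cover)
  interpret U: normal U "SGe M" by (rule U)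
  interpret V: normal V "SGee M" by (rule V)
  show "carrier (SGe (sg_quot M U V)) \<noteq> {}" "carrier (SGee (sg_quot M U V)) \<noteq> {}"
    using e.one_closed ee.one_closed by (auto simp: sg_quot_def carrier_FactGroup)
  fix x y z a b c
  assume *: "{x, y, z} \<subseteq> carrier (SGe (sg_quot M U V))" "{a, b, c} \<subseteq> carrier (SGee (sg_quot M U V))"
  show "\<exists>(D :: ('a, 'b) square) f. square_group D \<and> f \<in> sg_hom D (sg_quot M U V) \<and>
        fst f \<one>\<^bsub>SGe D\<^esub> = \<one>\<^bsub>SGe (sg_quot M U V)\<^esub> \<and> snd f \<one>\<^bsub>SGee D\<^esub> = \<one>\<^bsub>SGee (sg_quot M U V)\<^esub> \<and>
        {x, y, z} \<subseteq> fst f ` carrier (SGe D) \<and> {a, b, c} \<subseteq> snd f ` carrier (SGee D)"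
  proof (intro exI conjI)
    show "fst (sg_quot_proj M U V) \<one>\<^bsub>SGe M\<^esub> = \<one>\<^bsub>SGe (sg_quot M U V)\<^esub>"
      "snd (sg_quot_proj M U V) \<one>\<^bsub>SGee M\<^esub> = \<one>\<^bsub>SGee (sg_quot M U V)\<^esub>"
      using U.subset V.subset by (simp_all add: sg_quot_def sg_quot_proj_def)
  qed (use * sg_epiD[OF proj_epi] in \<open>simp_all add: square_group_axioms\<close>)
qed

end

text \<open>The first isomorphism theorem. A morphism commutes with \<open>H\<close> and
  \<open>P\<close>, which makes its pair of kernels compatible with both maps in the sense of
  \<open>sg_ideal\<close>.\<close>

lemma sg_epi_kernel_ideal:
  assumes "square_group M" "square_group N" "f \<in> sg_epi M N"
  defines "U \<equiv> kernel (SGe M) (SGe N) (fst f)" and "V \<equiv> kernel (SGee M) (SGee N) (snd f)"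
  shows "\<exists>\<phi>. \<phi> \<in> sg_iso (sg_quot M U V) N \<and> sg_eq M (sg_comp \<phi> (sg_quot_proj M U V)) f"
proof -
  note fh = sg_epiD[OF assms(3)]
  interpret f: square_group_hom M N f by (rule square_group_homI[OF assms(1,2) fh(1)])
  have U: "U \<lhd> SGe M" and V: "V \<lhd> SGee M"
    unfolding U_def V_def by (rule f.kernel_e_normal f.kernel_ee_normal)+
  have Ueq: "U #>\<^bsub>SGe M\<^esub> x = U #>\<^bsub>SGe M\<^esub> x' \<longleftrightarrow> fst f x = fst f x'"
    if "x \<in> carrier (SGe M)" "x' \<in> carrier (SGe M)" for x x'
    using that f.N.e.inv_solve_right'[of "\<one>\<^bsub>SGe N\<^esub>" "fst f x" "fst f x'"]
    unfolding Mod_coset_eq_iff[OF U that] by (simp add: U_def kernel_iff)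
  have Veq: "V #>\<^bsub>SGee M\<^esub> x = V #>\<^bsub>SGee M\<^esub> x' \<longleftrightarrow> snd f x = snd f x'"
    if "x \<in> carrier (SGee M)" "x' \<in> carrier (SGee M)" for x x'
    using that f.N.ee.inv_solve_right'[of "\<one>\<^bsub>SGee N\<^esub>" "snd f x" "snd f x'"]
    unfolding Mod_coset_eq_iff[OF V that] by (simp add: V_def kernel_iff)
  interpret sg_ideal M U V
  proof (rule sg_ideal.intro[OF assms(1) sg_ideal_axioms.intro], rule U, rule V)
    show "V #>\<^bsub>SGee M\<^esub> SGH M x = V #>\<^bsub>SGee M\<^esub> SGH M x'"
      if "x \<in> carrier (SGe M)" "x' \<in> carrier (SGe M)" "U #>\<^bsub>SGe M\<^esub> x = U #>\<^bsub>SGe M\<^esub> x'" for x x'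
      using that by (simp add: Ueq Veq)
    show "U #>\<^bsub>SGe M\<^esub> SGP M a = U #>\<^bsub>SGe M\<^esub> SGP M a'"
      if "a \<in> carrier (SGee M)" "a' \<in> carrier (SGee M)" "V #>\<^bsub>SGee M\<^esub> a = V #>\<^bsub>SGee M\<^esub> a'" for a a'
      using that by (simp add: Ueq Veq)
  qed
  let ?Q = "sg_quot M U V"
  interpret Q: square_group_hom M ?Q "sg_quot_proj M U V"
    by (rule square_group_homI[OF assms(1) square_group_quot sg_epiD(1)[OF proj_epi]])
  define \<phi> where "\<phi> = (\<lambda>X. the_elem (fst f ` X), \<lambda>X. the_elem (snd f ` X))"
  have \<phi>e: "fst \<phi> (U #>\<^bsub>SGe M\<^esub> x) = fst f x" if "x \<in> carrier (SGe M)" for x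
    unfolding \<phi>_def fst_conv by (rule coset_the_elem[OF U that]) (use Ueq[OF _ that] in blast)
  have \<phi>ee: "snd \<phi> (V #>\<^bsub>SGee M\<^esub> x) = snd f x" if "x \<in> carrier (SGee M)" for x
    unfolding \<phi>_def snd_conv by (rule coset_the_elem[OF V that]) (use Veq[OF _ that] in blast)
  have se: "SGe ?Q = SGe M Mod U" "SGee ?Q = SGee M Mod V" by (simp_all add: sg_quot_def)
  have \<phi>1: "fst \<phi> \<in> hom (SGe ?Q) (SGe N)"
    unfolding \<phi>_def fst_conv se unfolding U_def by (rule f.e.FactGroup_hom)
  have \<phi>2: "snd \<phi> \<in> hom (SGee ?Q) (SGee N)"
    unfolding \<phi>_def snd_conv se unfolding V_def by (rule f.ee.FactGroup_hom)
  have Hq: "SGH ?Q (U #>\<^bsub>SGe M\<^esub> x) = V #>\<^bsub>SGee M\<^esub> SGH M x" if "x \<in> carrier (SGe M)" for x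
    using Q.H[OF that] by (simp add: sg_quot_proj_def)
  have Pq: "SGP ?Q (V #>\<^bsub>SGee M\<^esub> a) = U #>\<^bsub>SGe M\<^esub> SGP M a" if "a \<in> carrier (SGee M)" for a
    using Q.P[OF that] by (simp add: sg_quot_proj_def)
  have hom: "\<phi> \<in> sg_hom ?Q N"
    using \<phi>1 \<phi>2 by (auto simp: sg_hom_def se carrier_FactGroup Hq Pq \<phi>e \<phi>ee)
  have "inj_on (fst \<phi>) (carrier (SGe ?Q))" "inj_on (snd \<phi>) (carrier (SGee ?Q))"
    by (simp_all add: inj_on_def se carrier_FactGroup \<phi>e \<phi>ee Ueq Veq)
  moreover have "fst \<phi> ` carrier (SGe ?Q) = carrier (SGe N)" "snd \<phi> ` carrier (SGee ?Q) = carrier (SGee N)"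
    unfolding se carrier_FactGroup image_image using fh by (simp_all add: \<phi>e \<phi>ee)
  moreover have "sg_eq M (sg_comp \<phi> (sg_quot_proj M U V)) f"
    by (simp add: sg_eq_def sg_comp_def sg_quot_proj_def \<phi>e \<phi>ee)
  ultimately show ?thesis using hom by (intro exI[of _ \<phi>]) (simp add: sg_iso_def sg_mon_def sg_epi_def)
qed

text \<open>With the common section s one has f x - g x = f(x - s(g x)), and x - s(g x) lies in the
  kernel of g. Conversely f k = f k - g k for k in that kernel. The image of the kernel under f is
  normal because f is surjective.\<close>

lemma coeq_kernel_reflexive:
  assumes "group K" "group G" "f \<in> hom K G" "g \<in> hom K G"
    and s: "\<And>x. x \<in> carrier G \<Longrightarrow> s x \<in> carrier K \<and> f (s x) = x \<and> g (s x) = x"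
  shows "coeq_kernel K G f g = f ` kernel K G g" and "coeq_kernel K G f g \<lhd> G"
proof -
  interpret f: group_hom K G f using assms by (simp add: group_hom_def group_hom_axioms_def)
  interpret g: group_hom K G g using assms by (simp add: group_hom_def group_hom_axioms_def)
  have surj: "f ` carrier K = carrier G"
  proof
    show "carrier G \<subseteq> f ` carrier K"
      using s by (metis image_eqI subsetI)
  qed auto
  have norm: "f ` kernel K G g \<lhd> G"
    by (rule normal.surj_hom_normal_subgroup[OF g.normal_kernel f.group_hom_axioms surj])
  have sub: "f x \<otimes>\<^bsub>G\<^esub> inv\<^bsub>G\<^esub> g x \<in> f ` kernel K G g" if x: "x \<in> carrier K" for x
  proof (rule image_eqI)
    have sx: "s (g x) \<in> carrier K" "f (s (g x)) = g x" "g (s (g x)) = g x" using s x by auto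
    show "f x \<otimes>\<^bsub>G\<^esub> inv\<^bsub>G\<^esub> g x = f (x \<otimes>\<^bsub>K\<^esub> inv\<^bsub>K\<^esub> s (g x))" using x sx by simp
    show "x \<otimes>\<^bsub>K\<^esub> inv\<^bsub>K\<^esub> s (g x) \<in> kernel K G g" using x sx by (simp add: kernel_iff)
  qed
  have "f k \<in> N" if "k \<in> kernel K G g" and N: "(\<lambda>x. f x \<otimes>\<^bsub>G\<^esub> inv\<^bsub>G\<^esub> g x) ` carrier K \<subseteq> N" for k N
  proof -
    have k: "k \<in> carrier K" "g k = \<one>\<^bsub>G\<^esub>" using that(1) by (simp_all add: kernel_iff)
    then have "f k = f k \<otimes>\<^bsub>G\<^esub> inv\<^bsub>G\<^esub> g k" by simp
    then show ?thesis using k(1) N by auto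
  qed
  then show eq: "coeq_kernel K G f g = f ` kernel K G g"
    unfolding coeq_kernel_def normal_closure_def using norm sub by blast
  show "coeq_kernel K G f g \<lhd> G" unfolding eq by (rule norm)
qed

locale reflexive_pair = B1: square_group B1 + B0: square_group B0
  for B1 :: "('a, 'b) square" and B0 :: "('a, 'b) square" +
  fixes d0 d1 :: "('a, 'b, 'a, 'b) sg_map" and s :: "('a, 'b, 'a, 'b) sg_map"
  assumes d0: "d0 \<in> sg_hom B1 B0" and d1: "d1 \<in> sg_hom B1 B0" and s: "s \<in> sg_hom B0 B1"
    and d0s: "sg_eq B0 (sg_comp d0 s) sg_id" and d1s: "sg_eq B0 (sg_comp d1 s) sg_id"
begin

sublocale d0: square_group_hom B1 B0 d0 by unfold_locales (rule d0)
sublocale d1: square_group_hom B1 B0 d1 by unfold_locales (rule d1)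
sublocale s: square_group_hom B0 B1 s by unfold_locales (rule s)

lemma ds [simp]:
  "x \<in> carrier (SGe B0) \<Longrightarrow> fst d0 (fst s x) = x" "x \<in> carrier (SGe B0) \<Longrightarrow> fst d1 (fst s x) = x"
  "a \<in> carrier (SGee B0) \<Longrightarrow> snd d0 (snd s a) = a" "a \<in> carrier (SGee B0) \<Longrightarrow> snd d1 (snd s a) = a"
  using d0s d1s by (auto simp: sg_eq_def sg_comp_def sg_id_def)

abbreviation "Ke \<equiv> coeq_kernel (SGe B1) (SGe B0) (fst d0) (fst d1)"
abbreviation "Kee \<equiv> coeq_kernel (SGee B1) (SGee B0) (snd d0) (snd d1)"

lemma Ke_eq: "Ke = fst d0 ` kernel (SGe B1) (SGe B0) (fst d1)" and Ke_normal: "Ke \<lhd> SGe B0"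
  by (rule coeq_kernel_reflexive[where s = "fst s"]; simp)+

lemma Kee_eq: "Kee = snd d0 ` kernel (SGee B1) (SGee B0) (snd d1)" and Kee_normal: "Kee \<lhd> SGee B0"
  by (rule coeq_kernel_reflexive[where s = "snd s"]; simp)+

lemma KeE: assumes "x \<in> Ke" obtains k where "k \<in> carrier (SGe B1)" "x = fst d0 k" "fst d1 k = \<one>\<^bsub>SGe B0\<^esub>"
  using assms unfolding Ke_eq kernel_def by blast

lemma KeeE: assumes "x \<in> Kee" obtains k where "k \<in> carrier (SGee B1)" "x = snd d0 k" "snd d1 k = \<one>\<^bsub>SGee B0\<^esub>"
  using assms unfolding Kee_eq kernel_def by blast

lemma KeI: "k \<in> carrier (SGe B1) \<Longrightarrow> fst d1 k = \<one>\<^bsub>SGe B0\<^esub> \<Longrightarrow> fst d0 k \<in> Ke"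
  unfolding Ke_eq kernel_def by blast

lemma KeeI: "k \<in> carrier (SGee B1) \<Longrightarrow> snd d1 k = \<one>\<^bsub>SGee B0\<^esub> \<Longrightarrow> snd d0 k \<in> Kee"
  unfolding Kee_eq kernel_def by blast

sublocale ideal: sg_ideal B0 Ke Kee
proof (rule sg_ideal.intro[OF B0.square_group_axioms sg_ideal_axioms.intro], rule Ke_normal, rule Kee_normal)
  interpret Kee: normal Kee "SGee B0" by (rule Kee_normal)
  show "Kee #>\<^bsub>SGee B0\<^esub> SGH B0 x = Kee #>\<^bsub>SGee B0\<^esub> SGH B0 x'"
    if x: "x \<in> carrier (SGe B0)" "x' \<in> carrier (SGe B0)" and "Ke #>\<^bsub>SGe B0\<^esub> x = Ke #>\<^bsub>SGe B0\<^esub> x'" for x x'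
  proof -
    have "x \<otimes>\<^bsub>SGe B0\<^esub> inv\<^bsub>SGe B0\<^esub> x' \<in> Ke" using that Mod_coset_eq_iff[OF Ke_normal] by blast
    then obtain k where k: "k \<in> carrier (SGe B1)" "x \<otimes>\<^bsub>SGe B0\<^esub> inv\<^bsub>SGe B0\<^esub> x' = fst d0 k"
      "fst d1 k = \<one>\<^bsub>SGe B0\<^esub>" by (rule KeE)
    have "x = fst d0 k \<otimes>\<^bsub>SGe B0\<^esub> x'" unfolding k(2)[symmetric] using x by (simp add: B0.e.m_assoc)
    then have "SGH B0 x = SGH B0 (fst d0 k) \<otimes>\<^bsub>SGee B0\<^esub> SGH B0 x' \<otimes>\<^bsub>SGee B0\<^esub> sg_cross B0 (fst d0 k) x'"
      using k x by (simp add: B0.H.f_mult)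
    moreover have "SGH B0 (fst d0 k) \<in> carrier (SGee B0)" "SGH B0 x' \<in> carrier (SGee B0)"
      "sg_cross B0 (fst d0 k) x' \<in> carrier (SGee B0)" using k x by auto
    then have "SGH B0 (fst d0 k) \<otimes>\<^bsub>SGee B0\<^esub> SGH B0 x' \<otimes>\<^bsub>SGee B0\<^esub> sg_cross B0 (fst d0 k) x'
      \<otimes>\<^bsub>SGee B0\<^esub> inv\<^bsub>SGee B0\<^esub> SGH B0 x' = SGH B0 (fst d0 k) \<otimes>\<^bsub>SGee B0\<^esub> sg_cross B0 (fst d0 k) x'"
      by algebra
    moreover have "SGH B0 (fst d0 k) \<in> Kee"
      using KeeI[of "SGH B1 k"] k by simp
    \<comment> \<open>The section lifts x' to \<open>B1\<close>: the cross-effect is the image under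
      \<open>d0\<close> of the cross-effect of k and s(x'), and \<open>d1\<close> sends the latter
      to the cross-effect of zero and x'.\<close>
    moreover have "sg_cross B0 (fst d0 k) x' \<in> Kee"
      using KeeI[of "sg_cross B1 k (fst s x')"] k x by simp
    ultimately have "SGH B0 x \<otimes>\<^bsub>SGee B0\<^esub> inv\<^bsub>SGee B0\<^esub> SGH B0 x' \<in> Kee" by simp
    then show ?thesis using x by (simp add: Mod_coset_eq_iff[OF Kee_normal])
  qed
  show "Ke #>\<^bsub>SGe B0\<^esub> SGP B0 a = Ke #>\<^bsub>SGe B0\<^esub> SGP B0 a'"
    if a: "a \<in> carrier (SGee B0)" "a' \<in> carrier (SGee B0)" and "Kee #>\<^bsub>SGee B0\<^esub> a = Kee #>\<^bsub>SGee B0\<^esub> a'" for a a'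
  proof -
    have "a \<otimes>\<^bsub>SGee B0\<^esub> inv\<^bsub>SGee B0\<^esub> a' \<in> Kee" using that Mod_coset_eq_iff[OF Kee_normal] by blast
    then obtain k where k: "k \<in> carrier (SGee B1)" "a \<otimes>\<^bsub>SGee B0\<^esub> inv\<^bsub>SGee B0\<^esub> a' = snd d0 k"
      "snd d1 k = \<one>\<^bsub>SGee B0\<^esub>" by (rule KeeE)
    have "SGP B0 a \<otimes>\<^bsub>SGe B0\<^esub> inv\<^bsub>SGe B0\<^esub> SGP B0 a' = SGP B0 (a \<otimes>\<^bsub>SGee B0\<^esub> inv\<^bsub>SGee B0\<^esub> a')"
      using a by simp
    also have "\<dots> = fst d0 (SGP B1 k)" using k by simp
    also have "\<dots> \<in> Ke" using k by (intro KeI) simp_all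
    finally show ?thesis using a by (simp add: Mod_coset_eq_iff[OF Ke_normal])
  qed
qed

end

text \<open>Tensoring keeps the pair reflexive, so \<open>U'\<close> and \<open>V'\<close> are
  images under one face of the kernel of the other and meet the hypotheses of
  \<open>kernel_e\<close> and \<open>kernel_ee\<close>. They are therefore the kernels of the
  tensored projection, and the first isomorphism theorem applies.\<close>

theorem tensor_coequalizer:
  assumes A: "square_group A" and r: "reflexive_pair B1 B0 d0 d1 s"
  defines "U \<equiv> coeq_kernel (SGe B1) (SGe B0) (fst d0) (fst d1)"
    and "V \<equiv> coeq_kernel (SGee B1) (SGee B0) (snd d0) (snd d1)"
    and "U' \<equiv> coeq_kernel (tensor_e A B1) (tensor_e A B0) (fst (sg_tensor_map A B1 B0 d0)) (fst (sg_tensor_map A B1 B0 d1))"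
    and "V' \<equiv> coeq_kernel (tensor_ee A B1) (tensor_ee A B0) (snd (sg_tensor_map A B1 B0 d0)) (snd (sg_tensor_map A B1 B0 d1))"
  shows "\<exists>\<phi>. \<phi> \<in> sg_iso (sg_quot (sg_tensor A B0) U' V') (sg_tensor A (sg_quot B0 U V)) \<and>
    sg_eq (sg_tensor A B0) (sg_comp \<phi> (sg_quot_proj (sg_tensor A B0) U' V'))
      (sg_tensor_map A B0 (sg_quot B0 U V) (sg_quot_proj B0 U V))"
proof -
  interpret r: reflexive_pair B1 B0 d0 d1 s by (rule r)
  note sq1 = r.B1.square_group_axioms and sq0 = r.B0.square_group_axioms
  let ?C = "sg_quot B0 U V" and ?p = "sg_quot_proj B0 U V"
  let ?D0 = "sg_tensor_map A B1 B0 d0" and ?D1 = "sg_tensor_map A B1 B0 d1" and ?S = "sg_tensor_map A B0 B1 s"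
  have C: "square_group ?C" and p: "?p \<in> sg_epi B0 ?C"
    unfolding U_def V_def by (rule r.ideal.square_group_quot r.ideal.proj_epi)+
  interpret te: tensor_epi A B0 ?C ?p by (rule tensor_epiI[OF A sq0 C p])
  interpret AB1: square_tensor A B1 by (rule square_tensorI[OF A sq1])
  note D0_simps = sg_tensor_map_circ[OF A sq1 sq0 r.d0] sg_tensor_map_bar[OF A sq1 sq0 r.d0]
    sg_tensor_map_pure[OF A sq1 sq0 r.d0]
  note D1_simps = sg_tensor_map_circ[OF A sq1 sq0 r.d1] sg_tensor_map_bar[OF A sq1 sq0 r.d1]
    sg_tensor_map_pure[OF A sq1 sq0 r.d1]
  note S_simps = sg_tensor_map_circ[OF A sq0 sq1 r.s] sg_tensor_map_bar[OF A sq0 sq1 r.s]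
    sg_tensor_map_pure[OF A sq0 sq1 r.s]
  note D0 = sg_tensor_map_hom[OF A sq1 sq0 r.d0] and D1 = sg_tensor_map_hom[OF A sq1 sq0 r.d1]
    and S = sg_tensor_map_hom[OF A sq0 sq1 r.s]
  note D0h = sg_homD(1,2)[OF D0, unfolded sg_tensor_simps]
  note D1h = sg_homD(1,2)[OF D1, unfolded sg_tensor_simps]
  note Sh = sg_homD(1,2)[OF S, unfolded sg_tensor_simps]
  have id: "(\<lambda>z. z) \<in> hom G G" for G :: "'z monoid" by (simp add: hom_def)
  have e1: "(fst ?D0 \<circ> fst ?S) z = z" "(fst ?D1 \<circ> fst ?S) z = z" if "z \<in> carrier (tensor_e A B0)" for z
    by (rule te.AB.e_hom_eqI[OF te.AB.E.is_group hom_compose[OF Sh(1) D0h(1)] id that]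
        te.AB.e_hom_eqI[OF te.AB.E.is_group hom_compose[OF Sh(1) D1h(1)] id that];
        simp add: D0_simps D1_simps S_simps)+
  have e2: "(snd ?D0 \<circ> snd ?S) z = z" "(snd ?D1 \<circ> snd ?S) z = z" if "z \<in> carrier (tensor_ee A B0)" for z
    by (rule te.AB.ee_hom_eqI[OF te.AB.EE.is_group hom_compose[OF Sh(2) D0h(2)] id that]
        te.AB.ee_hom_eqI[OF te.AB.EE.is_group hom_compose[OF Sh(2) D1h(2)] id that];
        simp add: D0_simps D1_simps S_simps)+
  interpret R: reflexive_pair "sg_tensor A B1" "sg_tensor A B0" ?D0 ?D1 ?S
    by (intro reflexive_pair.intro reflexive_pair_axioms.intro AB1.tensor_square_group
        te.AB.tensor_square_group D0 D1 S)
      (use e1 e2 in \<open>simp_all add: sg_eq_def sg_comp_def sg_id_def\<close>)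
  have U': "U' = R.Ke" and V': "V' = R.Kee" by (simp_all add: U'_def V'_def)
  have pd: "fst ?p (fst d0 x) = fst ?p (fst d1 x)" if "x \<in> carrier (SGe B1)" for x
  proof -
    have "fst d0 x \<otimes>\<^bsub>SGe B0\<^esub> inv\<^bsub>SGe B0\<^esub> fst d1 x = fst d0 (x \<otimes>\<^bsub>SGe B1\<^esub> inv\<^bsub>SGe B1\<^esub> fst s (fst d1 x))"
      using that by simp
    also have "\<dots> \<in> U" unfolding U_def using that by (intro r.KeI) simp_all
    finally show ?thesis
      using that r.Ke_normal by (simp add: sg_quot_proj_def Mod_coset_eq_iff U_def)
  qed
  have pd': "snd ?p (snd d0 x) = snd ?p (snd d1 x)" if "x \<in> carrier (SGee B1)" for x
  proof -
    have "snd d0 x \<otimes>\<^bsub>SGee B0\<^esub> inv\<^bsub>SGee B0\<^esub> snd d1 x = snd d0 (x \<otimes>\<^bsub>SGee B1\<^esub> inv\<^bsub>SGee B1\<^esub> snd s (snd d1 x))"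
      using that by simp
    also have "\<dots> \<in> V" unfolding V_def using that by (intro r.KeeI) simp_all
    finally show ?thesis
      using that r.Kee_normal by (simp add: sg_quot_proj_def Mod_coset_eq_iff V_def)
  qed
  have ker: "k \<in> U" if "k \<in> kernel (SGe B0) (SGe ?C) (fst ?p)" for k
  proof -
    have k: "k \<in> carrier (SGe B0)" and "U #>\<^bsub>SGe B0\<^esub> k = U"
      using that by (simp_all add: kernel_iff sg_quot_proj_def sg_quot_def)
    then show ?thesis using Mod_coset_one_iff[OF r.Ke_normal k] by (simp only: U_def)
  qed
  have ker': "k \<in> V" if "k \<in> kernel (SGee B0) (SGee ?C) (snd ?p)" for k
  proof -
    have k: "k \<in> carrier (SGee B0)" and "V #>\<^bsub>SGee B0\<^esub> k = V"
      using that by (simp_all add: kernel_iff sg_quot_proj_def sg_quot_def)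
    then show ?thesis using Mod_coset_one_iff[OF r.Kee_normal k] by (simp only: V_def)
  qed
  have k1: "circ A B0 x k \<in> U'" if x: "x \<in> carrier (SGe A)" and k: "k \<in> kernel (SGe B0) (SGe ?C) (fst ?p)" for x k
  proof -
    obtain l where l: "l \<in> carrier (SGe B1)" "k = fst d0 l" "fst d1 l = \<one>\<^bsub>SGe B0\<^esub>"
      using ker[OF k] unfolding U_def by (rule r.KeE)
    have "fst ?D0 (circ A B1 x l) \<in> U'"
      unfolding U' by (rule R.KeI) (use x l in \<open>simp_all add: D1_simps\<close>)
    then show ?thesis using x l by (simp add: D0_simps)
  qed
  have k2: "bar A B0 a k \<in> U'" if a: "a \<in> carrier (SGee A)" and k: "k \<in> kernel (SGee B0) (SGee ?C) (snd ?p)" for a k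
  proof -
    obtain l where l: "l \<in> carrier (SGee B1)" "k = snd d0 l" "snd d1 l = \<one>\<^bsub>SGee B0\<^esub>"
      using ker'[OF k] unfolding V_def by (rule r.KeeE)
    have "fst ?D0 (bar A B1 a l) \<in> U'"
      unfolding U' by (rule R.KeI) (use a l in \<open>simp_all add: D1_simps\<close>)
    then show ?thesis using a l by (simp add: D0_simps)
  qed
  have k3: "pure A B0 a k \<in> V'" if a: "a \<in> carrier (SGee A)" and k: "k \<in> kernel (SGee B0) (SGee ?C) (snd ?p)" for a k
  proof -
    obtain l where l: "l \<in> carrier (SGee B1)" "k = snd d0 l" "snd d1 l = \<one>\<^bsub>SGee B0\<^esub>"
      using ker'[OF k] unfolding V_def by (rule r.KeeE)
    have "snd ?D0 (pure A B1 a l) \<in> V'"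
      unfolding V' by (rule R.KeeI) (use a l in \<open>simp_all add: D1_simps\<close>)
    then show ?thesis using a l by (simp add: D0_simps)
  qed
  have Ueq: "U' = kernel (tensor_e A B0) (tensor_e A ?C) (fst te.A\<sigma>)"
  proof (intro equalityI subsetI)
    show "w \<in> U'" if w: "w \<in> kernel (tensor_e A B0) (tensor_e A ?C) (fst te.A\<sigma>)" for w
    proof (rule te.kernel_e[OF _ k1 k2 w])
      show "U' \<lhd> tensor_e A B0" using R.Ke_normal by (simp add: U')
    qed
    show "w \<in> kernel (tensor_e A B0) (tensor_e A ?C) (fst te.A\<sigma>)" if w: "w \<in> U'" for w
    proof -
      obtain k where k: "k \<in> carrier (tensor_e A B1)" "w = fst ?D0 k" "fst ?D1 k = \<one>\<^bsub>tensor_e A B0\<^esub>"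
        using w unfolding U' by (rule R.KeE) simp
      have "(fst te.A\<sigma> \<circ> fst ?D0) k = (fst te.A\<sigma> \<circ> fst ?D1) k"
        by (rule AB1.e_hom_eqI[OF te.AC.E.is_group hom_compose[OF D0h(1) te.map_homs(1)]
              hom_compose[OF D1h(1) te.map_homs(1)] k(1)])
          (simp_all add: D0_simps D1_simps te.map_simps pd pd')
      then show ?thesis
        using k hom_in_carrier[OF D0h(1) k(1)] hom_one[OF te.map_homs(1) te.AB.E.is_group te.AC.E.is_group]
        by (simp add: kernel_iff)
    qed
  qed
  have Veq: "V' = kernel (tensor_ee A B0) (tensor_ee A ?C) (snd te.A\<sigma>)"
  proof (intro equalityI subsetI)
    show "w \<in> V'" if w: "w \<in> kernel (tensor_ee A B0) (tensor_ee A ?C) (snd te.A\<sigma>)" for w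
    proof (rule te.kernel_ee[OF _ k3 w])
      show "subgroup V' (tensor_ee A B0)" using R.Kee_normal by (simp add: V' normal_imp_subgroup)
    qed
    show "w \<in> kernel (tensor_ee A B0) (tensor_ee A ?C) (snd te.A\<sigma>)" if w: "w \<in> V'" for w
    proof -
      obtain k where k: "k \<in> carrier (tensor_ee A B1)" "w = snd ?D0 k" "snd ?D1 k = \<one>\<^bsub>tensor_ee A B0\<^esub>"
        using w unfolding V' by (rule R.KeeE) simp
      have "(snd te.A\<sigma> \<circ> snd ?D0) k = (snd te.A\<sigma> \<circ> snd ?D1) k"
        by (rule AB1.ee_hom_eqI[OF te.AC.EE.is_group hom_compose[OF D0h(2) te.map_homs(2)]
              hom_compose[OF D1h(2) te.map_homs(2)] k(1)])
          (simp_all add: D0_simps D1_simps te.map_simps pd')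
      then show ?thesis
        using k hom_in_carrier[OF D0h(2) k(1)] hom_one[OF te.map_homs(2) te.AB.EE.is_group te.AC.EE.is_group]
        by (simp add: kernel_iff)
    qed
  qed
  from sg_epi_kernel_ideal[OF te.AB.tensor_square_group te.AC.tensor_square_group te.map_epi]
  show ?thesis unfolding Ueq Veq sg_tensor_simps .
qed

section \<open>Functoriality in the second variable\<close>

lemma sg_tensor_map_eqI:
  assumes sq: "square_group A" "square_group N" "square_group N'" and f: "f \<in> sg_hom N N'"
    and h: "h \<in> sg_hom (sg_tensor A N) (sg_tensor A N')"
    and c: "\<And>x y. x \<in> carrier (SGe A) \<Longrightarrow> y \<in> carrier (SGe N) \<Longrightarrow> fst h (circ A N x y) = circ A N' x (fst f y)"
    and b: "\<And>a b. a \<in> carrier (SGee A) \<Longrightarrow> b \<in> carrier (SGee N) \<Longrightarrow> fst h (bar A N a b) = bar A N' a (snd f b)"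
    and p: "\<And>a b. a \<in> carrier (SGee A) \<Longrightarrow> b \<in> carrier (SGee N) \<Longrightarrow> snd h (pure A N a b) = pure A N' a (snd f b)"
  shows "sg_eq (sg_tensor A N) (sg_tensor_map A N N' f) h"
proof -
  interpret S: square_tensor A N by (rule square_tensorI[OF sq(1,2)])
  interpret S': square_tensor A N' by (rule square_tensorI[OF sq(1,3)])
  note hh = sg_homD(1,2)[OF h, unfolded sg_tensor_simps]
  note fh = sg_homD(1,2)[OF sg_tensor_map_hom[OF sq f], unfolded sg_tensor_simps]
  note fs = sg_tensor_map_circ[OF sq f] sg_tensor_map_bar[OF sq f] sg_tensor_map_pure[OF sq f]
  have "fst (sg_tensor_map A N N' f) w = fst h w" if "w \<in> carrier (tensor_e A N)" for w
    by (rule S.e_hom_eqI[OF S'.E.is_group fh(1) hh(1) that]) (simp_all add: fs c b)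
  moreover have "snd (sg_tensor_map A N N' f) w = snd h w" if "w \<in> carrier (tensor_ee A N)" for w
    by (rule S.ee_hom_eqI[OF S'.EE.is_group fh(2) hh(2) that]) (simp_all add: fs p)
  ultimately show ?thesis by (simp add: sg_eq_def)
qed

lemma sg_tensor_map_comp:
  assumes sq: "square_group A" "square_group L" "square_group M" "square_group N"
    and f: "f \<in> sg_hom L M" and g: "g \<in> sg_hom M N"
  shows "sg_eq (sg_tensor A L) (sg_tensor_map A L N (sg_comp g f))
    (sg_comp (sg_tensor_map A M N g) (sg_tensor_map A L M f))"
proof (rule sg_tensor_map_eqI[OF sq(1,2,4) sg_hom_comp[OF f g]])
  show "sg_comp (sg_tensor_map A M N g) (sg_tensor_map A L M f) \<in> sg_hom (sg_tensor A L) (sg_tensor A N)"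
    by (rule sg_hom_comp[OF sg_tensor_map_hom[OF sq(1-3) f] sg_tensor_map_hom[OF sq(1,3,4) g]])
qed (simp_all add: sg_comp_def sg_tensor_map_circ[OF sq(1-3) f] sg_tensor_map_bar[OF sq(1-3) f]
    sg_tensor_map_pure[OF sq(1-3) f] sg_tensor_map_circ[OF sq(1,3,4) g] sg_tensor_map_bar[OF sq(1,3,4) g]
    sg_tensor_map_pure[OF sq(1,3,4) g] sg_homD(5,6)[OF f])

lemma sg_tensor_map_cong:
  assumes sq: "square_group A" "square_group N" "square_group N'"
    and f: "f \<in> sg_hom N N'" and g: "g \<in> sg_hom N N'" and "sg_eq N f g"
  shows "sg_eq (sg_tensor A N) (sg_tensor_map A N N' f) (sg_tensor_map A N N' g)"
  by (rule sg_tensor_map_eqI[OF sq f sg_tensor_map_hom[OF sq g]])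
    (use assms(6) in \<open>simp_all add: sg_eq_def sg_tensor_map_circ[OF sq g] sg_tensor_map_bar[OF sq g]
      sg_tensor_map_pure[OF sq g]\<close>)

lemma sg_tensor_map_id:
  assumes sq: "square_group A" "square_group N" and f: "f \<in> sg_hom N N" and "sg_eq N f sg_id"
  shows "sg_eq (sg_tensor A N) (sg_tensor_map A N N f) sg_id"
  by (rule sg_tensor_map_eqI[OF sq(1,2,2) f sg_hom_id])
    (use assms(4) in \<open>simp_all add: sg_eq_def sg_id_def\<close>)

lemma sg_tensor_map_one:
  assumes sq: "square_group A" "square_group N" "square_group N'" and f: "f \<in> sg_hom N N'"
    and f1: "\<And>y. y \<in> carrier (SGe N) \<Longrightarrow> fst f y = \<one>\<^bsub>SGe N'\<^esub>"
    and f2: "\<And>b. b \<in> carrier (SGee N) \<Longrightarrow> snd f b = \<one>\<^bsub>SGee N'\<^esub>"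
  shows "w \<in> carrier (tensor_e A N) \<Longrightarrow> fst (sg_tensor_map A N N' f) w = \<one>\<^bsub>tensor_e A N'\<^esub>"
    and "t \<in> carrier (tensor_ee A N) \<Longrightarrow> snd (sg_tensor_map A N N' f) t = \<one>\<^bsub>tensor_ee A N'\<^esub>"
proof -
  interpret S: square_tensor A N by (rule square_tensorI[OF sq(1,2)])
  interpret S': square_tensor A N' by (rule square_tensorI[OF sq(1,3)])
  note fh = sg_homD(1,2)[OF sg_tensor_map_hom[OF sq f], unfolded sg_tensor_simps]
  note fs = sg_tensor_map_circ[OF sq f] sg_tensor_map_bar[OF sq f] sg_tensor_map_pure[OF sq f]
  have tr: "(\<lambda>_. \<one>\<^bsub>tensor_e A N'\<^esub>) \<in> hom (tensor_e A N) (tensor_e A N')"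
    "(\<lambda>_. \<one>\<^bsub>tensor_ee A N'\<^esub>) \<in> hom (tensor_ee A N) (tensor_ee A N')" by (simp_all add: hom_def)
  show "fst (sg_tensor_map A N N' f) w = \<one>\<^bsub>tensor_e A N'\<^esub>" if "w \<in> carrier (tensor_e A N)"
    by (rule S.e_hom_eqI[OF S'.E.is_group fh(1) tr(1) that]) (simp_all add: fs f1 f2)
  show "snd (sg_tensor_map A N N' f) t = \<one>\<^bsub>tensor_ee A N'\<^esub>" if "t \<in> carrier (tensor_ee A N)"
    by (rule S.ee_hom_eqI[OF S'.EE.is_group fh(2) tr(2) that]) (simp_all add: fs f2)
qed

text \<open>A pointwise sum of homomorphisms into \<open>tensor_e\<close> is a homomorphism once
  their images commute. Orthogonality of f and g spreads from generators to all of
  \<open>tensor_e\<close>, and commutators are values of \<open>P\<close> on cross-effects.\<close>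

lemma sg_tensor_map_mult:
  assumes sq: "square_group A" "square_group N" "square_group N'"
    and f: "f \<in> sg_hom N N'" and g: "g \<in> sg_hom N N'" and h: "h \<in> sg_hom N N'"
    and he: "\<And>y. y \<in> carrier (SGe N) \<Longrightarrow> fst h y = fst f y \<otimes>\<^bsub>SGe N'\<^esub> fst g y"
    and hee: "\<And>b. b \<in> carrier (SGee N) \<Longrightarrow> snd h b = snd f b \<otimes>\<^bsub>SGee N'\<^esub> snd g b"
    and orth: "\<And>y y'. y \<in> carrier (SGe N) \<Longrightarrow> y' \<in> carrier (SGe N) \<Longrightarrow>
      sg_cross N' (fst f y) (fst g y') = \<one>\<^bsub>SGee N'\<^esub>"
  shows "w \<in> carrier (tensor_e A N) \<Longrightarrow> fst (sg_tensor_map A N N' h) w =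
      fst (sg_tensor_map A N N' f) w \<otimes>\<^bsub>tensor_e A N'\<^esub> fst (sg_tensor_map A N N' g) w"
    and "t \<in> carrier (tensor_ee A N) \<Longrightarrow> snd (sg_tensor_map A N N' h) t =
      snd (sg_tensor_map A N N' f) t \<otimes>\<^bsub>tensor_ee A N'\<^esub> snd (sg_tensor_map A N N' g) t"
proof -
  interpret S: square_tensor A N by (rule square_tensorI[OF sq(1,2)])
  interpret S': square_tensor A N' by (rule square_tensorI[OF sq(1,3)])
  let ?F = "sg_tensor_map A N N' f" and ?G = "sg_tensor_map A N N' g" and ?H = "sg_tensor_map A N N' h"
  note Fh = sg_homD(1,2)[OF sg_tensor_map_hom[OF sq f], unfolded sg_tensor_simps]
    and Gh = sg_homD(1,2)[OF sg_tensor_map_hom[OF sq g], unfolded sg_tensor_simps]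
    and Hh = sg_homD(1,2)[OF sg_tensor_map_hom[OF sq h], unfolded sg_tensor_simps]
  note simps = sg_tensor_map_circ[OF sq f] sg_tensor_map_bar[OF sq f] sg_tensor_map_pure[OF sq f]
    sg_tensor_map_circ[OF sq g] sg_tensor_map_bar[OF sq g] sg_tensor_map_pure[OF sq g]
    sg_tensor_map_circ[OF sq h] sg_tensor_map_bar[OF sq h] sg_tensor_map_pure[OF sq h]
  note cl [simp] = sg_homD(5,6)[OF f] sg_homD(5,6)[OF g]
  note clF [simp] = hom_in_carrier[OF Fh(1)] hom_in_carrier[OF Gh(1)]
  let ?c = "cross_effect (tensor_e A N') (tensor_ee A N') (tensor_H A N')"
  have c1: "?c (fst ?F s) (fst ?G t) = \<one>\<^bsub>tensor_ee A N'\<^esub>" if "s \<in> S.gen_set" "t \<in> S.gen_set" for s t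
  proof -
    have c: "s \<in> carrier (tensor_e A N)" "t \<in> carrier (tensor_e A N)" using that S.gen_set_sub by blast+
    show ?thesis using that
      by (cases rule: S.gen_set_pair_cases)
        (use c in \<open>simp_all add: simps S'.tensor_H_cross_bar S'.tensor_H_cross_circ orth\<close>)
  qed
  have tr: "(\<lambda>_. \<one>\<^bsub>tensor_ee A N'\<^esub>) \<in> hom (tensor_e A N) (tensor_ee A N')" by (simp add: hom_def)
  have c2: "?c (fst ?F s) (fst ?G t) = \<one>\<^bsub>tensor_ee A N'\<^esub>" if s: "s \<in> S.gen_set" and t: "t \<in> carrier (tensor_e A N)" for s t
  proof -
    have m: "fst ?F s \<in> carrier (tensor_e A N')" using s S.gen_set_sub by (auto intro: clF)
    have "(?c (fst ?F s) \<circ> fst ?G) t = \<one>\<^bsub>tensor_ee A N'\<^esub>"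
    proof (rule hom_eq_on_generate[OF S.E.is_group S'.EE.is_group hom_compose[OF Gh(1) S'.H.cr.hom_right[OF m]] tr S.gen_set_sub])
      show "t \<in> generate (tensor_e A N) S.gen_set" using t by (simp only: S.carrier_generate)
    qed (simp add: c1[OF s])
    then show ?thesis by simp
  qed
  have c3: "?c (fst ?F s) (fst ?G t) = \<one>\<^bsub>tensor_ee A N'\<^esub>"
    if s: "s \<in> carrier (tensor_e A N)" and t: "t \<in> carrier (tensor_e A N)" for s t
  proof -
    have m: "fst ?G t \<in> carrier (tensor_e A N')" using t by simp
    have "((\<lambda>z. ?c z (fst ?G t)) \<circ> fst ?F) s = \<one>\<^bsub>tensor_ee A N'\<^esub>"
    proof (rule hom_eq_on_generate[OF S.E.is_group S'.EE.is_group hom_compose[OF Fh(1) S'.H.cr.hom_left[OF m]] tr S.gen_set_sub])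
      show "s \<in> generate (tensor_e A N) S.gen_set" using s by (simp only: S.carrier_generate)
    qed (simp add: c2 t)
    then show ?thesis by simp
  qed
  \<comment> \<open>By \<open>c3\<close> the commutator is \<open>P\<close> of zero.\<close>
  have com: "fst ?F s \<otimes>\<^bsub>tensor_e A N'\<^esub> fst ?G t = fst ?G t \<otimes>\<^bsub>tensor_e A N'\<^esub> fst ?F s"
    if "s \<in> carrier (tensor_e A N)" "t \<in> carrier (tensor_e A N)" for s t
    using S'.tensor_commutator[of "fst ?F s" "fst ?G t"] that by (simp only: c3 clF S'.P.hom_one S'.E.r_one S'.E.m_closed)
  have FG: "(\<lambda>w. fst ?F w \<otimes>\<^bsub>tensor_e A N'\<^esub> fst ?G w) \<in> hom (tensor_e A N) (tensor_e A N')"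
  proof (rule homI)
    fix s t assume st: "s \<in> carrier (tensor_e A N)" "t \<in> carrier (tensor_e A N)"
    have "fst ?F (s \<otimes>\<^bsub>tensor_e A N\<^esub> t) \<otimes>\<^bsub>tensor_e A N'\<^esub> fst ?G (s \<otimes>\<^bsub>tensor_e A N\<^esub> t) =
      fst ?F s \<otimes>\<^bsub>tensor_e A N'\<^esub> (fst ?F t \<otimes>\<^bsub>tensor_e A N'\<^esub> fst ?G s) \<otimes>\<^bsub>tensor_e A N'\<^esub> fst ?G t"
      using st by (simp add: hom_mult[OF Fh(1)] hom_mult[OF Gh(1)] S'.E.m_assoc)
    also have "\<dots> = fst ?F s \<otimes>\<^bsub>tensor_e A N'\<^esub> fst ?G s \<otimes>\<^bsub>tensor_e A N'\<^esub> (fst ?F t \<otimes>\<^bsub>tensor_e A N'\<^esub> fst ?G t)"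
      unfolding com[OF st(2,1)] using st by (simp add: S'.E.m_assoc)
    finally show "fst ?F (s \<otimes>\<^bsub>tensor_e A N\<^esub> t) \<otimes>\<^bsub>tensor_e A N'\<^esub> fst ?G (s \<otimes>\<^bsub>tensor_e A N\<^esub> t) =
      fst ?F s \<otimes>\<^bsub>tensor_e A N'\<^esub> fst ?G s \<otimes>\<^bsub>tensor_e A N'\<^esub> (fst ?F t \<otimes>\<^bsub>tensor_e A N'\<^esub> fst ?G t)" .
  qed simp
  show "fst ?H w = fst ?F w \<otimes>\<^bsub>tensor_e A N'\<^esub> fst ?G w" if "w \<in> carrier (tensor_e A N)"
    by (rule S.e_hom_eqI[OF S'.E.is_group Hh(1) FG that]) (simp_all add: simps he hee S'.bar_mult)
  show "snd ?H t = snd ?F t \<otimes>\<^bsub>tensor_ee A N'\<^esub> snd ?G t" if "t \<in> carrier (tensor_ee A N)"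
    by (rule S.ee_hom_eqI[OF S'.EE.is_group Hh(2) S'.EE.hom_group_mult[OF Fh(2) Gh(2)] that])
      (simp_all add: simps hee)
qed

section \<open>Finite products\<close>

lemma sg_product_simps [simp]:
  "carrier (SGe (sg_product I D)) = (\<Pi>\<^sub>E i\<in>I. carrier (SGe (D i)))"
  "carrier (SGee (sg_product I D)) = (\<Pi>\<^sub>E i\<in>I. carrier (SGee (D i)))"
  "x \<otimes>\<^bsub>SGe (sg_product I D)\<^esub> y = (\<lambda>i\<in>I. x i \<otimes>\<^bsub>SGe (D i)\<^esub> y i)"
  "a \<otimes>\<^bsub>SGee (sg_product I D)\<^esub> b = (\<lambda>i\<in>I. a i \<otimes>\<^bsub>SGee (D i)\<^esub> b i)"
  "\<one>\<^bsub>SGe (sg_product I D)\<^esub> = (\<lambda>i\<in>I. \<one>\<^bsub>SGe (D i)\<^esub>)"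
  "\<one>\<^bsub>SGee (sg_product I D)\<^esub> = (\<lambda>i\<in>I. \<one>\<^bsub>SGee (D i)\<^esub>)"
  "SGH (sg_product I D) x = (\<lambda>i\<in>I. SGH (D i) (x i))"
  "SGP (sg_product I D) a = (\<lambda>i\<in>I. SGP (D i) (a i))"
  by (simp_all add: sg_product_def)

locale sg_family =
  fixes I :: "'k set" and D :: "'k \<Rightarrow> ('a, 'b) square"
  assumes square: "i \<in> I \<Longrightarrow> square_group (D i)"
begin

abbreviation "Pr \<equiv> sg_product I D"

lemma facts:
  assumes "i \<in> I"
  shows "group (SGe (D i))" "comm_group (SGee (D i))" "group (SGee (D i))"
    "quadratic (SGe (D i)) (SGee (D i)) (SGH (D i))"
    "group_hom (SGee (D i)) (SGe (D i)) (SGP (D i))"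
    "biadditive_map (SGe (D i)) (SGe (D i)) (SGee (D i)) (sg_cross (D i))"
proof -
  interpret square_group "D i" by (rule square[OF assms])
  show "group (SGe (D i))" "comm_group (SGee (D i))" "group (SGee (D i))"
    "quadratic (SGe (D i)) (SGee (D i)) (SGH (D i))"
    "group_hom (SGee (D i)) (SGe (D i)) (SGP (D i))"
    "biadditive_map (SGe (D i)) (SGe (D i)) (SGee (D i)) (sg_cross (D i))"
    by (rule e.is_group ee.comm_group_axioms ee.is_group H.quadratic_axioms P.group_hom_axioms
        H.cr.biadditive_map_axioms)+
qed

lemma group_e: "group (SGe Pr)"
  using facts(1) by (simp add: sg_product_def)

lemma comm_group_ee: "comm_group (SGee Pr)"
proof (rule group.group_comm_groupI)
  show "group (SGee Pr)" using facts(3) by (simp add: sg_product_def)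
  show "a \<otimes>\<^bsub>SGee Pr\<^esub> b = b \<otimes>\<^bsub>SGee Pr\<^esub> a" if "a \<in> carrier (SGee Pr)" "b \<in> carrier (SGee Pr)" for a b
    using that by (auto intro!: restrict_ext simp: PiE_iff comm_monoid.m_comm[OF comm_group.axioms(1)[OF facts(2)]])
qed

lemma inv_e: "x \<in> carrier (SGe Pr) \<Longrightarrow> inv\<^bsub>SGe Pr\<^esub> x = (\<lambda>i\<in>I. inv\<^bsub>SGe (D i)\<^esub> x i)"
  using facts(1) by (simp add: sg_product_def)

lemma H_mem: "x \<in> carrier (SGe Pr) \<Longrightarrow> SGH Pr x \<in> carrier (SGee Pr)"
  by (auto simp: PiE_iff intro: quadratic.f_closed[OF facts(4)])

lemma cross_closed: "x \<in> carrier (SGe Pr) \<Longrightarrow> y \<in> carrier (SGe Pr) \<Longrightarrow>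
    (\<lambda>i\<in>I. sg_cross (D i) (x i) (y i)) \<in> carrier (SGee Pr)"
  by (auto simp: PiE_iff intro: biadditive_map.closed[OF facts(6)])

lemma cross_biadditive: "biadditive (SGe Pr) (SGe Pr) (SGee Pr) (\<lambda>x y. \<lambda>i\<in>I. sg_cross (D i) (x i) (y i))"
proof (rule biadditiveI)
  show "(\<lambda>i\<in>I. sg_cross (D i) (x i) (y i)) \<in> carrier (SGee Pr)"
    if "x \<in> carrier (SGe Pr)" "y \<in> carrier (SGe Pr)" for x y
    using cross_closed[OF that] .
qed (auto intro!: restrict_ext simp: PiE_iff biadditive_map.mult_left[OF facts(6)] biadditive_map.mult_right[OF facts(6)])

lemma H_mult:
  assumes "x \<in> carrier (SGe Pr)" "y \<in> carrier (SGe Pr)"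
  shows "SGH Pr (x \<otimes>\<^bsub>SGe Pr\<^esub> y) = SGH Pr x \<otimes>\<^bsub>SGee Pr\<^esub> SGH Pr y \<otimes>\<^bsub>SGee Pr\<^esub> (\<lambda>i\<in>I. sg_cross (D i) (x i) (y i))"
  using assms by (auto intro!: restrict_ext simp: PiE_iff quadratic.f_mult[OF facts(4)])

lemma H_Pi: "SGH Pr \<in> carrier (SGe Pr) \<rightarrow> carrier (SGee Pr)"
  using H_mem by blast

lemma H_quadratic: "quadratic_map (SGe Pr) (SGee Pr) (SGH Pr)"
  by (rule quadratic_mapI(1)[OF group_e comm_group_ee H_Pi cross_biadditive]) (rule H_mult)

lemma cross_eq:
  assumes "x \<in> carrier (SGe Pr)" "y \<in> carrier (SGe Pr)"
  shows "sg_cross Pr x y = (\<lambda>i\<in>I. sg_cross (D i) (x i) (y i))"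
  by (rule quadratic_mapI(2)[OF group_e comm_group_ee H_Pi cross_biadditive]) (rule H_mult assms; assumption?)+

lemma square_group_product: "square_group Pr"
proof (rule square_group.intro)
  have P_mem: "SGP Pr a \<in> carrier (SGe Pr)" if "a \<in> carrier (SGee Pr)" for a
    using that by (auto simp: PiE_iff intro: group_hom.hom_closed[OF facts(5)])
  show "SGP Pr \<in> hom (SGee Pr) (SGe Pr)"
  proof (rule homI)
    show "SGP Pr (a \<otimes>\<^bsub>SGee Pr\<^esub> b) = SGP Pr a \<otimes>\<^bsub>SGe Pr\<^esub> SGP Pr b"
      if "a \<in> carrier (SGee Pr)" "b \<in> carrier (SGee Pr)" for a b
      using that by (auto intro!: restrict_ext simp: PiE_iff group_hom.hom_mult[OF facts(5)])
  qed (rule P_mem)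
  show "sg_cross Pr (SGP Pr a) y = \<one>\<^bsub>SGee Pr\<^esub>" if "a \<in> carrier (SGee Pr)" "y \<in> carrier (SGe Pr)" for a y
    unfolding cross_eq[OF P_mem[OF that(1)] that(2)]
    using that by (auto intro!: restrict_ext simp: PiE_iff square_group.cross_P[OF square])
  show "sg_cross Pr y (SGP Pr a) = \<one>\<^bsub>SGee Pr\<^esub>" if "y \<in> carrier (SGe Pr)" "a \<in> carrier (SGee Pr)" for a y
    unfolding cross_eq[OF that(1) P_mem[OF that(2)]]
    using that by (auto intro!: restrict_ext simp: PiE_iff square_group.cross_P[OF square])
  show "SGP Pr (sg_cross Pr x y) = inv\<^bsub>SGe Pr\<^esub> x \<otimes>\<^bsub>SGe Pr\<^esub> inv\<^bsub>SGe Pr\<^esub> y \<otimes>\<^bsub>SGe Pr\<^esub> x \<otimes>\<^bsub>SGe Pr\<^esub> y"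
    if "x \<in> carrier (SGe Pr)" "y \<in> carrier (SGe Pr)" for x y
    unfolding cross_eq[OF that] inv_e[OF that(1)] inv_e[OF that(2)]
    using that by (auto intro!: restrict_ext simp: PiE_iff square_group.P_cross[OF square])
  show "SGP Pr (SGH Pr (SGP Pr a)) = SGP Pr a \<otimes>\<^bsub>SGe Pr\<^esub> SGP Pr a" if "a \<in> carrier (SGee Pr)" for a
    using that by (auto intro!: restrict_ext simp: PiE_iff square_group.PHP[OF square])
qed (rule group_e comm_group_ee H_quadratic)+

lemma proj_hom: "i \<in> I \<Longrightarrow> sg_proj i \<in> sg_hom Pr (D i)"
  by (auto simp: sg_hom_def sg_proj_def hom_def PiE_iff)

lemma pair_hom:
  assumes "\<And>i. i \<in> I \<Longrightarrow> f i \<in> sg_hom M (D i)"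
  shows "sg_pair I f \<in> sg_hom M Pr"
  using assms by (auto simp: sg_hom_def sg_pair_def hom_def Pi_iff intro!: restrict_ext)

definition part :: "'k set \<Rightarrow> ('k \<Rightarrow> 'a, 'k \<Rightarrow> 'b, 'k \<Rightarrow> 'a, 'k \<Rightarrow> 'b) sg_map" where
  "part J = (\<lambda>x. \<lambda>i\<in>I. if i \<in> J then x i else \<one>\<^bsub>SGe (D i)\<^esub>, \<lambda>a. \<lambda>i\<in>I. if i \<in> J then a i else \<one>\<^bsub>SGee (D i)\<^esub>)"

definition incl :: "'k \<Rightarrow> ('a, 'b, 'k \<Rightarrow> 'a, 'k \<Rightarrow> 'b) sg_map" where
  "incl j = (\<lambda>x. \<lambda>i\<in>I. if i = j then x else \<one>\<^bsub>SGe (D i)\<^esub>, \<lambda>a. \<lambda>i\<in>I. if i = j then a else \<one>\<^bsub>SGee (D i)\<^esub>)"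

lemma one_facts:
  assumes "i \<in> I"
  shows "\<one>\<^bsub>SGe (D i)\<^esub> \<in> carrier (SGe (D i))" "\<one>\<^bsub>SGee (D i)\<^esub> \<in> carrier (SGee (D i))"
    "SGH (D i) \<one>\<^bsub>SGe (D i)\<^esub> = \<one>\<^bsub>SGee (D i)\<^esub>" "SGP (D i) \<one>\<^bsub>SGee (D i)\<^esub> = \<one>\<^bsub>SGe (D i)\<^esub>"
    "x \<in> carrier (SGe (D i)) \<Longrightarrow> x \<otimes>\<^bsub>SGe (D i)\<^esub> \<one>\<^bsub>SGe (D i)\<^esub> = x"
    "x \<in> carrier (SGe (D i)) \<Longrightarrow> \<one>\<^bsub>SGe (D i)\<^esub> \<otimes>\<^bsub>SGe (D i)\<^esub> x = x"
    "a \<in> carrier (SGee (D i)) \<Longrightarrow> a \<otimes>\<^bsub>SGee (D i)\<^esub> \<one>\<^bsub>SGee (D i)\<^esub> = a"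
    "a \<in> carrier (SGee (D i)) \<Longrightarrow> \<one>\<^bsub>SGee (D i)\<^esub> \<otimes>\<^bsub>SGee (D i)\<^esub> a = a"
    "x \<in> carrier (SGe (D i)) \<Longrightarrow> sg_cross (D i) x \<one>\<^bsub>SGe (D i)\<^esub> = \<one>\<^bsub>SGee (D i)\<^esub>"
    "x \<in> carrier (SGe (D i)) \<Longrightarrow> sg_cross (D i) \<one>\<^bsub>SGe (D i)\<^esub> x = \<one>\<^bsub>SGee (D i)\<^esub>"
proof -
  interpret square_group "D i" by (rule square[OF assms])
  show "\<one>\<^bsub>SGe (D i)\<^esub> \<in> carrier (SGe (D i))" "\<one>\<^bsub>SGee (D i)\<^esub> \<in> carrier (SGee (D i))"
    "SGH (D i) \<one>\<^bsub>SGe (D i)\<^esub> = \<one>\<^bsub>SGee (D i)\<^esub>" "SGP (D i) \<one>\<^bsub>SGee (D i)\<^esub> = \<one>\<^bsub>SGe (D i)\<^esub>"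
    "x \<in> carrier (SGe (D i)) \<Longrightarrow> x \<otimes>\<^bsub>SGe (D i)\<^esub> \<one>\<^bsub>SGe (D i)\<^esub> = x"
    "x \<in> carrier (SGe (D i)) \<Longrightarrow> \<one>\<^bsub>SGe (D i)\<^esub> \<otimes>\<^bsub>SGe (D i)\<^esub> x = x"
    "a \<in> carrier (SGee (D i)) \<Longrightarrow> a \<otimes>\<^bsub>SGee (D i)\<^esub> \<one>\<^bsub>SGee (D i)\<^esub> = a"
    "a \<in> carrier (SGee (D i)) \<Longrightarrow> \<one>\<^bsub>SGee (D i)\<^esub> \<otimes>\<^bsub>SGee (D i)\<^esub> a = a"
    "x \<in> carrier (SGe (D i)) \<Longrightarrow> sg_cross (D i) x \<one>\<^bsub>SGe (D i)\<^esub> = \<one>\<^bsub>SGee (D i)\<^esub>"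
    "x \<in> carrier (SGe (D i)) \<Longrightarrow> sg_cross (D i) \<one>\<^bsub>SGe (D i)\<^esub> x = \<one>\<^bsub>SGee (D i)\<^esub>"
    by simp_all
qed

lemma part_hom: "part J \<in> sg_hom Pr Pr"
  by (auto simp: sg_hom_def part_def hom_def PiE_iff one_facts intro!: restrict_ext)

lemma incl_hom: "j \<in> I \<Longrightarrow> incl j \<in> sg_hom (D j) Pr"
  by (auto simp: sg_hom_def incl_def hom_def PiE_iff one_facts intro!: restrict_ext)

lemma tensor_product_map:
  assumes A: "square_group A"
  shows "sg_pair I (\<lambda>i. sg_tensor_map A Pr (D i) (sg_proj i)) \<in> sg_hom (sg_tensor A Pr) (sg_product I (\<lambda>i. sg_tensor A (D i)))"
proof -
  interpret T: sg_family I "\<lambda>i. sg_tensor A (D i)"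
    by (rule sg_family.intro) (intro square_tensor.tensor_square_group square_tensorI A square)
  show ?thesis
    by (rule T.pair_hom) (intro sg_tensor_map_hom A square_group_product square proj_hom)
qed

context
  fixes A :: "('c, 'd) square"
  assumes A: "square_group A"
begin

abbreviation "prj i \<equiv> sg_tensor_map A Pr (D i) (sg_proj i)"
abbreviation "inc i \<equiv> sg_tensor_map A (D i) Pr (incl i)"
abbreviation "prt J \<equiv> sg_tensor_map A Pr Pr (part J)"

lemma map_homs:
  "i \<in> I \<Longrightarrow> prj i \<in> sg_hom (sg_tensor A Pr) (sg_tensor A (D i))"
  "i \<in> I \<Longrightarrow> inc i \<in> sg_hom (sg_tensor A (D i)) (sg_tensor A Pr)"
  "prt J \<in> sg_hom (sg_tensor A Pr) (sg_tensor A Pr)"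
  by (intro sg_tensor_map_hom A square_group_product square proj_hom incl_hom part_hom; assumption)+

text \<open>\<open>part (insert j J)\<close> is the sum of \<open>part J\<close> and the idempotent
  of the factor j. The two live in disjoint coordinates, hence have trivial cross-effect, and
  \<open>sg_tensor_map_mult\<close> applies.\<close>

lemma part_insert:
  assumes "j \<in> I" "j \<notin> J"
  shows "w \<in> carrier (tensor_e A Pr) \<Longrightarrow> fst (prt (insert j J)) w =
      fst (prt J) w \<otimes>\<^bsub>tensor_e A Pr\<^esub> fst (inc j) (fst (prj j) w)"
    and "t \<in> carrier (tensor_ee A Pr) \<Longrightarrow> snd (prt (insert j J)) t =
      snd (prt J) t \<otimes>\<^bsub>tensor_ee A Pr\<^esub> snd (inc j) (snd (prj j) t)"
proof -
  have ip: "sg_comp (incl j) (sg_proj j) \<in> sg_hom Pr Pr"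
    by (rule sg_hom_comp[OF proj_hom[OF assms(1)] incl_hom[OF assms(1)]])
  have comp: "sg_eq (sg_tensor A Pr) (sg_tensor_map A Pr Pr (sg_comp (incl j) (sg_proj j))) (sg_comp (inc j) (prj j))"
    by (rule sg_tensor_map_comp[OF A square_group_product square[OF assms(1)] square_group_product
          proj_hom[OF assms(1)] incl_hom[OF assms(1)]])
  have 1: "fst (part (insert j J)) y = fst (part J) y \<otimes>\<^bsub>SGe Pr\<^esub> fst (sg_comp (incl j) (sg_proj j)) y"
    if "y \<in> carrier (SGe Pr)" for y
    using that assms by (auto simp: part_def incl_def sg_comp_def sg_proj_def PiE_iff one_facts intro!: restrict_ext)
  have 2: "snd (part (insert j J)) y = snd (part J) y \<otimes>\<^bsub>SGee Pr\<^esub> snd (sg_comp (incl j) (sg_proj j)) y"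
    if "y \<in> carrier (SGee Pr)" for y
    using that assms by (auto simp: part_def incl_def sg_comp_def sg_proj_def PiE_iff one_facts intro!: restrict_ext)
  have 3: "sg_cross Pr (fst (part J) y) (fst (sg_comp (incl j) (sg_proj j)) y') = \<one>\<^bsub>SGee Pr\<^esub>"
    if "y \<in> carrier (SGe Pr)" "y' \<in> carrier (SGe Pr)" for y y'
    unfolding cross_eq[OF sg_homD(5)[OF part_hom that(1)] sg_homD(5)[OF ip that(2)]]
    using that assms by (auto simp: part_def incl_def sg_comp_def sg_proj_def PiE_iff one_facts intro!: restrict_ext)
  note m = sg_tensor_map_mult[OF A square_group_product square_group_product part_hom ip part_hom 1 2 3]
  show "fst (prt (insert j J)) w = fst (prt J) w \<otimes>\<^bsub>tensor_e A Pr\<^esub> fst (inc j) (fst (prj j) w)"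
    if "w \<in> carrier (tensor_e A Pr)"
    using m(1) comp that by (simp add: sg_eq_def sg_comp_def)
  show "snd (prt (insert j J)) t = snd (prt J) t \<otimes>\<^bsub>tensor_ee A Pr\<^esub> snd (inc j) (snd (prj j) t)"
    if "t \<in> carrier (tensor_ee A Pr)"
    using m(2) comp that by (simp add: sg_eq_def sg_comp_def)
qed

lemma prt_empty:
  "w \<in> carrier (tensor_e A Pr) \<Longrightarrow> fst (prt {}) w = \<one>\<^bsub>tensor_e A Pr\<^esub>"
  "t \<in> carrier (tensor_ee A Pr) \<Longrightarrow> snd (prt {}) t = \<one>\<^bsub>tensor_ee A Pr\<^esub>"
  by (rule sg_tensor_map_one[OF A square_group_product square_group_product part_hom];
      simp add: part_def)+

lemma prt_all:
  "w \<in> carrier (tensor_e A Pr) \<Longrightarrow> fst (prt I) w = w"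
  "t \<in> carrier (tensor_ee A Pr) \<Longrightarrow> snd (prt I) t = t"
proof -
  have "sg_eq Pr (part I) sg_id"
    by (auto simp: sg_eq_def part_def sg_id_def PiE_iff intro!: extensionalityI[of _ I])
  from sg_tensor_map_id[OF A square_group_product part_hom this]
  show "w \<in> carrier (tensor_e A Pr) \<Longrightarrow> fst (prt I) w = w"
    "t \<in> carrier (tensor_ee A Pr) \<Longrightarrow> snd (prt I) t = t"
    by (simp_all add: sg_eq_def sg_id_def)
qed

lemma prj_inc:
  assumes "i \<in> I" "j \<in> I"
  shows "w \<in> carrier (tensor_e A (D j)) \<Longrightarrow> fst (prj i) (fst (inc j) w) = (if i = j then w else \<one>\<^bsub>tensor_e A (D i)\<^esub>)"
    and "t \<in> carrier (tensor_ee A (D j)) \<Longrightarrow> snd (prj i) (snd (inc j) t) = (if i = j then t else \<one>\<^bsub>tensor_ee A (D i)\<^esub>)"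
proof -
  note h = incl_hom[OF assms(2)] proj_hom[OF assms(1)]
  note comp = sg_tensor_map_comp[OF A square[OF assms(2)] square_group_product square[OF assms(1)] h]
  have *: "(w \<in> carrier (tensor_e A (D j)) \<longrightarrow> fst (prj i) (fst (inc j) w) = (if i = j then w else \<one>\<^bsub>tensor_e A (D i)\<^esub>)) \<and>
    (t \<in> carrier (tensor_ee A (D j)) \<longrightarrow> snd (prj i) (snd (inc j) t) = (if i = j then t else \<one>\<^bsub>tensor_ee A (D i)\<^esub>))" for w t
  proof (cases "i = j")
    case True
    have "sg_eq (D j) (sg_comp (sg_proj i) (incl j)) sg_id"
      using assms True by (simp add: sg_eq_def sg_comp_def incl_def sg_proj_def sg_id_def)
    from sg_tensor_map_id[OF A square[OF assms(2)] _ this] sg_hom_comp[OF h] True comp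
    show ?thesis by (simp add: sg_eq_def sg_comp_def sg_id_def)
  next
    case False
    have "fst (sg_comp (sg_proj i) (incl j)) y = \<one>\<^bsub>SGe (D i)\<^esub>" "snd (sg_comp (sg_proj i) (incl j)) a = \<one>\<^bsub>SGee (D i)\<^esub>" for y a
      using assms False by (simp_all add: sg_comp_def incl_def sg_proj_def)
    from sg_tensor_map_one[OF A square[OF assms(2)] square[OF assms(1)] sg_hom_comp[OF h] this] False comp
    show ?thesis by (simp add: sg_eq_def sg_comp_def)
  qed
  show "w \<in> carrier (tensor_e A (D j)) \<Longrightarrow> fst (prj i) (fst (inc j) w) = (if i = j then w else \<one>\<^bsub>tensor_e A (D i)\<^esub>)"
    "t \<in> carrier (tensor_ee A (D j)) \<Longrightarrow> snd (prj i) (snd (inc j) t) = (if i = j then t else \<one>\<^bsub>tensor_ee A (D i)\<^esub>)"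
    using * by blast+
qed

text \<open>If all projections of w vanish, then \<open>prt J w\<close> stays trivial while the
  factors are added one by one, and for the full index set it is w. For surjectivity the elements
  \<open>inc j (z j)\<close> are multiplied up; by \<open>prj_inc\<close> each affects only its own
  coordinate.\<close>

lemma tensor_product_iso:
  assumes fin: "finite I"
  shows "sg_pair I prj \<in> sg_iso (sg_tensor A Pr) (sg_product I (\<lambda>i. sg_tensor A (D i)))"
proof -
  interpret S: square_tensor A Pr by (rule square_tensorI[OF A square_group_product])
  interpret T: sg_family I "\<lambda>i. sg_tensor A (D i)"
    by (rule sg_family.intro) (intro square_tensor.tensor_square_group square_tensorI A square)
  let ?f = "sg_pair I prj"
  have hom: "?f \<in> sg_hom (sg_tensor A Pr) T.Pr" by (rule tensor_product_map[OF A])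
  interpret f: square_group_hom "sg_tensor A Pr" T.Pr ?f
    by (rule square_group_homI[OF S.tensor_square_group T.square_group_product hom])
  note prj_h = sg_homD(1,2)[OF map_homs(1), unfolded sg_tensor_simps]
  note inc_h = sg_homD(1,2)[OF map_homs(2), unfolded sg_tensor_simps]
  have gD: "group (tensor_e A (D i))" "group (tensor_ee A (D i))" if "i \<in> I" for i
    using T.facts(1,3)[OF that] by simp_all
  have inj_e: "fst (prt J) w = \<one>\<^bsub>tensor_e A Pr\<^esub>"
    if w: "w \<in> carrier (tensor_e A Pr)" and p: "\<And>i. i \<in> I \<Longrightarrow> fst (prj i) w = \<one>\<^bsub>tensor_e A (D i)\<^esub>" and J: "finite J" "J \<subseteq> I" for w J
    using J
  proof (induction J rule: finite_induct)
    case empty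
    then show ?case using prt_empty(1)[OF w] by simp
  next
    case (insert j J)
    then show ?case
      using part_insert(1)[of j J w] w p[of j] hom_one[OF inc_h(1) gD(1) S.E.is_group, of j] by simp
  qed
  have inj_ee: "snd (prt J) w = \<one>\<^bsub>tensor_ee A Pr\<^esub>"
    if w: "w \<in> carrier (tensor_ee A Pr)" and p: "\<And>i. i \<in> I \<Longrightarrow> snd (prj i) w = \<one>\<^bsub>tensor_ee A (D i)\<^esub>" and J: "finite J" "J \<subseteq> I" for w J
    using J
  proof (induction J rule: finite_induct)
    case empty
    then show ?case using prt_empty(2)[OF w] by simp
  next
    case (insert j J)
    then show ?case
      using part_insert(2)[of j J w] w p[of j] hom_one[OF inc_h(2) gD(2) S.EE.is_group, of j] by simp
  qed
  have "inj_on (fst ?f) (carrier (tensor_e A Pr))"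
    unfolding f.e.inj_on_one_iff[unfolded sg_tensor_simps]
  proof (intro allI impI)
    fix w assume w: "w \<in> carrier (tensor_e A Pr)" and eq: "fst ?f w = \<one>\<^bsub>SGe T.Pr\<^esub>"
    have "fst (prj i) w = \<one>\<^bsub>tensor_e A (D i)\<^esub>" if "i \<in> I" for i
      using fun_cong[OF eq, of i] that by (simp add: sg_pair_def)
    from inj_e[OF w this fin subset_refl] show "w = \<one>\<^bsub>tensor_e A Pr\<^esub>" using prt_all(1)[OF w] by simp
  qed
  moreover have "inj_on (snd ?f) (carrier (tensor_ee A Pr))"
    unfolding f.ee.inj_on_one_iff[unfolded sg_tensor_simps]
  proof (intro allI impI)
    fix w assume w: "w \<in> carrier (tensor_ee A Pr)" and eq: "snd ?f w = \<one>\<^bsub>SGee T.Pr\<^esub>"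
    have "snd (prj i) w = \<one>\<^bsub>tensor_ee A (D i)\<^esub>" if "i \<in> I" for i
      using fun_cong[OF eq, of i] that by (simp add: sg_pair_def)
    from inj_ee[OF w this fin subset_refl] show "w = \<one>\<^bsub>tensor_ee A Pr\<^esub>" using prt_all(2)[OF w] by simp
  qed
  moreover have "carrier (SGe T.Pr) \<subseteq> fst ?f ` carrier (tensor_e A Pr)"
  proof
    fix z assume z: "z \<in> carrier (SGe T.Pr)"
    have "\<exists>w\<in>carrier (tensor_e A Pr). \<forall>i\<in>I. fst (prj i) w = (if i \<in> J then z i else \<one>\<^bsub>tensor_e A (D i)\<^esub>)"
      if "finite J" "J \<subseteq> I" for J
      using that
    proof (induction J rule: finite_induct)
      case empty
      show ?case
        by (rule bexI[of _ "\<one>\<^bsub>tensor_e A Pr\<^esub>"]) (simp_all add: hom_one[OF prj_h(1) S.E.is_group gD(1)])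
    next
      case (insert j J)
      then obtain w where w: "w \<in> carrier (tensor_e A Pr)"
        "\<And>i. i \<in> I \<Longrightarrow> fst (prj i) w = (if i \<in> J then z i else \<one>\<^bsub>tensor_e A (D i)\<^esub>)" by auto
      have j: "j \<in> I" "z j \<in> carrier (tensor_e A (D j))" using insert z by (auto simp: PiE_iff)
      have iz: "fst (inc j) (z j) \<in> carrier (tensor_e A Pr)" using hom_in_carrier[OF inc_h(1)] j by simp
      have "fst (prj i) (w \<otimes>\<^bsub>tensor_e A Pr\<^esub> fst (inc j) (z j)) = (if i \<in> insert j J then z i else \<one>\<^bsub>tensor_e A (D i)\<^esub>)"
        if i: "i \<in> I" for i
      proof -
        interpret Gi: group "tensor_e A (D i)" by (rule gD(1)[OF i])
        have zi: "z i \<in> carrier (tensor_e A (D i))" using i z by (auto simp: PiE_iff)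
        have "fst (prj i) (w \<otimes>\<^bsub>tensor_e A Pr\<^esub> fst (inc j) (z j)) =
          (if i \<in> J then z i else \<one>\<^bsub>tensor_e A (D i)\<^esub>) \<otimes>\<^bsub>tensor_e A (D i)\<^esub> (if i = j then z j else \<one>\<^bsub>tensor_e A (D i)\<^esub>)"
          by (simp only: hom_mult[OF prj_h(1)[OF i] w(1) iz] w(2)[OF i] prj_inc(1)[OF i j(1) j(2)])
        then show ?thesis
          using insert(2) zi Gi.l_one[OF zi] by (cases "i = j") simp_all
      qed
      then show ?case using w(1) iz by (intro bexI[of _ "w \<otimes>\<^bsub>tensor_e A Pr\<^esub> fst (inc j) (z j)"]) simp_all
    qed
    from this[OF fin subset_refl] obtain w where w: "w \<in> carrier (tensor_e A Pr)" "\<And>i. i \<in> I \<Longrightarrow> fst (prj i) w = z i"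
      by auto
    have "z = fst ?f w"
      using z w(2) by (auto simp: sg_pair_def PiE_iff intro!: extensionalityI[of _ I])
    then show "z \<in> fst ?f ` carrier (tensor_e A Pr)" using w(1) by blast
  qed
  moreover have "carrier (SGee T.Pr) \<subseteq> snd ?f ` carrier (tensor_ee A Pr)"
  proof
    fix z assume z: "z \<in> carrier (SGee T.Pr)"
    have "\<exists>w\<in>carrier (tensor_ee A Pr). \<forall>i\<in>I. snd (prj i) w = (if i \<in> J then z i else \<one>\<^bsub>tensor_ee A (D i)\<^esub>)"
      if "finite J" "J \<subseteq> I" for J
      using that
    proof (induction J rule: finite_induct)
      case empty
      show ?case
        by (rule bexI[of _ "\<one>\<^bsub>tensor_ee A Pr\<^esub>"]) (simp_all add: hom_one[OF prj_h(2) S.EE.is_group gD(2)])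
    next
      case (insert j J)
      then obtain w where w: "w \<in> carrier (tensor_ee A Pr)"
        "\<And>i. i \<in> I \<Longrightarrow> snd (prj i) w = (if i \<in> J then z i else \<one>\<^bsub>tensor_ee A (D i)\<^esub>)" by auto
      have j: "j \<in> I" "z j \<in> carrier (tensor_ee A (D j))" using insert z by (auto simp: PiE_iff)
      have iz: "snd (inc j) (z j) \<in> carrier (tensor_ee A Pr)" using hom_in_carrier[OF inc_h(2)] j by simp
      have "snd (prj i) (w \<otimes>\<^bsub>tensor_ee A Pr\<^esub> snd (inc j) (z j)) = (if i \<in> insert j J then z i else \<one>\<^bsub>tensor_ee A (D i)\<^esub>)"
        if i: "i \<in> I" for i
      proof -
        interpret Gi: group "tensor_ee A (D i)" by (rule gD(2)[OF i])
        have zi: "z i \<in> carrier (tensor_ee A (D i))" using i z by (auto simp: PiE_iff)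
        have "snd (prj i) (w \<otimes>\<^bsub>tensor_ee A Pr\<^esub> snd (inc j) (z j)) =
          (if i \<in> J then z i else \<one>\<^bsub>tensor_ee A (D i)\<^esub>) \<otimes>\<^bsub>tensor_ee A (D i)\<^esub> (if i = j then z j else \<one>\<^bsub>tensor_ee A (D i)\<^esub>)"
          by (simp only: hom_mult[OF prj_h(2)[OF i] w(1) iz] w(2)[OF i] prj_inc(2)[OF i j(1) j(2)])
        then show ?thesis
          using insert(2) zi Gi.l_one[OF zi] by (cases "i = j") simp_all
      qed
      then show ?case using w(1) iz by (intro bexI[of _ "w \<otimes>\<^bsub>tensor_ee A Pr\<^esub> snd (inc j) (z j)"]) simp_all
    qed
    from this[OF fin subset_refl] obtain w where w: "w \<in> carrier (tensor_ee A Pr)" "\<And>i. i \<in> I \<Longrightarrow> snd (prj i) w = z i"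
      by auto
    have "z = snd ?f w"
      using z w(2) by (auto simp: sg_pair_def PiE_iff intro!: extensionalityI[of _ I])
    then show "z \<in> snd ?f ` carrier (tensor_ee A Pr)" using w(1) by blast
  qed
  moreover have "fst ?f ` carrier (tensor_e A Pr) \<subseteq> carrier (SGe T.Pr)"
    "snd ?f ` carrier (tensor_ee A Pr) \<subseteq> carrier (SGee T.Pr)"
    using sg_homD(5,6)[OF hom] unfolding sg_tensor_simps by blast+
  ultimately have "inj_on (fst ?f) (carrier (tensor_e A Pr)) \<and> inj_on (snd ?f) (carrier (tensor_ee A Pr)) \<and>
    fst ?f ` carrier (tensor_e A Pr) = carrier (SGe T.Pr) \<and> snd ?f ` carrier (tensor_ee A Pr) = carrier (SGee T.Pr)"
    by (simp only: subset_antisym simp_thms)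
  then show ?thesis unfolding sg_iso_def sg_mon_def sg_epi_def sg_tensor_simps using hom by simp
qed

end

end

section \<open>Filtered colimits\<close>

locale filtered_sets =
  fixes J :: "('i, 'm) small_cat" and S :: "'i \<Rightarrow> 'a set" and t :: "'m \<Rightarrow> 'a \<Rightarrow> 'a"
  assumes filtered: "filtered_category J"
    and t_closed: "\<And>m x. m \<in> Arr J \<Longrightarrow> x \<in> S (Dom J m) \<Longrightarrow> t m x \<in> S (Cod J m)"
    and t_id: "\<And>i x. i \<in> Obj J \<Longrightarrow> x \<in> S i \<Longrightarrow> t (Ide J i) x = x"
    and t_comp: "\<And>g f x. g \<in> Arr J \<Longrightarrow> f \<in> Arr J \<Longrightarrow> Dom J g = Cod J f \<Longrightarrow> x \<in> S (Dom J f) \<Longrightarrow>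
      t (Cmp J g f) x = t g (t f x)"
begin

definition eqv where
  "eqv i x j y \<longleftrightarrow> (\<exists>f\<in>Arr J. \<exists>g\<in>Arr J. Dom J f = i \<and> Dom J g = j \<and> Cod J f = Cod J g \<and> t f x = t g y)"

definition cls where
  "cls i x = {(j, y). j \<in> Obj J \<and> y \<in> S j \<and> eqv i x j y}"

lemma cat: "small_category J"
  using filtered by (simp add: filtered_category_def)

lemma dom_obj: "f \<in> Arr J \<Longrightarrow> Dom J f \<in> Obj J" and cod_obj: "f \<in> Arr J \<Longrightarrow> Cod J f \<in> Obj J"
  using cat by (auto simp: small_category_def)

lemma ide: "i \<in> Obj J \<Longrightarrow> Ide J i \<in> Arr J \<and> Dom J (Ide J i) = i \<and> Cod J (Ide J i) = i"
  using cat by (auto simp: small_category_def)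

lemma cmp: "g \<in> Arr J \<Longrightarrow> f \<in> Arr J \<Longrightarrow> Dom J g = Cod J f \<Longrightarrow>
    Cmp J g f \<in> Arr J \<and> Dom J (Cmp J g f) = Dom J f \<and> Cod J (Cmp J g f) = Cod J g"
  using cat by (auto simp: small_category_def)

lemma cospan: "i \<in> Obj J \<Longrightarrow> j \<in> Obj J \<Longrightarrow> \<exists>f\<in>Arr J. \<exists>g\<in>Arr J. Dom J f = i \<and> Dom J g = j \<and> Cod J f = Cod J g"
  using filtered unfolding filtered_category_def by blast

lemma equalize: "f \<in> Arr J \<Longrightarrow> g \<in> Arr J \<Longrightarrow> Dom J f = Dom J g \<Longrightarrow> Cod J f = Cod J g \<Longrightarrow>
    \<exists>h\<in>Arr J. Dom J h = Cod J f \<and> Cmp J h f = Cmp J h g"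
  using filtered unfolding filtered_category_def by blast

lemma eqv_refl: "i \<in> Obj J \<Longrightarrow> eqv i x i x"
  unfolding eqv_def using ide by blast

lemma eqv_sym: "eqv i x j y \<Longrightarrow> eqv j y i x"
  unfolding eqv_def by (elim bexE conjE) (intro bexI conjI; simp)

text \<open>Join the targets of the two cospans, then equalize the two composites with the first
  legs, then those with the second legs. Later equalizing does not disturb the earlier
  equation.\<close>

lemma amalgamate:
  assumes "f \<in> Arr J" "g \<in> Arr J" "f' \<in> Arr J" "g' \<in> Arr J"
    and "Dom J f = Dom J f'" "Dom J g = Dom J g'" "Cod J f = Cod J g" "Cod J f' = Cod J g'"
  shows "\<exists>u\<in>Arr J. \<exists>v\<in>Arr J. Dom J u = Cod J f \<and> Dom J v = Cod J f' \<and> Cod J u = Cod J v \<and>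
    Cmp J u f = Cmp J v f' \<and> Cmp J u g = Cmp J v g'"
proof -
  have assoc: "Cmp J h (Cmp J k l) = Cmp J (Cmp J h k) l"
    if "h \<in> Arr J" "k \<in> Arr J" "l \<in> Arr J" "Dom J h = Cod J k" "Dom J k = Cod J l" for h k l
    using cat that unfolding small_category_def by blast
  obtain u v where u: "u \<in> Arr J" "Dom J u = Cod J f" and v: "v \<in> Arr J" "Dom J v = Cod J f'"
    and uv: "Cod J u = Cod J v"
    using cospan[OF cod_obj[OF assms(1)] cod_obj[OF assms(3)]] by blast
  have uf: "Cmp J u f \<in> Arr J" "Dom J (Cmp J u f) = Dom J f" "Cod J (Cmp J u f) = Cod J u"
    and vf: "Cmp J v f' \<in> Arr J" "Dom J (Cmp J v f') = Dom J f'" "Cod J (Cmp J v f') = Cod J v"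
    using cmp u v assms by auto
  obtain w where w: "w \<in> Arr J" "Dom J w = Cod J u" "Cmp J w (Cmp J u f) = Cmp J w (Cmp J v f')"
    using equalize[OF uf(1) vf(1)] uf vf uv assms(5) by auto
  define u1 v1 where "u1 = Cmp J w u" and "v1 = Cmp J w v"
  have u1: "u1 \<in> Arr J" "Dom J u1 = Cod J f" "Cod J u1 = Cod J w"
    and v1: "v1 \<in> Arr J" "Dom J v1 = Cod J f'" "Cod J v1 = Cod J w"
    unfolding u1_def v1_def using cmp u v w uv by auto
  have 1: "Cmp J u1 f = Cmp J v1 f'"
    unfolding u1_def v1_def using w(3) assoc[OF w(1) u(1) assms(1)] assoc[OF w(1) v(1) assms(3)] u v uv w by simp
  have ug: "Cmp J u1 g \<in> Arr J" "Dom J (Cmp J u1 g) = Dom J g" "Cod J (Cmp J u1 g) = Cod J w"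
    and vg: "Cmp J v1 g' \<in> Arr J" "Dom J (Cmp J v1 g') = Dom J g'" "Cod J (Cmp J v1 g') = Cod J w"
    using cmp u1 v1 assms by auto
  obtain z where z: "z \<in> Arr J" "Dom J z = Cod J w" "Cmp J z (Cmp J u1 g) = Cmp J z (Cmp J v1 g')"
    using equalize[OF ug(1) vg(1)] ug vg assms(6) by auto
  show ?thesis
  proof (intro bexI conjI)
    show "Cmp J z u1 \<in> Arr J" "Cmp J z v1 \<in> Arr J" "Dom J (Cmp J z u1) = Cod J f"
      "Dom J (Cmp J z v1) = Cod J f'" "Cod J (Cmp J z u1) = Cod J (Cmp J z v1)"
      using cmp[OF z(1) u1(1)] cmp[OF z(1) v1(1)] u1 v1 z by auto
    show "Cmp J (Cmp J z u1) f = Cmp J (Cmp J z v1) f'"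
      using assoc[OF z(1) u1(1) assms(1)] assoc[OF z(1) v1(1) assms(3)] 1 u1 v1 z by simp
    show "Cmp J (Cmp J z u1) g = Cmp J (Cmp J z v1) g'"
      using assoc[OF z(1) u1(1) assms(2)] assoc[OF z(1) v1(1) assms(4)] z u1 v1 assms by simp
  qed
qed

text \<open>Each equation is witnessed by its own cospan. Amalgamating the two gives one cospan for
  both, as is needed to multiply representatives.\<close>

lemma eqv_pair:
  assumes "eqv i x j y" "eqv i x' j y'" "x \<in> S i" "x' \<in> S i" "y \<in> S j" "y' \<in> S j"
  shows "\<exists>f\<in>Arr J. \<exists>g\<in>Arr J. Dom J f = i \<and> Dom J g = j \<and> Cod J f = Cod J g \<and>
    t f x = t g y \<and> t f x' = t g y'"
proof -
  obtain f g where f: "f \<in> Arr J" "Dom J f = i" and g: "g \<in> Arr J" "Dom J g = j" and fg: "Cod J f = Cod J g" "t f x = t g y"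
    using assms(1) unfolding eqv_def by blast
  obtain f' g' where f': "f' \<in> Arr J" "Dom J f' = i" and g': "g' \<in> Arr J" "Dom J g' = j"
    and fg': "Cod J f' = Cod J g'" "t f' x' = t g' y'"
    using assms(2) unfolding eqv_def by blast
  obtain u v where u: "u \<in> Arr J" "Dom J u = Cod J f" and v: "v \<in> Arr J" "Dom J v = Cod J f'"
    and uv: "Cod J u = Cod J v" "Cmp J u f = Cmp J v f'" "Cmp J u g = Cmp J v g'"
    using amalgamate[OF f(1) g(1) f'(1) g'(1)] f g f' g' fg fg' by auto
  show ?thesis
  proof (intro bexI conjI)
    show "Cmp J u f \<in> Arr J" "Cmp J u g \<in> Arr J" "Dom J (Cmp J u f) = i" "Dom J (Cmp J u g) = j"
      "Cod J (Cmp J u f) = Cod J (Cmp J u g)"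
      using cmp[OF u(1) f(1)] cmp[OF u(1) g(1)] u f g fg by auto
    show "t (Cmp J u f) x = t (Cmp J u g) y"
      using t_comp[OF u(1) f(1)] t_comp[OF u(1) g(1)] u f g fg assms by simp
    show "t (Cmp J u f) x' = t (Cmp J u g) y'"
      unfolding uv(2,3) using t_comp[OF v(1) f'(1)] t_comp[OF v(1) g'(1)] v f' g' fg' assms by simp
  qed
qed

lemma eqv_trans:
  assumes "eqv i x j y" "eqv j y k z" "x \<in> S i" "y \<in> S j" "z \<in> S k"
  shows "eqv i x k z"
proof -
  obtain f g where f: "f \<in> Arr J" "Dom J f = i" and g: "g \<in> Arr J" "Dom J g = j" and fg: "Cod J f = Cod J g" "t f x = t g y"
    using assms(1) unfolding eqv_def by blast
  obtain g' h where g': "g' \<in> Arr J" "Dom J g' = j" and h: "h \<in> Arr J" "Dom J h = k"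
    and gh: "Cod J g' = Cod J h" "t g' y = t h z"
    using assms(2) unfolding eqv_def by blast
  \<comment> \<open>Degenerate use of \<open>amalgamate\<close>: both legs of each cospan are the
    same arrow, so it only completes \<open>g\<close> and \<open>g'\<close> to a commutative
    square.\<close>
  obtain u v where u: "u \<in> Arr J" "Dom J u = Cod J g" and v: "v \<in> Arr J" "Dom J v = Cod J g'"
    and uv: "Cod J u = Cod J v" "Cmp J u g = Cmp J v g'"
    using amalgamate[OF g(1) g(1) g'(1) g'(1)] g g' by auto
  have "t u (t f x) = t (Cmp J u g) y" using t_comp[OF u(1) g(1)] u g fg assms by simp
  also have "\<dots> = t v (t h z)" unfolding uv(2) using t_comp[OF v(1) g'(1)] v g' gh assms by simp
  finally have eq: "t (Cmp J u f) x = t (Cmp J v h) z"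
    using t_comp[OF u(1) f(1)] t_comp[OF v(1) h(1)] u v f h fg gh assms by simp
  have "Cmp J u f \<in> Arr J" "Cmp J v h \<in> Arr J" "Dom J (Cmp J u f) = i" "Dom J (Cmp J v h) = k"
    "Cod J (Cmp J u f) = Cod J (Cmp J v h)"
    using cmp[OF u(1) f(1)] cmp[OF v(1) h(1)] u v f h fg gh uv by auto
  with eq show ?thesis unfolding eqv_def by blast
qed

lemma cls_eq_iff:
  assumes "i \<in> Obj J" "x \<in> S i" "j \<in> Obj J" "y \<in> S j"
  shows "cls i x = cls j y \<longleftrightarrow> eqv i x j y"
proof
  assume "cls i x = cls j y"
  moreover have "(j, y) \<in> cls j y" using assms eqv_refl by (simp add: cls_def)
  ultimately show "eqv i x j y" by (auto simp: cls_def)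
next
  assume e: "eqv i x j y"
  have "eqv i x k z \<longleftrightarrow> eqv j y k z" if "z \<in> S k" for k z
    using eqv_trans[OF eqv_sym[OF e]] eqv_trans[OF e] assms that by blast
  then show "cls i x = cls j y" unfolding cls_def by blast
qed

lemma eqv_move:
  assumes "f \<in> Arr J" "x \<in> S (Dom J f)"
  shows "eqv (Dom J f) x (Cod J f) (t f x)"
  unfolding eqv_def
proof (intro bexI conjI)
  show "t f x = t (Ide J (Cod J f)) (t f x)" using t_id t_closed assms cod_obj by simp
qed (use assms ide cod_obj in auto)

lemma cls_move: "f \<in> Arr J \<Longrightarrow> x \<in> S (Dom J f) \<Longrightarrow> cls (Cod J f) (t f x) = cls (Dom J f) x"
  using eqv_move[of f x] cls_eq_iff[of "Dom J f" x "Cod J f" "t f x"] dom_obj cod_obj t_closed by simp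

lemma upper_bound:
  assumes "finite A" "A \<subseteq> Obj J"
  shows "\<exists>k\<in>Obj J. \<forall>i\<in>A. \<exists>f\<in>Arr J. Dom J f = i \<and> Cod J f = k"
  using assms
proof (induction A rule: finite_induct)
  case empty
  then show ?case using filtered by (auto simp: filtered_category_def)
next
  case (insert j A)
  then obtain k where k: "k \<in> Obj J" "\<forall>i\<in>A. \<exists>f\<in>Arr J. Dom J f = i \<and> Cod J f = k" by auto
  obtain f g where fg: "f \<in> Arr J" "g \<in> Arr J" "Dom J f = k" "Dom J g = j" "Cod J f = Cod J g"
    using cospan[of k j] k insert by auto
  have "\<exists>h\<in>Arr J. Dom J h = i \<and> Cod J h = Cod J g" if i: "i \<in> insert j A" for i
  proof (cases "i = j")
    case False
    then obtain h where "h \<in> Arr J" "Dom J h = i" "Cod J h = k" using k i by auto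
    then show ?thesis using cmp[of f h] fg by (intro bexI[of _ "Cmp J f h"]) auto
  qed (use fg in auto)
  then show ?case using cod_obj[OF fg(2)] by blast
qed

end

section \<open>The standard filtered colimit of square groups\<close>

locale filtered_diagram =
  fixes J :: "('i, 'm) small_cat" and D :: "'i \<Rightarrow> ('c, 'd) square" and F :: "'m \<Rightarrow> ('c, 'd, 'c, 'd) sg_map"
  assumes filtered: "filtered_category J" and diagram: "sg_diagram J D F"
begin

lemma square: "i \<in> Obj J \<Longrightarrow> square_group (D i)"
  and F_hom: "m \<in> Arr J \<Longrightarrow> F m \<in> sg_hom (D (Dom J m)) (D (Cod J m))"
  and F_id: "i \<in> Obj J \<Longrightarrow> sg_eq (D i) (F (Ide J i)) sg_id"
  and F_comp: "g \<in> Arr J \<Longrightarrow> f \<in> Arr J \<Longrightarrow> Dom J g = Cod J f \<Longrightarrow>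
    sg_eq (D (Dom J f)) (F (Cmp J g f)) (sg_comp (F g) (F f))"
  using diagram by (auto simp: sg_diagram_def)

sublocale e: filtered_sets J "\<lambda>i. carrier (SGe (D i))" "\<lambda>m. fst (F m)"
proof (rule filtered_sets.intro[OF filtered])
  show "fst (F m) x \<in> carrier (SGe (D (Cod J m)))" if "m \<in> Arr J" "x \<in> carrier (SGe (D (Dom J m)))" for m x
    using sg_homD(5)[OF F_hom[OF that(1)] that(2)] .
qed (use F_id F_comp in \<open>simp_all add: sg_eq_def sg_id_def sg_comp_def\<close>)

sublocale ee: filtered_sets J "\<lambda>i. carrier (SGee (D i))" "\<lambda>m. snd (F m)"
proof (rule filtered_sets.intro[OF filtered])
  show "snd (F m) x \<in> carrier (SGee (D (Cod J m)))" if "m \<in> Arr J" "x \<in> carrier (SGee (D (Dom J m)))" for m x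
    using sg_homD(6)[OF F_hom[OF that(1)] that(2)] .
qed (use F_id F_comp in \<open>simp_all add: sg_eq_def sg_id_def sg_comp_def\<close>)

lemma F_square_hom: "m \<in> Arr J \<Longrightarrow> square_group_hom (D (Dom J m)) (D (Cod J m)) (F m)"
  using e.dom_obj e.cod_obj by (intro square_group_homI square F_hom) auto

text \<open>Each operation is evaluated on representatives at a common index.
  \<open>cls_mult_e\<close>, \<open>cls_mult_ee\<close>, \<open>cls_H\<close>, \<open>cls_P\<close>
  and \<open>cls_one\<close> show that the results do not depend on the choice.\<close>

definition colim :: "(('i \<times> 'c) set, ('i \<times> 'd) set) square" where
  "colim =
    \<lparr>SGe = \<lparr>carrier = {e.cls i x | i x. i \<in> Obj J \<and> x \<in> carrier (SGe (D i))},
       monoid.mult = (\<lambda>X Y. THE Z. \<exists>k\<in>Obj J. \<exists>x\<in>carrier (SGe (D k)). \<exists>y\<in>carrier (SGe (D k)).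
         X = e.cls k x \<and> Y = e.cls k y \<and> Z = e.cls k (x \<otimes>\<^bsub>SGe (D k)\<^esub> y)),
       one = (THE Z. \<exists>k\<in>Obj J. Z = e.cls k \<one>\<^bsub>SGe (D k)\<^esub>)\<rparr>,
     SGee = \<lparr>carrier = {ee.cls i x | i x. i \<in> Obj J \<and> x \<in> carrier (SGee (D i))},
       monoid.mult = (\<lambda>X Y. THE Z. \<exists>k\<in>Obj J. \<exists>x\<in>carrier (SGee (D k)). \<exists>y\<in>carrier (SGee (D k)).
         X = ee.cls k x \<and> Y = ee.cls k y \<and> Z = ee.cls k (x \<otimes>\<^bsub>SGee (D k)\<^esub> y)),
       one = (THE Z. \<exists>k\<in>Obj J. Z = ee.cls k \<one>\<^bsub>SGee (D k)\<^esub>)\<rparr>,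
     SGH = (\<lambda>X. THE Z. \<exists>k\<in>Obj J. \<exists>x\<in>carrier (SGe (D k)). X = e.cls k x \<and> Z = ee.cls k (SGH (D k) x)),
     SGP = (\<lambda>X. THE Z. \<exists>k\<in>Obj J. \<exists>a\<in>carrier (SGee (D k)). X = ee.cls k a \<and> Z = e.cls k (SGP (D k) a))\<rparr>"

definition kap :: "'i \<Rightarrow> ('c, 'd, ('i \<times> 'c) set, ('i \<times> 'd) set) sg_map" where
  "kap i = (e.cls i, ee.cls i)"

lemma cls_mult_e:
  assumes "k \<in> Obj J" "x \<in> carrier (SGe (D k))" "y \<in> carrier (SGe (D k))"
    and "l \<in> Obj J" "x' \<in> carrier (SGe (D l))" "y' \<in> carrier (SGe (D l))"
    and "e.cls l x' = e.cls k x" "e.cls l y' = e.cls k y"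
  shows "e.cls l (x' \<otimes>\<^bsub>SGe (D l)\<^esub> y') = e.cls k (x \<otimes>\<^bsub>SGe (D k)\<^esub> y)"
proof -
  interpret k: square_group "D k" using assms by (simp add: square)
  interpret l: square_group "D l" using assms by (simp add: square)
  obtain f g where fg: "f \<in> Arr J" "g \<in> Arr J" "Dom J f = l" "Dom J g = k" "Cod J f = Cod J g"
    "fst (F f) x' = fst (F g) x" "fst (F f) y' = fst (F g) y"
    using e.eqv_pair[of l x' k x y' y] assms e.cls_eq_iff by auto
  have "fst (F f) (x' \<otimes>\<^bsub>SGe (D l)\<^esub> y') = fst (F g) (x \<otimes>\<^bsub>SGe (D k)\<^esub> y)"
    using hom_mult[OF sg_homD(1)[OF F_hom[OF fg(1)]], of x' y'] hom_mult[OF sg_homD(1)[OF F_hom[OF fg(2)]], of x y]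
      fg assms by simp
  then have "e.eqv l (x' \<otimes>\<^bsub>SGe (D l)\<^esub> y') k (x \<otimes>\<^bsub>SGe (D k)\<^esub> y)"
    unfolding e.eqv_def using fg by blast
  then show ?thesis using assms by (simp add: e.cls_eq_iff)
qed

lemma cls_mult_ee:
  assumes "k \<in> Obj J" "x \<in> carrier (SGee (D k))" "y \<in> carrier (SGee (D k))"
    and "l \<in> Obj J" "x' \<in> carrier (SGee (D l))" "y' \<in> carrier (SGee (D l))"
    and "ee.cls l x' = ee.cls k x" "ee.cls l y' = ee.cls k y"
  shows "ee.cls l (x' \<otimes>\<^bsub>SGee (D l)\<^esub> y') = ee.cls k (x \<otimes>\<^bsub>SGee (D k)\<^esub> y)"
proof -
  interpret k: square_group "D k" using assms by (simp add: square)
  interpret l: square_group "D l" using assms by (simp add: square)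
  obtain f g where fg: "f \<in> Arr J" "g \<in> Arr J" "Dom J f = l" "Dom J g = k" "Cod J f = Cod J g"
    "snd (F f) x' = snd (F g) x" "snd (F f) y' = snd (F g) y"
    using ee.eqv_pair[of l x' k x y' y] assms ee.cls_eq_iff by auto
  have "snd (F f) (x' \<otimes>\<^bsub>SGee (D l)\<^esub> y') = snd (F g) (x \<otimes>\<^bsub>SGee (D k)\<^esub> y)"
    using hom_mult[OF sg_homD(2)[OF F_hom[OF fg(1)]], of x' y'] hom_mult[OF sg_homD(2)[OF F_hom[OF fg(2)]], of x y]
      fg assms by simp
  then have "ee.eqv l (x' \<otimes>\<^bsub>SGee (D l)\<^esub> y') k (x \<otimes>\<^bsub>SGee (D k)\<^esub> y)"
    unfolding ee.eqv_def using fg by blast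
  then show ?thesis using assms by (simp add: ee.cls_eq_iff)
qed

lemma cls_H:
  assumes "k \<in> Obj J" "x \<in> carrier (SGe (D k))" "l \<in> Obj J" "y \<in> carrier (SGe (D l))" "e.cls l y = e.cls k x"
  shows "ee.cls l (SGH (D l) y) = ee.cls k (SGH (D k) x)"
proof -
  interpret k: square_group "D k" using assms by (simp add: square)
  interpret l: square_group "D l" using assms by (simp add: square)
  have "e.eqv l y k x" using e.cls_eq_iff assms by simp
  then obtain f g where fg: "f \<in> Arr J" "g \<in> Arr J" "Dom J f = l" "Dom J g = k" "Cod J f = Cod J g"
    "fst (F f) y = fst (F g) x"
    unfolding e.eqv_def by blast
  have "snd (F f) (SGH (D l) y) = snd (F g) (SGH (D k) x)"
    using sg_homD(3)[OF F_hom[OF fg(1)], of y] sg_homD(3)[OF F_hom[OF fg(2)], of x] fg assms by simp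
  then have "ee.eqv l (SGH (D l) y) k (SGH (D k) x)"
    unfolding ee.eqv_def using fg by blast
  then show ?thesis using assms by (simp add: ee.cls_eq_iff)
qed

lemma cls_P:
  assumes "k \<in> Obj J" "x \<in> carrier (SGee (D k))" "l \<in> Obj J" "y \<in> carrier (SGee (D l))" "ee.cls l y = ee.cls k x"
  shows "e.cls l (SGP (D l) y) = e.cls k (SGP (D k) x)"
proof -
  interpret k: square_group "D k" using assms by (simp add: square)
  interpret l: square_group "D l" using assms by (simp add: square)
  have "ee.eqv l y k x" using ee.cls_eq_iff assms by simp
  then obtain f g where fg: "f \<in> Arr J" "g \<in> Arr J" "Dom J f = l" "Dom J g = k" "Cod J f = Cod J g"
    "snd (F f) y = snd (F g) x"
    unfolding ee.eqv_def by blast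
  have "fst (F f) (SGP (D l) y) = fst (F g) (SGP (D k) x)"
    using sg_homD(4)[OF F_hom[OF fg(1)], of y] sg_homD(4)[OF F_hom[OF fg(2)], of x] fg assms by simp
  then have "e.eqv l (SGP (D l) y) k (SGP (D k) x)"
    unfolding e.eqv_def using fg by blast
  then show ?thesis using assms by (simp add: e.cls_eq_iff)
qed

lemma cls_one:
  assumes "k \<in> Obj J" "l \<in> Obj J"
  shows "e.cls l \<one>\<^bsub>SGe (D l)\<^esub> = e.cls k \<one>\<^bsub>SGe (D k)\<^esub>" and "ee.cls l \<one>\<^bsub>SGee (D l)\<^esub> = ee.cls k \<one>\<^bsub>SGee (D k)\<^esub>"
proof -
  interpret k: square_group "D k" using assms by (simp add: square)
  interpret l: square_group "D l" using assms by (simp add: square)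
  obtain f g where fg: "f \<in> Arr J" "g \<in> Arr J" "Dom J f = l" "Dom J g = k" "Cod J f = Cod J g"
    using e.cospan[OF assms(2,1)] by blast
  interpret f: square_group_hom "D (Dom J f)" "D (Cod J f)" "F f" by (rule F_square_hom[OF fg(1)])
  interpret g: square_group_hom "D (Dom J g)" "D (Cod J g)" "F g" by (rule F_square_hom[OF fg(2)])
  have "e.eqv l \<one>\<^bsub>SGe (D l)\<^esub> k \<one>\<^bsub>SGe (D k)\<^esub>" "ee.eqv l \<one>\<^bsub>SGee (D l)\<^esub> k \<one>\<^bsub>SGee (D k)\<^esub>"
    unfolding e.eqv_def ee.eqv_def using fg f.e.hom_one g.e.hom_one f.ee.hom_one g.ee.hom_one by metis+
  then show "e.cls l \<one>\<^bsub>SGe (D l)\<^esub> = e.cls k \<one>\<^bsub>SGe (D k)\<^esub>" "ee.cls l \<one>\<^bsub>SGee (D l)\<^esub> = ee.cls k \<one>\<^bsub>SGee (D k)\<^esub>"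
    using assms by (simp_all add: e.cls_eq_iff ee.cls_eq_iff)
qed

text \<open>The definite descriptions in \<open>colim\<close> may be evaluated at the index k
  itself. Preservation of the neutral elements is stated separately because
  \<open>square_groupI_cover\<close> asks for it before the target is known to be a group.\<close>

lemma kap_hom:
  assumes k: "k \<in> Obj J"
  shows "kap k \<in> sg_hom (D k) colim"
    and "fst (kap k) \<one>\<^bsub>SGe (D k)\<^esub> = \<one>\<^bsub>SGe colim\<^esub>" and "snd (kap k) \<one>\<^bsub>SGee (D k)\<^esub> = \<one>\<^bsub>SGee colim\<^esub>"
proof -
  have "e.cls k (x \<otimes>\<^bsub>SGe (D k)\<^esub> y) = e.cls k x \<otimes>\<^bsub>SGe colim\<^esub> e.cls k y"
    if "x \<in> carrier (SGe (D k))" "y \<in> carrier (SGe (D k))" for x y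
  proof -
    have "(THE Z. \<exists>l\<in>Obj J. \<exists>x'\<in>carrier (SGe (D l)). \<exists>y'\<in>carrier (SGe (D l)).
         e.cls k x = e.cls l x' \<and> e.cls k y = e.cls l y' \<and> Z = e.cls l (x' \<otimes>\<^bsub>SGe (D l)\<^esub> y')) = e.cls k (x \<otimes>\<^bsub>SGe (D k)\<^esub> y)"
    proof (rule the_equality)
      show "Z = e.cls k (x \<otimes>\<^bsub>SGe (D k)\<^esub> y)"
        if "\<exists>l\<in>Obj J. \<exists>x'\<in>carrier (SGe (D l)). \<exists>y'\<in>carrier (SGe (D l)).
         e.cls k x = e.cls l x' \<and> e.cls k y = e.cls l y' \<and> Z = e.cls l (x' \<otimes>\<^bsub>SGe (D l)\<^esub> y')" for Z
        using that cls_mult_e[OF k \<open>x \<in> _\<close> \<open>y \<in> _\<close>] by metis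
    qed (use k that in blast)
    then show ?thesis by (simp add: colim_def)
  qed
  moreover have "ee.cls k (x \<otimes>\<^bsub>SGee (D k)\<^esub> y) = ee.cls k x \<otimes>\<^bsub>SGee colim\<^esub> ee.cls k y"
    if "x \<in> carrier (SGee (D k))" "y \<in> carrier (SGee (D k))" for x y
  proof -
    have "(THE Z. \<exists>l\<in>Obj J. \<exists>x'\<in>carrier (SGee (D l)). \<exists>y'\<in>carrier (SGee (D l)).
         ee.cls k x = ee.cls l x' \<and> ee.cls k y = ee.cls l y' \<and> Z = ee.cls l (x' \<otimes>\<^bsub>SGee (D l)\<^esub> y')) = ee.cls k (x \<otimes>\<^bsub>SGee (D k)\<^esub> y)"
    proof (rule the_equality)
      show "Z = ee.cls k (x \<otimes>\<^bsub>SGee (D k)\<^esub> y)"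
        if "\<exists>l\<in>Obj J. \<exists>x'\<in>carrier (SGee (D l)). \<exists>y'\<in>carrier (SGee (D l)).
         ee.cls k x = ee.cls l x' \<and> ee.cls k y = ee.cls l y' \<and> Z = ee.cls l (x' \<otimes>\<^bsub>SGee (D l)\<^esub> y')" for Z
        using that cls_mult_ee[OF k \<open>x \<in> _\<close> \<open>y \<in> _\<close>] by metis
    qed (use k that in blast)
    then show ?thesis by (simp add: colim_def)
  qed
  moreover have "ee.cls k (SGH (D k) x) = SGH colim (e.cls k x)" if "x \<in> carrier (SGe (D k))" for x
  proof -
    have "(THE Z. \<exists>l\<in>Obj J. \<exists>x'\<in>carrier (SGe (D l)). e.cls k x = e.cls l x' \<and> Z = ee.cls l (SGH (D l) x')) =
      ee.cls k (SGH (D k) x)"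
    proof (rule the_equality)
      show "Z = ee.cls k (SGH (D k) x)"
        if "\<exists>l\<in>Obj J. \<exists>x'\<in>carrier (SGe (D l)). e.cls k x = e.cls l x' \<and> Z = ee.cls l (SGH (D l) x')" for Z
        using that cls_H[OF k \<open>x \<in> _\<close>] by metis
    qed (use k that in blast)
    then show ?thesis by (simp add: colim_def)
  qed
  moreover have "e.cls k (SGP (D k) x) = SGP colim (ee.cls k x)" if "x \<in> carrier (SGee (D k))" for x
  proof -
    have "(THE Z. \<exists>l\<in>Obj J. \<exists>x'\<in>carrier (SGee (D l)). ee.cls k x = ee.cls l x' \<and> Z = e.cls l (SGP (D l) x')) =
      e.cls k (SGP (D k) x)"
    proof (rule the_equality)
      show "Z = e.cls k (SGP (D k) x)"
        if "\<exists>l\<in>Obj J. \<exists>x'\<in>carrier (SGee (D l)). ee.cls k x = ee.cls l x' \<and> Z = e.cls l (SGP (D l) x')" for Z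
        using that cls_P[OF k \<open>x \<in> _\<close>] by metis
    qed (use k that in blast)
    then show ?thesis by (simp add: colim_def)
  qed
  moreover have "e.cls k x \<in> carrier (SGe colim)" if "x \<in> carrier (SGe (D k))" for x
    using that k by (auto simp: colim_def)
  moreover have "ee.cls k x \<in> carrier (SGee colim)" if "x \<in> carrier (SGee (D k))" for x
    using that k by (auto simp: colim_def)
  ultimately show "kap k \<in> sg_hom (D k) colim"
    by (simp add: sg_hom_def kap_def hom_def)
  have "(THE Z. \<exists>k\<in>Obj J. Z = e.cls k \<one>\<^bsub>SGe (D k)\<^esub>) = e.cls k \<one>\<^bsub>SGe (D k)\<^esub>"
    by (rule the_equality) (use k cls_one(1) in blast)+
  then show "fst (kap k) \<one>\<^bsub>SGe (D k)\<^esub> = \<one>\<^bsub>SGe colim\<^esub>"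
    by (simp add: kap_def colim_def)
  have "(THE Z. \<exists>k\<in>Obj J. Z = ee.cls k \<one>\<^bsub>SGee (D k)\<^esub>) = ee.cls k \<one>\<^bsub>SGee (D k)\<^esub>"
    by (rule the_equality) (use k cls_one(2) in blast)+
  then show "snd (kap k) \<one>\<^bsub>SGee (D k)\<^esub> = \<one>\<^bsub>SGee colim\<^esub>"
    by (simp add: kap_def colim_def)
qed

text \<open>An upper bound of finitely many indices carries all representatives. In this form the
  square groups \<open>D k\<close> cover \<open>colim\<close> as required by
  \<open>square_groupI_cover\<close>.\<close>

lemma colim_common:
  assumes "finite X" "X \<subseteq> carrier (SGe colim)" "finite Y" "Y \<subseteq> carrier (SGee colim)"
  shows "\<exists>k\<in>Obj J. X \<subseteq> fst (kap k) ` carrier (SGe (D k)) \<and> Y \<subseteq> snd (kap k) ` carrier (SGee (D k))"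
proof -
  have "\<forall>x\<in>X. \<exists>i. \<exists>y. i \<in> Obj J \<and> y \<in> carrier (SGe (D i)) \<and> x = e.cls i y"
    using assms(2) by (simp add: colim_def) blast
  then obtain i y where iy: "\<And>x. x \<in> X \<Longrightarrow> i x \<in> Obj J" "\<And>x. x \<in> X \<Longrightarrow> y x \<in> carrier (SGe (D (i x)))"
    "\<And>x. x \<in> X \<Longrightarrow> x = e.cls (i x) (y x)"
    by metis
  have "\<forall>a\<in>Y. \<exists>i. \<exists>y. i \<in> Obj J \<and> y \<in> carrier (SGee (D i)) \<and> a = ee.cls i y"
    using assms(4) by (simp add: colim_def) blast
  then obtain j b where jb: "\<And>a. a \<in> Y \<Longrightarrow> j a \<in> Obj J" "\<And>a. a \<in> Y \<Longrightarrow> b a \<in> carrier (SGee (D (j a)))"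
    "\<And>a. a \<in> Y \<Longrightarrow> a = ee.cls (j a) (b a)"
    by metis
  have fin: "finite (i ` X \<union> j ` Y)" and sub: "i ` X \<union> j ` Y \<subseteq> Obj J"
    using assms(1,3) iy(1) jb(1) by blast+
  from e.upper_bound[OF fin sub] obtain k where
    k: "k \<in> Obj J" "\<forall>l\<in>i ` X \<union> j ` Y. \<exists>f\<in>Arr J. Dom J f = l \<and> Cod J f = k"
    by (rule bexE)
  have "x \<in> fst (kap k) ` carrier (SGe (D k))" if x: "x \<in> X" for x
  proof -
    obtain f where f: "f \<in> Arr J" "Dom J f = i x" "Cod J f = k" using bspec[OF k(2), of "i x"] x by blast
    have "e.cls k (fst (F f) (y x)) = x"
      using e.cls_move[of f "y x"] f iy(2)[OF x] iy(3)[OF x, symmetric] by simp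
    moreover have "fst (F f) (y x) \<in> carrier (SGe (D k))" using e.t_closed[of f "y x"] f iy(2)[OF x] by simp
    ultimately show ?thesis unfolding kap_def fst_conv by (metis imageI)
  qed
  moreover have "a \<in> snd (kap k) ` carrier (SGee (D k))" if a: "a \<in> Y" for a
  proof -
    obtain f where f: "f \<in> Arr J" "Dom J f = j a" "Cod J f = k" using bspec[OF k(2), of "j a"] a by blast
    have "ee.cls k (snd (F f) (b a)) = a"
      using ee.cls_move[of f "b a"] f jb(2)[OF a] jb(3)[OF a, symmetric] by simp
    moreover have "snd (F f) (b a) \<in> carrier (SGee (D k))" using ee.t_closed[of f "b a"] f jb(2)[OF a] by simp
    ultimately show ?thesis unfolding kap_def snd_conv by (metis imageI)
  qed
  ultimately show ?thesis using k(1) by blast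
qed

lemma square_group_colim: "square_group colim"
proof (rule square_groupI_cover)
  obtain i where i: "i \<in> Obj J" using filtered by (auto simp: filtered_category_def)
  interpret D: square_group "D i" by (rule square[OF i])
  show "carrier (SGe colim) \<noteq> {}" "carrier (SGee colim) \<noteq> {}"
    using sg_homD(5,6)[OF kap_hom(1)[OF i]] D.e.one_closed D.ee.one_closed by blast+
  show "\<exists>(D' :: ('c, 'd) square) f. square_group D' \<and> f \<in> sg_hom D' colim \<and>
      fst f \<one>\<^bsub>SGe D'\<^esub> = \<one>\<^bsub>SGe colim\<^esub> \<and> snd f \<one>\<^bsub>SGee D'\<^esub> = \<one>\<^bsub>SGee colim\<^esub> \<and>
      {x, y, z} \<subseteq> fst f ` carrier (SGe D') \<and> {a, b, c} \<subseteq> snd f ` carrier (SGee D')"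
    if X: "{x, y, z} \<subseteq> carrier (SGe colim)" and Y: "{a, b, c} \<subseteq> carrier (SGee colim)" for x y z a b c
  proof -
    obtain k where k: "k \<in> Obj J" "{x, y, z} \<subseteq> fst (kap k) ` carrier (SGe (D k))"
      "{a, b, c} \<subseteq> snd (kap k) ` carrier (SGee (D k))"
      using colim_common[OF _ X _ Y] by auto
    show ?thesis
      by (rule exI[of _ "D k"], rule exI[of _ "kap k"])
        (use k(2,3) square[OF k(1)] kap_hom[OF k(1)] in simp)
  qed
qed

lemma colim_cocone: "sg_cocone J D F colim kap"
  unfolding sg_cocone_def using square_group_colim kap_hom(1)
  by (auto simp: sg_eq_def sg_comp_def kap_def e.cls_move ee.cls_move)

end

section \<open>Cocones: joint surjectivity and equality of representatives\<close>

locale filtered_cocone = filtered_diagram +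
  fixes C \<iota>
  assumes cocone: "sg_cocone J D F C \<iota>"
begin

lemma C_square: "square_group C"
  and \<iota>_hom: "i \<in> Obj J \<Longrightarrow> \<iota> i \<in> sg_hom (D i) C"
  and \<iota>_F: "m \<in> Arr J \<Longrightarrow> sg_eq (D (Dom J m)) (sg_comp (\<iota> (Cod J m)) (F m)) (\<iota> (Dom J m))"
  using cocone by (auto simp: sg_cocone_def)

sublocale C: square_group C by (rule C_square)

definition Ue where "Ue = (\<Union>i\<in>Obj J. fst (\<iota> i) ` carrier (SGe (D i)))"
definition Uee where "Uee = (\<Union>i\<in>Obj J. snd (\<iota> i) ` carrier (SGee (D i)))"

lemma move_e: "m \<in> Arr J \<Longrightarrow> x \<in> carrier (SGe (D (Dom J m))) \<Longrightarrow> fst (\<iota> (Cod J m)) (fst (F m) x) = fst (\<iota> (Dom J m)) x"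
  and move_ee: "m \<in> Arr J \<Longrightarrow> a \<in> carrier (SGee (D (Dom J m))) \<Longrightarrow> snd (\<iota> (Cod J m)) (snd (F m) a) = snd (\<iota> (Dom J m)) a"
  using \<iota>_F by (auto simp: sg_eq_def sg_comp_def)

lemma common:
  assumes "finite X" "X \<subseteq> Ue" "finite Y" "Y \<subseteq> Uee"
  shows "\<exists>k\<in>Obj J. X \<subseteq> fst (\<iota> k) ` carrier (SGe (D k)) \<and> Y \<subseteq> snd (\<iota> k) ` carrier (SGee (D k))"
proof -
  have "\<forall>x\<in>X. \<exists>i. \<exists>y. i \<in> Obj J \<and> y \<in> carrier (SGe (D i)) \<and> x = fst (\<iota> i) y"
    using assms(2) unfolding Ue_def by blast
  then obtain i y where iy: "\<And>x. x \<in> X \<Longrightarrow> i x \<in> Obj J" "\<And>x. x \<in> X \<Longrightarrow> y x \<in> carrier (SGe (D (i x)))"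
    "\<And>x. x \<in> X \<Longrightarrow> x = fst (\<iota> (i x)) (y x)"
    by metis
  have "\<forall>a\<in>Y. \<exists>i. \<exists>y. i \<in> Obj J \<and> y \<in> carrier (SGee (D i)) \<and> a = snd (\<iota> i) y"
    using assms(4) unfolding Uee_def by blast
  then obtain j b where jb: "\<And>a. a \<in> Y \<Longrightarrow> j a \<in> Obj J" "\<And>a. a \<in> Y \<Longrightarrow> b a \<in> carrier (SGee (D (j a)))"
    "\<And>a. a \<in> Y \<Longrightarrow> a = snd (\<iota> (j a)) (b a)"
    by metis
  have fin: "finite (i ` X \<union> j ` Y)" and sub: "i ` X \<union> j ` Y \<subseteq> Obj J"
    using assms(1,3) iy(1) jb(1) by blast+
  from e.upper_bound[OF fin sub] obtain k where
    k: "k \<in> Obj J" "\<forall>l\<in>i ` X \<union> j ` Y. \<exists>f\<in>Arr J. Dom J f = l \<and> Cod J f = k"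
    by (rule bexE)
  have "x \<in> fst (\<iota> k) ` carrier (SGe (D k))" if x: "x \<in> X" for x
  proof -
    obtain f where f: "f \<in> Arr J" "Dom J f = i x" "Cod J f = k" using bspec[OF k(2), of "i x"] x by blast
    have "fst (\<iota> k) (fst (F f) (y x)) = x"
      using move_e[of f "y x"] f iy(2)[OF x] iy(3)[OF x, symmetric] by simp
    moreover have "fst (F f) (y x) \<in> carrier (SGe (D k))" using e.t_closed[of f "y x"] f iy(2)[OF x] by simp
    ultimately show ?thesis by (metis imageI)
  qed
  moreover have "a \<in> snd (\<iota> k) ` carrier (SGee (D k))" if a: "a \<in> Y" for a
  proof -
    obtain f where f: "f \<in> Arr J" "Dom J f = j a" "Cod J f = k" using bspec[OF k(2), of "j a"] a by blast
    have "snd (\<iota> k) (snd (F f) (b a)) = a"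
      using move_ee[of f "b a"] f jb(2)[OF a] jb(3)[OF a, symmetric] by simp
    moreover have "snd (F f) (b a) \<in> carrier (SGee (D k))" using ee.t_closed[of f "b a"] f jb(2)[OF a] by simp
    ultimately show ?thesis by (metis imageI)
  qed
  ultimately show ?thesis using k(1) by blast
qed

lemma \<iota>_square_hom: "i \<in> Obj J \<Longrightarrow> square_group_hom (D i) C (\<iota> i)"
  by (intro square_group_homI square C_square \<iota>_hom)

lemma UeI: "i \<in> Obj J \<Longrightarrow> y \<in> carrier (SGe (D i)) \<Longrightarrow> fst (\<iota> i) y \<in> Ue"
  and UeeI: "i \<in> Obj J \<Longrightarrow> b \<in> carrier (SGee (D i)) \<Longrightarrow> snd (\<iota> i) b \<in> Uee"
  unfolding Ue_def Uee_def by blast+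

lemma Ue_subgroup: "subgroup Ue (SGe C)"
proof (rule C.e.subgroupI)
  obtain i where i: "i \<in> Obj J" using filtered by (auto simp: filtered_category_def)
  interpret D: square_group "D i" by (rule square[OF i])
  show "Ue \<noteq> {}" unfolding Ue_def using i D.e.one_closed by blast
  show "Ue \<subseteq> carrier (SGe C)" unfolding Ue_def using sg_homD(5)[OF \<iota>_hom] by blast
  show "inv\<^bsub>SGe C\<^esub> x \<in> Ue" if x: "x \<in> Ue" for x
  proof -
    obtain j y where j: "j \<in> Obj J" "y \<in> carrier (SGe (D j))" "x = fst (\<iota> j) y" using x by (auto simp: Ue_def)
    interpret j: square_group_hom "D j" C "\<iota> j" by (rule \<iota>_square_hom[OF j(1)])
    have "inv\<^bsub>SGe C\<^esub> x = fst (\<iota> j) (inv\<^bsub>SGe (D j)\<^esub> y)" using j by simp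
    then show ?thesis using UeI[OF j(1) j.M.e.inv_closed[OF j(2)]] by (simp only:)
  qed
  show "x \<otimes>\<^bsub>SGe C\<^esub> y \<in> Ue" if xy: "x \<in> Ue" "y \<in> Ue" for x y
  proof -
    obtain j where "j \<in> Obj J" "{x, y} \<subseteq> fst (\<iota> j) ` carrier (SGe (D j))"
      using common[of "{x, y}" "{}"] xy by auto
    then obtain x' y' where j: "j \<in> Obj J" "x' \<in> carrier (SGe (D j))" "x = fst (\<iota> j) x'"
      "y' \<in> carrier (SGe (D j))" "y = fst (\<iota> j) y'" by auto
    interpret j: square_group_hom "D j" C "\<iota> j" by (rule \<iota>_square_hom[OF j(1)])
    have "x \<otimes>\<^bsub>SGe C\<^esub> y = fst (\<iota> j) (x' \<otimes>\<^bsub>SGe (D j)\<^esub> y')" using j by simp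
    then show ?thesis using UeI[OF j(1) j.M.e.m_closed[OF j(2,4)]] by (simp only:)
  qed
qed

lemma Uee_subgroup: "subgroup Uee (SGee C)"
proof (rule C.ee.subgroupI)
  obtain i where i: "i \<in> Obj J" using filtered by (auto simp: filtered_category_def)
  interpret D: square_group "D i" by (rule square[OF i])
  show "Uee \<noteq> {}" unfolding Uee_def using i D.ee.one_closed by blast
  show "Uee \<subseteq> carrier (SGee C)" unfolding Uee_def using sg_homD(6)[OF \<iota>_hom] by blast
  show "inv\<^bsub>SGee C\<^esub> x \<in> Uee" if x: "x \<in> Uee" for x
  proof -
    obtain j y where j: "j \<in> Obj J" "y \<in> carrier (SGee (D j))" "x = snd (\<iota> j) y" using x by (auto simp: Uee_def)
    interpret j: square_group_hom "D j" C "\<iota> j" by (rule \<iota>_square_hom[OF j(1)])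
    have "inv\<^bsub>SGee C\<^esub> x = snd (\<iota> j) (inv\<^bsub>SGee (D j)\<^esub> y)" using j by simp
    then show ?thesis using UeeI[OF j(1) j.M.ee.inv_closed[OF j(2)]] by (simp only:)
  qed
  show "x \<otimes>\<^bsub>SGee C\<^esub> y \<in> Uee" if xy: "x \<in> Uee" "y \<in> Uee" for x y
  proof -
    obtain j where "j \<in> Obj J" "{x, y} \<subseteq> snd (\<iota> j) ` carrier (SGee (D j))"
      using common[of "{}" "{x, y}"] xy by auto
    then obtain x' y' where j: "j \<in> Obj J" "x' \<in> carrier (SGee (D j))" "x = snd (\<iota> j) x'"
      "y' \<in> carrier (SGee (D j))" "y = snd (\<iota> j) y'" by auto
    interpret j: square_group_hom "D j" C "\<iota> j" by (rule \<iota>_square_hom[OF j(1)])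
    have "x \<otimes>\<^bsub>SGee C\<^esub> y = snd (\<iota> j) (x' \<otimes>\<^bsub>SGee (D j)\<^esub> y')" using j by simp
    then show ?thesis using UeeI[OF j(1) j.M.ee.m_closed[OF j(2,4)]] by (simp only:)
  qed
qed

lemma U_HP: "x \<in> Ue \<Longrightarrow> SGH C x \<in> Uee" "a \<in> Uee \<Longrightarrow> SGP C a \<in> Ue"
proof -
  assume "x \<in> Ue"
  then obtain j y where j: "j \<in> Obj J" "y \<in> carrier (SGe (D j))" "x = fst (\<iota> j) y" by (auto simp: Ue_def)
  interpret j: square_group_hom "D j" C "\<iota> j" by (rule \<iota>_square_hom[OF j(1)])
  have "SGH C x = snd (\<iota> j) (SGH (D j) y)" using j by simp
  then show "SGH C x \<in> Uee" using UeeI[OF j(1) j.M.H.f_closed[OF j(2)]] by (simp only:)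
next
  assume "a \<in> Uee"
  then obtain j y where j: "j \<in> Obj J" "y \<in> carrier (SGee (D j))" "a = snd (\<iota> j) y" by (auto simp: Uee_def)
  interpret j: square_group_hom "D j" C "\<iota> j" by (rule \<iota>_square_hom[OF j(1)])
  have "SGP C a = fst (\<iota> j) (SGP (D j) y)" using j by simp
  then show "SGP C a \<in> Ue" using UeI[OF j(1) j.M.P.hom_closed[OF j(2)]] by (simp only:)
qed

end

text \<open>The union of the images is a square group through which the cocone factors. The induced
  map from \<open>C\<close> into it, followed by the inclusion, is the identity by uniqueness, so
  the union is all of \<open>C\<close>. Only test objects with the types of \<open>C\<close> are
  used.\<close>

lemma filtered_cocone_surj:
  fixes C :: "('x, 'y) square"
  assumes fc: "filtered_cocone J D F C \<iota>" and c: "sg_colimit TYPE('x) TYPE('y) J D F C \<iota>"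
  shows "filtered_cocone.Ue J D \<iota> = carrier (SGe C)" and "filtered_cocone.Uee J D \<iota> = carrier (SGee C)"
proof -
  interpret filtered_cocone J D F C \<iota> by (rule fc)
  let ?R = "sg_restrict C Ue Uee"
  have sub: "Ue \<subseteq> carrier (SGe C)" "Uee \<subseteq> carrier (SGee C)"
    using Ue_subgroup Uee_subgroup by (auto dest: subgroup.subset)
  have R: "square_group ?R"
    by (rule C.square_group_restrict[OF Ue_subgroup Uee_subgroup U_HP])
  have "\<iota> i \<in> sg_hom (D i) ?R" if "i \<in> Obj J" for i
    using \<iota>_hom[OF that] UeI[OF that] UeeI[OF that] by (auto simp: sg_hom_def hom_def)
  then have "sg_cocone J D F ?R \<iota>"
    using R \<iota>_F by (simp add: sg_cocone_def)
  then obtain \<phi> where \<phi>: "\<phi> \<in> sg_hom C ?R" "\<forall>i\<in>Obj J. sg_eq (D i) (sg_comp \<phi> (\<iota> i)) (\<iota> i)"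
    using c unfolding sg_colimit_def by blast
  have \<phi>C: "\<phi> \<in> sg_hom C C"
    using \<phi>(1) sub by (auto simp: sg_hom_def hom_def Pi_iff)
  have "\<forall>i\<in>Obj J. sg_eq (D i) (sg_comp sg_id (\<iota> i)) (\<iota> i)"
    by (simp add: sg_eq_def sg_comp_def sg_id_def)
  moreover obtain \<psi> where "\<forall>\<theta>\<in>sg_hom C C. (\<forall>i\<in>Obj J. sg_eq (D i) (sg_comp \<theta> (\<iota> i)) (\<iota> i)) \<longrightarrow> sg_eq C \<theta> \<psi>"
    using c cocone unfolding sg_colimit_def by blast
  ultimately have "sg_eq C sg_id \<psi>" "sg_eq C \<phi> \<psi>"
    using \<phi>(2) \<phi>C sg_hom_id by blast+
  then have "sg_eq C \<phi> sg_id" by (simp add: sg_eq_def)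
  then have "x \<in> Ue" if "x \<in> carrier (SGe C)" for x
    using sg_homD(5)[OF \<phi>(1) that] that by (simp add: sg_eq_def sg_id_def)
  moreover have "a \<in> Uee" if "a \<in> carrier (SGee C)" for a
    using sg_homD(6)[OF \<phi>(1) that] that \<open>sg_eq C \<phi> sg_id\<close> by (simp add: sg_eq_def sg_id_def)
  ultimately show "Ue = carrier (SGe C)" "Uee = carrier (SGee C)" using sub by blast+
qed

text \<open>The standard colimit is one of the test objects. The map from \<open>C\<close> to it
  sends equal elements of \<open>C\<close> to equal classes, and equality of classes is
  \<open>eqv\<close>.\<close>

lemma filtered_cocone_eqv:
  fixes J :: "('i, 'm) small_cat" and D :: "'i \<Rightarrow> ('c, 'd) square"
  assumes fd: "filtered_diagram J D F"
    and c: "sg_colimit TYPE(('i \<times> 'c) set) TYPE(('i \<times> 'd) set) J D F C \<iota>"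
    and ij: "i \<in> Obj J" "j \<in> Obj J"
  shows "x \<in> carrier (SGe (D i)) \<Longrightarrow> y \<in> carrier (SGe (D j)) \<Longrightarrow> fst (\<iota> i) x = fst (\<iota> j) y \<Longrightarrow>
      filtered_sets.eqv J (\<lambda>m. fst (F m)) i x j y"
    and "a \<in> carrier (SGee (D i)) \<Longrightarrow> b \<in> carrier (SGee (D j)) \<Longrightarrow> snd (\<iota> i) a = snd (\<iota> j) b \<Longrightarrow>
      filtered_sets.eqv J (\<lambda>m. snd (F m)) i a j b"
proof -
  interpret filtered_diagram J D F by (rule fd)
  obtain \<phi> where \<phi>: "\<forall>i\<in>Obj J. sg_eq (D i) (sg_comp \<phi> (\<iota> i)) (kap i)"
    using c colim_cocone unfolding sg_colimit_def by blast
  show "e.eqv i x j y" if "x \<in> carrier (SGe (D i))" "y \<in> carrier (SGe (D j))" "fst (\<iota> i) x = fst (\<iota> j) y"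
  proof -
    have "fst \<phi> (fst (\<iota> i) x) = e.cls i x" "fst \<phi> (fst (\<iota> j) y) = e.cls j y"
      using bspec[OF \<phi> ij(1)] bspec[OF \<phi> ij(2)] that(1,2) by (simp_all add: sg_eq_def sg_comp_def kap_def)
    then have "e.cls i x = e.cls j y" using that(3) by simp
    then show ?thesis using that(1,2) ij e.cls_eq_iff by blast
  qed
  show "ee.eqv i a j b" if "a \<in> carrier (SGee (D i))" "b \<in> carrier (SGee (D j))" "snd (\<iota> i) a = snd (\<iota> j) b"
  proof -
    have "snd \<phi> (snd (\<iota> i) a) = ee.cls i a" "snd \<phi> (snd (\<iota> j) b) = ee.cls j b"
      using bspec[OF \<phi> ij(1)] bspec[OF \<phi> ij(2)] that(1,2) by (simp_all add: sg_eq_def sg_comp_def kap_def)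
    then have "ee.cls i a = ee.cls j b" using that(3) by simp
    then show ?thesis using that(1,2) ij ee.cls_eq_iff by blast
  qed
qed

section \<open>Filtered colimits under the tensor product\<close>

lemma (in filtered_cocone) tensor_cocone:
  assumes A: "square_group A"
  shows "filtered_cocone J (\<lambda>i. sg_tensor A (D i)) (\<lambda>m. sg_tensor_map A (D (Dom J m)) (D (Cod J m)) (F m))
    (sg_tensor A C) (\<lambda>i. sg_tensor_map A (D i) C (\<iota> i))"
proof -
  have sq: "square_group (sg_tensor A (D i))" if "i \<in> Obj J" for i
    by (intro square_tensor.tensor_square_group square_tensorI A square that)
  have sqC: "square_group (sg_tensor A C)"
    by (intro square_tensor.tensor_square_group square_tensorI A C_square)
  let ?F = "\<lambda>m. sg_tensor_map A (D (Dom J m)) (D (Cod J m)) (F m)"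
  have Fh: "?F m \<in> sg_hom (sg_tensor A (D (Dom J m))) (sg_tensor A (D (Cod J m)))" if "m \<in> Arr J" for m
    by (intro sg_tensor_map_hom A square F_hom e.dom_obj e.cod_obj that)
  have "sg_diagram J (\<lambda>i. sg_tensor A (D i)) ?F"
    unfolding sg_diagram_def
  proof (intro conjI ballI impI)
    fix i assume i: "i \<in> Obj J"
    note ide = e.ide[OF i]
    show "sg_eq (sg_tensor A (D i)) (?F (Ide J i)) sg_id"
      using sg_tensor_map_id[OF A square[OF i] _ F_id[OF i]] F_hom[of "Ide J i"] ide by simp
  next
    fix g f assume gf: "g \<in> Arr J" "f \<in> Arr J" "Dom J g = Cod J f"
    note cmp = e.cmp[OF gf]
    have sqs: "square_group (D (Dom J f))" "square_group (D (Cod J f))" "square_group (D (Cod J g))"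
      by (intro square e.dom_obj e.cod_obj gf)+
    have h: "F f \<in> sg_hom (D (Dom J f)) (D (Cod J f))" "F g \<in> sg_hom (D (Cod J f)) (D (Cod J g))"
      "F (Cmp J g f) \<in> sg_hom (D (Dom J f)) (D (Cod J g))"
      using F_hom[OF gf(1)] F_hom[OF gf(2)] F_hom[of "Cmp J g f"] cmp gf by auto
    have "sg_eq (sg_tensor A (D (Dom J f))) (sg_tensor_map A (D (Dom J f)) (D (Cod J g)) (F (Cmp J g f)))
      (sg_tensor_map A (D (Dom J f)) (D (Cod J g)) (sg_comp (F g) (F f)))"
      by (rule sg_tensor_map_cong[OF A sqs(1,3) h(3) sg_hom_comp[OF h(1,2)] F_comp[OF gf]])
    moreover have "sg_eq (sg_tensor A (D (Dom J f))) (sg_tensor_map A (D (Dom J f)) (D (Cod J g)) (sg_comp (F g) (F f)))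
      (sg_comp (sg_tensor_map A (D (Cod J f)) (D (Cod J g)) (F g)) (sg_tensor_map A (D (Dom J f)) (D (Cod J f)) (F f)))"
      by (rule sg_tensor_map_comp[OF A sqs h(1,2)])
    ultimately show "sg_eq (sg_tensor A (D (Dom J f))) (?F (Cmp J g f)) (sg_comp (?F g) (?F f))"
      using cmp gf by (simp add: sg_eq_def)
  qed (use sq Fh in auto)
  moreover have "sg_cocone J (\<lambda>i. sg_tensor A (D i)) ?F (sg_tensor A C) (\<lambda>i. sg_tensor_map A (D i) C (\<iota> i))"
    unfolding sg_cocone_def
  proof (intro conjI ballI sqC)
    show "sg_tensor_map A (D i) C (\<iota> i) \<in> sg_hom (sg_tensor A (D i)) (sg_tensor A C)" if "i \<in> Obj J" for i
      by (intro sg_tensor_map_hom A square C_square \<iota>_hom that)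
    fix m assume m: "m \<in> Arr J"
    have sqs: "square_group (D (Dom J m))" "square_group (D (Cod J m))" and ih: "\<iota> (Cod J m) \<in> sg_hom (D (Cod J m)) C"
      "\<iota> (Dom J m) \<in> sg_hom (D (Dom J m)) C"
      by (intro square \<iota>_hom e.dom_obj e.cod_obj m)+
    have "sg_eq (sg_tensor A (D (Dom J m))) (sg_tensor_map A (D (Dom J m)) C (sg_comp (\<iota> (Cod J m)) (F m)))
      (sg_tensor_map A (D (Dom J m)) C (\<iota> (Dom J m)))"
      by (rule sg_tensor_map_cong[OF A sqs(1) C_square sg_hom_comp[OF F_hom[OF m] ih(1)] ih(2) \<iota>_F[OF m]])
    moreover have "sg_eq (sg_tensor A (D (Dom J m))) (sg_tensor_map A (D (Dom J m)) C (sg_comp (\<iota> (Cod J m)) (F m)))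
      (sg_comp (sg_tensor_map A (D (Cod J m)) C (\<iota> (Cod J m))) (?F m))"
      by (rule sg_tensor_map_comp[OF A sqs C_square F_hom[OF m] ih(1)])
    ultimately show "sg_eq (sg_tensor A (D (Dom J m))) (sg_comp (sg_tensor_map A (D (Cod J m)) C (\<iota> (Cod J m))) (?F m))
      (sg_tensor_map A (D (Dom J m)) C (\<iota> (Dom J m)))"
      by (simp add: sg_eq_def)
  qed
  ultimately show ?thesis
    using filtered by (simp add: filtered_cocone_def filtered_cocone_axioms_def filtered_diagram_def)
qed

text \<open>The universal property is checked directly against an arbitrary cocone \<open>X\<close>:
  generators over \<open>C\<close> are sent where their representatives go at some index. The two
  hypotheses on \<open>C\<close> enter through \<open>surj\<close> and \<open>inj\<close>, so the
  types of the test objects in the conclusion are free.\<close>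

theorem tensor_filtered_colimit:
  fixes A :: "('a, 'b) square" and J :: "('i, 'm) small_cat" and D :: "'i \<Rightarrow> ('c, 'd) square"
    and C :: "('x, 'y) square"
  assumes A: "square_group A" and fil: "filtered_category J" and dia: "sg_diagram J D F"
    and c1: "sg_colimit TYPE('x) TYPE('y) J D F C \<iota>"
    and c2: "sg_colimit TYPE(('i \<times> 'c) set) TYPE(('i \<times> 'd) set) J D F C \<iota>"
  shows "sg_colimit TYPE('u) TYPE('v) J (\<lambda>i. sg_tensor A (D i))
    (\<lambda>m. sg_tensor_map A (D (Dom J m)) (D (Cod J m)) (F m)) (sg_tensor A C) (\<lambda>i. sg_tensor_map A (D i) C (\<iota> i))"
proof -
  have fd: "filtered_diagram J D F" using fil dia by (simp add: filtered_diagram_def)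
  have co: "sg_cocone J D F C \<iota>" using c1 by (simp add: sg_colimit_def)
  interpret fc: filtered_cocone J D F C \<iota>
    by (rule filtered_cocone.intro[OF fd filtered_cocone_axioms.intro[OF co]])
  note surj = filtered_cocone_surj[OF fc.filtered_cocone_axioms c1]
  note inj = filtered_cocone_eqv[OF fd c2]
  interpret T: filtered_cocone J "\<lambda>i. sg_tensor A (D i)" "\<lambda>m. sg_tensor_map A (D (Dom J m)) (D (Cod J m)) (F m)"
    "sg_tensor A C" "\<lambda>i. sg_tensor_map A (D i) C (\<iota> i)"
    by (rule fc.tensor_cocone[OF A])
  interpret S: square_tensor A C by (rule square_tensorI[OF A fc.C_square])
  let ?I = "\<lambda>i. sg_tensor_map A (D i) C (\<iota> i)" and ?F = "\<lambda>m. sg_tensor_map A (D (Dom J m)) (D (Cod J m)) (F m)"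
  have SD: "square_tensor A (D i)" if "i \<in> Obj J" for i by (intro square_tensorI A fc.square that)
  have I_circ: "fst (?I i) (circ A (D i) x y) = circ A C x (fst (\<iota> i) y)"
    if "i \<in> Obj J" "x \<in> carrier (SGe A)" "y \<in> carrier (SGe (D i))" for i x y
    by (rule sg_tensor_map_circ[OF A fc.square[OF that(1)] fc.C_square fc.\<iota>_hom[OF that(1)] that(2,3)])
  have I_bar: "fst (?I i) (bar A (D i) a b) = bar A C a (snd (\<iota> i) b)"
    if "i \<in> Obj J" "a \<in> carrier (SGee A)" "b \<in> carrier (SGee (D i))" for i a b
    by (rule sg_tensor_map_bar[OF A fc.square[OF that(1)] fc.C_square fc.\<iota>_hom[OF that(1)] that(2,3)])
  have I_pure: "snd (?I i) (pure A (D i) a b) = pure A C a (snd (\<iota> i) b)"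
    if "i \<in> Obj J" "a \<in> carrier (SGee A)" "b \<in> carrier (SGee (D i))" for i a b
    by (rule sg_tensor_map_pure[OF A fc.square[OF that(1)] fc.C_square fc.\<iota>_hom[OF that(1)] that(2,3)])
  have rep_e: "\<exists>i\<in>Obj J. \<exists>y\<in>carrier (SGe (D i)). c = fst (\<iota> i) y" if "c \<in> carrier (SGe C)" for c
    using that unfolding surj(1)[symmetric] fc.Ue_def by blast
  have rep_ee: "\<exists>i\<in>Obj J. \<exists>y\<in>carrier (SGee (D i)). c = snd (\<iota> i) y" if "c \<in> carrier (SGee C)" for c
    using that unfolding surj(2)[symmetric] fc.Uee_def by blast
  have Tsurj_e: "T.Ue = carrier (tensor_e A C)"
  proof
    show "T.Ue \<subseteq> carrier (tensor_e A C)" using subgroup.subset[OF T.Ue_subgroup] by simp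
    have "S.gen_set \<subseteq> T.Ue"
    proof
      fix s assume "s \<in> S.gen_set"
      then show "s \<in> T.Ue"
      proof (cases rule: S.gen_set_cases)
        case (circ x c)
        obtain i y where i: "i \<in> Obj J" "y \<in> carrier (SGe (D i))" "c = fst (\<iota> i) y" using rep_e[OF circ(2)] by blast
        interpret Di: square_tensor A "D i" by (rule SD[OF i(1)])
        show ?thesis
          using T.UeI[OF i(1), of "circ A (D i) x y"] circ i by (simp add: I_circ)
      next
        case (bar a c)
        obtain i y where i: "i \<in> Obj J" "y \<in> carrier (SGee (D i))" "c = snd (\<iota> i) y" using rep_ee[OF bar(2)] by blast
        interpret Di: square_tensor A "D i" by (rule SD[OF i(1)])
        show ?thesis
          using T.UeI[OF i(1), of "bar A (D i) a y"] bar i by (simp add: I_bar)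
      qed
    qed
    from subgroup_generate_incl[OF S.E.is_group _ this] T.Ue_subgroup
    show "carrier (tensor_e A C) \<subseteq> T.Ue" unfolding S.carrier_generate by auto
  qed
  have Tsurj_ee: "T.Uee = carrier (tensor_ee A C)"
  proof
    show "T.Uee \<subseteq> carrier (tensor_ee A C)" using subgroup.subset[OF T.Uee_subgroup] by simp
    let ?S = "{pure A C a b |a b. a \<in> carrier (SGee A) \<and> b \<in> carrier (SGee C)}"
    have "pure A C a c \<in> T.Uee" if a: "a \<in> carrier (SGee A)" and c: "c \<in> carrier (SGee C)" for a c
    proof -
      obtain i y where i: "i \<in> Obj J" "y \<in> carrier (SGee (D i))" "c = snd (\<iota> i) y" using rep_ee[OF c] by blast
      interpret Di: square_tensor A "D i" by (rule SD[OF i(1)])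
      show ?thesis
        using T.UeeI[OF i(1), of "pure A (D i) a y"] a i by (simp add: I_pure)
    qed
    then have "?S \<subseteq> T.Uee" by blast
    from subgroup_generate_incl[OF S.EE.is_group _ this] T.Uee_subgroup
    show "carrier (tensor_ee A C) \<subseteq> T.Uee" unfolding S.ee_carrier_generate by auto
  qed
  have Trep_e: "\<exists>i\<in>Obj J. \<exists>v\<in>carrier (tensor_e A (D i)). w = fst (?I i) v" if "w \<in> carrier (tensor_e A C)" for w
    using that unfolding Tsurj_e[symmetric] T.Ue_def sg_tensor_simps by blast
  have Trep_ee: "\<exists>i\<in>Obj J. \<exists>v\<in>carrier (tensor_ee A (D i)). w = snd (?I i) v" if "w \<in> carrier (tensor_ee A C)" for w
    using that unfolding Tsurj_ee[symmetric] T.Uee_def sg_tensor_simps by blast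
  have univ: "\<exists>\<phi>\<in>sg_hom (sg_tensor A C) X. (\<forall>i\<in>Obj J. sg_eq (sg_tensor A (D i)) (sg_comp \<phi> (?I i)) (\<tau> i)) \<and>
     (\<forall>\<psi>\<in>sg_hom (sg_tensor A C) X. (\<forall>i\<in>Obj J. sg_eq (sg_tensor A (D i)) (sg_comp \<psi> (?I i)) (\<tau> i)) \<longrightarrow> sg_eq (sg_tensor A C) \<psi> \<phi>)"
    if X: "sg_cocone J (\<lambda>i. sg_tensor A (D i)) ?F X \<tau>" for X :: "('u, 'v) square" and \<tau>
  proof -
    interpret X: filtered_cocone J "\<lambda>i. sg_tensor A (D i)" ?F X \<tau>
      by (rule filtered_cocone.intro[OF T.filtered_diagram_axioms filtered_cocone_axioms.intro[OF X]])
    note th = X.\<iota>_hom and tm = X.move_e X.move_ee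
    \<comment> \<open>Two representatives of one element of \<open>C\<close> become equal further
      along the diagram, and the maps \<open>\<tau>\<close> do not change under transition.\<close>
    have teq_circ: "fst (\<tau> i) (circ A (D i) x y) = fst (\<tau> j) (circ A (D j) x z)"
      if ij: "i \<in> Obj J" "j \<in> Obj J" and x: "x \<in> carrier (SGe A)" and y: "y \<in> carrier (SGe (D i))"
        and z: "z \<in> carrier (SGe (D j))" and eq: "fst (\<iota> i) y = fst (\<iota> j) z" for i j x y z
    proof -
      obtain f g where fg: "f \<in> Arr J" "g \<in> Arr J" "Dom J f = i" "Dom J g = j" "Cod J f = Cod J g"
        "fst (F f) y = fst (F g) z"
        using inj(1)[OF ij y z eq] unfolding fc.e.eqv_def by blast
      interpret Di: square_tensor A "D i" by (rule SD[OF ij(1)])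
      interpret Dj: square_tensor A "D j" by (rule SD[OF ij(2)])
      have k: "Cod J f \<in> Obj J" by (rule fc.e.cod_obj[OF fg(1)])
      have "fst (\<tau> i) (circ A (D i) x y) = fst (\<tau> (Cod J f)) (circ A (D (Cod J f)) x (fst (F f) y))"
        using X.move_e[OF fg(1), of "circ A (D i) x y"]
          sg_tensor_map_circ[OF A fc.square[OF ij(1)] fc.square[OF k] fc.F_hom[OF fg(1), unfolded fg(3)] x y]
          fg x y by simp
      moreover have "fst (\<tau> j) (circ A (D j) x z) = fst (\<tau> (Cod J g)) (circ A (D (Cod J g)) x (fst (F g) z))"
        using X.move_e[OF fg(2), of "circ A (D j) x z"]
          sg_tensor_map_circ[OF A fc.square[OF ij(2)] fc.square[OF k[unfolded fg(5)]] fc.F_hom[OF fg(2), unfolded fg(4)] x z]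
          fg x z by simp
      ultimately show ?thesis using fg(5,6) by simp
    qed
    have teq_bar: "fst (\<tau> i) (bar A (D i) a y) = fst (\<tau> j) (bar A (D j) a z) \<and>
        snd (\<tau> i) (pure A (D i) a y) = snd (\<tau> j) (pure A (D j) a z)"
      if ij: "i \<in> Obj J" "j \<in> Obj J" and x: "a \<in> carrier (SGee A)" and y: "y \<in> carrier (SGee (D i))"
        and z: "z \<in> carrier (SGee (D j))" and eq: "snd (\<iota> i) y = snd (\<iota> j) z" for i j a y z
    proof -
      obtain f g where fg: "f \<in> Arr J" "g \<in> Arr J" "Dom J f = i" "Dom J g = j" "Cod J f = Cod J g"
        "snd (F f) y = snd (F g) z"
        using inj(2)[OF ij y z eq] unfolding fc.ee.eqv_def by blast
      interpret Di: square_tensor A "D i" by (rule SD[OF ij(1)])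
      interpret Dj: square_tensor A "D j" by (rule SD[OF ij(2)])
      have k: "Cod J f \<in> Obj J" by (rule fc.e.cod_obj[OF fg(1)])
      have "fst (\<tau> i) (bar A (D i) a y) = fst (\<tau> (Cod J f)) (bar A (D (Cod J f)) a (snd (F f) y)) \<and>
        snd (\<tau> i) (pure A (D i) a y) = snd (\<tau> (Cod J f)) (pure A (D (Cod J f)) a (snd (F f) y))"
        using X.move_e[OF fg(1), of "bar A (D i) a y"] X.move_ee[OF fg(1), of "pure A (D i) a y"]
          sg_tensor_map_bar[OF A fc.square[OF ij(1)] fc.square[OF k] fc.F_hom[OF fg(1), unfolded fg(3)] x y]
          sg_tensor_map_pure[OF A fc.square[OF ij(1)] fc.square[OF k] fc.F_hom[OF fg(1), unfolded fg(3)] x y]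
          fg x y by simp
      moreover have "fst (\<tau> j) (bar A (D j) a z) = fst (\<tau> (Cod J g)) (bar A (D (Cod J g)) a (snd (F g) z)) \<and>
        snd (\<tau> j) (pure A (D j) a z) = snd (\<tau> (Cod J g)) (pure A (D (Cod J g)) a (snd (F g) z))"
        using X.move_e[OF fg(2), of "bar A (D j) a z"] X.move_ee[OF fg(2), of "pure A (D j) a z"]
          sg_tensor_map_bar[OF A fc.square[OF ij(2)] fc.square[OF k[unfolded fg(5)]] fc.F_hom[OF fg(2), unfolded fg(4)] x z]
          sg_tensor_map_pure[OF A fc.square[OF ij(2)] fc.square[OF k[unfolded fg(5)]] fc.F_hom[OF fg(2), unfolded fg(4)] x z]
          fg x z by simp
      ultimately show ?thesis using fg(5,6) by simp
    qed
    \<comment> \<open>The order of quantifiers matters: one function of x serves all representatives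
      of c, so a value can be chosen for each c alone.\<close>
    have "\<exists>v. \<forall>x\<in>carrier (SGe A). \<forall>i\<in>Obj J. \<forall>y\<in>carrier (SGe (D i)). c = fst (\<iota> i) y \<longrightarrow> v x = fst (\<tau> i) (circ A (D i) x y)"
      if "c \<in> carrier (SGe C)" for c
    proof -
      obtain i y where "i \<in> Obj J" "y \<in> carrier (SGe (D i))" "c = fst (\<iota> i) y" using rep_e[OF \<open>c \<in> _\<close>] by blast
      then show ?thesis
        by (intro exI[of _ "\<lambda>x. fst (\<tau> i) (circ A (D i) x y)"] ballI impI, intro teq_circ) simp_all
    qed
    then obtain fc' where fc': "\<And>c x i y. c \<in> carrier (SGe C) \<Longrightarrow> x \<in> carrier (SGe A) \<Longrightarrow> i \<in> Obj J \<Longrightarrow>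
        y \<in> carrier (SGe (D i)) \<Longrightarrow> c = fst (\<iota> i) y \<Longrightarrow> fc' c x = fst (\<tau> i) (circ A (D i) x y)"
      by metis
    have "\<exists>v. \<forall>a\<in>carrier (SGee A). \<forall>i\<in>Obj J. \<forall>y\<in>carrier (SGee (D i)). c = snd (\<iota> i) y \<longrightarrow>
        fst v a = fst (\<tau> i) (bar A (D i) a y) \<and> snd v a = snd (\<tau> i) (pure A (D i) a y)"
      if "c \<in> carrier (SGee C)" for c
    proof -
      obtain i y where "i \<in> Obj J" "y \<in> carrier (SGee (D i))" "c = snd (\<iota> i) y" using rep_ee[OF \<open>c \<in> _\<close>] by blast
      then show ?thesis
        by (intro exI[of _ "(\<lambda>a. fst (\<tau> i) (bar A (D i) a y), \<lambda>a. snd (\<tau> i) (pure A (D i) a y))"] ballI impI,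
          unfold fst_conv snd_conv, intro teq_bar) simp_all
    qed
    then obtain fb' where fb': "\<And>c a i y. c \<in> carrier (SGee C) \<Longrightarrow> a \<in> carrier (SGee A) \<Longrightarrow> i \<in> Obj J \<Longrightarrow>
        y \<in> carrier (SGee (D i)) \<Longrightarrow> c = snd (\<iota> i) y \<Longrightarrow>
        fst (fb' c) a = fst (\<tau> i) (bar A (D i) a y) \<and> snd (fb' c) a = snd (\<tau> i) (pure A (D i) a y)"
      by metis
    define gc where "gc x c = fc' c x" for x c
    define gb where "gb a c = fst (fb' c) a" for a c
    define gp where "gp a c = snd (fb' c) a" for a c
    have gc: "gc x (fst (\<iota> i) y) = fst (\<tau> i) (circ A (D i) x y)"
      if "x \<in> carrier (SGe A)" "i \<in> Obj J" "y \<in> carrier (SGe (D i))" for x i y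
      unfolding gc_def using fc'[OF sg_homD(5)[OF fc.\<iota>_hom[OF that(2)] that(3)] that HOL.refl] .
    have gb: "gb a (snd (\<iota> i) y) = fst (\<tau> i) (bar A (D i) a y)"
      and gp: "gp a (snd (\<iota> i) y) = snd (\<tau> i) (pure A (D i) a y)"
      if "a \<in> carrier (SGee A)" "i \<in> Obj J" "y \<in> carrier (SGee (D i))" for a i y
      unfolding gb_def gp_def using fb'[OF sg_homD(6)[OF fc.\<iota>_hom[OF that(2)] that(3)] that HOL.refl] by simp_all
    \<comment> \<open>A relation of the presentation over \<open>C\<close> involves at most two
      elements of each level of \<open>C\<close>. Moved to one index i, it becomes a relation that
      holds in \<open>sg_tensor A (D i)\<close>.\<close>
    have rep: "\<exists>i\<in>Obj J. \<exists>y\<in>carrier (SGe (D i)). \<exists>y'\<in>carrier (SGe (D i)). \<exists>b\<in>carrier (SGee (D i)). \<exists>b'\<in>carrier (SGee (D i)).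
        c = fst (\<iota> i) y \<and> c' = fst (\<iota> i) y' \<and> d = snd (\<iota> i) b \<and> d' = snd (\<iota> i) b'"
      if c: "c \<in> carrier (SGe C)" "c' \<in> carrier (SGe C)" "d \<in> carrier (SGee C)" "d' \<in> carrier (SGee C)" for c c' d d'
    proof -
      obtain k where k: "k \<in> Obj J" "{c, c'} \<subseteq> fst (\<iota> k) ` carrier (SGe (D k))" "{d, d'} \<subseteq> snd (\<iota> k) ` carrier (SGee (D k))"
        using fc.common[of "{c, c'}" "{d, d'}"] c surj by auto
      then show ?thesis unfolding insert_subset image_iff by metis
    qed
    have one: "\<one>\<^bsub>SGe C\<^esub> \<in> carrier (SGe C)" "\<one>\<^bsub>SGee C\<^esub> \<in> carrier (SGee C)" by simp_all
    have "\<exists>h\<in>hom (tensor_e A C) (SGe X). (\<forall>x\<in>carrier (SGe A). \<forall>y\<in>carrier (SGe C). h (circ A C x y) = gc x y) \<and>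
      (\<forall>a\<in>carrier (SGee A). \<forall>b\<in>carrier (SGee C). h (bar A C a b) = gb a b)"
    proof -
      have all: "gc x c \<in> carrier (SGe X) \<and> gb a d \<in> carrier (SGe X) \<and>
          gb (a \<otimes>\<^bsub>SGee A\<^esub> a') d = gb a d \<otimes>\<^bsub>SGe X\<^esub> gb a' d \<and>
          gb a (d \<otimes>\<^bsub>SGee C\<^esub> d') = gb a d \<otimes>\<^bsub>SGe X\<^esub> gb a d' \<and>
          gb a d \<otimes>\<^bsub>SGe X\<^esub> gc x c = gc x c \<otimes>\<^bsub>SGe X\<^esub> gb a d \<and>
          gb a d \<otimes>\<^bsub>SGe X\<^esub> gb a' d' = gb a' d' \<otimes>\<^bsub>SGe X\<^esub> gb a d \<and>
          gc x (c \<otimes>\<^bsub>SGe C\<^esub> c') = gc x c \<otimes>\<^bsub>SGe X\<^esub> gc x c' \<and>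
          gc (x \<otimes>\<^bsub>SGe A\<^esub> x') c = gc x c \<otimes>\<^bsub>SGe X\<^esub> gc x' c \<otimes>\<^bsub>SGe X\<^esub> gb (sg_cross A x' x) (SGH C c) \<and>
          gc x (SGP C d) = gb (sg_cross A x x) d \<and>
          gc (SGP A a) c = gb a (sg_Delta C c) \<and>
          gb (sg_T A a) (sg_T C d) = inv\<^bsub>SGe X\<^esub> gb a d"
        if m: "x \<in> carrier (SGe A)" "x' \<in> carrier (SGe A)" "a \<in> carrier (SGee A)" "a' \<in> carrier (SGee A)"
          "c \<in> carrier (SGe C)" "c' \<in> carrier (SGe C)" "d \<in> carrier (SGee C)" "d' \<in> carrier (SGee C)" for x x' a a' c c' d d'
      proof -
        obtain i y y' b b' where i: "i \<in> Obj J" and y: "y \<in> carrier (SGe (D i))" "y' \<in> carrier (SGe (D i))"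
          "b \<in> carrier (SGee (D i))" "b' \<in> carrier (SGee (D i))"
          and eq: "c = fst (\<iota> i) y" "c' = fst (\<iota> i) y'" "d = snd (\<iota> i) b" "d' = snd (\<iota> i) b'"
          using rep[OF m(5-8)] by blast
        interpret Di: square_tensor A "D i" by (rule SD[OF i])
        interpret \<iota>: square_group_hom "D i" C "\<iota> i" by (rule fc.\<iota>_square_hom[OF i])
        interpret \<tau>: group_hom "tensor_e A (D i)" "SGe X" "fst (\<tau> i)"
          using sg_homD(1)[OF th[OF i], unfolded sg_tensor_simps] X.C.e.is_group Di.E.is_group
          by (simp add: group_hom_def group_hom_axioms_def)
        have e1: "fst (\<iota> i) y \<otimes>\<^bsub>SGe C\<^esub> fst (\<iota> i) y' = fst (\<iota> i) (y \<otimes>\<^bsub>SGe (D i)\<^esub> y')"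
          "snd (\<iota> i) b \<otimes>\<^bsub>SGee C\<^esub> snd (\<iota> i) b' = snd (\<iota> i) (b \<otimes>\<^bsub>SGee (D i)\<^esub> b')"
          "SGH C (fst (\<iota> i) y) = snd (\<iota> i) (SGH (D i) y)" "SGP C (snd (\<iota> i) b) = fst (\<iota> i) (SGP (D i) b)"
          "sg_Delta C (fst (\<iota> i) y) = snd (\<iota> i) (sg_Delta (D i) y)"
          "sg_T C (snd (\<iota> i) b) = snd (\<iota> i) (sg_T (D i) b)"
          using y by simp_all
        have com: "fst (\<tau> i) (bar A (D i) a b) \<otimes>\<^bsub>SGe X\<^esub> fst (\<tau> i) z = fst (\<tau> i) z \<otimes>\<^bsub>SGe X\<^esub> fst (\<tau> i) (bar A (D i) a b)"
          if "z \<in> carrier (tensor_e A (D i))" for z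
        proof -
          have "fst (\<tau> i) (bar A (D i) a b \<otimes>\<^bsub>tensor_e A (D i)\<^esub> z) = fst (\<tau> i) (z \<otimes>\<^bsub>tensor_e A (D i)\<^esub> bar A (D i) a b)"
            using Di.bar_central[OF m(3) y(3) that] by simp
          then show ?thesis using that m y by simp
        qed
        show ?thesis
          unfolding eq e1
        proof (intro conjI)
          show "gb a (snd (\<iota> i) b) \<otimes>\<^bsub>SGe X\<^esub> gc x (fst (\<iota> i) y) = gc x (fst (\<iota> i) y) \<otimes>\<^bsub>SGe X\<^esub> gb a (snd (\<iota> i) b)"
            unfolding gb[OF m(3) i y(3)] gc[OF m(1) i y(1)] using m y by (intro com) simp
          show "gb a (snd (\<iota> i) b) \<otimes>\<^bsub>SGe X\<^esub> gb a' (snd (\<iota> i) b') = gb a' (snd (\<iota> i) b') \<otimes>\<^bsub>SGe X\<^esub> gb a (snd (\<iota> i) b)"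
            unfolding gb[OF m(3) i y(3)] gb[OF m(4) i y(4)] using m y by (intro com) simp
        qed (use m y i in \<open>simp_all add: gc gb Di.bar_mult Di.circ_mult_left Di.bar_T del: \<iota>.e.hom_mult \<iota>.ee.hom_mult
            \<iota>.H \<iota>.P \<iota>.Delta \<iota>.T\<close>)
      qed
      show ?thesis
        by (rule S.e_lift[OF X.C.e.is_group]) (use all one in blast)+
    qed
    then obtain he where he: "he \<in> hom (tensor_e A C) (SGe X)"
      "\<And>x c. x \<in> carrier (SGe A) \<Longrightarrow> c \<in> carrier (SGe C) \<Longrightarrow> he (circ A C x c) = gc x c"
      "\<And>a c. a \<in> carrier (SGee A) \<Longrightarrow> c \<in> carrier (SGee C) \<Longrightarrow> he (bar A C a c) = gb a c" by blast
    have "biadditive (SGee A) (SGee C) (SGee X) gp"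
    proof -
      have all: "gp a d \<in> carrier (SGee X) \<and> gp (a \<otimes>\<^bsub>SGee A\<^esub> a') d = gp a d \<otimes>\<^bsub>SGee X\<^esub> gp a' d \<and>
          gp a (d \<otimes>\<^bsub>SGee C\<^esub> d') = gp a d \<otimes>\<^bsub>SGee X\<^esub> gp a d'"
        if m: "a \<in> carrier (SGee A)" "a' \<in> carrier (SGee A)" "d \<in> carrier (SGee C)" "d' \<in> carrier (SGee C)" for a a' d d'
      proof -
        obtain i b b' where i: "i \<in> Obj J" and y: "b \<in> carrier (SGee (D i))" "b' \<in> carrier (SGee (D i))"
          and eq: "d = snd (\<iota> i) b" "d' = snd (\<iota> i) b'"
          using rep[OF one(1,1) m(3,4)] by blast
        interpret Di: square_tensor A "D i" by (rule SD[OF i])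
        interpret \<iota>: square_group_hom "D i" C "\<iota> i" by (rule fc.\<iota>_square_hom[OF i])
        interpret \<tau>: group_hom "tensor_ee A (D i)" "SGee X" "snd (\<tau> i)"
          using sg_homD(2)[OF th[OF i], unfolded sg_tensor_simps] X.C.ee.is_group Di.EE.is_group
          by (simp add: group_hom_def group_hom_axioms_def)
        have e1: "snd (\<iota> i) b \<otimes>\<^bsub>SGee C\<^esub> snd (\<iota> i) b' = snd (\<iota> i) (b \<otimes>\<^bsub>SGee (D i)\<^esub> b')" using y by simp
        show ?thesis
          unfolding eq e1 using m y i by (simp add: gp del: \<iota>.ee.hom_mult)
      qed
      show ?thesis by (rule biadditiveI) (use all one in blast)+
    qed
    from S.ee_lift[OF X.C.ee.comm_group_axioms this] obtain hee where hee: "hee \<in> hom (tensor_ee A C) (SGee X)"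
      "\<And>a c. a \<in> carrier (SGee A) \<Longrightarrow> c \<in> carrier (SGee C) \<Longrightarrow> hee (pure A C a c) = gp a c" by blast
    have comp_e: "he (fst (?I i) v) = fst (\<tau> i) v" if i: "i \<in> Obj J" and v: "v \<in> carrier (tensor_e A (D i))" for i v
    proof -
      interpret Di: square_tensor A "D i" by (rule SD[OF i])
      have "(he \<circ> fst (?I i)) v = fst (\<tau> i) v"
        by (rule Di.e_hom_eqI[OF X.C.e.is_group hom_compose[OF sg_homD(1)[OF T.\<iota>_hom[OF i], unfolded sg_tensor_simps] he(1)]
              sg_homD(1)[OF th[OF i], unfolded sg_tensor_simps] v])
          (use i in \<open>simp_all add: I_circ I_bar he gc gb sg_homD(5,6)[OF fc.\<iota>_hom[OF i]]\<close>)
      then show ?thesis by simp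
    qed
    have comp_ee: "hee (snd (?I i) v) = snd (\<tau> i) v" if i: "i \<in> Obj J" and v: "v \<in> carrier (tensor_ee A (D i))" for i v
    proof -
      interpret Di: square_tensor A "D i" by (rule SD[OF i])
      have "(hee \<circ> snd (?I i)) v = snd (\<tau> i) v"
        by (rule Di.ee_hom_eqI[OF X.C.ee.is_group hom_compose[OF sg_homD(2)[OF T.\<iota>_hom[OF i], unfolded sg_tensor_simps] hee(1)]
              sg_homD(2)[OF th[OF i], unfolded sg_tensor_simps] v])
          (use i in \<open>simp_all add: I_pure hee gp sg_homD(5,6)[OF fc.\<iota>_hom[OF i]]\<close>)
      then show ?thesis by simp
    qed
    \<comment> \<open>Every element of the tensor product over \<open>C\<close> already comes from
      some index, where compatibility with \<open>H\<close> is known for the structure map and for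
      \<open>\<tau> i\<close>.\<close>
    have H: "hee (tensor_H A C w) = SGH X (he w)" if w: "w \<in> carrier (tensor_e A C)" for w
    proof -
      obtain i v where i: "i \<in> Obj J" "v \<in> carrier (tensor_e A (D i))" "w = fst (?I i) v" using Trep_e[OF w] by blast
      interpret Di: square_tensor A "D i" by (rule SD[OF i(1)])
      have "hee (tensor_H A C w) = hee (snd (?I i) (tensor_H A (D i) v))"
        using sg_homD(3)[OF T.\<iota>_hom[OF i(1)], of v] i by simp
      also have "\<dots> = snd (\<tau> i) (tensor_H A (D i) v)" using i by (intro comp_ee) auto
      also have "\<dots> = SGH X (fst (\<tau> i) v)" using sg_homD(3)[OF th[OF i(1)], of v] i by simp
      also have "\<dots> = SGH X (he w)" using comp_e[OF i(1,2)] i(3) by simp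
      finally show ?thesis .
    qed
    have P: "he (tensor_P A C t) = SGP X (hee t)" if t: "t \<in> carrier (tensor_ee A C)" for t
    proof -
      obtain i v where i: "i \<in> Obj J" "v \<in> carrier (tensor_ee A (D i))" "t = snd (?I i) v" using Trep_ee[OF t] by blast
      interpret Di: square_tensor A "D i" by (rule SD[OF i(1)])
      have "he (tensor_P A C t) = he (fst (?I i) (tensor_P A (D i) v))"
        using sg_homD(4)[OF T.\<iota>_hom[OF i(1)], of v] i by simp
      also have "\<dots> = fst (\<tau> i) (tensor_P A (D i) v)" using i by (intro comp_e) auto
      also have "\<dots> = SGP X (snd (\<tau> i) v)" using sg_homD(4)[OF th[OF i(1)], of v] i by simp
      also have "\<dots> = SGP X (hee t)" using comp_ee[OF i(1,2)] i(3) by simp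
      finally show ?thesis .
    qed
    show ?thesis
    proof (intro bexI[of _ "(he, hee)"] conjI ballI impI)
      show "(he, hee) \<in> sg_hom (sg_tensor A C) X"
        using he(1) hee(1) H P by (simp add: sg_hom_def)
      show "sg_eq (sg_tensor A (D i)) (sg_comp (he, hee) (?I i)) (\<tau> i)" if "i \<in> Obj J" for i
        using comp_e[OF that] comp_ee[OF that] by (simp add: sg_eq_def sg_comp_def)
      fix \<psi> assume \<psi>: "\<forall>i\<in>Obj J. sg_eq (sg_tensor A (D i)) (sg_comp \<psi> (?I i)) (\<tau> i)"
      have "fst \<psi> w = he w" if w: "w \<in> carrier (tensor_e A C)" for w
      proof -
        obtain i v where i: "i \<in> Obj J" "v \<in> carrier (tensor_e A (D i))" "w = fst (?I i) v" using Trep_e[OF w] by blast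
        then show ?thesis using bspec[OF \<psi> i(1)] comp_e[OF i(1,2)] by (simp add: sg_eq_def sg_comp_def)
      qed
      moreover have "snd \<psi> w = hee w" if w: "w \<in> carrier (tensor_ee A C)" for w
      proof -
        obtain i v where i: "i \<in> Obj J" "v \<in> carrier (tensor_ee A (D i))" "w = snd (?I i) v" using Trep_ee[OF w] by blast
        then show ?thesis using bspec[OF \<psi> i(1)] comp_ee[OF i(1,2)] by (simp add: sg_eq_def sg_comp_def)
      qed
      ultimately show "sg_eq (sg_tensor A C) \<psi> (he, hee)" by (simp add: sg_eq_def)
    qed
  qed
  show ?thesis unfolding sg_colimit_def using T.cocone univ by blast
qed

section \<open>Projective square groups\<close>

lemma generate_finite_Union:
  assumes "group G" and w: "w \<in> generate G (Z \<union> (\<Union>k\<in>K. S k))"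
  shows "\<exists>F. finite F \<and> F \<subseteq> K \<and> w \<in> generate G (Z \<union> (\<Union>k\<in>F. S k))"
  using w
proof (induction rule: generate.induct)
  case one
  then show ?case by (intro exI[of _ "{}"]) (simp add: generate.one)
next
  case (incl h)
  then consider "h \<in> Z" | k where "k \<in> K" "h \<in> S k" by blast
  then show ?case
  proof cases
    case 1
    then show ?thesis by (intro exI[of _ "{}"]) (simp add: generate.incl)
  next
    case 2
    then show ?thesis by (intro exI[of _ "{k}"]) (simp add: generate.incl)
  qed
next
  case (inv h)
  then consider "h \<in> Z" | k where "k \<in> K" "h \<in> S k" by blast
  then show ?case
  proof cases
    case 1
    then show ?thesis by (intro exI[of _ "{}"]) (simp add: generate.inv)
  next
    case 2
    then show ?thesis by (intro exI[of _ "{k}"]) (simp add: generate.inv)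
  qed
next
  case (eng h1 h2)
  then obtain F1 F2 where F: "finite F1" "F1 \<subseteq> K" "h1 \<in> generate G (Z \<union> (\<Union>k\<in>F1. S k))"
    "finite F2" "F2 \<subseteq> K" "h2 \<in> generate G (Z \<union> (\<Union>k\<in>F2. S k))" by blast
  have "generate G (Z \<union> (\<Union>k\<in>F1. S k)) \<union> generate G (Z \<union> (\<Union>k\<in>F2. S k)) \<subseteq> generate G (Z \<union> (\<Union>k\<in>F1 \<union> F2. S k))"
    by (intro Un_least group.mono_generate[OF assms(1)]) auto
  then have "h1 \<in> generate G (Z \<union> (\<Union>k\<in>F1 \<union> F2. S k))" "h2 \<in> generate G (Z \<union> (\<Union>k\<in>F1 \<union> F2. S k))"
    using F(3,6) by blast+
  then show ?case using F(1,2,4,5) by (intro exI[of _ "F1 \<union> F2"]) (simp add: generate.eng)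
qed

text \<open>Modulo the central subgroup \<open>Z\<close> an element is a product of factors \<open>\<kappa> k y\<close> with distinct \<open>k\<close>,
  and \<open>\<phi> k\<close> extracts the factor of index \<open>k\<close>.\<close>

lemma (in group) detect_trivial:
  assumes B: "group B" and Z: "subgroup Z G" and cen: "\<And>z g. z \<in> Z \<Longrightarrow> g \<in> carrier G \<Longrightarrow> z \<otimes> g = g \<otimes> z"
    and \<kappa>: "\<And>k. k \<in> K \<Longrightarrow> \<kappa> k \<in> hom B G" and \<phi>: "\<And>k. k \<in> K \<Longrightarrow> \<phi> k \<in> hom G B"
    and self: "\<And>k y. k \<in> K \<Longrightarrow> y \<in> carrier B \<Longrightarrow> \<phi> k (\<kappa> k y) = y"
    and other: "\<And>j k y. j \<in> K \<Longrightarrow> k \<in> K \<Longrightarrow> j \<noteq> k \<Longrightarrow> y \<in> carrier B \<Longrightarrow> \<phi> j (\<kappa> k y) = \<one>\<^bsub>B\<^esub>"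
    and triv: "\<And>k z. k \<in> K \<Longrightarrow> z \<in> Z \<Longrightarrow> \<phi> k z = \<one>\<^bsub>B\<^esub>"
    and comm: "\<And>j k y y'. j \<in> K \<Longrightarrow> k \<in> K \<Longrightarrow> j \<noteq> k \<Longrightarrow> y \<in> carrier B \<Longrightarrow> y' \<in> carrier B \<Longrightarrow>
      \<exists>z\<in>Z. \<kappa> j y' \<otimes> \<kappa> k y = \<kappa> k y \<otimes> (\<kappa> j y' \<otimes> z)"
    and w: "w \<in> generate G (Z \<union> (\<Union>k\<in>K. \<kappa> k ` carrier B))" and zero: "\<And>k. k \<in> K \<Longrightarrow> \<phi> k w = \<one>\<^bsub>B\<^esub>"
  shows "w \<in> Z"
proof -
  interpret B: group B by fact
  interpret Z: subgroup Z G by fact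
  define N where "N F = generate G (Z \<union> (\<Union>k\<in>F. \<kappa> k ` carrier B))" for F
  have \<kappa>c [simp]: "\<kappa> k y \<in> carrier G" if "k \<in> K" "y \<in> carrier B" for k y
    using \<kappa>[OF that(1)] that(2) by (auto simp: hom_def)
  have sub: "Z \<union> (\<Union>k\<in>F. \<kappa> k ` carrier B) \<subseteq> carrier G" if "F \<subseteq> K" for F
    using that Z.subset by auto
  have "w \<in> N F \<longrightarrow> (\<forall>k\<in>F. \<phi> k w = \<one>\<^bsub>B\<^esub>) \<longrightarrow> w \<in> Z" if "finite F" "F \<subseteq> K" for F w
    using that
  proof (induction F arbitrary: w rule: finite_induct)
    case empty
    show ?case using subgroup_generate_incl[OF is_group Z, of Z w] by (simp add: N_def)
  next
    case (insert k F)
    have F: "F \<subseteq> K" and k: "k \<in> K" using insert.prems by auto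
    interpret N: subgroup "N F" G unfolding N_def by (rule generate_is_subgroup[OF sub[OF F]])
    have ZN: "Z \<subseteq> N F" "\<And>j y. j \<in> F \<Longrightarrow> y \<in> carrier B \<Longrightarrow> \<kappa> j y \<in> N F"
      unfolding N_def by (auto intro: generate.incl)
    \<comment> \<open>Factors of different index commute up to \<open>Z\<close>, so each
      \<open>\<kappa> k y\<close> normalizes \<open>N F\<close>. This makes the products of a factor
      of index k with an element of \<open>N F\<close> a subgroup.\<close>
    have conj: "inv (\<kappa> k y) \<otimes> n \<otimes> \<kappa> k y \<in> N F" if y: "y \<in> carrier B" and n: "n \<in> N F" for y n
    proof (rule generate_hom_mem[OF is_group is_group _ sub[OF F] N.subgroup_axioms _ n[unfolded N_def]])
      show "(\<lambda>n. inv (\<kappa> k y) \<otimes> n \<otimes> \<kappa> k y) \<in> hom G G"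
        using k y by (auto intro!: homI simp: m_assoc inv_cancel_left)
      fix s assume "s \<in> Z \<union> (\<Union>k\<in>F. \<kappa> k ` carrier B)"
      then consider "s \<in> Z" | j y' where "j \<in> F" "y' \<in> carrier B" "s = \<kappa> j y'" by blast
      then show "inv (\<kappa> k y) \<otimes> s \<otimes> \<kappa> k y \<in> N F"
      proof cases
        case 1
        then have "inv (\<kappa> k y) \<otimes> s \<otimes> \<kappa> k y = s"
          using cen[OF 1, of "\<kappa> k y"] k y by (simp add: m_assoc inv_cancel_left)
        with 1 ZN show ?thesis by auto
      next
        case 2
        then obtain z where z: "z \<in> Z" "s \<otimes> \<kappa> k y = \<kappa> k y \<otimes> (s \<otimes> z)"
          using comm[of j k y y'] insert.hyps(2) F k y by blast
        have s: "s \<in> N F" "s \<in> carrier G" using 2 ZN(2) N.subset by auto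
        then have "inv (\<kappa> k y) \<otimes> s \<otimes> \<kappa> k y = s \<otimes> z"
          using z k y by (simp add: m_assoc inv_cancel_left)
        then show ?thesis using s z ZN(1) by auto
      qed
    qed
    define U where "U = {\<kappa> k y \<otimes> n |y n. y \<in> carrier B \<and> n \<in> N F}"
    have k1: "\<kappa> k \<one>\<^bsub>B\<^esub> = \<one>" using hom_one[OF \<kappa>[OF k] B is_group] .
    have UI: "\<kappa> k y \<otimes> n \<in> U" if "y \<in> carrier B" "n \<in> N F" for y n using that unfolding U_def by blast
    have U: "subgroup U G"
    proof (rule subgroupI)
      show "U \<subseteq> carrier G" using k N.subset by (auto simp: U_def)
      show "U \<noteq> {}" unfolding U_def using N.one_closed B.one_closed by blast
    next
      fix u assume "u \<in> U"
      then obtain y n where u: "u = \<kappa> k y \<otimes> n" "y \<in> carrier B" "n \<in> N F" unfolding U_def by blast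
      have ki: "\<kappa> k (inv\<^bsub>B\<^esub> y) = inv (\<kappa> k y)" by (rule hom_inv[OF \<kappa>[OF k] B is_group u(2)])
      have "inv u = \<kappa> k (inv\<^bsub>B\<^esub> y) \<otimes> (inv (\<kappa> k (inv\<^bsub>B\<^esub> y)) \<otimes> inv n \<otimes> \<kappa> k (inv\<^bsub>B\<^esub> y))"
        using u k N.subset unfolding ki by (auto simp: inv_mult_group m_assoc inv_cancel_left)
      then show "inv u \<in> U" using UI[OF _ conj] u by simp
    next
      fix u v assume "u \<in> U" "v \<in> U"
      then obtain y n y' n' where u: "u = \<kappa> k y \<otimes> n" "y \<in> carrier B" "n \<in> N F"
        "v = \<kappa> k y' \<otimes> n'" "y' \<in> carrier B" "n' \<in> N F" unfolding U_def by blast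
      have "u \<otimes> v = \<kappa> k (y \<otimes>\<^bsub>B\<^esub> y') \<otimes> ((inv (\<kappa> k y') \<otimes> n \<otimes> \<kappa> k y') \<otimes> n')"
        using u k N.subset hom_mult[OF \<kappa>[OF k] u(2,5)] by (auto simp: m_assoc inv_cancel_left)
      then show "u \<otimes> v \<in> U" using UI[OF _ N.m_closed[OF conj]] u by simp
    qed
    have "Z \<union> (\<Union>k\<in>insert k F. \<kappa> k ` carrier B) \<subseteq> U"
    proof
      fix s assume "s \<in> Z \<union> (\<Union>k\<in>insert k F. \<kappa> k ` carrier B)"
      then consider "s \<in> N F" | y where "y \<in> carrier B" "s = \<kappa> k y" using ZN by blast
      then show "s \<in> U"
        using UI[of "\<one>\<^bsub>B\<^esub>" s] UI[of _ \<one>] k1 k N.subset by cases auto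
    qed
    from subgroup_generate_incl[OF is_group U this] have NU: "N (insert k F) \<subseteq> U"
      unfolding N_def by blast
    show ?case
    proof (intro impI)
      assume w: "w \<in> N (insert k F)" and 0: "\<forall>j\<in>insert k F. \<phi> j w = \<one>\<^bsub>B\<^esub>"
      then obtain y n where yn: "w = \<kappa> k y \<otimes> n" "y \<in> carrier B" "n \<in> N F" using NU unfolding U_def by blast
      \<comment> \<open>\<open>\<phi> k\<close> kills \<open>Z\<close> and all factors of index
        other than k, hence \<open>N F\<close>. It therefore returns the parameter y of the
        split-off factor.\<close>
      have "\<phi> k n \<in> {\<one>\<^bsub>B\<^esub>}"
        by (rule generate_hom_mem[OF is_group B \<phi>[OF k] sub[OF F] B.triv_subgroup _ yn(3)[unfolded N_def]])
          (use triv other k F insert.hyps(2) in blast)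
      then have "\<phi> k w = y" using yn k hom_mult[OF \<phi>[OF k], of "\<kappa> k y" n] N.subset self[OF k] by auto
      then have "w = n" using 0 yn k1 N.subset by auto
      then show "w \<in> Z" using insert.IH[OF F, of w] 0 yn(3) by blast
    qed
  qed
  then show ?thesis
    using generate_finite_Union[OF is_group w] zero unfolding N_def by blast
qed

text \<open>The bars are treated first, since expanding \<open>circ\<close> in its first variable
  leaves bars with arbitrary entries as corrections.\<close>

lemma (in square_tensor) generate_circ_bar:
  assumes S: "S \<subseteq> carrier (SGe M)" "carrier (SGe M) = generate (SGe M) S"
    and R: "R \<subseteq> carrier (SGee M)" "carrier (SGee M) = generate (SGee M) R"
    and K: "subgroup K TE" "\<And>s y. s \<in> S \<Longrightarrow> y \<in> carrier (SGe N) \<Longrightarrow> circ M N s y \<in> K"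
      "\<And>r b. r \<in> R \<Longrightarrow> b \<in> carrier (SGee N) \<Longrightarrow> bar M N r b \<in> K"
  shows "carrier TE \<subseteq> K"
proof -
  interpret K: subgroup K TE by fact
  have bar: "bar M N a b \<in> K" if "a \<in> carrier (SGee M)" "b \<in> carrier (SGee N)" for a b
    using that(1) unfolding R(2)
  proof (induction rule: generate.induct)
    case one
    then show ?case using that(2) by simp
  next
    case (incl h)
    then show ?case using K(3) that(2) by blast
  next
    case (inv h)
    then have "h \<in> carrier (SGee M)" using R by blast
    then show ?case using K(3)[OF inv that(2)] that(2) by (simp add: bar_inv)
  next
    case (eng h1 h2)
    then show ?case using that(2) unfolding R(2)[symmetric] by (simp add: bar_mult)
  qed
  have circ: "circ M N x y \<in> K" if "x \<in> carrier (SGe M)" "y \<in> carrier (SGe N)" for x y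
    using that(1) unfolding S(2)
  proof (induction rule: generate.induct)
    case one
    then show ?case using that(2) by simp
  next
    case (incl h)
    then show ?case using K(2) that(2) by blast
  next
    case (inv h)
    then have h: "h \<in> carrier (SGe M)" using S by blast
    let ?b = "bar M N (sg_cross M h (inv\<^bsub>SGe M\<^esub> h)) (SGH N y)"
    \<comment> \<open>Expanding \<open>circ\<close> at -h + h = 0 expresses its value at -h through
      the value at h and a bar.\<close>
    have "circ M N (inv\<^bsub>SGe M\<^esub> h) y \<otimes>\<^bsub>TE\<^esub> circ M N h y \<otimes>\<^bsub>TE\<^esub> ?b = \<one>\<^bsub>TE\<^esub>"
      using circ_mult_left[of "inv\<^bsub>SGe M\<^esub> h" h y, symmetric] h that(2) by simp
    then have "circ M N (inv\<^bsub>SGe M\<^esub> h) y \<otimes>\<^bsub>TE\<^esub> (circ M N h y \<otimes>\<^bsub>TE\<^esub> ?b) = \<one>\<^bsub>TE\<^esub>"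
      using h that(2) by (simp add: E.m_assoc)
    then have "circ M N (inv\<^bsub>SGe M\<^esub> h) y = inv\<^bsub>TE\<^esub> (circ M N h y \<otimes>\<^bsub>TE\<^esub> ?b)"
      using h that(2) by (intro E.inv_equality[symmetric]) simp_all
    moreover have "circ M N h y \<in> K" "?b \<in> K" using K(2) inv that(2) h bar by simp_all
    ultimately show ?case by simp
  next
    case (eng h1 h2)
    then show ?case using that(2) bar unfolding S(2)[symmetric] by (simp add: circ_mult_left)
  qed
  have "gen_set \<subseteq> K" using bar circ unfolding gen_set_def by blast
  from subgroup_generate_incl[OF E.is_group K(1) this] show ?thesis unfolding carrier_generate by blast
qed

lemma (in square_tensor) generate_pure:
  assumes R: "R \<subseteq> carrier (SGee M)" "carrier (SGee M) = generate (SGee M) R"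
    and K: "subgroup K TEE" "\<And>r b. r \<in> R \<Longrightarrow> b \<in> carrier (SGee N) \<Longrightarrow> pure M N r b \<in> K"
  shows "carrier TEE \<subseteq> K"
proof -
  have pure: "pure M N a b \<in> K" if "a \<in> carrier (SGee M)" and b: "b \<in> carrier (SGee N)" for a b
    by (rule generate_hom_mem[where f = "\<lambda>a. pure M N a b",
          OF M.ee.is_group EE.is_group pure.hom_left[OF b] R(1) K(1) _ that(1)[unfolded R(2)]])
      (use K(2) b in auto)
  then have "{pure M N a b | a b. a \<in> carrier (SGee M) \<and> b \<in> carrier (SGee N)} \<subseteq> K" by blast
  from subgroup_generate_incl[OF EE.is_group K(1) this] show ?thesis unfolding ee_carrier_generate by blast
qed

section \<open>Binary products, transport of structure and sections of epimorphisms\<close>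

definition sg_times :: "('a, 'b) square \<Rightarrow> ('c, 'd) square \<Rightarrow> ('a \<times> 'c, 'b \<times> 'd) square" where
  "sg_times M N = \<lparr>SGe = SGe M \<times>\<times> SGe N, SGee = SGee M \<times>\<times> SGee N,
     SGH = map_prod (SGH M) (SGH N), SGP = map_prod (SGP M) (SGP N)\<rparr>"

lemma sg_times_simps [simp]:
  "SGe (sg_times M N) = SGe M \<times>\<times> SGe N" "SGee (sg_times M N) = SGee M \<times>\<times> SGee N"
  "SGH (sg_times M N) = map_prod (SGH M) (SGH N)" "SGP (sg_times M N) = map_prod (SGP M) (SGP N)"
  by (simp_all add: sg_times_def)

lemma square_group_times:
  assumes "square_group M" "square_group N"
  shows "square_group (sg_times M N)" (is ?A)
    and "x \<in> carrier (SGe M) \<Longrightarrow> y \<in> carrier (SGe N) \<Longrightarrow> x' \<in> carrier (SGe M) \<Longrightarrow> y' \<in> carrier (SGe N) \<Longrightarrow>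
      sg_cross (sg_times M N) (x, y) (x', y') = (sg_cross M x x', sg_cross N y y')" (is "PROP ?cr x y x' y'")
    and "a \<in> carrier (SGee M) \<Longrightarrow> b \<in> carrier (SGee N) \<Longrightarrow>
      sg_T (sg_times M N) (a, b) = (sg_T M a, sg_T N b)"
proof -
  interpret M: square_group M by fact
  interpret N: square_group N by fact
  have inv_e: "inv\<^bsub>SGe M \<times>\<times> SGe N\<^esub> (x, y) = (inv\<^bsub>SGe M\<^esub> x, inv\<^bsub>SGe N\<^esub> y)"
    if "x \<in> carrier (SGe M)" "y \<in> carrier (SGe N)" for x y
    using that by (intro inv_DirProd M.e.is_group N.e.is_group)
  have inv_ee: "inv\<^bsub>SGee M \<times>\<times> SGee N\<^esub> (x, y) = (inv\<^bsub>SGee M\<^esub> x, inv\<^bsub>SGee N\<^esub> y)"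
    if "x \<in> carrier (SGee M)" "y \<in> carrier (SGee N)" for x y
    using that by (intro inv_DirProd M.ee.is_group N.ee.is_group)
  have cr: "PROP ?cr x y x' y'" for x y x' y'
    by (simp add: cross_effect_def inv_ee)
  have bi: "biadditive (SGe M \<times>\<times> SGe N) (SGe M \<times>\<times> SGe N) (SGee M \<times>\<times> SGee N)
     (cross_effect (SGe M \<times>\<times> SGe N) (SGee M \<times>\<times> SGee N) (map_prod (SGH M) (SGH N)))"
    by (rule biadditiveI) (auto simp: cr[unfolded sg_times_simps])
  show ?A
  proof (rule square_group.intro)
    show "comm_group (SGee (sg_times M N))"
      by (rule group.group_comm_groupI) (auto simp: DirProd_group M.ee.m_comm N.ee.m_comm)
    show "SGP (sg_times M N) \<in> hom (SGee (sg_times M N)) (SGe (sg_times M N))"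
      by (rule homI) auto
    show "quadratic_map (SGe (sg_times M N)) (SGee (sg_times M N)) (SGH (sg_times M N))"
      using bi by (auto simp: quadratic_map_def biadditive_def)
  qed (auto simp: cr[unfolded sg_times_simps] inv_e DirProd_group M.P_cross N.P_cross M.PHP N.PHP)
  show "PROP ?cr x y x' y'" by (rule cr)
  show "a \<in> carrier (SGee M) \<Longrightarrow> b \<in> carrier (SGee N) \<Longrightarrow>
      sg_T (sg_times M N) (a, b) = (sg_T M a, sg_T N b)"
    by (simp add: sg_T_def inv_ee)
qed

definition sg_transport :: "('a, 'b) square \<Rightarrow> ('a \<Rightarrow> 'c) \<Rightarrow> ('b \<Rightarrow> 'd) \<Rightarrow> ('c, 'd) square" where
  "sg_transport M i j = \<lparr>
     SGe = \<lparr>carrier = i ` carrier (SGe M), monoid.mult = (\<lambda>x y. i (inv_into UNIV i x \<otimes>\<^bsub>SGe M\<^esub> inv_into UNIV i y)), one = i \<one>\<^bsub>SGe M\<^esub>\<rparr>,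
     SGee = \<lparr>carrier = j ` carrier (SGee M), monoid.mult = (\<lambda>x y. j (inv_into UNIV j x \<otimes>\<^bsub>SGee M\<^esub> inv_into UNIV j y)), one = j \<one>\<^bsub>SGee M\<^esub>\<rparr>,
     SGH = (\<lambda>x. j (SGH M (inv_into UNIV i x))), SGP = (\<lambda>a. i (SGP M (inv_into UNIV j a)))\<rparr>"

lemma square_group_transport:
  assumes "square_group M" "inj i" "inj j"
  shows "square_group (sg_transport M i j)"
    and "(i, j) \<in> sg_hom M (sg_transport M i j)" and "(inv_into UNIV i, inv_into UNIV j) \<in> sg_hom (sg_transport M i j) M"
    and "fst f ` carrier (SGe M) = X \<Longrightarrow> fst (sg_comp f (inv_into UNIV i, inv_into UNIV j)) ` carrier (SGe (sg_transport M i j)) = X"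
    and "snd f ` carrier (SGee M) = Y \<Longrightarrow> snd (sg_comp f (inv_into UNIV i, inv_into UNIV j)) ` carrier (SGee (sg_transport M i j)) = Y"
proof -
  interpret M: square_group M by fact
  show ij: "(i, j) \<in> sg_hom M (sg_transport M i j)"
    using assms(2,3) by (auto simp: sg_hom_def hom_def sg_transport_def)
  show "(inv_into UNIV i, inv_into UNIV j) \<in> sg_hom (sg_transport M i j) M"
    using assms(2,3) by (auto simp: sg_hom_def hom_def sg_transport_def)
  show "square_group (sg_transport M i j)"
  proof (rule square_groupI_cover)
    show "carrier (SGe (sg_transport M i j)) \<noteq> {}" "carrier (SGee (sg_transport M i j)) \<noteq> {}"
      using M.e.one_closed M.ee.one_closed unfolding sg_transport_def by auto
    fix x y z a b c
    assume "{x, y, z} \<subseteq> carrier (SGe (sg_transport M i j))" "{a, b, c} \<subseteq> carrier (SGee (sg_transport M i j))"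
    then show "\<exists>(D :: ('a, 'b) square) f. square_group D \<and> f \<in> sg_hom D (sg_transport M i j) \<and>
        fst f \<one>\<^bsub>SGe D\<^esub> = \<one>\<^bsub>SGe (sg_transport M i j)\<^esub> \<and> snd f \<one>\<^bsub>SGee D\<^esub> = \<one>\<^bsub>SGee (sg_transport M i j)\<^esub> \<and>
        {x, y, z} \<subseteq> fst f ` carrier (SGe D) \<and> {a, b, c} \<subseteq> snd f ` carrier (SGee D)"
      using ij assms(1) by (intro exI[of _ M] exI[of _ "(i, j)"]) (simp add: sg_transport_def)
  qed
  show "fst f ` carrier (SGe M) = X \<Longrightarrow> fst (sg_comp f (inv_into UNIV i, inv_into UNIV j)) ` carrier (SGe (sg_transport M i j)) = X"
    "snd f ` carrier (SGee M) = Y \<Longrightarrow> snd (sg_comp f (inv_into UNIV i, inv_into UNIV j)) ` carrier (SGee (sg_transport M i j)) = Y"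
    using assms(2,3) by (auto simp: sg_comp_def sg_transport_def image_image)
qed

text \<open>Lifting is available only between square groups carried by the test types. Copying both
  \<open>X\<close> and \<open>A\<close> there along injections turns \<open>p\<close> into an
  admissible epimorphism; lifting the copy of the identity and translating back gives the
  section.\<close>

lemma projective_section:
  fixes A :: "('a, 'b) square" and X :: "('x, 'y) square" and i :: "'x \<Rightarrow> 'u" and j :: "'y \<Rightarrow> 'v"
    and i' :: "'a \<Rightarrow> 'u" and j' :: "'b \<Rightarrow> 'v"
  assumes pr: "sg_projective TYPE('u) TYPE('v) A" and X: "square_group X" and p: "p \<in> sg_epi X A"
    and inj: "inj i" "inj j" "inj i'" "inj j'"
  shows "\<exists>g\<in>sg_hom A X. sg_eq A (sg_comp p g) sg_id"
proof -
  have A: "square_group A" using pr by (simp add: sg_projective_def)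
  let ?X = "sg_transport X i j" and ?A = "sg_transport A i' j'"
  note tX = square_group_transport[OF X inj(1,2)] and tA = square_group_transport[OF A inj(3,4)]
  have ph: "p \<in> sg_hom X A" using p by (simp add: sg_epi_def)
  let ?q = "sg_comp (sg_comp (i', j') p) (inv_into UNIV i, inv_into UNIV j)"
  have "?q \<in> sg_hom ?X ?A" by (rule sg_hom_comp[OF tX(3) sg_hom_comp[OF ph tA(2)]])
  moreover have "fst ?q ` carrier (SGe ?X) = carrier (SGe ?A)" "snd ?q ` carrier (SGee ?X) = carrier (SGee ?A)"
    using p by (intro tX(4,5); simp add: sg_epi_def sg_comp_def sg_transport_def
        image_image[symmetric, of i' "fst p"] image_image[symmetric, of j' "snd p"] del: image_image)+
  ultimately have "?q \<in> sg_epi ?X ?A" by (simp add: sg_epi_def)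
  then obtain g where g: "g \<in> sg_hom A ?X" "sg_eq A (sg_comp ?q g) (i', j')"
    using pr tX(1) tA(1,2) unfolding sg_projective_def by blast
  have "sg_comp (inv_into UNIV i, inv_into UNIV j) g \<in> sg_hom A X" by (rule sg_hom_comp[OF g(1) tX(3)])
  moreover have "sg_eq A (sg_comp p (sg_comp (inv_into UNIV i, inv_into UNIV j) g)) sg_id"
    using g(2) inj(3,4) by (simp add: sg_eq_def sg_comp_def sg_id_def inj_eq)
  ultimately show ?thesis by blast
qed

section \<open>Powers of a product with central commutator\<close>

lemma (in group) conj_int_pow:
  assumes "a \<in> carrier G" "z \<in> carrier G"
  shows "a [^] (i::int) \<otimes> z = z \<otimes> (inv z \<otimes> a \<otimes> z) [^] i"
proof -
  have "(\<lambda>g. inv z \<otimes> g \<otimes> z) \<in> hom G G"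
    using assms by (auto intro!: homI simp: m_assoc inv_cancel_left)
  from hom_int_pow[OF this assms(1) is_group is_group, of i]
  have "(inv z \<otimes> a \<otimes> z) [^] i = inv z \<otimes> a [^] i \<otimes> z" by simp
  with assms show ?thesis by (simp add: m_assoc inv_cancel_left)
qed

text \<open>The class-two power formula, with c the commutator of y and x and exponent n choose 2.
  That exponent is passed as a solution m of 2m = n(n - 1), so that a coordinate of a vector can
  take its place.\<close>

lemma (in group) int_pow_mult_commutator:
  assumes x: "x \<in> carrier G" and y: "y \<in> carrier G" and c: "c \<in> carrier G"
    and yx: "y \<otimes> x = x \<otimes> (y \<otimes> c)" and cx: "c \<otimes> x = x \<otimes> c" and cy: "c \<otimes> y = y \<otimes> c"
    and m: "2 * m = n * (n - 1)"
  shows "(x \<otimes> y) [^] (n::int) = x [^] n \<otimes> y [^] n \<otimes> c [^] m"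
proof -
  note [simp] = x y c
  have comm: "c [^] i \<otimes> z = z \<otimes> c [^] i" if "z = x \<or> z = y" for i :: int and z
  proof -
    have "inv z \<otimes> c \<otimes> z = c" using cx cy that by (auto simp: m_assoc inv_cancel_left)
    then show ?thesis using conj_int_pow[of c z i] that by auto
  qed
  have ypow: "y [^] i \<otimes> x = x \<otimes> (y [^] i \<otimes> c [^] i)" for i :: int
  proof -
    have "inv x \<otimes> y \<otimes> x = y \<otimes> c" by (simp add: m_assoc yx inv_cancel_left)
    then show ?thesis using conj_int_pow[of y x i] int_pow_mult_distrib[OF cy[symmetric], of i] by simp
  qed
  have lcomm: "c [^] i \<otimes> (z \<otimes> w) = z \<otimes> (c [^] i \<otimes> w)" if "z = x \<or> z = y" "w \<in> carrier G" for i :: int and z w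
  proof -
    have "c [^] i \<otimes> z \<otimes> w = z \<otimes> c [^] i \<otimes> w" using comm[OF that(1), of i] by simp
    then show ?thesis using that by (auto simp: m_assoc)
  qed
  \<comment> \<open>The right-hand side satisfies the recursion of the powers of xy. The induction
    runs over all integers, upwards and downwards from 0.\<close>
  define f where "f i = x [^] i \<otimes> y [^] i \<otimes> c [^] (i * (i - 1) div 2)" for i :: int
  have [simp]: "f i \<in> carrier G" for i by (simp add: f_def)
  have step: "f (i + 1) = f i \<otimes> (x \<otimes> y)" for i
  proof -
    let ?m = "i * (i - 1) div 2"
    have "(i + 1) * i = i * (i - 1) + i * 2" by (simp add: algebra_simps)
    then have m: "(i + 1) * (i + 1 - 1) div 2 = i + ?m" by simp
    have "f i \<otimes> (x \<otimes> y) = x [^] i \<otimes> y [^] i \<otimes> (c [^] ?m \<otimes> x) \<otimes> y" by (simp add: f_def m_assoc)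
    also have "\<dots> = x [^] i \<otimes> (y [^] i \<otimes> x) \<otimes> (c [^] ?m \<otimes> y)" by (simp add: m_assoc comm)
    also have "\<dots> = x [^] i \<otimes> x \<otimes> y [^] i \<otimes> (c [^] i \<otimes> y) \<otimes> c [^] ?m" by (simp add: m_assoc comm lcomm ypow)
    also have "\<dots> = (x [^] i \<otimes> x) \<otimes> (y [^] i \<otimes> y) \<otimes> (c [^] i \<otimes> c [^] ?m)" by (simp add: m_assoc comm lcomm)
    also have "\<dots> = f (i + 1)" unfolding f_def m by (simp add: int_pow_mult)
    finally show ?thesis by simp
  qed
  have "(x \<otimes> y) [^] n = f n"
  proof (induction n rule: int_induct[where k = 0])
    case base
    then show ?case by (simp add: f_def)
  next
    case (step1 i)
    then show ?case by (simp add: step int_pow_mult)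
  next
    case (step2 i)
    have "f (i - 1) \<otimes> (x \<otimes> y) = (x \<otimes> y) [^] (i - 1) \<otimes> (x \<otimes> y)"
      using step[of "i - 1"] step2 int_pow_mult[of "x \<otimes> y" "i - 1" 1] by simp
    then show ?case by simp
  qed
  moreover have "n * (n - 1) div 2 = m" using m by presburger
  ultimately show ?thesis by (simp add: f_def)
qed

section \<open>A square group of integer vectors\<close>

text \<open>Integer vectors indexed by these keys are coordinates on a free square group with generators
  \<open>s :: 'a\<close> on the \<open>e\<close>-level and \<open>u :: 'b\<close> on the \<open>ee\<close>-level. \<open>Gen (Inl s) False\<close> and
  \<open>Gen (Inl s) True\<close> stand for \<open>H s\<close> and \<open>T (H s)\<close>, \<open>Gen (Inr u) False\<close> and \<open>Gen (Inr u) True\<close> for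
  \<open>u\<close> and \<open>T u\<close>, and \<open>Pr s t\<close> for the cross-effect of \<open>s\<close> and \<open>t\<close>. An element of the \<open>e\<close>-level is
  represented by its value under \<open>H\<close>.\<close>

datatype ('a, 'b) key = Gen "'a + 'b" bool | Pr 'a 'a

text \<open>The exponent of the generator s in the \<open>e\<close>-level element with
  \<open>H\<close>-value q: the generator itself contributes to H(s) only, while an element a + T a
  of the image of \<open>P\<close> contributes equally to both coordinates.\<close>

definition deg :: "(('a, 'b) key \<Rightarrow> int) \<Rightarrow> 'a \<Rightarrow> int" where
  "deg q s = q (Gen (Inl s) False) - q (Gen (Inl s) True)"

text \<open>The involution \<open>T\<close> in coordinates. The sign in the second clause is T(s|t)
  = -(t|s).\<close>

fun twist :: "(('a, 'b) key \<Rightarrow> int) \<Rightarrow> ('a, 'b) key \<Rightarrow> int" where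
  "twist q (Gen r e) = q (Gen r (\<not> e))"
| "twist q (Pr s t) = - q (Pr t s)"

fun deg_prod :: "('a \<Rightarrow> int) \<Rightarrow> ('a \<Rightarrow> int) \<Rightarrow> ('a, 'b) key \<Rightarrow> int" where
  "deg_prod v w (Gen r e) = 0"
| "deg_prod v w (Pr s t) = v s * w t"

text \<open>The carrier condition describes \<open>H\<close>-values: n copies of s give n choose 2
  times (s|s), and an element a + T a has coordinate 0 at (s,s). The product on the
  \<open>e\<close>-level is H(x + y) = H(x) + H(y) + (x|y), where the cross-effect depends only on
  the exponents.\<close>

definition model :: "(('a, 'b) key \<Rightarrow> int, ('a, 'b) key \<Rightarrow> int) square" where
  "model = \<lparr>SGe = \<lparr>carrier = {q. \<forall>s. 2 * q (Pr s s) = deg q s * (deg q s - 1)},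
       monoid.mult = (\<lambda>p q k. p k + q k + deg_prod (deg p) (deg q) k), one = (\<lambda>_. 0)\<rparr>,
     SGee = \<lparr>carrier = UNIV, monoid.mult = (\<lambda>p q k. p k + q k), one = (\<lambda>_. 0)\<rparr>,
     SGH = (\<lambda>q. q), SGP = (\<lambda>a k. a k + twist a k)\<rparr>"

lemma deg_simps [simp]:
  "deg (\<lambda>k. p k + q k) s = deg p s + deg q s" "deg (\<lambda>k. p k - q k) s = deg p s - deg q s" "deg (\<lambda>k. 0) s = 0"
  "deg (deg_prod v w) s = 0" "deg (twist q) s = - deg q s"
  by (simp_all add: deg_def)

lemma model_simps [simp]:
  "carrier (SGe model) = {q. \<forall>s. 2 * q (Pr s s) = deg q s * (deg q s - 1)}"
  "p \<otimes>\<^bsub>SGe model\<^esub> q = (\<lambda>k. p k + q k + deg_prod (deg p) (deg q) k)" "\<one>\<^bsub>SGe model\<^esub> = (\<lambda>_. 0)"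
  "carrier (SGee model) = UNIV" "p \<otimes>\<^bsub>SGee model\<^esub> q = (\<lambda>k. p k + q k)" "\<one>\<^bsub>SGee model\<^esub> = (\<lambda>_. 0)"
  "SGH model = (\<lambda>q. q)" "SGP model a = (\<lambda>k. a k + twist a k)"
  by (simp_all add: model_def)

lemma deg_prod_add [simp]:
  "deg_prod (\<lambda>s. v s + v' s) w k = deg_prod v w k + deg_prod v' w k"
  "deg_prod v (\<lambda>s. w s + w' s) k = deg_prod v w k + deg_prod v w' k"
  "deg_prod (\<lambda>s. v s - v' s) w k = deg_prod v w k - deg_prod v' w k"
  "deg_prod v (\<lambda>s. w s - w' s) k = deg_prod v w k - deg_prod v w' k"
  "deg_prod (\<lambda>s. - v s) w k = - deg_prod v w k" "deg_prod v (\<lambda>s. - w s) k = - deg_prod v w k"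
  "deg_prod (\<lambda>s. 0) w k = 0" "deg_prod v (\<lambda>s. 0) k = 0"
  by (cases k; simp add: algebra_simps)+

lemma deg_fun [simp]:
  "deg (\<lambda>k. p k + q k) = (\<lambda>s. deg p s + deg q s)" "deg (\<lambda>k. p k - q k) = (\<lambda>s. deg p s - deg q s)" "deg (\<lambda>k. 0) = (\<lambda>s. 0)"
  "deg (twist q) = (\<lambda>s. - deg q s)" "deg (deg_prod v w) = (\<lambda>s. 0)"
  by (simp_all add: fun_eq_iff)

lemma twist_simps [simp]:
  "twist (\<lambda>k. p k + q k) k = twist p k + twist q k" "twist (twist q) k = q k" "twist (\<lambda>k. 0) k = 0"
  by (cases k; simp)+

lemma group_model: "group (SGe (model :: (('a, 'b) key \<Rightarrow> int, ('a, 'b) key \<Rightarrow> int) square))" (is "group ?G")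
proof (rule groupI)
  fix p q r assume pq: "p \<in> carrier ?G" "q \<in> carrier ?G"
  have "2 * (p (Pr s s) + q (Pr s s) + deg p s * deg q s) = (deg p s + deg q s) * (deg p s + deg q s - 1)" for s
  proof -
    have "2 * p (Pr s s) = deg p s * (deg p s - 1)" "2 * q (Pr s s) = deg q s * (deg q s - 1)"
      using pq by simp_all
    then show ?thesis by (simp add: algebra_simps)
  qed
  then show "p \<otimes>\<^bsub>?G\<^esub> q \<in> carrier ?G" by simp
  show "p \<otimes>\<^bsub>?G\<^esub> q \<otimes>\<^bsub>?G\<^esub> r = p \<otimes>\<^bsub>?G\<^esub> (q \<otimes>\<^bsub>?G\<^esub> r)" by (simp add: fun_eq_iff)
next
  fix q assume q: "q \<in> carrier ?G"
  have "2 * q (Pr s s) = deg q s * (deg q s - 1)" for s using q by simp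
  \<comment> \<open>The witness is the \<open>H\<close>-value of an inverse, -H(x) + (x|x).\<close>
  then have "(\<lambda>k. deg_prod (deg q) (deg q) k - q k) \<in> carrier ?G" by (simp add: algebra_simps)
  moreover have "(\<lambda>k. deg_prod (deg q) (deg q) k - q k) \<otimes>\<^bsub>?G\<^esub> q = \<one>\<^bsub>?G\<^esub>" by (simp add: fun_eq_iff)
  ultimately show "\<exists>p\<in>carrier ?G. p \<otimes>\<^bsub>?G\<^esub> q = \<one>\<^bsub>?G\<^esub>" by blast
qed (simp_all add: fun_eq_iff)

lemma comm_group_model_ee: "comm_group (SGee (model :: (('a, 'b) key \<Rightarrow> int, ('a, 'b) key \<Rightarrow> int) square))"
proof (rule comm_groupI)
  show "\<exists>b\<in>carrier (SGee model). b \<otimes>\<^bsub>SGee model\<^esub> a = \<one>\<^bsub>SGee model\<^esub>" for a :: "('a, 'b) key \<Rightarrow> int"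
    by (rule bexI[of _ "\<lambda>k. - a k"]) simp_all
qed (simp_all add: fun_eq_iff)

lemma inv_model:
  fixes q a :: "('a, 'b) key \<Rightarrow> int"
  shows
  "q \<in> carrier (SGe model) \<Longrightarrow> inv\<^bsub>SGe model\<^esub> q = (\<lambda>k. deg_prod (deg q) (deg q) k - q k)"
  "inv\<^bsub>SGee model\<^esub> a = (\<lambda>k. - a k)"
proof -
  assume q: "q \<in> carrier (SGe model)"
  show "inv\<^bsub>SGe model\<^esub> q = (\<lambda>k. deg_prod (deg q) (deg q) k - q k)"
  proof (rule group.inv_equality[OF group_model _ q])
    have "2 * q (Pr s s) = deg q s * (deg q s - 1)" for s using q by simp
    then show "(\<lambda>k. deg_prod (deg q) (deg q) k - q k) \<in> carrier (SGe model)"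
      by (simp add: algebra_simps)
  qed (simp add: fun_eq_iff)
next
  interpret ee: comm_group "SGee (model :: (('a, 'b) key \<Rightarrow> int, ('a, 'b) key \<Rightarrow> int) square)"
    by (rule comm_group_model_ee)
  show "inv\<^bsub>SGee model\<^esub> a = (\<lambda>k. - a k)" by (intro ee.inv_equality) (simp_all add: fun_eq_iff)
qed

lemma model_cross [simp]: "cross_effect (SGe model) (SGee model) (\<lambda>q. q) p q = deg_prod (deg p) (deg q)"
  by (simp add: cross_effect_def inv_model(2) fun_eq_iff)

lemma model_T: "sg_T model a = twist a"
  by (simp add: sg_T_def inv_model(2) fun_eq_iff)

lemma square_group_model: "square_group (model :: (('a, 'b) key \<Rightarrow> int, ('a, 'b) key \<Rightarrow> int) square)" (is "square_group ?M")
proof (rule square_group.intro)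
  show "comm_group (SGee ?M)" by (rule comm_group_model_ee)
  show "SGP ?M \<in> hom (SGee ?M) (SGe ?M)" by (rule homI) (simp_all add: fun_eq_iff)
  have "biadditive (SGe ?M) (SGe ?M) (SGee ?M) (sg_cross ?M)"
    by (rule biadditiveI) (simp_all add: model_cross fun_eq_iff)
  then show "quadratic_map (SGe ?M) (SGee ?M) (SGH ?M)"
    by (auto simp: quadratic_map_def biadditive_def)
  show "SGP ?M (sg_cross ?M x y) = inv\<^bsub>SGe ?M\<^esub> x \<otimes>\<^bsub>SGe ?M\<^esub> inv\<^bsub>SGe ?M\<^esub> y \<otimes>\<^bsub>SGe ?M\<^esub> x \<otimes>\<^bsub>SGe ?M\<^esub> y"
    if "x \<in> carrier (SGe ?M)" "y \<in> carrier (SGe ?M)" for x y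
  proof
    fix k
    show "SGP ?M (sg_cross ?M x y) k = (inv\<^bsub>SGe ?M\<^esub> x \<otimes>\<^bsub>SGe ?M\<^esub> inv\<^bsub>SGe ?M\<^esub> y \<otimes>\<^bsub>SGe ?M\<^esub> x \<otimes>\<^bsub>SGe ?M\<^esub> y) k"
      unfolding model_cross inv_model(1)[OF that(1)] inv_model(1)[OF that(2)]
      by (cases k) (simp_all add: algebra_simps)
  qed
qed (simp_all add: group_model model_cross fun_eq_iff)

text \<open>The correction of \<open>y\<close> to the power \<open>deg q s\<close> by \<open>P (H y)\<close> makes the formula additive in \<open>y\<close>:
  the commutators that arise have exponent \<open>deg q s\<close> choose 2, which is \<open>q (Pr s s)\<close>.\<close>

lemma model_coordinate_e:
  fixes B :: "('c, 'd) square" and s :: 'a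
  assumes B: "square_group B"
  defines "M \<equiv> model :: (('a, 'b) key \<Rightarrow> int, ('a, 'b) key \<Rightarrow> int) square"
  obtains h where "h \<in> hom (tensor_e M B) (SGe B)"
    and "\<And>q y. q \<in> carrier (SGe M) \<Longrightarrow> y \<in> carrier (SGe B) \<Longrightarrow>
      h (circ M B q y) = y [^]\<^bsub>SGe B\<^esub> deg q s \<otimes>\<^bsub>SGe B\<^esub> SGP B (SGH B y) [^]\<^bsub>SGe B\<^esub> q (Pr s s)"
    and "\<And>a b. b \<in> carrier (SGee B) \<Longrightarrow> h (bar M B a b) = SGP B b [^]\<^bsub>SGe B\<^esub> a (Pr s s)"
proof -
  interpret B: square_group B by fact
  interpret S: square_tensor M B unfolding M_def by (intro square_tensorI square_group_model B)
  let ?fc = "\<lambda>q y. y [^]\<^bsub>SGe B\<^esub> deg q s \<otimes>\<^bsub>SGe B\<^esub> SGP B (SGH B y) [^]\<^bsub>SGe B\<^esub> q (Pr s s)"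
  let ?fb = "\<lambda>a b. SGP B b [^]\<^bsub>SGe B\<^esub> (a (Pr s s) :: int)"
  have cen: "SGP B b [^]\<^bsub>SGe B\<^esub> (i::int) \<otimes>\<^bsub>SGe B\<^esub> z = z \<otimes>\<^bsub>SGe B\<^esub> SGP B b [^]\<^bsub>SGe B\<^esub> i"
    if "b \<in> carrier (SGee B)" "z \<in> carrier (SGe B)" for b i z
    using that B.P_central[of "b [^]\<^bsub>SGee B\<^esub> i" z] by (simp add: B.P.hom_int_pow)
  have pow: "SGP B (b \<otimes>\<^bsub>SGee B\<^esub> b') [^]\<^bsub>SGe B\<^esub> (i::int) = SGP B b [^]\<^bsub>SGe B\<^esub> i \<otimes>\<^bsub>SGe B\<^esub> SGP B b' [^]\<^bsub>SGe B\<^esub> i"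
    if "b \<in> carrier (SGee B)" "b' \<in> carrier (SGee B)" for b b' i
    using that by (simp add: B.ee.int_pow_distrib flip: B.P.hom_int_pow B.P.hom_mult)
  have "\<exists>h\<in>hom (tensor_e M B) (SGe B). (\<forall>q\<in>carrier (SGe M). \<forall>y\<in>carrier (SGe B). h (circ M B q y) = ?fc q y) \<and>
    (\<forall>a\<in>carrier (SGee M). \<forall>b\<in>carrier (SGee B). h (bar M B a b) = ?fb a b)"
  proof (rule S.e_lift[OF B.e.is_group])
    fix q y y' assume q: "q \<in> carrier (SGe M)" and y: "y \<in> carrier (SGe B)" "y' \<in> carrier (SGe B)"
    let ?n = "deg q s" and ?m = "q (Pr s s)" and ?c = "SGP B (sg_cross B y' y)"
    have m: "2 * ?m = ?n * (?n - 1)" using q by (simp add: M_def)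
    have "y' \<otimes>\<^bsub>SGe B\<^esub> y = y \<otimes>\<^bsub>SGe B\<^esub> (y' \<otimes>\<^bsub>SGe B\<^esub> ?c)"
      using y by (simp add: B.P_cross B.e.m_assoc B.e.inv_cancel_left)
    from B.e.int_pow_mult_commutator[OF y _ this _ _ m]
    have 1: "(y \<otimes>\<^bsub>SGe B\<^esub> y') [^]\<^bsub>SGe B\<^esub> ?n = y [^]\<^bsub>SGe B\<^esub> ?n \<otimes>\<^bsub>SGe B\<^esub> y' [^]\<^bsub>SGe B\<^esub> ?n \<otimes>\<^bsub>SGe B\<^esub> ?c [^]\<^bsub>SGe B\<^esub> ?m"
      using y by (simp add: B.P_central)
    \<comment> \<open>\<open>P\<close> absorbs \<open>T\<close>, so P(y'|y) = -P(y|y'): the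
      commutator produced by the power formula is opposite to the deviation of PH.\<close>
    have "sg_T B (sg_cross B y' y) = inv\<^bsub>SGee B\<^esub> sg_cross B y y'" using y by simp
    then have c: "?c = SGP B (inv\<^bsub>SGee B\<^esub> sg_cross B y y')" using y by (metis B.P_T B.H.cr.closed)
    \<comment> \<open>The commutator factor cancels the cross-effect in PH(y + y'). This works
      because both carry the same exponent \<open>q (Pr s s)\<close>.\<close>
    have 2: "?c [^]\<^bsub>SGe B\<^esub> ?m \<otimes>\<^bsub>SGe B\<^esub> SGP B (SGH B (y \<otimes>\<^bsub>SGe B\<^esub> y')) [^]\<^bsub>SGe B\<^esub> ?m =
        SGP B (SGH B y) [^]\<^bsub>SGe B\<^esub> ?m \<otimes>\<^bsub>SGe B\<^esub> SGP B (SGH B y') [^]\<^bsub>SGe B\<^esub> ?m"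
    proof -
      let ?z = "sg_cross B y y'"
      have "inv\<^bsub>SGee B\<^esub> ?z \<otimes>\<^bsub>SGee B\<^esub> SGH B (y \<otimes>\<^bsub>SGe B\<^esub> y') = SGH B y \<otimes>\<^bsub>SGee B\<^esub> SGH B y'"
        using y B.H.cr.closed[OF y] B.H.f_closed[OF y(1)] B.H.f_closed[OF y(2)] B.H.f_mult[OF y]
        by (metis B.ee.inv_cancel_left(2) B.ee.m_closed B.ee.m_comm)
      then have "SGP B (inv\<^bsub>SGee B\<^esub> ?z \<otimes>\<^bsub>SGee B\<^esub> SGH B (y \<otimes>\<^bsub>SGe B\<^esub> y')) [^]\<^bsub>SGe B\<^esub> ?m =
          SGP B (SGH B y \<otimes>\<^bsub>SGee B\<^esub> SGH B y') [^]\<^bsub>SGe B\<^esub> ?m" by (simp only:)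
      then show ?thesis
        unfolding c by (simp only: pow[OF B.ee.inv_closed[OF B.H.cr.closed[OF y]] B.H.f_closed[OF B.e.m_closed[OF y]]]
          pow[OF B.H.f_closed[OF y(1)] B.H.f_closed[OF y(2)]])
    qed
    have "?fc q (y \<otimes>\<^bsub>SGe B\<^esub> y') = y [^]\<^bsub>SGe B\<^esub> ?n \<otimes>\<^bsub>SGe B\<^esub> y' [^]\<^bsub>SGe B\<^esub> ?n \<otimes>\<^bsub>SGe B\<^esub>
      (SGP B (SGH B y) [^]\<^bsub>SGe B\<^esub> ?m \<otimes>\<^bsub>SGe B\<^esub> SGP B (SGH B y') [^]\<^bsub>SGe B\<^esub> ?m)"
      unfolding 1 2[symmetric] using y by (simp add: B.e.m_assoc)
    also have "\<dots> = y [^]\<^bsub>SGe B\<^esub> ?n \<otimes>\<^bsub>SGe B\<^esub> (y' [^]\<^bsub>SGe B\<^esub> ?n \<otimes>\<^bsub>SGe B\<^esub> SGP B (SGH B y) [^]\<^bsub>SGe B\<^esub> ?m) \<otimes>\<^bsub>SGe B\<^esub>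
      SGP B (SGH B y') [^]\<^bsub>SGe B\<^esub> ?m" using y by (simp add: B.e.m_assoc)
    also have "\<dots> = ?fc q y \<otimes>\<^bsub>SGe B\<^esub> ?fc q y'"
      unfolding cen[OF B.H.f_closed[OF y(1)] B.e.int_pow_closed[OF y(2)], symmetric] using y by (simp add: B.e.m_assoc)
    finally show "?fc q (y \<otimes>\<^bsub>SGe B\<^esub> y') = ?fc q y \<otimes>\<^bsub>SGe B\<^esub> ?fc q y'" .
  next
    fix p q y assume pq: "p \<in> carrier (SGe M)" "q \<in> carrier (SGe M)" and y: "y \<in> carrier (SGe B)"
    let ?z = "SGP B (SGH B y)"
    have z: "SGH B y \<in> carrier (SGee B)" using y by simp
    have "?fc (p \<otimes>\<^bsub>SGe M\<^esub> q) y = y [^]\<^bsub>SGe B\<^esub> deg p s \<otimes>\<^bsub>SGe B\<^esub> y [^]\<^bsub>SGe B\<^esub> deg q s \<otimes>\<^bsub>SGe B\<^esub>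
      (?z [^]\<^bsub>SGe B\<^esub> p (Pr s s) \<otimes>\<^bsub>SGe B\<^esub> ?z [^]\<^bsub>SGe B\<^esub> q (Pr s s) \<otimes>\<^bsub>SGe B\<^esub> ?z [^]\<^bsub>SGe B\<^esub> (deg p s * deg q s))"
      using y by (simp add: M_def B.e.int_pow_mult)
    also have "\<dots> = y [^]\<^bsub>SGe B\<^esub> deg p s \<otimes>\<^bsub>SGe B\<^esub> (y [^]\<^bsub>SGe B\<^esub> deg q s \<otimes>\<^bsub>SGe B\<^esub>
      ?z [^]\<^bsub>SGe B\<^esub> p (Pr s s)) \<otimes>\<^bsub>SGe B\<^esub> ?z [^]\<^bsub>SGe B\<^esub> q (Pr s s) \<otimes>\<^bsub>SGe B\<^esub> ?z [^]\<^bsub>SGe B\<^esub> (deg p s * deg q s)"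
      using y by (simp add: B.e.m_assoc)
    also have "\<dots> = ?fc p y \<otimes>\<^bsub>SGe B\<^esub> ?fc q y \<otimes>\<^bsub>SGe B\<^esub> ?fb (sg_cross M q p) (SGH B y)"
      unfolding cen[OF z B.e.int_pow_closed[OF y, of "deg q s"], of "p (Pr s s)", symmetric]
      using y by (simp add: M_def B.e.m_assoc mult.commute)
    finally show "?fc (p \<otimes>\<^bsub>SGe M\<^esub> q) y = ?fc p y \<otimes>\<^bsub>SGe B\<^esub> ?fc q y \<otimes>\<^bsub>SGe B\<^esub> ?fb (sg_cross M q p) (SGH B y)" .
  next
    fix q b assume q: "q \<in> carrier (SGe M)" and b: "b \<in> carrier (SGee B)"
    \<comment> \<open>The carrier condition again, as n^2 = n + 2m. It matches the exponents in
      \<open>circ_P_right\<close>, where PHP(b) = 2P(b) doubles m.\<close>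
    have m: "deg q s * deg q s = deg q s + q (Pr s s) + q (Pr s s)" using q by (simp add: M_def algebra_simps)
    have "?fb (sg_cross M q q) b = SGP B b [^]\<^bsub>SGe B\<^esub> (deg q s * deg q s)" by (simp add: M_def)
    also have "\<dots> = SGP B b [^]\<^bsub>SGe B\<^esub> (deg q s + q (Pr s s) + q (Pr s s))" by (simp only: m)
    also have "\<dots> = SGP B b [^]\<^bsub>SGe B\<^esub> deg q s \<otimes>\<^bsub>SGe B\<^esub> SGP B b [^]\<^bsub>SGe B\<^esub> q (Pr s s) \<otimes>\<^bsub>SGe B\<^esub> SGP B b [^]\<^bsub>SGe B\<^esub> q (Pr s s)"
      using b by (simp only: B.e.int_pow_mult B.P.hom_closed)
    also have "\<dots> = ?fc q (SGP B b)"
      using b by (simp add: B.PHP B.e.int_pow_mult_distrib B.e.m_assoc)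
    finally show "?fc q (SGP B b) = ?fb (sg_cross M q q) b" by (rule HOL.sym)
  next
    fix a b assume "b \<in> carrier (SGee B)"
    then show "?fb (sg_T M a) (sg_T B b) = inv\<^bsub>SGe B\<^esub> ?fb a b"
      by (simp add: M_def model_T B.e.int_pow_neg)
  next
    fix a b q y assume "b \<in> carrier (SGee B)" "y \<in> carrier (SGe B)"
    then show "?fb a b \<otimes>\<^bsub>SGe B\<^esub> ?fc q y = ?fc q y \<otimes>\<^bsub>SGe B\<^esub> ?fb a b" by (intro cen) simp_all
  next
    fix a b a' b' assume "b \<in> carrier (SGee B)" "b' \<in> carrier (SGee B)"
    then show "?fb a b \<otimes>\<^bsub>SGe B\<^esub> ?fb a' b' = ?fb a' b' \<otimes>\<^bsub>SGe B\<^esub> ?fb a b" by (intro cen) simp_all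
  qed (simp_all add: M_def B.e.int_pow_mult pow del: B.P.hom_mult)
  with that show thesis by (auto simp: M_def)
qed

definition unit_vec :: "'k \<Rightarrow> 'k \<Rightarrow> int" where
  "unit_vec k j = (if j = k then 1 else 0)"

lemma unit_vec_simps [simp]:
  "deg (unit_vec (Gen (Inl s) False)) = unit_vec s"
  "deg (unit_vec (Pr s' t')) = (\<lambda>_. 0)"
  "twist (unit_vec (Gen r e)) = unit_vec (Gen r (\<not> e))"
  "twist (unit_vec (Pr s t)) = (\<lambda>k. - unit_vec (Pr t s) k)"
  "deg_prod (unit_vec s) (unit_vec t) = unit_vec (Pr s t)"
proof -
  show "deg (unit_vec (Gen (Inl s) False)) = unit_vec s" "deg (unit_vec (Pr s' t')) = (\<lambda>_. 0)"
    by (auto simp: deg_def unit_vec_def)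
  show "twist (unit_vec (Gen r e)) = unit_vec (Gen r (\<not> e))"
    "twist (unit_vec (Pr s t)) = (\<lambda>k. - unit_vec (Pr t s) k)"
    "deg_prod (unit_vec s) (unit_vec t) = unit_vec (Pr s t)"
    subgoal by (rule ext) (rename_tac k, case_tac k; auto simp: unit_vec_def)
    subgoal by (rule ext) (rename_tac k, case_tac k; auto simp: unit_vec_def)
    subgoal by (rule ext) (rename_tac k, case_tac k; auto simp: unit_vec_def)
    done
qed

section \<open>The free square group that covers \<open>M\<close>\<close>

context square_group
begin

abbreviation "Q \<equiv> sg_times M (model :: (('a, 'b) key \<Rightarrow> int, ('a, 'b) key \<Rightarrow> int) square)"

text \<open>The first component evaluates a generator in \<open>M\<close>, the second records it as
  a basis element. Coordinates thus stay available after relations have been imposed in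
  \<open>M\<close>.\<close>

definition gen_e :: "'a \<Rightarrow> 'a \<times> (('a, 'b) key \<Rightarrow> int)" where
  "gen_e s = (s, unit_vec (Gen (Inl s) False))"

text \<open>The basis of the \<open>ee\<close>-level of the free square group: H(s) and T(H(s)), u
  and T u, and the cross-effects (s|t), each evaluated in \<open>M\<close> and paired with its
  coordinate vector.\<close>

fun base :: "('a, 'b) key \<Rightarrow> 'b \<times> (('a, 'b) key \<Rightarrow> int)" where
  "base (Gen (Inl s) e) = (if e then sg_T M (SGH M s) else SGH M s, unit_vec (Gen (Inl s) e))"
| "base (Gen (Inr u) e) = (if e then sg_T M u else u, unit_vec (Gen (Inr u) e))"
| "base (Pr s t) = (sg_cross M s t, unit_vec (Pr s t))"

definition keys :: "('a, 'b) key set" where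
  "keys = {Gen r e | r e. r \<in> carrier (SGe M) <+> carrier (SGee M)} \<union>
     {Pr s t | s t. s \<in> carrier (SGe M) \<and> t \<in> carrier (SGe M)}"

definition cover_ee :: "('b \<times> (('a, 'b) key \<Rightarrow> int)) set" where
  "cover_ee = generate (SGee Q) (base ` keys)"

definition cover_e :: "('a \<times> (('a, 'b) key \<Rightarrow> int)) set" where
  "cover_e = generate (SGe Q) (gen_e ` carrier (SGe M) \<union> SGP Q ` cover_ee)"

definition cover :: "('a \<times> (('a, 'b) key \<Rightarrow> int), 'b \<times> (('a, 'b) key \<Rightarrow> int)) square" where
  "cover = sg_restrict Q cover_e cover_ee"

lemma keys_iff [simp]:
  "Gen (Inl s) e \<in> keys \<longleftrightarrow> s \<in> carrier (SGe M)" "Gen (Inr u) e \<in> keys \<longleftrightarrow> u \<in> carrier (SGee M)"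
  "Pr s t \<in> keys \<longleftrightarrow> s \<in> carrier (SGe M) \<and> t \<in> carrier (SGe M)"
  by (auto simp: keys_def)

lemma snd_base: "snd (base k) = unit_vec k"
  by (cases k rule: base.cases) auto

lemma base_closed: "k \<in> keys \<Longrightarrow> base k \<in> carrier (SGee Q)"
  by (cases k rule: base.cases) auto

lemma gen_e_closed: "s \<in> carrier (SGe M) \<Longrightarrow> gen_e s \<in> carrier (SGe Q)"
  by (auto simp: gen_e_def unit_vec_def)

lemma square_group_Q: "square_group Q"
  by (intro square_group_times square_group_axioms square_group_model)

lemma base_Pr: "s \<in> carrier (SGe M) \<Longrightarrow> t \<in> carrier (SGe M) \<Longrightarrow> base (Pr s t) = sg_cross Q (gen_e s) (gen_e t)"
  using gen_e_closed[of s] gen_e_closed[of t]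
  by (subst gen_e_def, subst gen_e_def, subst square_group_times(2)[OF square_group_axioms square_group_model])
    (auto simp: gen_e_def fun_eq_iff)

lemma base_twist: "Gen r e \<in> keys \<Longrightarrow> sg_T Q (base (Gen r e)) = base (Gen r (\<not> e))"
  using base_closed[of "Gen r e"]
  by (cases r; cases e) (simp_all add: square_group_times(3)[OF square_group_axioms square_group_model] model_T)

text \<open>The issue is closure of the two generated subgroups under \<open>H\<close>. On P a it
  requires stability under \<open>T\<close>, since HP(a) = a + T a, and on sums it requires
  stability under cross-effects; both are verified on generators.\<close>

lemma square_group_cover: "square_group cover"
  and cover_e_subgroup: "subgroup cover_e (SGe Q)" and cover_ee_subgroup: "subgroup cover_ee (SGee Q)"
  and base_cover: "k \<in> keys \<Longrightarrow> base k \<in> cover_ee"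
  and gen_e_cover: "s \<in> carrier (SGe M) \<Longrightarrow> gen_e s \<in> cover_e"
proof -
  interpret Q: square_group Q by (rule square_group_Q)
  have b: "base ` keys \<subseteq> carrier (SGee Q)" using base_closed by blast
  show V: "subgroup cover_ee (SGee Q)"
    unfolding cover_ee_def by (rule Q.ee.generate_is_subgroup[OF b])
  interpret V: subgroup cover_ee "SGee Q" by (rule V)
  let ?S = "gen_e ` carrier (SGe M) \<union> SGP Q ` cover_ee"
  have S: "?S \<subseteq> carrier (SGe Q)"
    using gen_e_closed V.subset Q.P.hom_closed by (intro Un_least image_subsetI) blast+
  show U: "subgroup cover_e (SGe Q)"
    unfolding cover_e_def by (rule Q.e.generate_is_subgroup[OF S])
  interpret U: subgroup cover_e "SGe Q" by (rule U)
  show bc: "base k \<in> cover_ee" if "k \<in> keys" for k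
    unfolding cover_ee_def using that by (auto intro: generate.incl)
  show ge: "gen_e s \<in> cover_e" if "s \<in> carrier (SGe M)" for s
    unfolding cover_e_def using that by (auto intro: generate.incl)
  have T: "sg_T Q a \<in> cover_ee" if a: "a \<in> cover_ee" for a
  proof (rule generate_hom_mem[OF Q.ee.is_group Q.ee.is_group Q.T_hom b V _ a[unfolded cover_ee_def]])
    fix x assume "x \<in> base ` keys"
    then obtain k where k: "k \<in> keys" "x = base k" by blast
    show "sg_T Q x \<in> cover_ee"
    proof (cases k)
      case (Gen r e)
      then have "Gen r (\<not> e) \<in> keys" using k(1) by (cases r) auto
      then show ?thesis using base_twist[of r e] bc k Gen by simp
    next
      case (Pr s t)
      then have st: "s \<in> carrier (SGe M)" "t \<in> carrier (SGe M)" using k(1) by simp_all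
      have "sg_T Q x = inv\<^bsub>SGee Q\<^esub> base (Pr t s)"
        unfolding k Pr base_Pr[OF st] base_Pr[OF st(2,1)] by (rule Q.T_cross[OF gen_e_closed gen_e_closed, OF st])
      moreover have "base (Pr t s) \<in> cover_ee" using bc st by (simp only: keys_iff simp_thms)
      ultimately show ?thesis using V.m_inv_closed by (simp only:)
    qed
  qed
  \<comment> \<open>Cross-effects of two generators s, t are basis elements by design, and those
    involving an element of the image of \<open>P\<close> vanish.\<close>
  have cr1: "sg_cross Q s t \<in> cover_ee" if s: "s \<in> ?S" and t: "t \<in> ?S" for s t
  proof -
    have tc: "t \<in> carrier (SGe Q)" "s \<in> carrier (SGe Q)" using s t S by blast+
    consider s' t' where "s = gen_e s'" "t = gen_e t'" "s' \<in> carrier (SGe M)" "t' \<in> carrier (SGe M)"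
      | a where "a \<in> cover_ee" "s = SGP Q a \<or> t = SGP Q a" using s t by blast
    then show ?thesis
    proof cases
      case 1
      then show ?thesis using bc[of "Pr s' t'"] by (simp only: base_Pr keys_iff simp_thms)
    next
      case 2
      then have "sg_cross Q s t = \<one>\<^bsub>SGee Q\<^esub>"
        using tc V.subset Q.cross_P_left[of a t] Q.cross_P_right[of s a] by blast
      then show ?thesis by (simp only: V.one_closed)
    qed
  qed
  have cr2: "sg_cross Q s y \<in> cover_ee" if s: "s \<in> ?S" and y: "y \<in> cover_e" for s y
    by (rule generate_hom_mem[OF Q.e.is_group Q.ee.is_group Q.H.cr.hom_right S V _ y[unfolded cover_e_def]])
      (use s cr1 S in blast)+
  have cr: "sg_cross Q x y \<in> cover_ee" if x: "x \<in> cover_e" and y: "y \<in> cover_e" for x y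
    by (rule generate_hom_mem[OF Q.e.is_group Q.ee.is_group Q.H.cr.hom_left S V _ x[unfolded cover_e_def]])
      (use y cr2 U.subset in blast)+
  have HS: "SGH Q s \<in> cover_ee" if "s \<in> ?S" for s
  proof -
    from that consider s' where "s' \<in> carrier (SGe M)" "s = gen_e s'" | a where "a \<in> cover_ee" "s = SGP Q a" by blast
    then show ?thesis
    proof cases
      case 1
      then have "SGH Q s = base (Gen (Inl s') False)" by (simp add: gen_e_def)
      with bc[of "Gen (Inl s') False"] 1(1) show ?thesis by (simp only: keys_iff)
    next
      case 2
      show ?thesis
        unfolding 2(2) Q.HP_eq[OF subsetD[OF V.subset 2(1)]] by (rule V.m_closed[OF 2(1) T[OF 2(1)]])
    qed
  qed
  have H: "SGH Q x \<in> cover_ee" if "x \<in> cover_e" for x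
    using that unfolding cover_e_def
  proof (induction rule: generate.induct)
    case one
    show ?case unfolding Q.H.f_one by (rule V.one_closed)
  next
    case (incl h)
    then show ?case by (rule HS)
  next
    case (inv h)
    have h: "h \<in> cover_e" unfolding cover_e_def using inv by (rule generate.incl)
    show ?case
      unfolding Q.H.f_inv[OF subsetD[OF S inv]] by (rule V.m_closed[OF V.m_inv_closed[OF HS[OF inv]] cr[OF h h]])
  next
    case (eng h1 h2)
    then have h: "h1 \<in> cover_e" "h2 \<in> cover_e" by (simp_all only: cover_e_def)
    then have hc: "h1 \<in> carrier (SGe Q)" "h2 \<in> carrier (SGe Q)" using U.subset by blast+
    show ?case unfolding Q.H.f_mult[OF hc] by (intro V.m_closed eng.IH cr h)
  qed
  have "SGP Q a \<in> cover_e" if "a \<in> cover_ee" for a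
    unfolding cover_e_def using that by (auto intro: generate.incl)
  then show "square_group cover"
    unfolding cover_def by (intro Q.square_group_restrict U V H)
qed

lemma cover_incl: "sg_id \<in> sg_hom cover Q"
  unfolding cover_def
  by (intro sg_restrict_incl subgroup.subset cover_e_subgroup cover_ee_subgroup)

lemma cover_carrier [simp]: "carrier (SGe cover) = cover_e" "carrier (SGee cover) = cover_ee"
  by (simp_all add: cover_def)

lemma cover_generate:
  "cover_e = generate (SGe cover) (gen_e ` carrier (SGe M) \<union> SGP cover ` cover_ee)"
  "cover_ee = generate (SGee cover) (base ` keys)"
proof -
  interpret Q: square_group Q by (rule square_group_Q)
  have "SGP Q a \<in> cover_e" if "a \<in> cover_ee" for a
    unfolding cover_e_def using that by (auto intro: generate.incl)
  then have "gen_e ` carrier (SGe M) \<union> SGP Q ` cover_ee \<subseteq> cover_e" using gen_e_cover by blast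
  from Q.e.generate_consistent[OF this cover_e_subgroup]
  show "cover_e = generate (SGe cover) (gen_e ` carrier (SGe M) \<union> SGP cover ` cover_ee)"
    unfolding cover_def sg_restrict_simps by (simp only: sg_restrict_def square.simps cover_e_def)
  have "base ` keys \<subseteq> cover_ee" using base_cover by blast
  from Q.ee.generate_consistent[OF this cover_ee_subgroup]
  show "cover_ee = generate (SGee cover) (base ` keys)"
    unfolding cover_def by (simp only: sg_restrict_def square.simps cover_ee_def)
qed

lemma cover_T: "a \<in> cover_ee \<Longrightarrow> sg_T cover a = sg_T Q a"
  using square_group_hom.T[OF square_group_homI[OF square_group_cover square_group_Q cover_incl], of a]
  by (simp add: sg_id_def)

lemma cover_cross: "x \<in> cover_e \<Longrightarrow> y \<in> cover_e \<Longrightarrow> sg_cross cover x y = sg_cross Q x y"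
  using square_group_hom.cross[OF square_group_homI[OF square_group_cover square_group_Q cover_incl], of x y]
  by (simp add: sg_id_def)

lemma snd_cover_T: "a \<in> cover_ee \<Longrightarrow> snd (sg_T cover a) = twist (snd a)"
  using subgroup.subset[OF cover_ee_subgroup] cover_T[of a]
  by (cases a) (auto simp: square_group_times(3)[OF square_group_axioms square_group_model] model_T)

text \<open>Every element of either level of \<open>M\<close> is itself the first component of a
  generator, namely of \<open>gen_e s\<close> or of the basis element for u.\<close>

lemma cover_proj: "(fst, fst) \<in> sg_epi cover M"
proof -
  have "(fst, fst) \<in> sg_hom Q M" by (auto simp: sg_hom_def hom_def)
  from sg_hom_comp[OF cover_incl this] have h: "(fst, fst) \<in> sg_hom cover M"
    by (simp add: sg_comp_def sg_id_def)
  have "s \<in> fst ` cover_e" if "s \<in> carrier (SGe M)" for s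
    using gen_e_cover[OF that] by (rule rev_image_eqI) (simp add: gen_e_def)
  moreover have "u \<in> fst ` cover_ee" if "u \<in> carrier (SGee M)" for u
    by (rule rev_image_eqI[OF base_cover[of "Gen (Inr u) False"]]) (simp_all add: that)
  ultimately show ?thesis using h sg_homD(5,6)[OF h] by (auto simp: sg_epi_def)
qed

lemma cover_model: "(snd, snd) \<in> sg_hom cover model"
proof -
  have "(snd, snd) \<in> sg_hom Q (model :: (('a, 'b) key \<Rightarrow> int, ('a, 'b) key \<Rightarrow> int) square)"
    by (auto simp: sg_hom_def hom_def)
  from sg_hom_comp[OF cover_incl this] show ?thesis by (simp add: sg_comp_def sg_id_def)
qed

end

section \<open>Coordinates on tensor products with the cover, and injectivity\<close>

context square_group
begin

text \<open>Tensoring an abelian group B with a free one gives a sum of copies of B; this is the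
  projection to the copy with index k.\<close>

lemma cover_coordinate_ee:
  assumes B: "square_group B"
  shows "\<exists>h\<in>hom (tensor_ee cover B) (SGee B). \<forall>a\<in>cover_ee. \<forall>b\<in>carrier (SGee B).
    h (pure cover B a b) = b [^]\<^bsub>SGee B\<^esub> snd a k"
proof -
  interpret B: square_group B by fact
  interpret S: square_tensor cover B by (intro square_tensorI square_group_cover B)
  have snd: "snd (a \<otimes>\<^bsub>SGee cover\<^esub> a') k = snd a k + snd a' k" for a a'
    by (cases a; cases a') (simp add: cover_def)
  have "biadditive (SGee cover) (SGee B) (SGee B) (\<lambda>a b. b [^]\<^bsub>SGee B\<^esub> snd a k)"
    by (rule biadditiveI) (simp_all add: snd B.ee.int_pow_mult B.ee.int_pow_distrib)
  from S.ee_lift[OF B.ee.comm_group_axioms this] show ?thesis by simp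
qed

text \<open>Forgetting the component in \<open>M\<close> is a morphism from \<open>cover\<close> to
  \<open>model\<close>, along which \<open>model_coordinate_e\<close> is pulled back.\<close>

lemma cover_coordinate_e:
  fixes B :: "('c, 'd) square"
  assumes B: "square_group B"
  shows "\<exists>h\<in>hom (tensor_e cover B) (SGe B).
    (\<forall>x\<in>cover_e. \<forall>y\<in>carrier (SGe B). h (circ cover B x y) =
      y [^]\<^bsub>SGe B\<^esub> deg (snd x) s \<otimes>\<^bsub>SGe B\<^esub> SGP B (SGH B y) [^]\<^bsub>SGe B\<^esub> snd x (Pr s s)) \<and>
    (\<forall>a\<in>cover_ee. \<forall>b\<in>carrier (SGee B). h (bar cover B a b) = SGP B b [^]\<^bsub>SGe B\<^esub> snd a (Pr s s))"
proof -
  obtain g where g: "g \<in> sg_hom (sg_tensor cover B) (sg_tensor model B)"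
    "\<And>x y. x \<in> carrier (SGe cover) \<Longrightarrow> y \<in> carrier (SGe B) \<Longrightarrow>
      fst g (circ cover B x y) = circ model B (snd x) y"
    "\<And>a b. a \<in> carrier (SGee cover) \<Longrightarrow> b \<in> carrier (SGee B) \<Longrightarrow>
      fst g (bar cover B a b) = bar model B (snd a) b"
    by (rule tensor_map_exists[OF square_group_cover B square_group_model B cover_model sg_hom_id], rule that; simp add: sg_id_def)
  obtain h where h: "h \<in> hom (tensor_e (model :: (('a, 'b) key \<Rightarrow> int, ('a, 'b) key \<Rightarrow> int) square) B) (SGe B)"
    "\<And>q y. q \<in> carrier (SGe model) \<Longrightarrow> y \<in> carrier (SGe B) \<Longrightarrow>
      h (circ model B q y) = y [^]\<^bsub>SGe B\<^esub> deg q s \<otimes>\<^bsub>SGe B\<^esub> SGP B (SGH B y) [^]\<^bsub>SGe B\<^esub> q (Pr s s)"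
    "\<And>a b. b \<in> carrier (SGee B) \<Longrightarrow> h (bar model B a b) = SGP B b [^]\<^bsub>SGe B\<^esub> a (Pr s s)"
    by (rule model_coordinate_e[OF B]) blast
  have "snd x \<in> carrier (SGe model)" if "x \<in> cover_e" for x
    using sg_homD(5)[OF cover_model, of x] that by simp
  then show ?thesis
    using g h hom_compose[OF sg_homD(1)[OF g(1), unfolded sg_tensor_simps] h(1)]
    by (intro bexI[of _ "h \<circ> fst g"]) simp_all
qed

text \<open>The coordinates commute with \<open>\<mu>\<close>, so those of an element with trivial
  image are killed by the injective \<open>\<mu>\<close> and vanish. They detect triviality, with
  the trivial group in the role of the central subgroup.\<close>

lemma cover_tensor_inj_ee:
  fixes B :: "('c, 'd) square" and C :: "('x, 'y) square"
  assumes B: "square_group B" and C: "square_group C" and \<mu>: "\<mu> \<in> sg_mon B C"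
    and t: "t \<in> carrier (tensor_ee cover B)" and 0: "snd (sg_tensor_map cover B C \<mu>) t = \<one>\<^bsub>tensor_ee cover C\<^esub>"
  shows "t = \<one>\<^bsub>tensor_ee cover B\<^esub>"
proof -
  interpret B: square_group B by fact
  interpret C: square_group C by fact
  interpret X: square_group cover by (rule square_group_cover)
  interpret S: square_tensor cover B by (intro square_tensorI square_group_cover B)
  interpret S': square_tensor cover C by (intro square_tensorI square_group_cover C)
  have \<mu>h: "\<mu> \<in> sg_hom B C" and \<mu>i: "inj_on (snd \<mu>) (carrier (SGee B))" using \<mu> by (auto simp: sg_mon_def)
  interpret \<mu>: square_group_hom B C \<mu> by (intro square_group_homI B C \<mu>h)
  obtain h where h: "\<And>k. h k \<in> hom (tensor_ee cover B) (SGee B)"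
    "\<And>k a b. a \<in> cover_ee \<Longrightarrow> b \<in> carrier (SGee B) \<Longrightarrow> h k (pure cover B a b) = b [^]\<^bsub>SGee B\<^esub> snd a k"
    using cover_coordinate_ee[OF B] by metis
  have zero: "h k t = \<one>\<^bsub>SGee B\<^esub>" for k
  proof -
    obtain h' where h': "h' \<in> hom (tensor_ee cover C) (SGee C)"
      "\<And>a b. a \<in> cover_ee \<Longrightarrow> b \<in> carrier (SGee C) \<Longrightarrow> h' (pure cover C a b) = b [^]\<^bsub>SGee C\<^esub> snd a k"
      using cover_coordinate_ee[OF C] by metis
    note m = sg_tensor_map_hom[OF square_group_cover B C \<mu>h] sg_tensor_map_pure[OF square_group_cover B C \<mu>h]
    \<comment> \<open>Naturality of the coordinate: a homomorphism preserves integer powers, and on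
      pure tensors both sides are such powers.\<close>
    have "(snd \<mu> \<circ> h k) t = (h' \<circ> snd (sg_tensor_map cover B C \<mu>)) t"
      by (rule S.ee_hom_eqI[OF C.ee.is_group hom_compose[OF h(1) \<mu>.ee.homh]
            hom_compose[OF sg_homD(2)[OF m(1), unfolded sg_tensor_simps] h'(1)] t])
        (simp_all add: m(2) h(2) h'(2) \<mu>.ee.hom_int_pow)
    then have "snd \<mu> (h k t) = snd \<mu> \<one>\<^bsub>SGee B\<^esub>"
      using hom_one[OF h'(1) S'.EE.is_group C.ee.is_group] 0 by simp
    then show ?thesis by (rule inj_onD[OF \<mu>i]) (use h(1)[of k] t in \<open>auto simp: hom_def\<close>)
  qed
  have "t \<in> {\<one>\<^bsub>tensor_ee cover B\<^esub>}"
  proof (rule S.EE.detect_trivial[where K = keys and \<kappa> = "\<lambda>k. pure cover B (base k)" and \<phi> = h and B = "SGee B"])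
    let ?G = "generate (tensor_ee cover B) ({\<one>\<^bsub>tensor_ee cover B\<^esub>} \<union> (\<Union>k\<in>keys. pure cover B (base k) ` carrier (SGee B)))"
    have "subgroup ?G (tensor_ee cover B)"
      by (rule S.EE.generate_is_subgroup) (auto simp: base_cover)
    moreover have "pure cover B x b \<in> ?G" if "x \<in> base ` keys" "b \<in> carrier (SGee B)" for x b
      using that by (intro generate.incl) blast
    moreover have "base ` keys \<subseteq> carrier (SGee cover)" "carrier (SGee cover) = generate (SGee cover) (base ` keys)"
      using base_cover by (auto simp flip: cover_generate(2))
    ultimately have "carrier (tensor_ee cover B) \<subseteq> ?G" by (intro S.generate_pure)
    with t show "t \<in> ?G" by blast
  next
    fix j k y y' assume "j \<in> keys" "k \<in> keys" "y \<in> carrier (SGee B)" "y' \<in> carrier (SGee B)"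
    then show "\<exists>z\<in>{\<one>\<^bsub>tensor_ee cover B\<^esub>}. pure cover B (base j) y' \<otimes>\<^bsub>tensor_ee cover B\<^esub> pure cover B (base k) y =
        pure cover B (base k) y \<otimes>\<^bsub>tensor_ee cover B\<^esub> (pure cover B (base j) y' \<otimes>\<^bsub>tensor_ee cover B\<^esub> z)"
      using S.EE.m_comm[of "pure cover B (base j) y'" "pure cover B (base k) y"] by (simp add: base_cover)
  next
    fix k z assume "z \<in> {\<one>\<^bsub>tensor_ee cover B\<^esub>}"
    then show "h k z = \<one>\<^bsub>SGee B\<^esub>" using hom_one[OF h(1) S.EE.is_group B.ee.is_group] by simp
  next
    show "pure cover B (base k) \<in> hom (SGee B) (tensor_ee cover B)" if "k \<in> keys" for k
      using S.pure.hom_right[of "base k"] base_cover[OF that] by simp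
  qed (simp_all add: h zero B.ee.is_group S.EE.triv_subgroup base_cover snd_base unit_vec_def)
  then show ?thesis by simp
qed

text \<open>The homomorphisms \<open>f s\<close> read off the generators \<open>circ cover B (gen_e s) y\<close>. What is left lies in
  the image of \<open>P\<close>, where \<open>H\<close> is additive and reduces the question to the \<open>ee\<close>-level. A well-order
  selects one of \<open>Pr s t\<close> and \<open>Pr t s\<close>, because the corresponding bars are related by \<open>T\<close>.\<close>

lemma cover_tensor_inj_e:
  fixes B :: "('c, 'd) square" and C :: "('x, 'y) square"
  assumes B: "square_group B" and C: "square_group C" and \<mu>: "\<mu> \<in> sg_mon B C"
    and w: "w \<in> carrier (tensor_e cover B)" and 0: "fst (sg_tensor_map cover B C \<mu>) w = \<one>\<^bsub>tensor_e cover C\<^esub>"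
  shows "w = \<one>\<^bsub>tensor_e cover B\<^esub>"
proof -
  interpret B: square_group B by fact
  interpret C: square_group C by fact
  interpret X: square_group cover by (rule square_group_cover)
  interpret S: square_tensor cover B by (intro square_tensorI square_group_cover B)
  interpret S': square_tensor cover C by (intro square_tensorI square_group_cover C)
  interpret W: square_group "sg_tensor cover B" by (rule S.tensor_square_group)
  interpret W': square_group "sg_tensor cover C" by (rule S'.tensor_square_group)
  have \<mu>h: "\<mu> \<in> sg_hom B C" and \<mu>i: "inj_on (fst \<mu>) (carrier (SGe B))" using \<mu> by (auto simp: sg_mon_def)
  interpret \<mu>: square_group_hom B C \<mu> by (intro square_group_homI B C \<mu>h)
  note m = sg_tensor_map_hom[OF square_group_cover B C \<mu>h] sg_tensor_map_circ[OF square_group_cover B C \<mu>h]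
    sg_tensor_map_bar[OF square_group_cover B C \<mu>h]
  let ?TE = "tensor_e cover B" and ?TEE = "tensor_ee cover B" and ?P = "tensor_P cover B" and ?H = "tensor_H cover B"
  note Ph = S.tensor_P_hom
  \<comment> \<open>All that is used is a total antisymmetric relation on the generators.\<close>
  obtain r :: "'a rel" where "well_order_on UNIV r" using well_order_on by blast
  then have r: "antisym r" "\<And>s t. s \<noteq> t \<Longrightarrow> (s, t) \<in> r \<or> (t, s) \<in> r"
    by (auto simp: well_order_on_def linear_order_on_def partial_order_on_def total_on_def)
  \<comment> \<open>One key from each pair exchanged by \<open>T\<close> up to sign. The keys
    \<open>Pr s s\<close>, which \<open>T\<close> maps to themselves with a sign, are left
    out.\<close>
  define K where "K = {k \<in> keys. case k of Gen r e \<Rightarrow> \<not> e | Pr s t \<Rightarrow> (s, t) \<in> r \<and> s \<noteq> t}"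
  have Kk: "k \<in> keys" if "k \<in> K" for k using that by (simp add: K_def)
  have Kc: "base k \<in> cover_ee" if "k \<in> K" for k using base_cover[OF Kk[OF that]] .
  define N where "N = generate ?TEE (\<Union>k\<in>K. pure cover B (base k) ` carrier (SGee B))"
  have Ng: "(\<Union>k\<in>K. pure cover B (base k) ` carrier (SGee B)) \<subseteq> carrier ?TEE" using Kc by auto
  have N: "subgroup N ?TEE" unfolding N_def by (rule S.EE.generate_is_subgroup[OF Ng])
  define Z where "Z = ?P ` N"
  have Z: "subgroup Z ?TE"
    unfolding Z_def using W.P.subgroup_img_is_subgroup[of N] N by simp
  interpret Z: subgroup Z ?TE by (rule Z)
  have bar_K: "bar cover B (base k) b \<in> Z" if "k \<in> K" "b \<in> carrier (SGee B)" for k b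
    unfolding Z_def using that Kc
    by (intro rev_image_eqI[of "pure cover B (base k) b"]) (auto simp: N_def S.tensor_P_pure intro: generate.incl)
  have bar_T: "bar cover B (sg_T cover a) b = inv\<^bsub>?TE\<^esub> bar cover B a (sg_T B b)"
    if "a \<in> cover_ee" "b \<in> carrier (SGee B)" for a b
    using S.bar_T[of a "sg_T B b"] that by simp
  have base_cross: "base (Pr s t) = sg_cross cover (gen_e s) (gen_e t)"
    if "s \<in> carrier (SGe M)" "t \<in> carrier (SGe M)" for s t
    unfolding base_Pr[OF that] cover_cross[OF gen_e_cover gen_e_cover, OF that] ..
  \<comment> \<open>Moving \<open>T\<close> to the other factor by \<open>bar_T\<close> replaces a
    key outside \<open>K\<close> by its partner in \<open>K\<close>; only the keys
    \<open>Pr s s\<close> have no such partner.\<close>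
  have bar_base: "bar cover B (base k) b \<in> Z"
    if k: "k \<in> keys" "\<And>s. k \<noteq> Pr s s" and b: "b \<in> carrier (SGee B)" for k b
  proof (cases "k \<in> K")
    case True
    then show ?thesis using bar_K b by blast
  next
    case False
    show ?thesis
    proof (cases k)
      case (Gen q e)
      with False k(1) have e: "e" "Gen q False \<in> K" by (auto simp: K_def keys_def)
      have "base k = sg_T cover (base (Gen q False))"
        using base_twist[of q False] cover_T[OF Kc[OF e(2)]] Kk[OF e(2)] e Gen by simp
      then show ?thesis
        using bar_T[OF Kc[OF e(2)] b] bar_K[OF e(2), of "sg_T B b"] b by simp
    next
      case (Pr s t)
      then have st: "s \<in> carrier (SGe M)" "t \<in> carrier (SGe M)" "s \<noteq> t" using k by auto
      then have ts: "Pr t s \<in> K" using False r(2)[of s t] Pr by (auto simp: K_def)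
      have "sg_T cover (base (Pr t s)) = inv\<^bsub>SGee cover\<^esub> base k"
        unfolding Pr base_cross[OF st(1,2)] base_cross[OF st(2,1)]
        using X.T_cross[of "gen_e t" "gen_e s"] gen_e_cover st by simp
      then have "inv\<^bsub>?TE\<^esub> bar cover B (base k) b = inv\<^bsub>?TE\<^esub> bar cover B (base (Pr t s)) (sg_T B b)"
        using bar_T[OF Kc[OF ts] b] S.bar_inv(1)[of "base k" b] base_cover[OF k(1)] b by simp
      then have "bar cover B (base k) b = bar cover B (base (Pr t s)) (sg_T B b)"
        by (rule inj_onD[OF S.E.inv_inj]) (use base_cover[OF k(1)] Kc[OF ts] b in \<open>simp_all del: base.simps\<close>)
      then show ?thesis using bar_K[OF ts, of "sg_T B b"] b by simp
    qed
  qed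
  obtain f where f: "\<And>s. f s \<in> hom ?TE (SGe B)"
    "\<And>s x y. x \<in> cover_e \<Longrightarrow> y \<in> carrier (SGe B) \<Longrightarrow> f s (circ cover B x y) =
      y [^]\<^bsub>SGe B\<^esub> deg (snd x) s \<otimes>\<^bsub>SGe B\<^esub> SGP B (SGH B y) [^]\<^bsub>SGe B\<^esub> snd x (Pr s s)"
    "\<And>s a b. a \<in> cover_ee \<Longrightarrow> b \<in> carrier (SGee B) \<Longrightarrow> f s (bar cover B a b) = SGP B b [^]\<^bsub>SGe B\<^esub> snd a (Pr s s)"
    using cover_coordinate_e[OF B] by metis
  have f_zero: "f s w = \<one>\<^bsub>SGe B\<^esub>" for s
  proof -
    obtain f' where f': "f' \<in> hom (tensor_e cover C) (SGe C)"
      "\<And>x y. x \<in> cover_e \<Longrightarrow> y \<in> carrier (SGe C) \<Longrightarrow> f' (circ cover C x y) =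
        y [^]\<^bsub>SGe C\<^esub> deg (snd x) s \<otimes>\<^bsub>SGe C\<^esub> SGP C (SGH C y) [^]\<^bsub>SGe C\<^esub> snd x (Pr s s)"
      "\<And>a b. a \<in> cover_ee \<Longrightarrow> b \<in> carrier (SGee C) \<Longrightarrow> f' (bar cover C a b) = SGP C b [^]\<^bsub>SGe C\<^esub> snd a (Pr s s)"
      using cover_coordinate_e[OF C, of s] by metis
    have "(fst \<mu> \<circ> f s) w = (f' \<circ> fst (sg_tensor_map cover B C \<mu>)) w"
      by (rule S.e_hom_eqI[OF C.e.is_group hom_compose[OF f(1) \<mu>.e.homh]
            hom_compose[OF sg_homD(1)[OF m(1), unfolded sg_tensor_simps] f'(1)] w])
        (simp_all add: m(2,3) f(2,3) f'(2,3) \<mu>.e.hom_int_pow)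
    then have "fst \<mu> (f s w) = fst \<mu> \<one>\<^bsub>SGe B\<^esub>"
      using hom_one[OF f'(1) S'.E.is_group C.e.is_group] 0 by simp
    then show ?thesis by (rule inj_onD[OF \<mu>i]) (use f(1)[of s] w in \<open>auto simp: hom_def\<close>)
  qed
  have "w \<in> Z"
  proof (rule S.E.detect_trivial[where K = "carrier (SGe M)" and \<kappa> = "\<lambda>s. circ cover B (gen_e s)" and \<phi> = f and B = "SGe B"])
    let ?S = "Z \<union> (\<Union>s\<in>carrier (SGe M). circ cover B (gen_e s) ` carrier (SGe B))"
    have sub: "?S \<subseteq> carrier ?TE" using Z.subset gen_e_cover by auto
    have G: "subgroup (generate ?TE ?S) ?TE" by (rule S.E.generate_is_subgroup[OF sub])
    have ZG: "z \<in> generate ?TE ?S" if "z \<in> Z" for z using that by (auto intro: generate.incl)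
    have cG: "circ cover B (gen_e s) y \<in> generate ?TE ?S" if "s \<in> carrier (SGe M)" "y \<in> carrier (SGe B)" for s y
      using that by (auto intro: generate.incl)
    have bar_G: "bar cover B a b \<in> generate ?TE ?S" if a: "a \<in> base ` keys" and b: "b \<in> carrier (SGee B)" for a b
    proof -
      obtain k where k: "k \<in> keys" "a = base k" using a by blast
      show ?thesis
      proof (cases "\<exists>s. k = Pr s s")
        case True
        then obtain s where s: "k = Pr s s" "s \<in> carrier (SGe M)" using k(1) by auto
        \<comment> \<open>The relation \<open>circ_P_right\<close> accounts for the excluded keys:
          their bars are values of \<open>circ\<close> at \<open>gen_e s\<close> on the image of
          \<open>P\<close>.\<close>
        have "bar cover B a b = circ cover B (gen_e s) (SGP B b)"
          unfolding k(2) s(1) base_cross[OF s(2,2)] using gen_e_cover[OF s(2)] b by simp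
        then show ?thesis using cG[OF s(2), of "SGP B b"] b by simp
      next
        case False
        then show ?thesis using bar_base[OF k(1) _ b] ZG k(2) by blast
      qed
    qed
    have bar_G': "bar cover B a b \<in> generate ?TE ?S" if a: "a \<in> cover_ee" and b: "b \<in> carrier (SGee B)" for a b
      by (rule generate_hom_mem[where f = "\<lambda>a. bar cover B a b", OF X.ee.is_group S.E.is_group S.bar_hom_left[OF b] _ G _ a[unfolded cover_generate(2)]])
        (use bar_G b base_cover in auto)
    have "carrier ?TE \<subseteq> generate ?TE ?S"
    proof (rule S.generate_circ_bar[OF _ _ _ _ G])
      show "gen_e ` carrier (SGe M) \<union> SGP cover ` cover_ee \<subseteq> carrier (SGe cover)"
        using gen_e_cover X.P.hom_closed by (intro Un_least image_subsetI) simp_all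
      show "carrier (SGe cover) = generate (SGe cover) (gen_e ` carrier (SGe M) \<union> SGP cover ` cover_ee)"
        "carrier (SGee cover) = generate (SGee cover) (base ` keys)"
        by (simp_all flip: cover_generate)
      show "base ` keys \<subseteq> carrier (SGee cover)" using base_cover by auto
      show "circ cover B x y \<in> generate ?TE ?S"
        if "x \<in> gen_e ` carrier (SGe M) \<union> SGP cover ` cover_ee" "y \<in> carrier (SGe B)" for x y
        using that cG bar_G' by auto
    qed (rule bar_G)
    with w show "w \<in> generate ?TE ?S" by blast
  next
    fix s t y y' assume a: "s \<in> carrier (SGe M)" "t \<in> carrier (SGe M)" "s \<noteq> t" "y \<in> carrier (SGe B)" "y' \<in> carrier (SGe B)"
    let ?z = "bar cover B (base (Pr s t)) (sg_cross B y' y)"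
    \<comment> \<open>As s and t differ, the key \<open>Pr s t\<close> is not an excluded one, so
      the commutator lies in \<open>Z\<close>.\<close>
    have "?z \<in> Z" by (rule bar_base) (use a in auto)
    moreover have "circ cover B (gen_e s) y' \<otimes>\<^bsub>?TE\<^esub> circ cover B (gen_e t) y =
        circ cover B (gen_e t) y \<otimes>\<^bsub>?TE\<^esub> (circ cover B (gen_e s) y' \<otimes>\<^bsub>?TE\<^esub> ?z)"
      unfolding base_cross[OF a(1,2)]
      using S.circ_commutator[of "gen_e s" y' "gen_e t" y] X.H.cr.closed[of "gen_e s" "gen_e t"] gen_e_cover a
      by (simp add: S.E.m_assoc)
    ultimately show "\<exists>z\<in>Z. circ cover B (gen_e s) y' \<otimes>\<^bsub>?TE\<^esub> circ cover B (gen_e t) y =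
        circ cover B (gen_e t) y \<otimes>\<^bsub>?TE\<^esub> (circ cover B (gen_e s) y' \<otimes>\<^bsub>?TE\<^esub> z)" by blast
  next
    fix s z assume "z \<in> Z"
    then obtain t where t: "t \<in> N" "z = ?P t" unfolding Z_def by blast
    have "(f s \<circ> ?P) t \<in> {\<one>\<^bsub>SGe B\<^esub>}"
    proof (rule generate_hom_mem[OF S.EE.is_group B.e.is_group hom_compose[OF Ph f(1)] Ng B.e.triv_subgroup _ t(1)[unfolded N_def]])
      fix p assume "p \<in> (\<Union>k\<in>K. pure cover B (base k) ` carrier (SGee B))"
      then obtain k b where kb: "k \<in> K" "b \<in> carrier (SGee B)" "p = pure cover B (base k) b" by blast
      \<comment> \<open>On bars \<open>f s\<close> sees only the coordinate at
        \<open>Pr s s\<close>, and no key in \<open>K\<close> is of that form.\<close>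
      have "unit_vec k (Pr s s) = 0" using kb(1) by (auto simp: K_def unit_vec_def)
      then show "(f s \<circ> ?P) p \<in> {\<one>\<^bsub>SGe B\<^esub>}" using kb Kc f(3) by (simp add: S.tensor_P_pure snd_base)
    qed
    then show "f s z = \<one>\<^bsub>SGe B\<^esub>" using t(2) by simp
  next
    fix z g assume "z \<in> Z" and g: "g \<in> carrier ?TE"
    then obtain t where t: "t \<in> N" "z = ?P t" unfolding Z_def by blast
    then have "t \<in> carrier ?TEE" using subgroup.subset[OF N] by blast
    with t(2) g show "z \<otimes>\<^bsub>?TE\<^esub> g = g \<otimes>\<^bsub>?TE\<^esub> z" using W.P_central[of t g] by simp
  next
    show "circ cover B (gen_e s) \<in> hom (SGe B) ?TE" if "s \<in> carrier (SGe M)" for s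
      using S.circ_hom_right[of "gen_e s"] gen_e_cover[OF that] by simp
  next
    fix s t y assume "s \<in> carrier (SGe M)" "t \<in> carrier (SGe M)" "s \<noteq> t" "y \<in> carrier (SGe B)"
    then show "f s (circ cover B (gen_e t) y) = \<one>\<^bsub>SGe B\<^esub>"
      using f(2)[OF gen_e_cover] by (simp add: gen_e_def) (simp add: unit_vec_def)
  next
    fix s y assume "s \<in> carrier (SGe M)" "y \<in> carrier (SGe B)"
    then show "f s (circ cover B (gen_e s) y) = y"
      using f(2)[OF gen_e_cover] by (simp add: gen_e_def) (simp add: unit_vec_def)
  qed (use Z f f_zero B.e.is_group in simp_all)
  then obtain t where t: "t \<in> N" "w = ?P t" unfolding Z_def by blast
  have tc: "t \<in> carrier ?TEE" using t subgroup.subset[OF N] by blast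
  \<comment> \<open>The image of w is trivial, hence so is the image of H(w), and injectivity is
    already known on the \<open>ee\<close>-level.\<close>
  have Hw: "?H w = \<one>\<^bsub>?TEE\<^esub>"
  proof (rule cover_tensor_inj_ee[OF B C \<mu>])
    show "?H w \<in> carrier ?TEE" using W.H.f_closed[of w] w by simp
    show "snd (sg_tensor_map cover B C \<mu>) (?H w) = \<one>\<^bsub>tensor_ee cover C\<^esub>"
      using sg_homD(3)[OF m(1), of w] w 0 W'.H.f_one by simp
  qed
  obtain h where h: "\<And>k. h k \<in> hom ?TEE (SGee B)"
    "\<And>k a b. a \<in> cover_ee \<Longrightarrow> b \<in> carrier (SGee B) \<Longrightarrow> h k (pure cover B a b) = b [^]\<^bsub>SGee B\<^esub> snd a k"
    using cover_coordinate_ee[OF B] by metis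
  have HP: "?H \<circ> ?P \<in> hom ?TEE ?TEE"
  proof (rule homI)
    fix x y assume xy: "x \<in> carrier ?TEE" "y \<in> carrier ?TEE"
    have "?P x \<in> carrier ?TE" "?P y \<in> carrier ?TE" using Ph xy by (auto simp: hom_def)
    with xy show "(?H \<circ> ?P) (x \<otimes>\<^bsub>?TEE\<^esub> y) = (?H \<circ> ?P) x \<otimes>\<^bsub>?TEE\<^esub> (?H \<circ> ?P) y"
      using W.H.f_mult[of "?P x" "?P y"] W.cross_P_left[of x "?P y"] W.H.f_closed[of "?P x"] W.H.f_closed[of "?P y"]
        hom_mult[OF Ph xy] by simp
    show "(?H \<circ> ?P) x \<in> carrier ?TEE"
      using W.H.f_closed[of "?P x"] \<open>?P x \<in> carrier ?TE\<close> by simp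
  qed
  have hbase: "h j (?H (?P (pure cover B (base k) b))) = b [^]\<^bsub>SGee B\<^esub> unit_vec k j"
    if jk: "j \<in> K" "k \<in> K" and b: "b \<in> carrier (SGee B)" for j k b
  proof -
    \<comment> \<open>\<open>H\<close> of the bar of \<open>base k\<close> and b has the second term
      -T(base k) tensor T(b). Its coordinates lie at the partner of k, which is not in
      \<open>K\<close>, so on \<open>K\<close> the map HP acts as the identity in
      coordinates.\<close>
    have "twist (unit_vec k) j = 0"
      using jk r(1) by (cases k; cases j) (auto simp: K_def unit_vec_def antisym_def)
    then have "h j (pure cover B (sg_T cover (base k)) (sg_T B b)) = \<one>\<^bsub>SGee B\<^esub>"
      using h(2)[of "sg_T cover (base k)" "sg_T B b" j] X.T.hom_closed[of "base k"] Kc[OF jk(2)] b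
      by (simp add: snd_cover_T snd_base)
    moreover have "pure cover B (base k) b \<in> carrier ?TEE" "pure cover B (sg_T cover (base k)) (sg_T B b) \<in> carrier ?TEE"
      using Kc[OF jk(2)] X.T.hom_closed[of "base k"] b by simp_all
    ultimately show ?thesis
      using Kc[OF jk(2)] b h(2)[of "base k" b j] hom_mult[OF h(1)[of j]] hom_inv[OF h(1)[of j] S.EE.is_group B.ee.is_group]
      by (simp add: S.tensor_P_pure S.tensor_H_bar snd_base)
  qed
  have "t \<in> {\<one>\<^bsub>?TEE\<^esub>}"
  proof (rule S.EE.detect_trivial[where K = K and \<kappa> = "\<lambda>k. pure cover B (base k)" and \<phi> = "\<lambda>k. h k \<circ> (?H \<circ> ?P)" and B = "SGee B"])
    show "t \<in> generate ?TEE ({\<one>\<^bsub>?TEE\<^esub>} \<union> (\<Union>k\<in>K. pure cover B (base k) ` carrier (SGee B)))"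
      using t(1) S.EE.mono_generate[of "\<Union>k\<in>K. pure cover B (base k) ` carrier (SGee B)"] unfolding N_def by blast
  next
    fix j k y y' assume "j \<in> K" "k \<in> K" "y \<in> carrier (SGee B)" "y' \<in> carrier (SGee B)"
    then show "\<exists>z\<in>{\<one>\<^bsub>?TEE\<^esub>}. pure cover B (base j) y' \<otimes>\<^bsub>?TEE\<^esub> pure cover B (base k) y =
        pure cover B (base k) y \<otimes>\<^bsub>?TEE\<^esub> (pure cover B (base j) y' \<otimes>\<^bsub>?TEE\<^esub> z)"
      using S.EE.m_comm[of "pure cover B (base j) y'" "pure cover B (base k) y"] by (simp add: Kc)
  next
    fix k z assume "z \<in> {\<one>\<^bsub>?TEE\<^esub>}"
    then show "(h k \<circ> (?H \<circ> ?P)) z = \<one>\<^bsub>SGee B\<^esub>"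
      using hom_one[OF hom_compose[OF HP h(1)] S.EE.is_group B.ee.is_group] by simp
  next
    show "(h k \<circ> (?H \<circ> ?P)) t = \<one>\<^bsub>SGee B\<^esub>" for k
      using Hw hom_one[OF h(1) S.EE.is_group B.ee.is_group] unfolding t(2) by simp
    show "pure cover B (base k) \<in> hom (SGee B) ?TEE" if "k \<in> K" for k
      using S.pure.hom_right[of "base k"] Kc[OF that] by simp
    show "h k \<circ> (?H \<circ> ?P) \<in> hom ?TEE (SGee B)" for k
      by (rule hom_compose[OF HP h(1)])
  qed (simp_all add: hbase B.ee.is_group S.EE.triv_subgroup unit_vec_def)
  then show ?thesis unfolding t(2) using hom_one[OF Ph S.EE.is_group S.E.is_group] by simp
qed

end

section \<open>Encoding the cover in the test types, and the retraction argument\<close>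

definition int_code :: "int \<Rightarrow> ('a + 'b) list" where
  "int_code n = (if n < 0 then Inl undefined else Inr undefined) # replicate (nat \<bar>n\<bar>) (Inl undefined)"

fun key_code :: "('a, 'b) key \<Rightarrow> int \<Rightarrow> ('a + 'b) list" where
  "key_code (Gen r e) n = [Inl undefined, r, if e then Inl undefined else Inr undefined] @ int_code n"
| "key_code (Pr s t) n = [Inr undefined, Inl s, Inl t] @ int_code n"

text \<open>The vector is stored as its graph, one list for each key, next to a list of length one
  that holds the first component. A set is required because a vector may have infinitely many
  nonzero coordinates.\<close>

definition pair_code :: "'a + 'b \<Rightarrow> (('a, 'b) key \<Rightarrow> int) \<Rightarrow> ('a + 'b) list set" where
  "pair_code v q = insert [v] {key_code k (q k) | k. True}"

lemma int_code_inject [simp]: "int_code m = (int_code n :: ('a + 'b) list) \<longleftrightarrow> m = n"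
proof
  assume a: "int_code m = (int_code n :: ('a + 'b) list)"
  then have "m < 0 \<longleftrightarrow> n < 0" by (auto simp: int_code_def split: if_splits)
  moreover have "nat \<bar>m\<bar> = nat \<bar>n\<bar>"
    using arg_cong[OF a, of length] by (simp add: int_code_def)
  ultimately show "m = n" by (auto simp: abs_if split: if_splits)
qed simp

lemma key_code_inject: "key_code k m = key_code k' n \<longleftrightarrow> k = k' \<and> m = n"
  by (cases k; cases k') (auto split: if_splits)

lemma pair_code_inject: "pair_code v q = pair_code v' q' \<longleftrightarrow> v = v' \<and> q = q'"
proof
  assume a: "pair_code v q = pair_code v' q'"
  \<comment> \<open>Codes of keys have more than one entry, so the list of length one can be told
    apart from the graph.\<close>
  have len: "key_code k n \<noteq> [u]" for k :: "('a, 'b) key" and n u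
    by (cases k) simp_all
  have "[v] \<in> pair_code v' q'" using a by (auto simp: pair_code_def)
  then have v: "v = v'" using len by (auto simp: pair_code_def dest: HOL.sym)
  have "q k = q' k" for k
  proof -
    have "key_code k (q k) \<in> pair_code v' q'" using a by (auto simp: pair_code_def)
    then show ?thesis using len by (auto simp: pair_code_def key_code_inject)
  qed
  with v show "v = v' \<and> q = q'" by auto
qed simp

lemma projective_cover_section:
  fixes A :: "('a, 'b) square"
  assumes "sg_projective TYPE(('a + 'b) list set) TYPE(('a + 'b) list set) A"
  shows "\<exists>g\<in>sg_hom A (square_group.cover A). sg_eq A (sg_comp (fst, fst) g) sg_id"
proof -
  interpret square_group A using assms by (simp add: sg_projective_def)
  show ?thesis
  proof (rule projective_section[OF assms square_group_cover cover_proj])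
    show "inj (\<lambda>(x, q). pair_code (Inl x) q :: ('a + 'b) list set)"
      "inj (\<lambda>(x, q). pair_code (Inr x) q :: ('a + 'b) list set)"
      by (auto simp: inj_def pair_code_inject)
    show "inj (\<lambda>x. {[Inl x]} :: ('a + 'b) list set)" "inj (\<lambda>x. {[Inr x]} :: ('a + 'b) list set)"
      by (auto simp: inj_def)
  qed
qed

text \<open>The section g of p induces a split injection of the tensor products that is natural in
  the second variable. An element killed over \<open>A\<close> is killed over \<open>X\<close>,
  hence trivial there, and the retraction brings this back.\<close>

lemma tensor_map_mono_retract:
  assumes sq: "square_group A" "square_group X" "square_group B" "square_group C"
    and g: "g \<in> sg_hom A X" and p: "p \<in> sg_hom X A" and pg: "sg_eq A (sg_comp p g) sg_id"
    and \<mu>: "\<mu> \<in> sg_hom B C"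
    and inj: "\<And>w. w \<in> carrier (tensor_e X B) \<Longrightarrow> fst (sg_tensor_map X B C \<mu>) w = \<one>\<^bsub>tensor_e X C\<^esub> \<Longrightarrow> w = \<one>\<^bsub>tensor_e X B\<^esub>"
      "\<And>t. t \<in> carrier (tensor_ee X B) \<Longrightarrow> snd (sg_tensor_map X B C \<mu>) t = \<one>\<^bsub>tensor_ee X C\<^esub> \<Longrightarrow> t = \<one>\<^bsub>tensor_ee X B\<^esub>"
  shows "sg_tensor_map A B C \<mu> \<in> sg_mon (sg_tensor A B) (sg_tensor A C)"
proof -
  interpret S: square_tensor A B by (rule square_tensorI[OF sq(1,3)])
  interpret SC: square_tensor A C by (rule square_tensorI[OF sq(1,4)])
  interpret X: square_tensor X B by (rule square_tensorI[OF sq(2,3)])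
  interpret XC: square_tensor X C by (rule square_tensorI[OF sq(2,4)])
  note idn = sg_id_def fst_conv snd_conv id_apply
  obtain gB where gB: "gB \<in> sg_hom (sg_tensor A B) (sg_tensor X B)"
    "\<And>x y. x \<in> carrier (SGe A) \<Longrightarrow> y \<in> carrier (SGe B) \<Longrightarrow> fst gB (circ A B x y) = circ X B (fst g x) y"
    "\<And>a b. a \<in> carrier (SGee A) \<Longrightarrow> b \<in> carrier (SGee B) \<Longrightarrow> fst gB (bar A B a b) = bar X B (snd g a) b"
    "\<And>a b. a \<in> carrier (SGee A) \<Longrightarrow> b \<in> carrier (SGee B) \<Longrightarrow> snd gB (pure A B a b) = pure X B (snd g a) b"
    using tensor_map_exists[OF sq(1,3,2,3) g sg_hom_id] unfolding idn by blast
  obtain gC where gC: "gC \<in> sg_hom (sg_tensor A C) (sg_tensor X C)"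
    "\<And>x y. x \<in> carrier (SGe A) \<Longrightarrow> y \<in> carrier (SGe C) \<Longrightarrow> fst gC (circ A C x y) = circ X C (fst g x) y"
    "\<And>a b. a \<in> carrier (SGee A) \<Longrightarrow> b \<in> carrier (SGee C) \<Longrightarrow> fst gC (bar A C a b) = bar X C (snd g a) b"
    "\<And>a b. a \<in> carrier (SGee A) \<Longrightarrow> b \<in> carrier (SGee C) \<Longrightarrow> snd gC (pure A C a b) = pure X C (snd g a) b"
    using tensor_map_exists[OF sq(1,4,2,4) g sg_hom_id] unfolding idn by blast
  obtain pB where pB: "pB \<in> sg_hom (sg_tensor X B) (sg_tensor A B)"
    "\<And>x y. x \<in> carrier (SGe X) \<Longrightarrow> y \<in> carrier (SGe B) \<Longrightarrow> fst pB (circ X B x y) = circ A B (fst p x) y"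
    "\<And>a b. a \<in> carrier (SGee X) \<Longrightarrow> b \<in> carrier (SGee B) \<Longrightarrow> fst pB (bar X B a b) = bar A B (snd p a) b"
    "\<And>a b. a \<in> carrier (SGee X) \<Longrightarrow> b \<in> carrier (SGee B) \<Longrightarrow> snd pB (pure X B a b) = pure A B (snd p a) b"
    using tensor_map_exists[OF sq(2,3,1,3) p sg_hom_id] unfolding idn by blast
  note hom = sg_homD(1,2)[OF gB(1), unfolded sg_tensor_simps] sg_homD(1,2)[OF gC(1), unfolded sg_tensor_simps]
    sg_homD(1,2)[OF pB(1), unfolded sg_tensor_simps]
  note mA = sg_tensor_map_hom[OF sq(1,3,4) \<mu>] and mX = sg_tensor_map_hom[OF sq(2,3,4) \<mu>]
  note homm = sg_homD(1,2)[OF mA, unfolded sg_tensor_simps] sg_homD(1,2)[OF mX, unfolded sg_tensor_simps]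
  note mAv = sg_tensor_map_circ[OF sq(1,3,4) \<mu>] sg_tensor_map_bar[OF sq(1,3,4) \<mu>] sg_tensor_map_pure[OF sq(1,3,4) \<mu>]
  note mXv = sg_tensor_map_circ[OF sq(2,3,4) \<mu>] sg_tensor_map_bar[OF sq(2,3,4) \<mu>] sg_tensor_map_pure[OF sq(2,3,4) \<mu>]
  note cl = sg_homD(5,6)[OF g] sg_homD(5,6)[OF p] sg_homD(5,6)[OF \<mu>]
  have pg': "x \<in> carrier (SGe A) \<Longrightarrow> fst p (fst g x) = x" "a \<in> carrier (SGee A) \<Longrightarrow> snd p (snd g a) = a" for x a
    using pg by (simp_all add: sg_eq_def sg_comp_def sg_id_def)
  let ?mA = "sg_tensor_map A B C \<mu>" and ?mX = "sg_tensor_map X B C \<mu>"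
  interpret me: group_hom "tensor_e A B" "tensor_e A C" "fst ?mA" by unfold_locales (rule homm)
  interpret mee: group_hom "tensor_ee A B" "tensor_ee A C" "snd ?mA" by unfold_locales (rule homm)
  have "w = \<one>\<^bsub>tensor_e A B\<^esub>" if w: "w \<in> carrier (tensor_e A B)" "fst ?mA w = \<one>\<^bsub>tensor_e A C\<^esub>" for w
  proof -
    have "(fst ?mX \<circ> fst gB) w = (fst gC \<circ> fst ?mA) w"
      by (rule S.e_hom_eqI[OF XC.E.is_group hom_compose[OF hom(1) homm(3)] hom_compose[OF homm(1) hom(3)] w(1)])
        (simp_all add: gB gC mAv mXv cl)
    then have "fst ?mX (fst gB w) = \<one>\<^bsub>tensor_e X C\<^esub>"
      using w(2) hom_one[OF hom(3) SC.E.is_group XC.E.is_group] by simp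
    from inj(1)[OF _ this] have "fst gB w = \<one>\<^bsub>tensor_e X B\<^esub>" using hom(1) w(1) by (auto simp: hom_def)
    moreover have "(fst pB \<circ> fst gB) w = id w"
      by (rule S.e_hom_eqI[OF S.E.is_group hom_compose[OF hom(1) hom(5)] _ w(1)])
        (simp_all add: gB pB cl pg' hom_def)
    ultimately show ?thesis using hom_one[OF hom(5) X.E.is_group S.E.is_group] by simp
  qed
  moreover have "t = \<one>\<^bsub>tensor_ee A B\<^esub>" if t: "t \<in> carrier (tensor_ee A B)" "snd ?mA t = \<one>\<^bsub>tensor_ee A C\<^esub>" for t
  proof -
    have "(snd ?mX \<circ> snd gB) t = (snd gC \<circ> snd ?mA) t"
      by (rule S.ee_hom_eqI[OF XC.EE.is_group hom_compose[OF hom(2) homm(4)] hom_compose[OF homm(2) hom(4)] t(1)])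
        (simp_all add: gB gC mAv mXv cl)
    then have "snd ?mX (snd gB t) = \<one>\<^bsub>tensor_ee X C\<^esub>"
      using t(2) hom_one[OF hom(4) SC.EE.is_group XC.EE.is_group] by simp
    from inj(2)[OF _ this] have "snd gB t = \<one>\<^bsub>tensor_ee X B\<^esub>" using hom(2) t(1) by (auto simp: hom_def)
    moreover have "(snd pB \<circ> snd gB) t = id t"
      by (rule S.ee_hom_eqI[OF S.EE.is_group hom_compose[OF hom(2) hom(6)] _ t(1)])
        (simp_all add: gB pB cl pg' hom_def)
    ultimately show ?thesis using hom_one[OF hom(6) X.EE.is_group S.EE.is_group] by simp
  qed
  ultimately show ?thesis
    using mA unfolding sg_mon_def by (simp add: me.inj_on_one_iff mee.inj_on_one_iff)
qed

theorem tensor_projective_mono: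
  fixes A :: "('a, 'b) square"
  assumes pr: "sg_projective TYPE(('a + 'b) list set) TYPE(('a + 'b) list set) A"
    and sq: "square_group B" "square_group C" and \<mu>: "\<mu> \<in> sg_mon B C"
  shows "sg_tensor_map A B C \<mu> \<in> sg_mon (sg_tensor A B) (sg_tensor A C)"
proof -
  interpret square_group A using pr by (simp add: sg_projective_def)
  obtain g where g: "g \<in> sg_hom A cover" "sg_eq A (sg_comp (fst, fst) g) sg_id"
    using projective_cover_section[OF pr] by blast
  have "(fst, fst) \<in> sg_hom cover A" "\<mu> \<in> sg_hom B C" using cover_proj \<mu> by (simp_all add: sg_epi_def sg_mon_def)
  with g show ?thesis
    by (intro tensor_map_mono_retract[OF square_group_axioms square_group_cover sq]
        cover_tensor_inj_e[OF sq \<mu>] cover_tensor_inj_ee[OF sq \<mu>])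
qed

theorem proposition4:
  fixes A :: "('a, 'b) square"
  assumes "square_group A"
  shows
    "(\<forall>(J :: ('i, 'm) small_cat) (D :: 'i \<Rightarrow> ('c, 'd) square) F (C :: ('x, 'y) square) \<iota>.
        filtered_category J \<longrightarrow> sg_diagram J D F \<longrightarrow>
        sg_colimit TYPE('x) TYPE('y) J D F C \<iota> \<longrightarrow>
        sg_colimit TYPE(('i \<times> 'c) set) TYPE(('i \<times> 'd) set) J D F C \<iota> \<longrightarrow>
        sg_colimit TYPE('u) TYPE('v) J
          (\<lambda>i. sg_tensor A (D i)) (\<lambda>m. sg_tensor_map A (D (Dom J m)) (D (Cod J m)) (F m))
          (sg_tensor A C) (\<lambda>i. sg_tensor_map A (D i) C (\<iota> i)))
   \<and> (\<forall>(B :: nat \<Rightarrow> ('e, 'f) square) d s. sg_simplicial B d s \<longrightarrow>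
        (let RB = (\<lambda>n. sg_tensor A (B n));
             Rd = (\<lambda>n i. sg_tensor_map A (B (Suc n)) (B n) (d n i))
         in \<exists>\<phi>. \<phi> \<in> sg_iso (sg_pi0 RB Rd) (sg_tensor A (sg_pi0 B d)) \<and>
              sg_eq (RB 0) (sg_comp \<phi> (sg_pi0_proj RB Rd))
                (sg_tensor_map A (B 0) (sg_pi0 B d) (sg_pi0_proj B d))))
   \<and> (\<forall>(I :: 'k set) (D :: 'k \<Rightarrow> ('g, 'h) square).
        finite I \<longrightarrow> (\<forall>i\<in>I. square_group (D i)) \<longrightarrow>
        sg_pair I (\<lambda>i. sg_tensor_map A (sg_product I D) (D i) (sg_proj i))
          \<in> sg_iso (sg_tensor A (sg_product I D)) (sg_product I (\<lambda>i. sg_tensor A (D i))))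
   \<and> (\<forall>(B\<^sub>1 :: ('l, 'n) square) (B :: ('o, 'p) square) (B\<^sub>2 :: ('q, 'r) square) \<mu> \<sigma>.
        sg_short_exact B\<^sub>1 B B\<^sub>2 \<mu> \<sigma> \<longrightarrow>
        sg_exact_at (sg_tensor A B\<^sub>1) (sg_tensor A B) (sg_tensor A B\<^sub>2)
          (sg_tensor_map A B\<^sub>1 B \<mu>) (sg_tensor_map A B B\<^sub>2 \<sigma>) \<and>
        sg_tensor_map A B B\<^sub>2 \<sigma> \<in> sg_epi (sg_tensor A B) (sg_tensor A B\<^sub>2) \<and>
        (sg_projective TYPE(('a + 'b) list set) TYPE(('a + 'b) list set) A \<longrightarrow>
         sg_tensor_map A B\<^sub>1 B \<mu> \<in> sg_mon (sg_tensor A B\<^sub>1) (sg_tensor A B)))"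
proof -
  have pi0: "\<exists>\<phi>. \<phi> \<in> sg_iso (sg_pi0 RB Rd) (sg_tensor A (sg_pi0 B d)) \<and>
      sg_eq (RB 0) (sg_comp \<phi> (sg_pi0_proj RB Rd)) (sg_tensor_map A (B 0) (sg_pi0 B d) (sg_pi0_proj B d))"
    if s: "sg_simplicial B d s" and RB: "RB = (\<lambda>n. sg_tensor A (B n))"
      and Rd: "Rd = (\<lambda>n i. sg_tensor_map A (B (Suc n)) (B n) (d n i))"
    for B :: "nat \<Rightarrow> ('e, 'f) square" and d s RB Rd
  proof -
    \<comment> \<open>The simplicial identities in lowest degree make \<open>s 0 0\<close> a common
      section of the two faces, and \<open>sg_pi0\<close> is then the quotient treated in
      \<open>tensor_coequalizer\<close>.\<close>
    have "reflexive_pair (B 1) (B 0) (d 0 0) (d 0 1) (s 0 0)"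
      using s unfolding sg_simplicial_def reflexive_pair_def reflexive_pair_axioms_def
      by (metis One_nat_def add_0 le_refl zero_le_one)
    from tensor_coequalizer[OF assms this] show ?thesis
      unfolding RB Rd by (simp add: sg_pi0_def sg_pi0_proj_def sg_quot_def sg_quot_proj_def coeq_kernel_e_def coeq_kernel_ee_def)
  qed
  show ?thesis
    unfolding Let_def
    by (intro conjI allI impI, (rule tensor_filtered_colimit[OF assms]; assumption),
        (rule pi0[OF _ HOL.refl HOL.refl]; assumption),
        (rule sg_family.tensor_product_iso[OF sg_family.intro assms]; blast),
        (rule tensor_right_exact(1)[OF assms]; assumption), (rule tensor_right_exact(2)[OF assms]; assumption),
        (rule tensor_projective_mono; simp add: sg_short_exact_def))
qed

end
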